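(* Suppose the following, with $r_n=(nh)^{-1/2}+h^m$. (1) $\ell(y;a)$ is three times continuously differentiable and concave in $a$; there exist a bounded open interval $\mathcal I\supset\mathcal I_0$ and constants $C_0,C_1>0$ such that $E\{\exp(\sup_{a\in\mathcal I}|\ddot\ell_a(Y;a)|/C_0)\mid Z\}\le C_0$ and $E\{\exp(\sup_{a\in\mathcal I}|\ell'''_a(Y;a)|/C_0)\mid Z\}\le C_1$ a.s.; there is $C_2>0$ with $C_2^{-1}\le I(Z)\le C_2$ a.s.; and $E(\epsilon\mid Z)=0$, $E(\epsilon^2\mid Z)=I(Z)$ a.s. (2) There exist functions $h_\nu\in\mathcal H$, $\nu\in\mathbb N=\{0,1,2,\dots\}$, with $\sup_\nu\|h_\nu\|_{\sup}<\infty$, and a nondecreasing sequence $\gamma_\nu\asymp\nu^{2m}$, such that $V(h_\mu,h_\nu)=\delta_{\mu\nu}$ and $J(h_\mu,h_\nu)=\gamma_\mu\delta_{\mu\nu}$ for all $\mu,\nu$, and every $g\in\mathcal H$ admits the expansion $g=\sum_\nu V(g,h_\nu)h_\nu$ with convergence in $\|\cdot\|$. (3) $\|\widehat g_{n,\lambda}-g_0\|=O_P(r_n)$. (4) $nh^{2m+1}=O(1)$, $nh^2\to\infty$, $a_n=o(\min\{r_n,\,n^{-1}r_n^{-1}h^{-1/2}(\log n)^{-1},\,n^{-1/2}(\log n)^{-1}\})$ and $r_n^2h^{-1/2}=o(a_n)$, where $a_n=n^{-1/2}((nh)^{-1/2}+h^m)h^{-(6m-1)/(4m)}(\log\log n)^{1/2}+C_\ell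 h^{-1/2}((nh)^{-1}+h^{2m})/\log n$ and $C_\ell=\sup_{z\in\mathbb I}E\{\sup_{a\in\mathcal I}|\ell'''_a(Y;a)|\mid Z=z\}$. (5) Under the null hypothesis $H_0^{\mathrm{global}}$ that $g_0$ is the true function, $E\{\epsilon^4\mid Z\}\le C$ a.s. for some constant $C>0$, where $\epsilon=\dot\ell_a(Y;g_0(Z))$. Then, under $H_0^{\mathrm{global}}$, $$(2u_n)^{-1/2}\left(-2nr_K\cdot\mathrm{PLRT}_{n,\lambda}-nr_K\|W_\lambda g_0\|^2-u_n\right)\stackrel{d}{\longrightarrow}N(0,1),$$ where $u_n=h^{-1}\sigma_K^4/\rho_K^2$, $r_K=\sigma_K^2/\rho_K^2$, $$\sigma_K^2=hE\{\epsilon^2K(Z,Z)\}=\sum_\nu\frac{h}{1+\lambda\gamma_\nu},\qquad\rho_K^2=hE\{\epsilon_1^2\epsilon_2^2K(Z_1,Z_2)^2\}=\sum_\nu\frac{h}{(1+\lambda\gamma_\nu)^2},$$ and $(\epsilon_i,Z_i)$, $i=1,2$, are i.i.d. copies of $(\epsilon,Z)$.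
   Context: Data: $T_i=(Y_i,Z_i)$, $i=1,\dots,n$, are i.i.d. copies of $T=(Y,Z)$, $Y\in\mathcal Y\subseteq\mathbb R$, $Z\in\mathbb I=[0,1]$, with $E(Y\mid Z)=F(g(Z))$, $F$ a known link function and $g\in\mathcal H$ the regression function. The order $m>1/2$ is fixed and known. $\mathcal H$ is either the Sobolev space $H^m(\mathbb I)=\{g:\mathbb I\to\mathbb R: g^{(j)}$ absolutely continuous for $j=0,\dots,m-1$, $g^{(m)}\in L_2(\mathbb I)\}$ or its periodic subspace $H^m_0(\mathbb I)$ of those $g$ with $g^{(j)}(0)=g^{(j)}(1)$, $j=0,\dots,m-1$. $J(g,\widetilde g)=\int_{\mathbb I}g^{(m)}(z)\widetilde g^{(m)}(z)\,dz$. The hypotheses are $H_0^{\mathrm{global}}:g=g_0$ versus $H_1^{\mathrm{global}}:g\in\mathcal H-\{g_0\}$, with $g_0\in\mathcal H$; $\mathcal I_0$ is the range of $g_0$. The criterion function $\ell:\mathcal Y\times\mathbb R\to\mathbb R$ is either $\ell(y;a)=\log p(y;F(a))$, where $p(y;\mu_0(z))$, $\mu_0=F(g_0)$, is the conditional density of $Y$ given $Z=z$, or the quasi-likelihood $\ell(y;a)=Q(y;F(a))$ with $Q(y;\mu)=\int_y^\mu (y-s)/\mathcal V(s)\,ds$, where $\mathrm{Var}(Y\mid Z)=\mathcal V(\mu_0(Z))$ for a known positive function $\mathcal V$. $\dot\ell_a,\ddot\ell_a,\ell'''_a$ are the first three derivatives of $\ell(y;a)$ in $a$. $\epsilon=\dot\ell_a(Y;g_0(Z))$,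 $I(Z)=-E(\ddot\ell_a(Y;g_0(Z))\mid Z)$. The penalized estimate $\widehat g_{n,\lambda}$ (assumed to exist uniquely) maximizes $\ell_{n,\lambda}(g)=\frac1n\sum_{i=1}^n\ell(Y_i;g(Z_i))-(\lambda/2)J(g,g)$ over $g\in\mathcal H$; $\lambda=\lambda_n>0$, $\lambda\to0$ as $n\to\infty$, and $h=\lambda^{1/(2m)}$. The penalized likelihood ratio statistic is $\mathrm{PLRT}_{n,\lambda}=\ell_{n,\lambda}(g_0)-\ell_{n,\lambda}(\widehat g_{n,\lambda})$. $V(g,\widetilde g)=E\{I(Z)g(Z)\widetilde g(Z)\}$; $\langle g,\widetilde g\rangle=V(g,\widetilde g)+\lambda J(g,\widetilde g)$, $\|g\|^2=\langle g,g\rangle$; with this inner product $\mathcal H$ is a reproducing kernel Hilbert space with kernel $K$, $K_z=K(z,\cdot)\in\mathcal H$, $\langle K_z,g\rangle=g(z)$. $W_\lambda:\mathcal H\to\mathcal H$ is the self-adjoint operator with $\langle W_\lambda g,\widetilde g\rangle=\lambda J(g,\widetilde g)$. $\|g\|_{\sup}=\sup_{z\in\mathbb I}|g(z)|$. For positive sequences, $a_\mu\asymp b_\mu$ means $\lim a_\mu/b_\mu=c$ for some $c\in(0,\infty)$. $\delta_{\mu\nu}$ is Kronecker's delta. *)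

theory Defs
  imports "HOL-Probability.Probability" "HOL-Library.Landau_Symbols"
begin

text \<open>
  Functions on the unit interval are represented by total functions of type real to real; everything
  below depends only on the values on the interval (one-sided derivatives at 0 and 1), and
  two elements are identified when they agree there.
\<close>

definition absolutely_continuous_on_Icc :: "real \<Rightarrow> real \<Rightarrow> (real \<Rightarrow> real) \<Rightarrow> bool" where
  "absolutely_continuous_on_Icc a b f \<longleftrightarrow>
     (\<forall>e>0. \<exists>d>0. \<forall>(k::nat) u v.
        (\<forall>i<k. a \<le> u i \<and> u i \<le> v i \<and> v i \<le> b) \<longrightarrow>
        disjoint_family_on (\<lambda>i. {u i<..<v i}) {..<k} \<longrightarrow>
        (\<Sum>i<k. v i - u i) < d \<longrightarrow>
        (\<Sum>i<k. \<bar>f (v i) - f (u i)\<bar>) < e)"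

primrec iter_deriv :: "nat \<Rightarrow> (real \<Rightarrow> real) \<Rightarrow> real \<Rightarrow> real" where
  "iter_deriv 0 g = g"
| "iter_deriv (Suc j) g = (\<lambda>x. vector_derivative (iter_deriv j g) (at x within {0..1}))"

text \<open>
  The derivatives of order below \<open>m\<close> exist everywhere on the interval. The \<open>m\<close>-th one exists
  almost everywhere, by absolute continuity; \<open>vector_derivative\<close> has one fixed arbitrary value
  at the remaining points, which form a null set.
\<close>

definition sobolev :: "nat \<Rightarrow> (real \<Rightarrow> real) set" where
  "sobolev m = {g.
     (\<forall>j. Suc j < m \<longrightarrow> (\<forall>x\<in>{0..1}. iter_deriv j g differentiable (at x within {0..1}))) \<and>
     (\<forall>j<m. absolutely_continuous_on_Icc 0 1 (iter_deriv j g)) \<and>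
     set_borel_measurable lborel {0..1} (iter_deriv m g) \<and>
     set_integrable lborel {0..1} (\<lambda>x. (iter_deriv m g x)\<^sup>2)}"

definition periodic_sobolev :: "nat \<Rightarrow> (real \<Rightarrow> real) set" where
  "periodic_sobolev m = {g \<in> sobolev m. \<forall>j<m. iter_deriv j g 0 = iter_deriv j g 1}"

definition penalty :: "nat \<Rightarrow> (real \<Rightarrow> real) \<Rightarrow> (real \<Rightarrow> real) \<Rightarrow> real" where
  "penalty m g g' = (LBINT z:{0..1}. iter_deriv m g z * iter_deriv m g' z)"

definition sup_norm :: "(real \<Rightarrow> real) \<Rightarrow> real" where
  "sup_norm g = (SUP z\<in>{0..1}. \<bar>g z\<bar>)"

definition sigma_gen :: "'w measure \<Rightarrow> ('w \<Rightarrow> real) \<Rightarrow> 'w measure" where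
  "sigma_gen M Z = vimage_algebra (space M) Z borel"

text \<open>
  Conditional expectation given \<open>Z\<close>, for integrable and for nonnegative (possibly non-integrable)
  variables.
\<close>

definition cond_E :: "'w measure \<Rightarrow> ('w \<Rightarrow> real) \<Rightarrow> ('w \<Rightarrow> real) \<Rightarrow> 'w \<Rightarrow> real" where
  "cond_E M Z X = real_cond_exp M (sigma_gen M Z) X"

definition cond_E_nn :: "'w measure \<Rightarrow> ('w \<Rightarrow> real) \<Rightarrow> ('w \<Rightarrow> real) \<Rightarrow> 'w \<Rightarrow> ennreal" where
  "cond_E_nn M Z X = nn_cond_exp M (sigma_gen M Z) (\<lambda>\<omega>. ennreal (X \<omega>))"

definition big_O_P :: "'w measure \<Rightarrow> (nat \<Rightarrow> 'w \<Rightarrow> real) \<Rightarrow> (nat \<Rightarrow> real) \<Rightarrow> bool" where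
  "big_O_P M X r \<longleftrightarrow>
     (\<forall>n. X n \<in> borel_measurable M) \<and>
     (\<forall>e>0. \<exists>C>0. \<forall>\<^sub>F n in sequentially. measure M {\<omega> \<in> space M. \<bar>X n \<omega>\<bar> > C * r n} \<le> e)"

definition same_order :: "(nat \<Rightarrow> real) \<Rightarrow> (nat \<Rightarrow> real) \<Rightarrow> bool" where
  "same_order a b \<longleftrightarrow> (\<exists>c>0. (\<lambda>k. a k / b k) \<longlonglongrightarrow> c)"

text \<open>The generic pair is \<open>(Y, Z)\<close>; the sample is \<open>(Ys i, Zs i)\<close> with \<open>i \<ge> 1\<close>.\<close>

definition iid_copies ::
  "'w measure \<Rightarrow> real set \<Rightarrow> ('w \<Rightarrow> real) \<Rightarrow> ('w \<Rightarrow> real) \<Rightarrow>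
   (nat \<Rightarrow> 'w \<Rightarrow> real) \<Rightarrow> (nat \<Rightarrow> 'w \<Rightarrow> real) \<Rightarrow> bool" where
  "iid_copies M S Y Z Ys Zs \<longleftrightarrow>
     Y \<in> borel_measurable M \<and> Z \<in> borel_measurable M \<and>
     (\<forall>\<omega>\<in>space M. Y \<omega> \<in> S \<and> Z \<omega> \<in> {0..1}) \<and>
     (\<forall>i\<ge>1. \<forall>\<omega>\<in>space M. Ys i \<omega> \<in> S \<and> Zs i \<omega> \<in> {0..1}) \<and>
     prob_space.indep_vars M (\<lambda>_. borel \<Otimes>\<^sub>M borel) (\<lambda>i \<omega>. (Ys i \<omega>, Zs i \<omega>)) {1..} \<and>
     (\<forall>i\<ge>1. distr M (borel \<Otimes>\<^sub>M borel) (\<lambda>\<omega>. (Ys i \<omega>, Zs i \<omega>)) =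
             distr M (borel \<Otimes>\<^sub>M borel) (\<lambda>\<omega>. (Y \<omega>, Z \<omega>)))"

definition regression_function ::
  "'w measure \<Rightarrow> ('w \<Rightarrow> real) \<Rightarrow> ('w \<Rightarrow> real) \<Rightarrow> (real \<Rightarrow> real) \<Rightarrow> (real \<Rightarrow> real) \<Rightarrow> bool" where
  "regression_function M Y Z F g \<longleftrightarrow>
     integrable M Y \<and> (AE \<omega> in M. cond_E M Z Y \<omega> = F (g (Z \<omega>)))"

text \<open>
  The conditional density of \<open>Y\<close> given \<open>Z\<close> is taken with respect to some sigma-finite dominating
  measure \<open>\<nu>\<close> on the line (Lebesgue measure, counting measure on a countable set, ...).
  Positivity is what makes the logarithm meaningful.
\<close>

definition log_likelihood_criterion ::
  "'w measure \<Rightarrow> real set \<Rightarrow> ('w \<Rightarrow> real) \<Rightarrow> ('w \<Rightarrow> real) \<Rightarrow> (real \<Rightarrow> real) \<Rightarrow> (real \<Rightarrow> real) \<Rightarrow>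
   (real \<Rightarrow> real \<Rightarrow> real) \<Rightarrow> bool" where
  "log_likelihood_criterion M S Y Z F g0 l \<longleftrightarrow>
     (\<exists>(\<nu> :: real measure) p.
        sigma_finite_measure \<nu> \<and> sets \<nu> = sets borel \<and>
        (\<forall>a. (\<lambda>y. p y (F a)) \<in> borel_measurable borel) \<and>
        (\<forall>y\<in>S. \<forall>a. p y (F a) > 0 \<and> l y a = ln (p y (F a))) \<and>
        (\<forall>A\<in>sets borel. AE \<omega> in M.
           cond_E_nn M Z (\<lambda>\<omega>. indicator A (Y \<omega>)) \<omega> =
             (\<integral>\<^sup>+y\<in>A. ennreal (p y (F (g0 (Z \<omega>)))) \<partial>\<nu>)))"

text \<open>
  Positivity of the variance function is only required where it enters (at the means \<open>F a\<close> and
  strictly between \<open>y\<close> and \<open>F a\<close>): for binary responses, \<open>s * (1 - s)\<close> is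
  positive only for \<open>0 < s < 1\<close>. Integrability is what makes \<open>Q (y; F a)\<close> well defined.
\<close>

definition quasi_likelihood_criterion ::
  "'w measure \<Rightarrow> real set \<Rightarrow> ('w \<Rightarrow> real) \<Rightarrow> ('w \<Rightarrow> real) \<Rightarrow> (real \<Rightarrow> real) \<Rightarrow> (real \<Rightarrow> real) \<Rightarrow>
   (real \<Rightarrow> real \<Rightarrow> real) \<Rightarrow> bool" where
  "quasi_likelihood_criterion M S Y Z F g0 l \<longleftrightarrow>
     (\<exists>Var :: real \<Rightarrow> real.
        Var \<in> borel_measurable borel \<and>
        (\<forall>a. Var (F a) > 0) \<and>
        (\<forall>y\<in>S. \<forall>a. \<forall>s\<in>open_segment y (F a). Var s > 0) \<and>
        integrable M (\<lambda>\<omega>. (Y \<omega>)\<^sup>2) \<and>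
        (AE \<omega> in M. cond_E M Z (\<lambda>\<omega>. (Y \<omega> - cond_E M Z Y \<omega>)\<^sup>2) \<omega> = Var (F (g0 (Z \<omega>)))) \<and>
        (\<forall>y\<in>S. \<forall>a.
           interval_lebesgue_integrable lborel (ereal y) (ereal (F a)) (\<lambda>s. (y - s) / Var s) \<and>
           l y a = (LBINT s=ereal y..ereal (F a). (y - s) / Var s)))"

definition deriv_a :: "nat \<Rightarrow> (real \<Rightarrow> real \<Rightarrow> real) \<Rightarrow> real \<Rightarrow> real \<Rightarrow> real" where
  "deriv_a k l y a = (deriv ^^ k) (l y) a"

definition score :: "(real \<Rightarrow> real \<Rightarrow> real) \<Rightarrow> (real \<Rightarrow> real) \<Rightarrow> real \<Rightarrow> real \<Rightarrow> real" where
  "score l g0 y z = deriv_a 1 l y (g0 z)"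

definition information ::
  "'w measure \<Rightarrow> ('w \<Rightarrow> real) \<Rightarrow> ('w \<Rightarrow> real) \<Rightarrow> (real \<Rightarrow> real \<Rightarrow> real) \<Rightarrow> (real \<Rightarrow> real) \<Rightarrow> 'w \<Rightarrow> real" where
  "information M Y Z l g0 \<omega> = - cond_E M Z (\<lambda>\<omega>. deriv_a 2 l (Y \<omega>) (g0 (Z \<omega>))) \<omega>"

definition V_form ::
  "'w measure \<Rightarrow> ('w \<Rightarrow> real) \<Rightarrow> ('w \<Rightarrow> real) \<Rightarrow> (real \<Rightarrow> real \<Rightarrow> real) \<Rightarrow> (real \<Rightarrow> real) \<Rightarrow>
   (real \<Rightarrow> real) \<Rightarrow> (real \<Rightarrow> real) \<Rightarrow> real" where
  "V_form M Y Z l g0 g g' = (\<integral>\<omega>. information M Y Z l g0 \<omega> * g (Z \<omega>) * g' (Z \<omega>) \<partial>M)"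

definition sup_deriv_a :: "nat \<Rightarrow> (real \<Rightarrow> real \<Rightarrow> real) \<Rightarrow> real set \<Rightarrow> real \<Rightarrow> real" where
  "sup_deriv_a k l J y = (SUP a\<in>J. \<bar>deriv_a k l y a\<bar>)"

text \<open>
  The real-valued supremum is accompanied by almost sure boundedness, which finiteness of
  the exponential moments entails.
\<close>

definition criterion_regularity ::
  "'w measure \<Rightarrow> real set \<Rightarrow> ('w \<Rightarrow> real) \<Rightarrow> ('w \<Rightarrow> real) \<Rightarrow> (real \<Rightarrow> real \<Rightarrow> real) \<Rightarrow> (real \<Rightarrow> real) \<Rightarrow>
   real set \<Rightarrow> bool" where
  "criterion_regularity M S Y Z l g0 J \<longleftrightarrow>
     (\<forall>y\<in>S. (\<forall>k<3. \<forall>a. deriv_a k l y differentiable (at a)) \<and>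
            continuous_on UNIV (deriv_a 3 l y) \<and> concave_on UNIV (l y)) \<and>
     open J \<and> bounded J \<and> is_interval J \<and> g0 ` {0..1} \<subseteq> J \<and>
     (AE \<omega> in M. bdd_above ((\<lambda>a. \<bar>deriv_a 2 l (Y \<omega>) a\<bar>) ` J) \<and>
                 bdd_above ((\<lambda>a. \<bar>deriv_a 3 l (Y \<omega>) a\<bar>) ` J)) \<and>
     (\<exists>C0>0. \<exists>C1>0.
        (AE \<omega> in M. cond_E_nn M Z (\<lambda>\<omega>. exp (sup_deriv_a 2 l J (Y \<omega>) / C0)) \<omega> \<le> ennreal C0) \<and>
        (AE \<omega> in M. cond_E_nn M Z (\<lambda>\<omega>. exp (sup_deriv_a 3 l J (Y \<omega>) / C0)) \<omega> \<le> ennreal C1)) \<and>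
     (\<exists>C2>0. AE \<omega> in M.
        1 / C2 \<le> information M Y Z l g0 \<omega> \<and> information M Y Z l g0 \<omega> \<le> C2) \<and>
     (AE \<omega> in M. cond_E M Z (\<lambda>\<omega>. score l g0 (Y \<omega>) (Z \<omega>)) \<omega> = 0) \<and>
     (AE \<omega> in M. cond_E M Z (\<lambda>\<omega>. (score l g0 (Y \<omega>) (Z \<omega>))\<^sup>2) \<omega> = information M Y Z l g0 \<omega>)"

text \<open>
  A conditional expectation given \<open>Z = z\<close> is only determined up to null sets of the law of \<open>Z\<close>,
  so the supremum over \<open>z\<close> is the essential supremum.
\<close>

definition C_l ::
  "'w measure \<Rightarrow> ('w \<Rightarrow> real) \<Rightarrow> ('w \<Rightarrow> real) \<Rightarrow> (real \<Rightarrow> real \<Rightarrow> real) \<Rightarrow> real set \<Rightarrow> real" where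
  "C_l M Y Z l J = enn2real (esssup M (cond_E_nn M Z (\<lambda>\<omega>. sup_deriv_a 3 l J (Y \<omega>))))"

definition reproducing_kernel ::
  "(real \<Rightarrow> real) set \<Rightarrow> ((real \<Rightarrow> real) \<Rightarrow> (real \<Rightarrow> real) \<Rightarrow> real) \<Rightarrow> (real \<Rightarrow> real \<Rightarrow> real) \<Rightarrow> bool" where
  "reproducing_kernel H ip K \<longleftrightarrow>
     (\<forall>z\<in>{0..1}. K z \<in> H \<and> (\<forall>g\<in>H. ip (K z) g = g z))"

text \<open>The operator \<open>W\<close> on \<open>H\<close> which represents the bilinear form \<open>B\<close>.\<close>

definition self_adjoint_representer ::
  "(real \<Rightarrow> real) set \<Rightarrow> ((real \<Rightarrow> real) \<Rightarrow> (real \<Rightarrow> real) \<Rightarrow> real) \<Rightarrow>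
   ((real \<Rightarrow> real) \<Rightarrow> (real \<Rightarrow> real) \<Rightarrow> real) \<Rightarrow> ((real \<Rightarrow> real) \<Rightarrow> real \<Rightarrow> real) \<Rightarrow> bool" where
  "self_adjoint_representer H ip B W \<longleftrightarrow>
     (\<forall>g\<in>H. W g \<in> H \<and> (\<forall>g'\<in>H. ip (W g) g' = B g g' \<and> ip (W g) g' = ip g (W g')))"

definition penalized_criterion ::
  "nat \<Rightarrow> (real \<Rightarrow> real \<Rightarrow> real) \<Rightarrow> (nat \<Rightarrow> 'w \<Rightarrow> real) \<Rightarrow> (nat \<Rightarrow> 'w \<Rightarrow> real) \<Rightarrow>
   (nat \<Rightarrow> real) \<Rightarrow> nat \<Rightarrow> 'w \<Rightarrow> (real \<Rightarrow> real) \<Rightarrow> real" where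
  "penalized_criterion m l Ys Zs lam n \<omega> g =
     (1 / real n) * (\<Sum>i=1..n. l (Ys i \<omega>) (g (Zs i \<omega>))) - (lam n / 2) * penalty m g g"

definition unique_maximizer ::
  "(real \<Rightarrow> real) set \<Rightarrow> ((real \<Rightarrow> real) \<Rightarrow> real) \<Rightarrow> (real \<Rightarrow> real) \<Rightarrow> bool" where
  "unique_maximizer H f g \<longleftrightarrow>
     g \<in> H \<and> (\<forall>g'\<in>H. f g' \<le> f g \<and> (f g' = f g \<longrightarrow> (\<forall>z\<in>{0..1}. g' z = g z)))"

end

theory Submission
  imports Defs
begin

text \<open>
  Write \<open>L f\<close> for the gain of the penalized criterion at \<open>g0 + f\<close> over \<open>g0\<close>. By Taylor's theorem
  \<open>L f = \<langle>S, f\<rangle> - \<langle>f, f\<rangle> / 2 + R f\<close> with \<open>S = n\<^sup>-\<^sup>1 \<Sum>\<^sub>i \<epsilon>\<^sub>i K(Z\<^sub>i) - W g0\<close>. In the basis \<open>h\<^sub>\<nu>\<close> the Hilbert--Schmidt norm of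
  the centred empirical Hessian has second moment of order \<open>1 / (n h\<^sup>2)\<close>, so that, because \<open>n h\<^sup>3\<close>
  diverges, \<open>n (R f)\<close> is \<open>o\<^sub>P(h\<^sup>-\<^sup>1\<^sup>/\<^sup>2)\<close> uniformly over balls of radius \<open>O(r\<^sub>n)\<close>. The maximizer beats \<open>S\<close>, and the quadratic
  part is at most \<open>\<langle>S, S\<rangle> / 2\<close>; hence \<open>- 2 n PLRT\<close> is \<open>n \<langle>S, S\<rangle>\<close> up to \<open>o\<^sub>P(h\<^sup>-\<^sup>1\<^sup>/\<^sup>2)\<close>, without any
  Bahadur representation of the estimate. In \<open>n \<langle>S, S\<rangle>\<close> the diagonal terms contribute the centring, the
  cross terms with \<open>W g0\<close> are negligible, and the off-diagonal terms form a degenerate U-statistic, to which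
  a central limit theorem of P. Hall applies. It is proved by comparing characteristic functions one
  martingale increment at a time.
\<close>

section \<open>Absolutely continuous functions\<close>

text \<open>The quadratic expansion of the gain presupposes that the penalty is bilinear. Where the
  m-th derivative fails to exist it carries a default value, which is not linear, so bilinearity
  passes through an almost everywhere identity; this is why the development opens with
  differentiability of absolutely continuous functions. Four further obstacles shape it. The kernel
  changes with n, so the limit theorem is one for triangular arrays, with every moment bound
  explicit in the trace, which is of order 1/h. Neither \<open>l\<close> is known to be measurable
  in y nor \<open>ghat\<close> as a random element: Borel versions on \<open>S\<close>,
  discretization and spectral series supply measurability. Maximality of the estimate holds only
  eventually, for almost every outcome, and becomes a statement in probability by dominated
  convergence. Uniformity over an infinite dimensional ball comes from the bounded basis functions
  and the summable weights \<open>1 / (1 + lam * gam \<nu>)\<close>, which make the random quadratic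
  form Hilbert-Schmidt. Divergence of n h^3 is drawn from a = o(n^(-1/2) / log n), because the
  exponent (6m - 1) / (4m) of 1/h in \<open>a\<close> is at least 1.\<close>

definition increment :: "(real => real) => real set => real" where
  "increment f S = f (Sup S) - f (Inf S)"

text \<open>Intervals are kept as sets, with endpoints recovered by \<open>Inf\<close> and
  \<open>Sup\<close>, so that Vitali families and divisions can be summed over directly. Degenerate
  intervals are left out: a Vitali ball needs a positive radius and a slope a nonzero
  length.\<close>

definition proper_intervals :: "real set set" where
  "proper_intervals = {{u..v} |u v. u < v}"

lemma proper_intervalsE:
  assumes "S \<in> proper_intervals"
  obtains u v where "S = {u..v}" "u < v" "Inf S = u" "Sup S = v"
  using assms unfolding proper_intervals_def by auto

text \<open>Renumbering an arbitrary finite index set. The families met below are indexed by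
  intervals, or by pairs of intervals, rather than by initial segments of the naturals.\<close>

lemma AC_finite_family:
  assumes "absolutely_continuous_on_Icc a b f" "e > 0"
  shows "\<exists>d>0. \<forall>(I :: 'i set) u v. finite I \<longrightarrow>
      (\<forall>i\<in>I. a \<le> u i \<and> u i \<le> v i \<and> v i \<le> b) \<longrightarrow>
      disjoint_family_on (\<lambda>i. {u i<..<v i}) I \<longrightarrow> (\<Sum>i\<in>I. v i - u i) < d \<longrightarrow>
      (\<Sum>i\<in>I. \<bar>f (v i) - f (u i)\<bar>) < e"
proof -
  obtain d where d: "d > 0" "\<And>(k::nat) u v.
        (\<forall>i<k. a \<le> u i \<and> u i \<le> v i \<and> v i \<le> b) ==>
        disjoint_family_on (\<lambda>i. {u i<..<v i}) {..<k} ==>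
        (\<Sum>i<k. v i - u i) < d ==>
        (\<Sum>i<k. \<bar>f (v i) - f (u i)\<bar>) < e"
    using assms unfolding absolutely_continuous_on_Icc_def by meson
  show ?thesis
  proof (intro exI[of _ d] conjI allI impI d(1))
    fix I :: "'i set" and u v
    assume I: "finite I" "\<forall>i\<in>I. a \<le> u i \<and> u i \<le> v i \<and> v i \<le> b"
      "disjoint_family_on (\<lambda>i. {u i<..<v i}) I" "(\<Sum>i\<in>I. v i - u i) < d"
    obtain g where g: "bij_betw g {..<card I} I"
      using ex_bij_betw_nat_finite[OF I(1)] by (auto simp: atLeast0LessThan)
    have gin: "\<And>i. i < card I ==> g i \<in> I" using g by (auto simp: bij_betw_def)
    have "(\<Sum>i<card I. \<bar>f (v (g i)) - f (u (g i))\<bar>) < e"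
    proof (rule d(2))
      show "\<forall>i<card I. a \<le> u (g i) \<and> u (g i) \<le> v (g i) \<and> v (g i) \<le> b" using I gin by auto
      show "disjoint_family_on (\<lambda>i. {u (g i)<..<v (g i)}) {..<card I}"
        unfolding disjoint_family_on_def
      proof (intro ballI impI)
        fix i j assume ij: "i \<in> {..<card I}" "j \<in> {..<card I}" "i \<noteq> j"
        then have "g i \<noteq> g j" using g by (auto simp: bij_betw_def inj_on_def)
        then show "{u (g i)<..<v (g i)} \<inter> {u (g j)<..<v (g j)} = {}"
          using I(3) gin ij unfolding disjoint_family_on_def by blast
      qed
      show "(\<Sum>i<card I. v (g i) - u (g i)) < d"
        using I(4) sum.reindex_bij_betw[OF g, of "\<lambda>i. v i - u i"] by simp
    qed
    then show "(\<Sum>i\<in>I. \<bar>f (v i) - f (u i)\<bar>) < e"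
      using sum.reindex_bij_betw[OF g, of "\<lambda>i. \<bar>f (v i) - f (u i)\<bar>"] by simp
  qed
qed

lemma AC_continuous_on:
  assumes "absolutely_continuous_on_Icc a b f"
  shows "continuous_on {a..b} f"
  unfolding continuous_on_iff
proof (intro ballI allI impI)
  fix x e :: real assume x: "x \<in> {a..b}" and e: "e > 0"
  obtain d where d: "d > 0" "\<forall>(I :: unit set) u v. finite I \<longrightarrow>
      (\<forall>i\<in>I. a \<le> u i \<and> u i \<le> v i \<and> v i \<le> b) \<longrightarrow>
      disjoint_family_on (\<lambda>i. {u i<..<v i}) I \<longrightarrow> (\<Sum>i\<in>I. v i - u i) < d \<longrightarrow>
      (\<Sum>i\<in>I. \<bar>f (v i) - f (u i)\<bar>) < e"
    using AC_finite_family[OF assms e, where 'i=unit] by auto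
  have "dist (f x') (f x) < e" if x': "x' \<in> {a..b}" "dist x' x < d" for x'
  proof -
    have "(\<Sum>i\<in>{()}. \<bar>f (max x x') - f (min x x')\<bar>) < e"
      using d(2)[rule_format, of "{()}" "\<lambda>_. min x x'" "\<lambda>_. max x x'"] x x'
      by (simp add: dist_real_def disjoint_family_on_def max_def min_def abs_less_iff split: if_splits)
    then show ?thesis by (auto simp: dist_real_def max_def min_def abs_minus_commute split: if_splits)
  qed
  then show "\<exists>d>0. \<forall>x'\<in>{a..b}. dist x' x < d \<longrightarrow> dist (f x') (f x) < e" using d(1) by blast
qed

text \<open>The identity for \<open>k\<close> is asked for on the interval only, since iterated
  derivatives of a linear combination are known to split only there.\<close>

lemma AC_linear:
  assumes f: "absolutely_continuous_on_Icc a b f" and g: "absolutely_continuous_on_Icc a b g"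
    and k: "\<And>x. x \<in> {a..b} ==> k x = c * f x + d * g x"
  shows "absolutely_continuous_on_Icc a b k"
  unfolding absolutely_continuous_on_Icc_def
proof (intro allI impI)
  fix e :: real assume e: "e > 0"
  define e1 where "e1 = e / (2 * (\<bar>c\<bar> + \<bar>d\<bar> + 1))"
  have e1: "e1 > 0" using e by (auto simp: e1_def intro!: divide_pos_pos mult_pos_pos)
  obtain d1 where d1: "d1 > 0" "\<And>(k::nat) u v.
        (\<forall>i<k. a \<le> u i \<and> u i \<le> v i \<and> v i \<le> b) ==>
        disjoint_family_on (\<lambda>i. {u i<..<v i}) {..<k} ==>
        (\<Sum>i<k. v i - u i) < d1 ==> (\<Sum>i<k. \<bar>f (v i) - f (u i)\<bar>) < e1"
    using f e1 unfolding absolutely_continuous_on_Icc_def by meson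
  obtain d2 where d2: "d2 > 0" "\<And>(k::nat) u v.
        (\<forall>i<k. a \<le> u i \<and> u i \<le> v i \<and> v i \<le> b) ==>
        disjoint_family_on (\<lambda>i. {u i<..<v i}) {..<k} ==>
        (\<Sum>i<k. v i - u i) < d2 ==> (\<Sum>i<k. \<bar>g (v i) - g (u i)\<bar>) < e1"
    using g e1 unfolding absolutely_continuous_on_Icc_def by meson
  show "\<exists>d>0. \<forall>(n::nat) u v. (\<forall>i<n. a \<le> u i \<and> u i \<le> v i \<and> v i \<le> b) \<longrightarrow>
        disjoint_family_on (\<lambda>i. {u i<..<v i}) {..<n} \<longrightarrow>
        (\<Sum>i<n. v i - u i) < d \<longrightarrow> (\<Sum>i<n. \<bar>k (v i) - k (u i)\<bar>) < e"
  proof (intro exI[of _ "min d1 d2"] conjI allI impI)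
    show "0 < min d1 d2" using d1 d2 by simp
    fix n :: nat and u v assume A: "\<forall>i<n. a \<le> u i \<and> u i \<le> v i \<and> v i \<le> b"
        "disjoint_family_on (\<lambda>i. {u i<..<v i}) {..<n}" "(\<Sum>i<n. v i - u i) < min d1 d2"
    have "(\<Sum>i<n. \<bar>k (v i) - k (u i)\<bar>)
        \<le> (\<Sum>i<n. \<bar>c\<bar> * \<bar>f (v i) - f (u i)\<bar> + \<bar>d\<bar> * \<bar>g (v i) - g (u i)\<bar>)"
    proof (rule sum_mono)
      fix i assume "i \<in> {..<n}"
      with A have ab: "a \<le> u i" "u i \<le> v i" "v i \<le> b" by auto
      have "k (v i) - k (u i) = c * (f (v i) - f (u i)) + d * (g (v i) - g (u i))"
        using ab by (simp add: k algebra_simps)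
      then show "\<bar>k (v i) - k (u i)\<bar> \<le> \<bar>c\<bar> * \<bar>f (v i) - f (u i)\<bar> + \<bar>d\<bar> * \<bar>g (v i) - g (u i)\<bar>"
        by (metis abs_mult abs_triangle_ineq)
    qed
    also have "\<dots> = \<bar>c\<bar> * (\<Sum>i<n. \<bar>f (v i) - f (u i)\<bar>) + \<bar>d\<bar> * (\<Sum>i<n. \<bar>g (v i) - g (u i)\<bar>)"
      by (simp add: sum.distrib sum_distrib_left)
    also have "\<dots> \<le> \<bar>c\<bar> * e1 + \<bar>d\<bar> * e1"
      using d1(2)[OF A(1,2)] d2(2)[OF A(1,2)] A(3) by (intro add_mono mult_left_mono) auto
    also have "\<dots> < e"
    proof -
      have "(\<bar>c\<bar> + \<bar>d\<bar>) * e1 \<le> (\<bar>c\<bar> + \<bar>d\<bar> + 1) * e1" using e1 by (intro mult_right_mono) auto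
      also have "\<dots> = e / 2" unfolding e1_def by (simp add: field_simps)
      finally show ?thesis using e by (simp add: algebra_simps)
    qed
    finally show "(\<Sum>i<n. \<bar>k (v i) - k (u i)\<bar>) < e" .
  qed
qed

lemma increment_division:
  fixes f :: "real => real"
  assumes "a \<le> b" "p division_of {a..b}"
  shows "(\<Sum>K\<in>p. increment f K) = f b - f a"
proof -
  have ne: "K \<noteq> {}" "\<exists>u v. K = cbox u v" if "K \<in> p" for K
    using division_ofD(3,4)[OF assms(2) that] by auto
  have inf: "Inf K \<in> K" if "K \<in> p" for K using ne[OF that] by auto
  \<comment> \<open>Tagging each member by its left endpoint turns the division into a tagged one,
    for which the telescoping identity is available; the choice of tags is immaterial.\<close>
  let ?q = "(\<lambda>K. (Inf K, K)) ` p"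
  have "?q tagged_division_of {a..b}"
    unfolding tagged_division_of
  proof (intro conjI allI impI)
    show "finite ?q" using division_ofD(1)[OF assms(2)] by simp
    show "\<Union> {K. \<exists>x. (x, K) \<in> ?q} = {a..b}" using division_ofD(6)[OF assms(2)] by (auto simp: image_iff)
    show "interior K \<inter> interior K' = {}" if "(x, K) \<in> ?q \<and> (x', K') \<in> ?q \<and> (x, K) \<noteq> (x', K')" for x K x' K'
      using that division_ofD(5)[OF assms(2), of K K'] by auto
    show "K \<subseteq> {a..b}" if "(x, K) \<in> ?q" for x K using that division_ofD(2)[OF assms(2)] by blast
  qed (use inf ne in auto)
  from additive_tagged_division_1[OF assms(1) this, of f] show ?thesis
    by (subst (asm) sum.reindex) (auto simp: inj_on_def increment_def)
qed

section \<open>Vitali coverings on the line\<close>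

lemma lmeasure_disjoint_proper_intervals:
  assumes "finite D" "D \<subseteq> proper_intervals" "pairwise disjnt D"
  shows "measure lebesgue (\<Union>D) = (\<Sum>S\<in>D. Sup S - Inf S)" (is ?A) "\<Union>D \<in> lmeasurable"
proof -
  have m: "S \<in> lmeasurable" "measure lebesgue S = Sup S - Inf S" if S: "S \<in> D" for S
  proof -
    obtain u v where "S = {u..v}" "u < v" using S assms(2) proper_intervalsE by blast
    then show "S \<in> lmeasurable" "measure lebesgue S = Sup S - Inf S" by auto
  qed
  then show "\<Union>D \<in> lmeasurable" using assms(1) by (intro fmeasurable.finite_Union) auto
  have "measure lebesgue (\<Union>D) = (\<Sum>S\<in>D. measure lebesgue S)"
    using assms m by (intro measure_Union' ) auto
  then show ?A using m by simp
qed

text \<open>A closed interval is a closed ball about its midpoint, so Vitali's theorem for balls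
  applies to the members of \<open>V\<close> inside \<open>U\<close>. It yields a countable disjoint
  family that misses only a null part of \<open>E\<close>; as \<open>U\<close> has finite measure, a
  finite subfamily loses at most \<open>e\<close>.\<close>

lemma Vitali_real:
  assumes V: "V \<subseteq> proper_intervals" and E: "E \<in> lmeasurable" and U: "open U" "E \<subseteq> U" "U \<in> lmeasurable"
    and cov: "\<And>x d. x \<in> E ==> d > 0 ==> \<exists>S\<in>V. x \<in> S \<and> Sup S - Inf S < d"
    and e: "e > 0"
  obtains D where "finite D" "D \<subseteq> V" "pairwise disjnt D" "\<Union>D \<subseteq> U"
    "measure lebesgue (\<Union>D) > measure lebesgue E - e"
proof -
  define K where "K = {S\<in>V. S \<subseteq> U}"
  define ce where "ce = (\<lambda>S::real set. (Sup S + Inf S) / 2)"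
  define ra where "ra = (\<lambda>S::real set. (Sup S - Inf S) / 2)"
  have cb: "cball (ce S) (ra S) = S" "0 < ra S" if S: "S \<in> proper_intervals" for S
  proof -
    obtain u v where uv: "S = {u..v}" "u < v" using S proper_intervalsE by blast
    then show "0 < ra S" by (simp add: ra_def)
    have "cball ((u+v)/2) ((v-u)/2) = {u..v}" by (auto simp: dist_real_def abs_le_iff field_simps cball_def)
    then show "cball (ce S) (ra S) = S" using uv by (simp add: ce_def ra_def add.commute)
  qed
  have KV: "K \<subseteq> V" "K \<subseteq> proper_intervals" using V by (auto simp: K_def)
  obtain C where C: "countable C" "C \<subseteq> K"
     "pairwise (\<lambda>i j. disjnt (cball (ce i) (ra i)) (cball (ce j) (ra j))) C"
     "negligible(E - (\<Union>i \<in> C. cball (ce i) (ra i)))"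
  proof (rule Vitali_covering_theorem_cballs[of K ra E ce])
    show "0 < ra S" if "S \<in> K" for S using that KV cb by blast
    fix x d :: real assume x: "x \<in> E" and d: "0 < d"
    obtain r where r: "r > 0" "ball x r \<subseteq> U" using U x by (meson openE subsetD)
    obtain S where S: "S \<in> V" "x \<in> S" "Sup S - Inf S < min d r" using cov[OF x, of "min d r"] d r by auto
    have Sp: "S \<in> proper_intervals" using S V by auto
    obtain u v where uv: "S = {u..v}" "u < v" "Inf S = u" "Sup S = v" using Sp proper_intervalsE by blast
    have "S \<subseteq> ball x r"
    proof
      fix y assume "y \<in> S"
      then show "y \<in> ball x r" using S(2,3) uv by (simp add: dist_real_def abs_less_iff)
    qed
    then have "S \<in> K" using S r by (auto simp: K_def)
    moreover have "ra S < d" using S(3) cb(2)[OF Sp] by (simp add: ra_def)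
    ultimately show "\<exists>i. i \<in> K \<and> x \<in> cball (ce i) (ra i) \<and> ra i < d"
      using S(2) cb(1)[OF Sp] by (intro exI[of _ S]) simp
  qed
  have cbC: "cball (ce S) (ra S) = S" if "S \<in> C" for S using that C KV cb by blast
  have disC: "pairwise disjnt C" using C(3) by (auto simp: pairwise_def cbC)
  have neg: "negligible (E - \<Union>C)" using C(4) cbC by (simp cong: SUP_cong)
  show thesis
  proof (cases "C = {}")
    case True
    then have "measure lebesgue E = 0" using neg by (simp add: negligible_imp_measure0)
    then show thesis using e that[of "{}"] by simp
  next
    case False
    \<comment> \<open>For finite \<open>C\<close> the enumeration repeats itself, which does no
      harm: the subfamilies are images, hence sets.\<close>
    define A where "A = (\<lambda>n::nat. \<Union>(from_nat_into C ` {..n}))"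
    have UA: "(\<Union>n. A n) = \<Union>C"
    proof
      show "(\<Union>n. A n) \<subseteq> \<Union>C" unfolding A_def using from_nat_into[OF False] by blast
      show "\<Union>C \<subseteq> (\<Union>n. A n)"
      proof
        fix x assume "x \<in> \<Union>C"
        then obtain S where S: "S \<in> C" "x \<in> S" by blast
        obtain n where "from_nat_into C n = S" using from_nat_into_surj[OF C(1) S(1)] by blast
        then have "x \<in> A n" unfolding A_def using S(2) by blast
        then show "x \<in> (\<Union>n. A n)" by blast
      qed
    qed
    have meas: "S \<in> sets lebesgue" if "S \<in> C" for S
    proof -
      have "S \<in> proper_intervals" using that C KV by blast
      then show ?thesis by (rule proper_intervalsE) simp
    qed
    have Asets: "range A \<subseteq> sets lebesgue"
    proof
      fix X assume "X \<in> range A"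
      then obtain n where X: "X = A n" by blast
      show "X \<in> sets lebesgue" unfolding X A_def
        by (rule sets.finite_Union) (use meas from_nat_into[OF False] in blast)+
    qed
    have UCs: "\<Union>C \<in> sets lebesgue" using meas C(1) by (intro sets.countable_Union) auto
    have CU: "\<Union>C \<subseteq> U" using C(2) by (auto simp: K_def)
    have UCm: "\<Union>C \<in> lmeasurable" using fmeasurableI2[OF U(3) CU UCs] .
    have "(\<lambda>n. measure lebesgue (A n)) \<longlonglongrightarrow> measure lebesgue (\<Union>n. A n)"
    proof (rule Lim_measure_incseq[OF Asets])
      show "incseq A" unfolding incseq_def A_def by (intro allI impI Union_mono image_mono) auto
      show "emeasure lebesgue (\<Union> (range A)) \<noteq> \<infinity>" using UCm UA by (auto simp: fmeasurable_def)
    qed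
    moreover have "measure lebesgue E \<le> measure lebesgue (\<Union>C)"
    proof -
      have "measure lebesgue E \<le> measure lebesgue ((E - \<Union>C) \<union> \<Union>C)"
        by (rule measure_mono_fmeasurable) (use E UCm in \<open>auto intro!: fmeasurable.Un fmeasurable.Diff\<close>)
      also have "\<dots> \<le> measure lebesgue (E - \<Union>C) + measure lebesgue (\<Union>C)"
        by (rule measure_Un_le) (use E UCm in auto)
      finally show ?thesis using neg by (simp add: negligible_imp_measure0)
    qed
    ultimately have "\<forall>\<^sub>F n in sequentially. measure lebesgue (A n) > measure lebesgue E - e"
      using e UA by (intro order_tendstoD(1)[of _ "measure lebesgue (\<Union>C)"]) auto
    then obtain n where n: "measure lebesgue (A n) > measure lebesgue E - e"
      by (auto simp: eventually_sequentially)
    let ?D = "from_nat_into C ` {..n}"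
    have DC: "?D \<subseteq> C" using from_nat_into[OF False] by blast
    show thesis
    proof (rule that[of ?D])
      show "?D \<subseteq> V" using DC C KV by blast
      show "pairwise disjnt ?D" using disC DC by (rule pairwise_subset)
      show "\<Union>?D \<subseteq> U" using DC CU by blast
    qed (use n in \<open>auto simp: A_def\<close>)
  qed
qed

definition slope :: "(real => real) => real => real => real" where
  "slope f x y = (f y - f x) / (y - x)"

lemma bounded_borel_lmeasurable: "A \<in> sets borel ==> A \<subseteq> {0<..<1::real} ==> A \<in> lmeasurable"
  by (rule fmeasurableI2[of "{0<..<1}"]) auto

lemma slope_sym: "slope f x y = slope f y x"
  unfolding slope_def by (metis minus_diff_eq minus_divide_divide)

text \<open>If small intervals at the points of \<open>E\<close> have slopes both below \<open>p\<close> and above \<open>q > p\<close>, then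
  a covering \<open>A\<close> of the first kind can be refined by a covering \<open>B\<close> of the second kind, and absolute
  continuity controls the increments over the short gaps between them.\<close>

lemma negligible_oscillating_slope:
  assumes f: "absolutely_continuous_on_Icc 0 1 f" and E: "E \<in> lmeasurable" "E \<subseteq> {0<..<1}"
    and pq: "p < q"
    and lo: "\<And>x d. x \<in> E ==> d > 0 ==> \<exists>y. y \<noteq> x \<and> \<bar>y - x\<bar> < d \<and> slope f x y < p"
    and hi: "\<And>x d. x \<in> E ==> d > 0 ==> \<exists>y. y \<noteq> x \<and> \<bar>y - x\<bar> < d \<and> slope f x y > q"
  shows "negligible E"
proof (rule ccontr)
  assume "\<not> negligible E"
  let ?m = "measure lebesgue"
  define \<mu> where "\<mu> = ?m E"
  have mu: "\<mu> > 0"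
    using \<open>\<not> negligible E\<close> E(1) unfolding \<mu>_def by (simp add: negligible_iff_measure zero_less_measure_iff less_le)
  \<comment> \<open>The two coverings will force the increments over the gaps to amount to at least
    (q - p) \<mu> / 2 = 2 \<open>e\<close>, whereas absolute continuity keeps them below
    \<open>e\<close>.\<close>
  define e where "e = (q - p) * \<mu> / 4"
  have e: "e > 0" using mu pq by (simp add: e_def)
  obtain d where d: "d > 0" "\<forall>(I :: (real set \<times> real set) set) u v. finite I \<longrightarrow>
      (\<forall>i\<in>I. 0 \<le> u i \<and> u i \<le> v i \<and> v i \<le> 1) \<longrightarrow>
      disjoint_family_on (\<lambda>i. {u i<..<v i}) I \<longrightarrow> (\<Sum>i\<in>I. v i - u i) < d \<longrightarrow>
      (\<Sum>i\<in>I. \<bar>f (v i) - f (u i)\<bar>) < e"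
    using AC_finite_family[OF f e, where 'i="real set \<times> real set"] by auto
  \<comment> \<open>The gaps will have total length below 4 \<epsilon>. The first bound keeps this
    under \<open>d\<close>, the second gives the fine covering at least 3/4 of \<mu>, the third
    keeps the slope \<open>p\<close> over the gaps from contributing more than (q - p) \<mu> /
    4.\<close>
  define \<epsilon> where "\<epsilon> = Min {d / 5, \<mu> / 12, (q - p) * \<mu> / (16 * (\<bar>p\<bar> + 1))}"
  have eps: "\<epsilon> > 0" "\<epsilon> \<le> d / 5" "\<epsilon> \<le> \<mu> / 12" "\<epsilon> \<le> (q - p) * \<mu> / (16 * (\<bar>p\<bar> + 1))"
  proof -
    have pos: "\<forall>x\<in>{d / 5, \<mu> / 12, (q - p) * \<mu> / (16 * (\<bar>p\<bar> + 1))}. 0 < x"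
      using d(1) mu pq by (auto intro!: divide_pos_pos mult_pos_pos)
    show "\<epsilon> > 0" unfolding \<epsilon>_def by (subst Min_gr_iff) (use pos in auto)
    show "\<epsilon> \<le> d / 5" "\<epsilon> \<le> \<mu> / 12" "\<epsilon> \<le> (q - p) * \<mu> / (16 * (\<bar>p\<bar> + 1))"
      unfolding \<epsilon>_def by (rule Min_le; simp)+
  qed
  obtain T where T: "open T" "E \<subseteq> T" "(T - E) \<in> lmeasurable" "emeasure lebesgue (T - E) < ennreal \<epsilon>"
    using sets_lebesgue_outer_open[OF fmeasurableD[OF E(1)] eps(1)] .
  define U where "U = T \<inter> {0<..<1}"
  have U: "open U" "E \<subseteq> U" "U \<subseteq> {0<..<1}" using T E(2) by (auto simp: U_def)
  have Um: "U \<in> lmeasurable" by (rule bounded_borel_lmeasurable[OF borel_open[OF U(1)] U(3)])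
  have mU: "?m U < \<mu> + \<epsilon>"
  proof -
    have "?m (T - E) < \<epsilon>"
    proof -
      have "ennreal (?m (T - E)) < ennreal \<epsilon>" using T(4) emeasure_eq_measure2[OF T(3)] by simp
      then show ?thesis using eps(1) by (simp add: ennreal_less_iff)
    qed
    moreover have "?m U \<le> ?m (E \<union> (T - E))"
      by (rule measure_mono_fmeasurable[OF _ fmeasurableD[OF Um] fmeasurable.Un[OF E(1) T(3)]])
        (use U_def in blast)
    moreover have "?m (E \<union> (T - E)) \<le> ?m E + ?m (T - E)" using E T by (intro measure_Un_le) auto
    ultimately show ?thesis by (simp add: \<mu>_def)
  qed
  define VA where "VA = {{u..v} |u v. u < v \<and> slope f u v < p}"
  have VA: "VA \<subseteq> proper_intervals" by (auto simp: VA_def proper_intervals_def)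
  obtain A where A: "finite A" "A \<subseteq> VA" "pairwise disjnt A" "\<Union>A \<subseteq> U" "?m (\<Union>A) > ?m E - \<epsilon>"
  proof (rule Vitali_real[OF VA E(1) U(1,2) Um _ eps(1)])
    fix x r :: real assume x: "x \<in> E" "r > 0"
    obtain y where y: "y \<noteq> x" "\<bar>y - x\<bar> < r" "slope f x y < p" using lo[OF x] by blast
    show "\<exists>S\<in>VA. x \<in> S \<and> Sup S - Inf S < r"
    proof (intro bexI conjI)
      show "{min x y..max x y} \<in> VA"
        using y slope_sym[of f x y] unfolding VA_def by (cases "x < y") (auto simp: min_def max_def)
    qed (use y in \<open>auto simp: min_def max_def\<close>)
  qed blast
  have Ap: "A \<subseteq> proper_intervals" using A(2) VA by blast
  note mA = lmeasure_disjoint_proper_intervals[OF A(1) Ap A(3)]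
  \<comment> \<open>Only at interior points do all sufficiently short intervals of the second kind
    fit into a member of \<open>A\<close>; the finitely many endpoints are negligible.\<close>
  define U' where "U' = (\<Union>S\<in>A. interior S)"
  have U': "open U'" "U' \<subseteq> \<Union>A" using interior_subset by (auto simp: U'_def)
  have U'm: "U' \<in> lmeasurable"
    by (rule bounded_borel_lmeasurable[OF borel_open[OF U'(1)]]) (use U'(2) A(4) U(3) in blast)
  define E' where "E' = E \<inter> U'"
  have E'm: "E' \<in> lmeasurable" using E U'm by (auto simp: E'_def)
  \<comment> \<open>One \<epsilon> is lost because \<open>A\<close> may miss that much, the other
    because \<open>A\<close> may stick out of \<open>E\<close> into the slightly larger
    \<open>U\<close>.\<close>
  have E'mu: "?m E' \<ge> \<mu> - 2 * \<epsilon>"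
  proof -
    have "negligible (\<Union>A - U')"
    proof (rule negligible_subset)
      show "negligible (\<Union>S\<in>A. frontier S)"
      proof (rule negligible_Union)
        fix t assume "t \<in> frontier ` A"
        then obtain S where S: "S \<in> A" "t = frontier S" by blast
        then have "S \<in> proper_intervals" using Ap by blast
        then show "negligible t" unfolding S(2) by (rule proper_intervalsE) (simp add: negligible_convex_frontier)
      qed (use A(1) in simp)
      have "closed S" if "S \<in> A" for S
      proof -
        have "S \<in> proper_intervals" using that Ap by blast
        then show ?thesis by (rule proper_intervalsE) simp
      qed
      then show "\<Union>A - U' \<subseteq> (\<Union>S\<in>A. frontier S)" by (auto simp: U'_def frontier_def)
    qed
    then have z: "?m (\<Union>A - U') = 0" by (rule negligible_imp_measure0)
    have "?m (E \<union> \<Union>A) \<le> ?m U" using E U A mA Um by (intro measure_mono_fmeasurable) auto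
    moreover have "?m (E \<union> \<Union>A) = ?m E + ?m (\<Union>A) - ?m (E \<inter> \<Union>A)"
      using measure_Un3[OF E(1) mA(2)] .
    moreover have "?m (E \<inter> \<Union>A) \<le> ?m (E' \<union> (\<Union>A - U'))"
      by (rule measure_mono_fmeasurable[OF _ _ fmeasurable.Un[OF E'm fmeasurable.Diff[OF mA(2) U'm]]])
        (use E mA in \<open>auto simp: E'_def\<close>)
    moreover have "?m (E' \<union> (\<Union>A - U')) \<le> ?m E' + ?m (\<Union>A - U')"
      by (rule measure_Un_le) (use E'm U'm mA in auto)
    ultimately show ?thesis using A(5) mU z by (simp add: \<mu>_def)
  qed
  define VB where "VB = {{u..v} |u v. u < v \<and> slope f u v > q \<and> (\<exists>S\<in>A. {u..v} \<subseteq> S)}"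
  have VB: "VB \<subseteq> proper_intervals" by (auto simp: VB_def proper_intervals_def)
  obtain B where B: "finite B" "B \<subseteq> VB" "pairwise disjnt B" "?m (\<Union>B) > ?m E' - \<epsilon>"
  proof (rule Vitali_real[OF VB E'm U(1) _ Um _ eps(1)])
    show "E' \<subseteq> U" using U by (auto simp: E'_def)
    fix x r :: real assume x: "x \<in> E'" "r > 0"
    then obtain S where S: "S \<in> A" "x \<in> interior S" by (auto simp: E'_def U'_def)
    obtain s where s: "s > 0" "ball x s \<subseteq> S" using S(2) by (auto simp: mem_interior)
    obtain y where y: "y \<noteq> x" "\<bar>y - x\<bar> < min r s" "slope f x y > q"
      using hi[of x "min r s"] x s by (auto simp: E'_def)
    have "{min x y..max x y} \<subseteq> ball x s" using y by (auto simp: dist_real_def min_def max_def split: if_splits)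
    then have sub: "{min x y..max x y} \<subseteq> S" using s by blast
    show "\<exists>S\<in>VB. x \<in> S \<and> Sup S - Inf S < r"
    proof (intro bexI conjI)
      show "{min x y..max x y} \<in> VB"
        using y slope_sym[of f x y] sub S(1) unfolding VB_def by (cases "x < y") (auto simp: min_def max_def)
    qed (use y in \<open>auto simp: min_def max_def split: if_splits\<close>)
  qed blast
  have Bp: "B \<subseteq> proper_intervals" using B(2) VB by blast
  note mB = lmeasure_disjoint_proper_intervals[OF B(1) Bp B(3)]
  \<comment> \<open>The members of \<open>B\<close> inside \<open>S\<close> are completed to a
    division of \<open>S\<close>; the intervals added in the completion are the gaps.\<close>
  define BS where "BS = (\<lambda>S. {K\<in>B. K \<subseteq> S})"
  have "\<exists>Q. BS S \<subseteq> Q \<and> Q division_of S" if S: "S \<in> A" for S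
  proof -
    have "S \<in> proper_intervals" using S Ap by blast
    then obtain u v where uv: "S = {u..v}" by (rule proper_intervalsE)
    have "BS S division_of \<Union>(BS S)"
    proof (rule division_ofI)
      fix K1 K2 assume "K1 \<in> BS S" "K2 \<in> BS S" "K1 \<noteq> K2"
      then have "disjnt K1 K2" using B(3) by (auto simp: BS_def pairwise_def)
      then show "interior K1 \<inter> interior K2 = {}" using interior_subset unfolding disjnt_def by blast
    next
      fix K assume "K \<in> BS S"
      then have "K \<in> proper_intervals" using Bp by (auto simp: BS_def)
      then obtain u v where "K = {u..v}" "u < v" by (rule proper_intervalsE)
      then show "K \<noteq> {}" "\<exists>a b. K = cbox a b" by (auto)
    qed (use B(1) in \<open>auto simp: BS_def\<close>)
    moreover have "\<Union>(BS S) \<subseteq> cbox u v" using uv by (auto simp: BS_def)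
    ultimately obtain Q where "BS S \<subseteq> Q" "Q division_of cbox u v" by (rule partial_division_extend_interval)
    then show ?thesis using uv by auto
  qed
  then obtain Q where Q: "\<And>S. S \<in> A ==> BS S \<subseteq> Q S" "\<And>S. S \<in> A ==> Q S division_of S" by metis
  have finQ: "finite (Q S)" if "S \<in> A" for S using Q(2)[OF that] by blast
  \<comment> \<open>Gaps are indexed together with their host interval, since the divisions of
    different hosts are chosen independently of each other and might share a member as a
    set.\<close>
  define G where "G = (SIGMA S:A. Q S - BS S)"
  have Gint: "Inf (snd i) \<le> Sup (snd i) \<and> 0 \<le> Inf (snd i) \<and> Sup (snd i) \<le> 1 \<and> {Inf (snd i)<..<Sup (snd i)} = interior (snd i) \<and> snd i \<subseteq> fst i"
    if i0: "i \<in> G" for i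
  proof -
    obtain S K where i: "i = (S, K)" "S \<in> A" "K \<in> Q S" using i0 by (auto simp: G_def)
    obtain a b where ab: "K = cbox a b" "K \<noteq> {}" using Q(2)[OF i(2)] i(3) by blast
    have KS: "K \<subseteq> S" using Q(2)[OF i(2)] i(3) by blast
    moreover have "S \<subseteq> {0<..<1}" using i(2) A(4) U(3) by blast
    moreover have "a \<in> K" "b \<in> K" using ab by auto
    ultimately have "a \<in> {0<..<1}" "b \<in> {0<..<1}" by blast+
    moreover have "a \<le> b" using ab by simp
    ultimately show ?thesis using ab(1) i(1) KS by (simp add: interior_atLeastAtMost_real)
  qed
  have sumB: "(\<Sum>S\<in>A. \<Sum>K\<in>BS S. \<phi> K) = (\<Sum>K\<in>B. \<phi> K)" for \<phi> :: "real set => real"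
  proof -
    have "B = (\<Union>S\<in>A. BS S)" using B(2) by (auto simp: BS_def VB_def)
    moreover have "(\<Sum>K\<in>(\<Union>S\<in>A. BS S). \<phi> K) = (\<Sum>S\<in>A. \<Sum>K\<in>BS S. \<phi> K)"
    proof (rule sum.UNION_disjoint)
      show "\<forall>i\<in>A. finite (BS i)" using B(1) by (auto simp: BS_def)
      show "\<forall>i\<in>A. \<forall>j\<in>A. i \<noteq> j \<longrightarrow> BS i \<inter> BS j = {}"
      proof (intro ballI impI)
        fix i j assume ij: "i \<in> A" "j \<in> A" "i \<noteq> j"
        then have "i \<inter> j = {}" using A(3) by (auto simp: pairwise_def disjnt_def)
        moreover have "K \<noteq> {}" if "K \<in> B" for K
        proof -
          have "K \<in> proper_intervals" using that Bp by blast
          then show ?thesis by (rule proper_intervalsE) simp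
        qed
        ultimately show "BS i \<inter> BS j = {}" unfolding BS_def by blast
      qed
    qed (rule A(1))
    ultimately show ?thesis by simp
  qed
  \<comment> \<open>Used twice: with \<phi> the identity it compares lengths, with \<phi> =
    \<open>f\<close> it compares increments.\<close>
  have split: "(\<Sum>S\<in>A. increment \<phi> S) = (\<Sum>K\<in>B. increment \<phi> K) + (\<Sum>i\<in>G. increment \<phi> (snd i))" for \<phi>
  proof -
    have "increment \<phi> S = (\<Sum>K\<in>BS S. increment \<phi> K) + (\<Sum>K\<in>Q S - BS S. increment \<phi> K)" if S: "S \<in> A" for S
    proof -
      have "S \<in> proper_intervals" using S Ap by blast
      then obtain u v where uv: "S = {u..v}" "u < v" "Inf S = u" "Sup S = v" by (rule proper_intervalsE)
      have "increment \<phi> S = (\<Sum>K\<in>Q S. increment \<phi> K)"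
        using increment_division[of u v "Q S" \<phi>] Q(2)[OF S] uv by (simp add: increment_def)
      then show ?thesis using sum.subset_diff[OF Q(1)[OF S] finQ[OF S]] by (simp add: add.commute)
    qed
    then have "(\<Sum>S\<in>A. increment \<phi> S) = (\<Sum>S\<in>A. \<Sum>K\<in>BS S. increment \<phi> K) + (\<Sum>S\<in>A. \<Sum>K\<in>Q S - BS S. increment \<phi> K)"
      by (simp add: sum.distrib)
    moreover have "(\<Sum>S\<in>A. \<Sum>K\<in>Q S - BS S. increment \<phi> K) = (\<Sum>(S, K)\<in>G. increment \<phi> K)"
      unfolding G_def by (rule sum.Sigma) (use A(1) finQ in auto)
    ultimately show ?thesis using sumB by (simp add: case_prod_beta)
  qed
  define a b where "a = ?m (\<Union>A)" and "b = ?m (\<Union>B)"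
  have lens: "a = b + (\<Sum>i\<in>G. Sup (snd i) - Inf (snd i))"
    using split[of id] mA(1) mB(1) by (simp add: increment_def a_def b_def)
  have aU: "a < \<mu> + \<epsilon>"
    using measure_mono_fmeasurable[OF A(4) _ Um] mA mU by (auto simp: a_def)
  have bl: "b > \<mu> - 3 * \<epsilon>" using B(4) E'mu by (simp add: b_def)
  have "\<bar>\<Sum>i\<in>G. increment f (snd i)\<bar> \<le> (\<Sum>i\<in>G. \<bar>increment f (snd i)\<bar>)" by (rule sum_abs)
  also have "\<dots> < e"
    unfolding increment_def
  proof (rule d(2)[rule_format])
    show "finite G" using A(1) finQ by (auto simp: G_def)
    show "disjoint_family_on (\<lambda>i. {Inf (snd i)<..<Sup (snd i)}) G"
      unfolding disjoint_family_on_def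
    proof (intro ballI impI)
      fix i j assume ij: "i \<in> G" "j \<in> G" "i \<noteq> j"
      have mem: "fst i \<in> A" "snd i \<in> Q (fst i)" "fst j \<in> A" "snd j \<in> Q (fst j)"
        using ij by (auto simp: G_def)
      have "interior (snd i) \<inter> interior (snd j) = {}"
      proof (cases "fst i = fst j")
        case True
        then have "snd i \<noteq> snd j" using ij by (simp add: prod_eq_iff)
        then show ?thesis using division_ofD(5)[OF Q(2)[OF mem(1)] mem(2)] mem(4) True by simp
      next
        case False
        then have "fst i \<inter> fst j = {}" using pairwiseD[OF A(3) mem(1,3)] by (simp add: disjnt_def)
        then show ?thesis using Gint[OF ij(1)] Gint[OF ij(2)] interior_subset by blast
      qed
      then show "{Inf (snd i)<..<Sup (snd i)} \<inter> {Inf (snd j)<..<Sup (snd j)} = {}"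
        using Gint[OF ij(1)] Gint[OF ij(2)] by simp
    qed
    show "(\<Sum>i\<in>G. Sup (snd i) - Inf (snd i)) < d" using lens aU bl eps(2) d(1) by simp
  qed (use Gint in auto)
  finally have gap: "\<bar>\<Sum>i\<in>G. increment f (snd i)\<bar> < e" .
  have incA: "(\<Sum>S\<in>A. increment f S) \<le> p * a"
  proof -
    have "increment f S \<le> p * (Sup S - Inf S)" if "S \<in> A" for S
    proof -
      obtain u v where uv: "S = {u..v}" "u < v" "slope f u v < p" using \<open>S \<in> A\<close> A(2) by (auto simp: VA_def)
      then show ?thesis by (simp add: increment_def slope_def field_simps)
    qed
    then have "(\<Sum>S\<in>A. increment f S) \<le> (\<Sum>S\<in>A. p * (Sup S - Inf S))" by (rule sum_mono)
    then show ?thesis using mA(1) by (simp add: a_def sum_distrib_left)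
  qed
  have incB: "(\<Sum>S\<in>B. increment f S) \<ge> q * b"
  proof -
    have "increment f S \<ge> q * (Sup S - Inf S)" if "S \<in> B" for S
    proof -
      obtain u v where uv: "S = {u..v}" "u < v" "slope f u v > q" using \<open>S \<in> B\<close> B(2) by (auto simp: VB_def)
      then show ?thesis by (simp add: increment_def slope_def field_simps)
    qed
    then have "(\<Sum>S\<in>B. increment f S) \<ge> (\<Sum>S\<in>B. q * (Sup S - Inf S))" by (rule sum_mono)
    then show ?thesis using mB(1) by (simp add: b_def sum_distrib_left)
  qed
  have "q * b - p * a < e" using split[of f] gap incA incB by linarith
  moreover have "q * b - p * a = (q - p) * b - p * (a - b)" by (simp add: algebra_simps)
  moreover have "(q - p) * b \<ge> (q - p) * (3 / 4 * \<mu>)"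
    using bl eps(3) pq by (intro mult_left_mono) auto
  moreover have "p * (a - b) \<le> (q - p) * \<mu> / 4"
  proof -
    have "0 \<le> a - b" using lens Gint by (auto intro!: sum_nonneg)
    have "p * (a - b) \<le> \<bar>p\<bar> * (a - b)" using \<open>0 \<le> a - b\<close> by (intro mult_right_mono) auto
    also have "\<dots> \<le> \<bar>p\<bar> * (4 * \<epsilon>)" using aU bl by (intro mult_left_mono) auto
    also have "\<dots> \<le> (\<bar>p\<bar> + 1) * (4 * ((q - p) * \<mu> / (16 * (\<bar>p\<bar> + 1))))"
      using eps by (intro mult_mono) auto
    also have "\<dots> = (q - p) * \<mu> / 4" by (simp add: field_simps)
    finally show ?thesis .
  qed
  ultimately have "(q - p) * (3 / 4 * \<mu>) - (q - p) * \<mu> / 4 < e" by linarith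
  moreover have "(q - p) * (3 / 4 * \<mu>) - (q - p) * \<mu> / 4 = 2 * e" unfolding e_def by (simp add: field_simps)
  ultimately show False using e by simp
qed

text \<open>Inside a window of length \<open>d\<close>, absolute continuity bounds the variation
  over disjoint intervals by 1. If \<open>E\<close> had positive measure there, intervals of slope
  beyond N covering more than half of it would have variation above N/2 times that measure, which
  exceeds 1 for large N.\<close>

lemma negligible_unbounded_slope:
  assumes f: "absolutely_continuous_on_Icc 0 1 f" and E: "E \<in> lmeasurable" "E \<subseteq> {0<..<1}"
    and unb: "\<And>x d N. x \<in> E ==> d > 0 ==> \<exists>y. y \<noteq> x \<and> \<bar>y - x\<bar> < d \<and> \<bar>slope f x y\<bar> > real N"
  shows "negligible E"
proof -
  let ?m = "measure lebesgue"
  obtain d where d: "d > 0" "\<forall>(I :: real set set) u v. finite I \<longrightarrow>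
      (\<forall>i\<in>I. 0 \<le> u i \<and> u i \<le> v i \<and> v i \<le> 1) \<longrightarrow>
      disjoint_family_on (\<lambda>i. {u i<..<v i}) I \<longrightarrow> (\<Sum>i\<in>I. v i - u i) < d \<longrightarrow>
      (\<Sum>i\<in>I. \<bar>f (v i) - f (u i)\<bar>) < 1"
    using AC_finite_family[OF f zero_less_one, where 'i="real set"] by auto
  have "negligible (E \<inter> {s<..<s + d})" for s
  proof (rule ccontr)
    assume nn: "\<not> negligible (E \<inter> {s<..<s + d})"
    define F where "F = E \<inter> {s<..<s + d}"
    have Fm: "F \<in> lmeasurable" using E(1) by (auto simp: F_def intro: fmeasurable_Int_fmeasurable)
    have mu: "?m F > 0" using nn Fm unfolding F_def by (simp add: negligible_iff_measure zero_less_measure_iff less_le)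
    obtain N :: nat where N: "real N > 2 / ?m F" using reals_Archimedean2 by blast
    define U where "U = {s<..<s + d} \<inter> {0<..<1::real}"
    have U: "open U" "F \<subseteq> U" "U \<in> lmeasurable"
      using E(2) by (auto simp: U_def F_def)
    define VA where "VA = {{u..v} |u v. u < v \<and> \<bar>slope f u v\<bar> > real N}"
    have VA: "VA \<subseteq> proper_intervals" by (auto simp: VA_def proper_intervals_def)
    obtain A where A: "finite A" "A \<subseteq> VA" "pairwise disjnt A" "\<Union>A \<subseteq> U" "?m (\<Union>A) > ?m F - ?m F / 2"
    proof (rule Vitali_real[OF VA Fm U(1,2,3)])
      fix x r :: real assume x: "x \<in> F" "r > 0"
      then obtain y where y: "y \<noteq> x" "\<bar>y - x\<bar> < r" "\<bar>slope f x y\<bar> > real N" using unb[of x r N] by (auto simp: F_def)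
      show "\<exists>S\<in>VA. x \<in> S \<and> Sup S - Inf S < r"
      proof (intro bexI conjI)
        show "{min x y..max x y} \<in> VA"
          using y slope_sym[of f x y] unfolding VA_def by (cases "x < y") (auto simp: min_def max_def)
      qed (use y in \<open>auto simp: min_def max_def\<close>)
    next
      show "?m F / 2 > 0" using mu by simp
    qed blast
    have Ap: "A \<subseteq> proper_intervals" using A(2) VA by blast
    note mA = lmeasure_disjoint_proper_intervals[OF A(1) Ap A(3)]
    have Ai: "Inf S \<le> Sup S \<and> 0 \<le> Inf S \<and> Sup S \<le> 1 \<and> {Inf S<..<Sup S} \<subseteq> S" if "S \<in> A" for S
    proof -
      have "S \<in> proper_intervals" using that Ap by blast
      then obtain u v where uv: "S = {u..v}" "u < v" "Inf S = u" "Sup S = v" by (rule proper_intervalsE)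
      have "S \<subseteq> {0<..<1}" using that A(4) by (auto simp: U_def)
      moreover have "u \<in> S" "v \<in> S" using uv by auto
      ultimately have "u \<in> {0<..<1}" "v \<in> {0<..<1}" by blast+
      then show ?thesis using uv by auto
    qed
    have lt: "?m (\<Union>A) < d"
    proof -
      have "?m (\<Union>A) \<le> ?m {s<..<s + d}" using A(4) mA by (intro measure_mono_fmeasurable) (auto simp: U_def)
      moreover have "?m (\<Union>A) \<noteq> d"
      proof
        assume eq: "?m (\<Union>A) = d"
        have "closed (\<Union>A)"
        proof (rule closed_Union[OF A(1)], rule ballI)
          fix S assume "S \<in> A"
          then have "S \<in> proper_intervals" using Ap by blast
          then show "closed S" by (rule proper_intervalsE) simp
        qed
        then have op: "open ({s<..<s + d} - \<Union>A)" by (intro open_Diff) auto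
        have "?m ({s<..<s + d} - \<Union>A) = ?m {s<..<s + d} - ?m (\<Union>A)"
          using A(4) mA by (intro measurable_measure_Diff) (auto simp: U_def)
        then have "?m ({s<..<s + d} - \<Union>A) = 0" using eq d(1) by simp
        then have "negligible ({s<..<s + d} - \<Union>A)"
          using mA by (subst negligible_iff_measure) (auto intro!: fmeasurable.Diff)
        then have "{s<..<s + d} - \<Union>A = {}" using op open_not_negligible by blast
        then have "{s<..<s + d} = \<Union>A" using A(4) by (auto simp: U_def)
        then have "closed {s<..<s + d}" using \<open>closed (\<Union>A)\<close> by simp
        then show False using d(1) by (metis clopen connected_UNIV greaterThanLessThan_empty_iff2 less_add_same_cancel1 not_le open_greaterThanLessThan UNIV_I greaterThanLessThan_iff less_irrefl)
      qed
      ultimately show ?thesis using d(1) by simp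
    qed
    have "(\<Sum>S\<in>A. \<bar>f (Sup S) - f (Inf S)\<bar>) < 1"
    proof (rule d(2)[rule_format])
      show "disjoint_family_on (\<lambda>i. {Inf i<..<Sup i}) A"
        using A(3) Ai unfolding disjoint_family_on_def pairwise_def disjnt_def by blast
    qed (use A(1) Ai lt mA(1) in auto)
    moreover have "(\<Sum>S\<in>A. \<bar>f (Sup S) - f (Inf S)\<bar>) \<ge> (\<Sum>S\<in>A. real N * (Sup S - Inf S))"
    proof (rule sum_mono)
      fix S assume "S \<in> A"
      then obtain u v where uv: "S = {u..v}" "u < v" "\<bar>slope f u v\<bar> > real N" using A(2) by (auto simp: VA_def)
      then have "real N < \<bar>f v - f u\<bar> / (v - u)" by (simp add: slope_def abs_divide)
      then have "real N * (v - u) \<le> \<bar>f v - f u\<bar>" using uv(2) by (simp add: pos_less_divide_eq)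
      then show "real N * (Sup S - Inf S) \<le> \<bar>f (Sup S) - f (Inf S)\<bar>" using uv by simp
    qed
    moreover have "(\<Sum>S\<in>A. real N * (Sup S - Inf S)) = real N * ?m (\<Union>A)" using mA(1) by (simp add: sum_distrib_left)
    moreover have "real N * ?m (\<Union>A) \<ge> real N * (?m F / 2)" using A(5) by (intro mult_left_mono) auto
    moreover have "real N * (?m F / 2) > 1" using N mu by (simp add: field_simps)
    ultimately show False by linarith
  qed
  then have "negligible (\<Union>k::int. E \<inter> {of_int k * (d/2)<..<of_int k * (d/2) + d})"
    by (intro negligible_countable_Union) auto
  moreover have "E \<subseteq> (\<Union>k::int. E \<inter> {of_int k * (d/2)<..<of_int k * (d/2) + d})"
  proof
    fix x assume x: "x \<in> E"
    \<comment> \<open>The windows overlap by half, so points on their boundaries are covered too;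
      the ceiling minus one makes the left inequality strict.\<close>
    define k where "k = \<lceil>x / (d/2)\<rceil> - 1"
    have "of_int k < x / (d/2)" "x / (d/2) \<le> of_int k + 1" unfolding k_def by linarith+
    moreover have "x / (d/2) < of_int k + 2" using calculation(2) by linarith
    ultimately have "of_int k * (d/2) < x" "x < (of_int k + 2) * (d/2)"
      using d(1) by (simp_all only: pos_less_divide_eq pos_divide_less_eq half_gt_zero)
    then have "of_int k * (d/2) < x" "x < of_int k * (d/2) + d" by (simp_all add: algebra_simps)
    then show "x \<in> (\<Union>k::int. E \<inter> {of_int k * (d/2)<..<of_int k * (d/2) + d})" using x by auto
  qed
  ultimately show ?thesis by (rule negligible_subset)
qed

text \<open>This is \<open>frequently\<close> at \<open>x\<close>, spelled out with second points
  \<open>y\<close> inside the open interval, where continuity of \<open>f\<close> is known; in this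
  form it becomes a countable intersection of open sets.\<close>

definition slopes_meet :: "(real => real) => real set => real set" where
  "slopes_meet f T = {x\<in>{0<..<1}. \<forall>d>0. \<exists>y\<in>{0<..<1}. y \<noteq> x \<and> \<bar>y - x\<bar> < d \<and> slope f x y \<in> T}"

text \<open>For fixed \<open>y\<close> the admissible points form an open set, and unions of open
  sets over uncountably many \<open>y\<close> stay open; only the distance bound has to run through
  a countable sequence.\<close>

lemma borel_slopes_meet:
  assumes f: "continuous_on {0<..<1} f" and T: "open T"
  shows "slopes_meet f T \<in> sets borel"
proof -
  define A where "A = (\<lambda>(k::nat) y. {x\<in>{0<..<1} - {y}. \<bar>y - x\<bar> < 1 / (real k + 1) \<and> slope f x y \<in> T})"
  have opA: "open (A k y)" for k y
  proof -
    have c: "continuous_on ({0<..<1} - {y}) (\<lambda>x. slope f x y)"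
      unfolding slope_def by (intro continuous_intros continuous_on_subset[OF f]) auto
    have "open (({0<..<1} - {y}) \<inter> (\<lambda>x. slope f x y) -` T)"
      by (rule continuous_open_preimage[OF c _ T]) auto
    moreover have "A k y = ({0<..<1} - {y}) \<inter> (\<lambda>x. slope f x y) -` T \<inter> ball y (1 / (real k + 1))"
      by (auto simp: A_def dist_real_def)
    ultimately show ?thesis by (simp add: open_Int)
  qed
  have "slopes_meet f T = (\<Inter>k::nat. \<Union>y\<in>{0<..<1}. A k y)"
  proof (intro equalityI subsetI)
    fix x assume x: "x \<in> slopes_meet f T"
    show "x \<in> (\<Inter>k. \<Union>y\<in>{0<..<1}. A k y)"
    proof
      fix k :: nat
      have "1 / (real k + 1) > 0" by simp
      then obtain y where "y \<in> {0<..<1}" "y \<noteq> x" "\<bar>y - x\<bar> < 1 / (real k + 1)" "slope f x y \<in> T"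
        using x unfolding slopes_meet_def by blast
      then show "x \<in> (\<Union>y\<in>{0<..<1}. A k y)" using x by (auto simp: A_def slopes_meet_def)
    qed
  next
    fix x assume x: "x \<in> (\<Inter>k. \<Union>y\<in>{0<..<1}. A k y)"
    have "\<exists>y\<in>{0<..<1}. y \<noteq> x \<and> \<bar>y - x\<bar> < d \<and> slope f x y \<in> T" if d: "d > 0" for d
    proof -
      obtain k :: nat where k: "1 / (real k + 1) < d" using nat_approx_posE[OF d] by (metis of_nat_Suc add.commute)
      obtain y where "y \<in> {0<..<1}" "x \<in> A k y" using x by blast
      then show ?thesis using k by (intro bexI[of _ y]) (auto simp: A_def)
    qed
    moreover have "x \<in> {0<..<1}" using x by (auto simp: A_def)
    ultimately show "x \<in> slopes_meet f T" by (auto simp: slopes_meet_def)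
  qed
  moreover have "open (\<Union>y\<in>{0<..<1}. A k y)" for k using opA by blast
  ultimately show ?thesis by (simp add: borel_open)
qed

lemma slopes_meet_iff_frequently:
  "x \<in> slopes_meet f T \<longleftrightarrow> x \<in> {0<..<1} \<and> (\<exists>\<^sub>F y in at x. slope f x y \<in> T)"
proof (cases "x \<in> {0<..<1}")
  case True
  then obtain r where r: "r > 0" "ball x r \<subseteq> {0<..<1}" by (meson open_greaterThanLessThan openE)
  have "(\<exists>\<^sub>F y in at x. slope f x y \<in> T) \<longleftrightarrow> (\<forall>d>0. \<exists>y. y \<noteq> x \<and> \<bar>y - x\<bar> < d \<and> slope f x y \<in> T)"
    unfolding frequently_def eventually_at by (auto simp: dist_real_def)
  also have "\<dots> \<longleftrightarrow> (\<forall>d>0. \<exists>y\<in>{0<..<1}. y \<noteq> x \<and> \<bar>y - x\<bar> < d \<and> slope f x y \<in> T)"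
  proof (intro iffI allI impI)
    fix d :: real assume *: "\<forall>d>0. \<exists>y. y \<noteq> x \<and> \<bar>y - x\<bar> < d \<and> slope f x y \<in> T" and d: "d > 0"
    obtain y where y: "y \<noteq> x" "\<bar>y - x\<bar> < min d r" "slope f x y \<in> T" using * d r(1) by (metis min_less_iff_conj)
    then have "y \<in> ball x r" by (simp add: dist_real_def abs_minus_commute)
    then show "\<exists>y\<in>{0<..<1}. y \<noteq> x \<and> \<bar>y - x\<bar> < d \<and> slope f x y \<in> T" using y r(2) by (intro bexI[of _ y]) auto
  qed blast
  finally show ?thesis using True by (simp add: slopes_meet_def)
qed (auto simp: slopes_meet_def)

text \<open>Rational levels make the union countable, so that both measurability and negligibility
  can be checked for one pair of levels at a time.\<close>

definition oscillating_slopes :: "(real => real) => real set" where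
  "oscillating_slopes f = (\<Union>p\<in>\<rat>. \<Union>q\<in>\<rat> \<inter> {p<..}. slopes_meet f {..<p} \<inter> slopes_meet f {q<..})"

definition unbounded_slopes :: "(real => real) => real set" where
  "unbounded_slopes f = (\<Inter>N::nat. slopes_meet f {s. \<bar>s\<bar> > real N})"

text \<open>Bounded slopes have finite lower and upper limits; if these differ, two rationals
  strictly between them are crossed frequently in opposite directions.\<close>

lemma slope_converges_iff:
  assumes x: "x \<in> {0<..<1}"
  shows "(\<exists>L. (slope f x \<longlongrightarrow> L) (at x)) \<longleftrightarrow>
    x \<notin> unbounded_slopes f \<union> oscillating_slopes f" (is "?L \<longleftrightarrow> x \<notin> ?U \<union> ?O")
proof
  assume ?L
  then obtain L where L: "(slope f x \<longlongrightarrow> L) (at x)" by blast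
  have "x \<notin> ?U"
  proof -
    obtain N :: nat where N: "real N > \<bar>L\<bar>" using reals_Archimedean2 by blast
    have "\<forall>\<^sub>F y in at x. \<bar>slope f x y\<bar> < real N" by (rule order_tendstoD(2)[OF tendsto_rabs[OF L] N])
    then have "x \<notin> slopes_meet f {s. \<bar>s\<bar> > real N}"
      unfolding slopes_meet_iff_frequently frequently_def by (auto elim: eventually_mono)
    then show ?thesis unfolding unbounded_slopes_def by blast
  qed
  moreover have "x \<notin> ?O"
  proof
    assume "x \<in> ?O"
    then obtain p q where pq: "p < q" "x \<in> slopes_meet f {..<p}" "x \<in> slopes_meet f {q<..}"
      unfolding oscillating_slopes_def by auto
    have "\<not> p < L"
    proof
      assume "p < L"
      then have "\<forall>\<^sub>F y in at x. slope f x y \<notin> {..<p}"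
        by (intro eventually_mono[OF order_tendstoD(1)[OF L]]) auto
      then show False using pq(2) by (simp add: slopes_meet_iff_frequently frequently_def)
    qed
    moreover have "\<not> L < q"
    proof
      assume "L < q"
      then have "\<forall>\<^sub>F y in at x. slope f x y \<notin> {q<..}"
        by (intro eventually_mono[OF order_tendstoD(2)[OF L]]) auto
      then show False using pq(3) by (simp add: slopes_meet_iff_frequently frequently_def)
    qed
    ultimately show False using pq(1) by simp
  qed
  ultimately show "x \<notin> ?U \<union> ?O" by blast
next
  assume nx: "x \<notin> ?U \<union> ?O"
  let ?s = "\<lambda>y. ereal (slope f x y)"
  have nt: "\<not> trivial_limit (at x)" by simp
  obtain N :: nat where "x \<notin> slopes_meet f {s. \<bar>s\<bar> > real N}" using nx unfolding unbounded_slopes_def by blast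
  then have ev: "\<forall>\<^sub>F y in at x. \<bar>slope f x y\<bar> \<le> real N"
    using x unfolding slopes_meet_iff_frequently by (simp add: not_frequently not_less)
  have l: "Liminf (at x) ?s \<ge> ereal (- real N)"
    by (rule Liminf_bounded) (use ev in \<open>auto elim: eventually_mono\<close>)
  have u: "Limsup (at x) ?s \<le> ereal (real N)"
    by (rule Limsup_bounded) (use ev in \<open>auto elim: eventually_mono\<close>)
  have lu: "Liminf (at x) ?s \<le> Limsup (at x) ?s" by (rule Liminf_le_Limsup[OF nt])
  have eq: "Liminf (at x) ?s = Limsup (at x) ?s"
  proof (rule ccontr)
    assume "Liminf (at x) ?s \<noteq> Limsup (at x) ?s"
    then have lt: "Liminf (at x) ?s < Limsup (at x) ?s" using lu by simp
    obtain q where q: "Liminf (at x) ?s < ereal (real_of_rat q)" "ereal (real_of_rat q) < Limsup (at x) ?s"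
      using ereal_dense3[OF lt] by blast
    obtain p where p: "Liminf (at x) ?s < ereal (real_of_rat p)" "ereal (real_of_rat p) < ereal (real_of_rat q)"
      using ereal_dense3[OF q(1)] by blast
    have "\<exists>\<^sub>F y in at x. slope f x y < real_of_rat p"
    proof (rule ccontr)
      assume "\<not> (\<exists>\<^sub>F y in at x. slope f x y < real_of_rat p)"
      then have "\<forall>\<^sub>F y in at x. ereal (real_of_rat p) \<le> ?s y" by (simp add: not_frequently not_less)
      then show False using Liminf_bounded[of "ereal (real_of_rat p)" ?s "at x"] p(1) by simp
    qed
    moreover have "\<exists>\<^sub>F y in at x. slope f x y > real_of_rat q"
    proof (rule ccontr)
      assume "\<not> (\<exists>\<^sub>F y in at x. slope f x y > real_of_rat q)"
      then have "\<forall>\<^sub>F y in at x. ?s y \<le> ereal (real_of_rat q)" by (simp add: not_frequently not_less)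
      then show False using Limsup_bounded[of ?s "ereal (real_of_rat q)" "at x"] q(2) by simp
    qed
    ultimately have "x \<in> slopes_meet f {..<real_of_rat p} \<inter> slopes_meet f {real_of_rat q<..}"
      using x by (simp add: slopes_meet_iff_frequently)
    moreover have "real_of_rat q \<in> \<rat> \<inter> {real_of_rat p<..}" "real_of_rat p \<in> \<rat>" using p(2) by simp_all
    ultimately have "x \<in> ?O" unfolding oscillating_slopes_def by blast
    then show False using nx by blast
  qed
  have "\<bar>Limsup (at x) ?s\<bar> \<noteq> \<infinity>" using l u eq by (cases "Limsup (at x) ?s") auto
  then obtain L where L: "Limsup (at x) ?s = ereal L" by auto
  have "(?s \<longlongrightarrow> ereal L) (at x)" using Liminf_eq_Limsup[OF nt _ L] eq L by simp
  then show ?L by (auto simp: lim_ereal)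
qed

lemma differentiable_iff_slope_converges:
  assumes x: "x \<in> {0<..<1}"
  shows "f differentiable (at x within {0..1}) \<longleftrightarrow> (\<exists>L. (slope f x \<longlongrightarrow> L) (at x))"
proof -
  have "at x within {0..1} = at x" using x by (intro at_within_Icc_at) auto
  then have "f differentiable (at x within {0..1}) \<longleftrightarrow> (\<exists>L. (f has_field_derivative L) (at x))"
    by (simp add: real_differentiable_def)
  then show ?thesis by (simp add: has_field_derivative_iff slope_def[abs_def])
qed

lemma nondifferentiable_eq:
  "{x\<in>{0<..<1}. \<not> f differentiable (at x within {0..1})} = {0<..<1} \<inter> (unbounded_slopes f \<union> oscillating_slopes f)"
  using slope_converges_iff[of _ f] differentiable_iff_slope_converges[of _ f] by blast

lemma borel_unbounded_slopes:
  assumes c: "continuous_on {0<..<1} f"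
  shows "unbounded_slopes f \<in> sets borel"
proof -
  have "open {s::real. \<bar>s\<bar> > real N}" for N :: nat by (intro open_Collect_less continuous_intros)
  then show ?thesis unfolding unbounded_slopes_def
    using borel_slopes_meet[OF c] by (intro sets.countable_INT) auto
qed

lemma borel_oscillating_slopes:
  assumes c: "continuous_on {0<..<1} f"
  shows "oscillating_slopes f \<in> sets borel"
proof -
  have pq: "slopes_meet f {..<p} \<inter> slopes_meet f {q<..} \<in> sets borel" for p q
    using borel_slopes_meet[OF c] by (intro sets.Int) auto
  have p: "(\<Union>q\<in>\<rat> \<inter> {p<..}. slopes_meet f {..<p} \<inter> slopes_meet f {q<..}) \<in> sets borel" for p
    by (rule sets.countable_UN'[OF countable_Int1[OF countable_rat]]) (use pq in blast)
  show ?thesis unfolding oscillating_slopes_def by (rule sets.countable_UN'[OF countable_rat]) (use p in blast)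
qed

lemma borel_nondifferentiable:
  fixes f :: "real => real"
  assumes "continuous_on {0..1} f"
  shows "{x\<in>{0<..<1}. \<not> f differentiable (at x within {0..1})} \<in> sets borel"
proof -
  have c: "continuous_on {0<..<1} f" by (rule continuous_on_subset[OF assms]) auto
  show ?thesis unfolding nondifferentiable_eq
    using borel_unbounded_slopes[OF c] borel_oscillating_slopes[OF c] by (intro sets.Int sets.Un) auto
qed

text \<open>Lebesgue's theorem, obtained from the two covering arguments directly for absolutely
  continuous functions, without a decomposition into monotone parts. The endpoints are discarded as
  null, so that users may work at interior points.\<close>

theorem AC_AE_differentiable:
  assumes f: "absolutely_continuous_on_Icc 0 1 f"
  shows "AE x in lborel. x \<in> {0..1} \<longrightarrow> x \<in> {0<..<1} \<and> f differentiable (at x within {0..1})"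
proof -
  have c0: "continuous_on {0..1} f" by (rule AC_continuous_on[OF f])
  have c: "continuous_on {0<..<1} f" by (rule continuous_on_subset[OF c0]) auto
  have sub: "slopes_meet f T \<subseteq> {0<..<1}" for T by (auto simp: slopes_meet_def)
  have U: "negligible (unbounded_slopes f)"
  proof (rule negligible_unbounded_slope[OF f])
    show us: "unbounded_slopes f \<subseteq> {0<..<1}" using sub unfolding unbounded_slopes_def by blast
    show "unbounded_slopes f \<in> lmeasurable" by (rule bounded_borel_lmeasurable[OF borel_unbounded_slopes[OF c] us])
    fix x d :: real and N :: nat assume "x \<in> unbounded_slopes f" "d > 0"
    then have "x \<in> slopes_meet f {s. \<bar>s\<bar> > real N}" unfolding unbounded_slopes_def by blast
    then show "\<exists>y. y \<noteq> x \<and> \<bar>y - x\<bar> < d \<and> \<bar>slope f x y\<bar> > real N"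
      using \<open>d > 0\<close> unfolding slopes_meet_def by blast
  qed
  have O1: "negligible (slopes_meet f {..<p} \<inter> slopes_meet f {q<..})" if "p < q" for p q
  proof (rule negligible_oscillating_slope[OF f _ _ that])
    show ss: "slopes_meet f {..<p} \<inter> slopes_meet f {q<..} \<subseteq> {0<..<1}" using sub by blast
    show "slopes_meet f {..<p} \<inter> slopes_meet f {q<..} \<in> lmeasurable"
      by (rule bounded_borel_lmeasurable[OF _ ss]) (use borel_slopes_meet[OF c] in \<open>auto intro: sets.Int\<close>)
    fix x d :: real assume x: "x \<in> slopes_meet f {..<p} \<inter> slopes_meet f {q<..}" and d: "d > 0"
    show "\<exists>y. y \<noteq> x \<and> \<bar>y - x\<bar> < d \<and> slope f x y < p" using x d unfolding slopes_meet_def by blast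
    show "\<exists>y. y \<noteq> x \<and> \<bar>y - x\<bar> < d \<and> slope f x y > q" using x d unfolding slopes_meet_def by blast
  qed
  have O2: "negligible (\<Union>q\<in>\<rat> \<inter> {p<..}. slopes_meet f {..<p} \<inter> slopes_meet f {q<..})" for p
  proof (rule negligible_countable_Union)
    show "countable ((\<lambda>q. slopes_meet f {..<p} \<inter> slopes_meet f {q<..}) ` (\<rat> \<inter> {p<..}))"
      by (intro countable_image countable_Int1 countable_rat)
  qed (use O1 in auto)
  have O3: "negligible (oscillating_slopes f)" unfolding oscillating_slopes_def
  proof (rule negligible_countable_Union)
    show "countable ((\<lambda>p. \<Union>q\<in>\<rat> \<inter> {p<..}. slopes_meet f {..<p} \<inter> slopes_meet f {q<..}) ` (\<rat> :: real set))"
      by (intro countable_image countable_rat)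
  qed (use O2 in auto)
  let ?N = "{x\<in>{0<..<1}. \<not> f differentiable (at x within {0..1})}"
  have "negligible ?N" unfolding nondifferentiable_eq
    by (rule negligible_subset[OF negligible_Un[OF U O3]]) blast
  then have "?N \<in> null_sets lebesgue" by (simp only: negligible_iff_null_sets)
  then have "?N \<in> null_sets lborel"
    using borel_nondifferentiable[OF c0] null_sets_completion_iff[of ?N lborel] by simp
  then have "AE x in lborel. x \<notin> ?N" by (rule AE_not_in)
  moreover have "AE x in lborel. x \<noteq> (0::real)" "AE x in lborel. x \<noteq> (1::real)" by (rule AE_lborel_singleton)+
  ultimately show ?thesis by eventually_elim auto
qed

text \<open>Membership in \<open>sobolev\<close> demands measurability of the top derivative
  including its default values; this lemma is what makes that verifiable for linear
  combinations.\<close>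

lemma borel_vector_derivative:
  fixes f :: "real => real"
  assumes f: "continuous_on {0..1} f"
  shows "set_borel_measurable lborel {0..1} (\<lambda>x. vector_derivative f (at x within {0..1}))"
proof -
  define D where "D = {x\<in>{0<..<1}. f differentiable (at x within {0..1})}"
  define ND where "ND = {x\<in>{0<..<1}. \<not> f differentiable (at x within {0..1})}"
  have ND: "ND \<in> sets borel" unfolding ND_def by (rule borel_nondifferentiable[OF f])
  have "D = {0<..<1} - ND" by (auto simp: D_def ND_def)
  then have D: "D \<in> sets borel" using ND by simp
  \<comment> \<open>Clamping extends \<open>f\<close> continuously to the line, so the forward
    difference quotients are Borel everywhere and may be taken without regard to the right
    endpoint.\<close>
  define fe where "fe = (\<lambda>x. f (max 0 (min 1 x)))"
  have "continuous_on UNIV fe" unfolding fe_def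
    by (rule continuous_on_compose2[OF f]) (auto intro!: continuous_intros)
  then have fe[measurable]: "fe \<in> borel_measurable borel" by (rule borel_measurable_continuous_onI)
  define G where "G = (\<lambda>x. lim (\<lambda>n. (fe (x + 1 / (real n + 1)) - fe x) / (1 / (real n + 1))))"
  have G[measurable]: "G \<in> borel_measurable borel" unfolding G_def by (rule borel_measurable_lim_metric) simp
  \<comment> \<open>Without a derivative, \<open>vector_derivative\<close> chooses from a predicate
    that is constantly false, hence it takes this same value at every such point.\<close>
  define c where "c = (SOME d::real. False)"
  let ?v = "\<lambda>x. vector_derivative f (at x within {0..1})"
  have GD: "?v x = G x" if x: "x \<in> D" for x
  proof -
    have xi: "x \<in> {0<..<1}" using x by (simp add: D_def)
    have at: "at x within {0..1} = at x" using xi by (intro at_within_Icc_at) auto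
    obtain L where L: "(slope f x \<longlongrightarrow> L) (at x)"
      using x differentiable_iff_slope_converges[OF xi] by (auto simp: D_def)
    then have "(f has_field_derivative L) (at x)" by (simp add: has_field_derivative_iff slope_def[abs_def])
    then have v: "?v x = L" unfolding at
      by (simp add: has_real_derivative_iff_has_vector_derivative vector_derivative_at)
    have lim0: "(\<lambda>n. x + 1 / (real n + 1)) \<longlonglongrightarrow> x"
      using tendsto_add[OF tendsto_const[of x] LIMSEQ_inverse_real_of_nat] by (simp add: inverse_eq_divide add.commute)
    have "filterlim (\<lambda>n. x + 1 / (real n + 1)) (at x) sequentially"
      using lim0 by (simp add: filterlim_at)
    then have l1: "(\<lambda>n. slope f x (x + 1 / (real n + 1))) \<longlonglongrightarrow> L" by (rule filterlim_compose[OF L])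
    have "\<forall>\<^sub>F n in sequentially. x + 1 / (real n + 1) < 1" using xi by (intro order_tendstoD[OF lim0]) auto
    then have "\<forall>\<^sub>F n in sequentially. slope f x (x + 1 / (real n + 1)) =
        (fe (x + 1 / (real n + 1)) - fe x) / (1 / (real n + 1))"
    proof eventually_elim
      case (elim n)
      have "0 \<le> x + 1 / (real n + 1)" using xi by (auto intro!: add_nonneg_nonneg)
      then show ?case using elim xi by (simp add: slope_def fe_def max_def min_def)
    qed
    then have "(\<lambda>n. (fe (x + 1 / (real n + 1)) - fe x) / (1 / (real n + 1))) \<longlonglongrightarrow> L"
      by (rule Lim_transform_eventually[OF l1])
    then show ?thesis unfolding v G_def by (simp add: limI)
  qed
  have ND2: "?v x = c" if x: "x \<in> ND" for x
  proof -
    have "\<not> (f has_vector_derivative d) (at x within {0..1})" for d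
      using x differentiableI_vector by (auto simp: ND_def)
    then show ?thesis unfolding vector_derivative_def c_def by simp
  qed
  have "(\<lambda>x. indicator {0..1} x *\<^sub>R ?v x) = (\<lambda>x. indicator D x * G x + indicator ND x * c
      + indicator {0} x * ?v 0 + indicator {1} x * ?v 1)"
  proof
    fix x :: real
    consider "x \<notin> {0..1}" | "x = 0" | "x = 1" | "x \<in> D" | "x \<in> ND"
      unfolding D_def ND_def by (cases "x = 0 \<or> x = 1") fastforce+
    then show "indicator {0..1} x *\<^sub>R ?v x = indicator D x * G x + indicator ND x * c
      + indicator {0} x * ?v 0 + indicator {1} x * ?v 1"
    proof cases
      case 4
      then have "x \<in> {0<..<1}" "x \<notin> ND" by (auto simp: D_def ND_def)
      then show ?thesis using GD[OF 4] 4 by (auto simp: indicator_def)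
    next
      case 5
      then have "x \<in> {0<..<1}" "x \<notin> D" by (auto simp: D_def ND_def)
      then show ?thesis using ND2[OF 5] 5 by (auto simp: indicator_def)
    qed (auto simp: D_def ND_def indicator_def)
  qed
  moreover have "(\<lambda>x. indicator D x * G x + indicator ND x * c
      + indicator {0} x * ?v 0 + indicator {1} x * ?v 1) \<in> borel_measurable lborel"
    using D ND by (auto intro!: borel_measurable_add borel_measurable_times)
  ultimately show ?thesis unfolding set_borel_measurable_def by simp
qed

section \<open>Sobolev spaces\<close>

lemma has_vector_derivative_cong_Icc:
  fixes f g :: "real => real"
  assumes "\<And>y. y \<in> {0..1} ==> f y = g y" "x \<in> {0..1}"
  shows "(f has_vector_derivative d) (at x within {0..1}) \<longleftrightarrow> (g has_vector_derivative d) (at x within {0..1})"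
  using has_vector_derivative_transform[of x "{0..1}" f g d] has_vector_derivative_transform[of x "{0..1}" g f d]
    assms by auto

lemma has_vector_derivative_linear_combination:
  fixes f g :: "real => real"
  assumes x: "x \<in> {0..1}" and f: "f differentiable (at x within {0..1})" and g: "g differentiable (at x within {0..1})"
    and k: "\<And>y. y \<in> {0..1} ==> k y = c * f y + d * g y"
  shows "(k has_vector_derivative (c * vector_derivative f (at x within {0..1})
          + d * vector_derivative g (at x within {0..1}))) (at x within {0..1})"
proof -
  have "((\<lambda>y. c * f y + d * g y) has_vector_derivative (c * vector_derivative f (at x within {0..1})
          + d * vector_derivative g (at x within {0..1}))) (at x within {0..1})"
    using f g unfolding vector_derivative_works by (intro has_vector_derivative_add has_vector_derivative_mult_right)
  then show ?thesis using has_vector_derivative_cong_Icc[OF k x] by simp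
qed

lemma iter_deriv_linear:
  assumes f: "f \<in> sobolev m" and g: "g \<in> sobolev m" and "j < m" "x \<in> {0..1}"
  shows "iter_deriv j (\<lambda>x. c * f x + d * g x) x = c * iter_deriv j f x + d * iter_deriv j g x"
  using assms(3,4)
proof (induction j arbitrary: x)
  case (Suc j)
  have fd: "iter_deriv j f differentiable (at x within {0..1})" and gd: "iter_deriv j g differentiable (at x within {0..1})"
    using f g Suc.prems by (auto simp: sobolev_def)
  have "(iter_deriv j (\<lambda>x. c * f x + d * g x) has_vector_derivative
      (c * vector_derivative (iter_deriv j f) (at x within {0..1})
          + d * vector_derivative (iter_deriv j g) (at x within {0..1}))) (at x within {0..1})"
    by (rule has_vector_derivative_linear_combination[OF Suc.prems(2) fd gd]) (use Suc in auto)
  then show ?case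
    using vector_derivative_within_closed_interval[OF zero_less_one Suc.prems(2)] by simp
qed simp

text \<open>At order m the identity can fail where \<open>f\<close> or \<open>g\<close> has no
  derivative of that order, because the default value is not linear; such points form a null
  set.\<close>

lemma iter_deriv_linear_AE:
  assumes f: "f \<in> sobolev m" and g: "g \<in> sobolev m" and m: "m > 0"
  shows "AE x in lborel. x \<in> {0..1} \<longrightarrow>
    iter_deriv m (\<lambda>x. c * f x + d * g x) x = c * iter_deriv m f x + d * iter_deriv m g x"
proof -
  obtain j where j: "m = Suc j" using m by (cases m) auto
  have "AE x in lborel. x \<in> {0..1} \<longrightarrow> x \<in> {0<..<1} \<and> iter_deriv j f differentiable (at x within {0..1})"
    using f j by (intro AC_AE_differentiable) (auto simp: sobolev_def)
  moreover have "AE x in lborel. x \<in> {0..1} \<longrightarrow> x \<in> {0<..<1} \<and> iter_deriv j g differentiable (at x within {0..1})"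
    using g j by (intro AC_AE_differentiable) (auto simp: sobolev_def)
  ultimately show ?thesis
  proof eventually_elim
    case (elim x)
    show ?case
    proof
      assume x: "x \<in> {0..1}"
      have "(iter_deriv j (\<lambda>x. c * f x + d * g x) has_vector_derivative
        (c * vector_derivative (iter_deriv j f) (at x within {0..1})
            + d * vector_derivative (iter_deriv j g) (at x within {0..1}))) (at x within {0..1})"
        by (rule has_vector_derivative_linear_combination[OF x])
          (use elim x iter_deriv_linear[OF f g, of j] j in auto)
      then show "iter_deriv m (\<lambda>x. c * f x + d * g x) x = c * iter_deriv m f x + d * iter_deriv m g x"
        using vector_derivative_within_closed_interval[OF zero_less_one x] by (simp add: j)
    qed
  qed
qed

lemma sobolev_top_measurable:
  assumes "f \<in> sobolev m"
  shows "(\<lambda>x. indicator {0..1} x * iter_deriv m f x) \<in> borel_measurable lborel"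
  using assms by (simp add: sobolev_def set_borel_measurable_def)

lemma integrable_square_sobolev:
  assumes "f \<in> sobolev m"
  shows "integrable lborel (\<lambda>x. (indicator {0..1} x * iter_deriv m f x)\<^sup>2)"
proof -
  have "(indicator {0..1} x * iter_deriv m f x)\<^sup>2 = indicator {0..1} x *\<^sub>R (iter_deriv m f x)\<^sup>2" for x
    by (simp add: indicator_def)
  then show ?thesis using assms by (simp add: sobolev_def set_integrable_def)
qed

lemma integrable_mult_of_squares:
  fixes f g :: "'a => real"
  assumes [measurable]: "f \<in> borel_measurable M" "g \<in> borel_measurable M"
    and "integrable M (\<lambda>x. (f x)\<^sup>2)" "integrable M (\<lambda>x. (g x)\<^sup>2)"
  shows "integrable M (\<lambda>x. f x * g x)"
proof (rule Bochner_Integration.integrable_bound)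
  show "integrable M (\<lambda>x. (f x)\<^sup>2 + (g x)\<^sup>2)" using assms by simp
  have "\<bar>a * b\<bar> \<le> a\<^sup>2 + b\<^sup>2" for a b :: real
  proof -
    have "2 * \<bar>a * b\<bar> \<le> a\<^sup>2 + b\<^sup>2" using sum_squares_bound[of "\<bar>a\<bar>" "\<bar>b\<bar>"] by (simp add: abs_mult)
    then show ?thesis by (smt (verit) abs_ge_zero)
  qed
  then show "AE x in M. norm (f x * g x) \<le> norm ((f x)\<^sup>2 + (g x)\<^sup>2)" by (intro AE_I2) (simp add: abs_of_nonneg)
qed simp

lemma sobolev_linear:
  assumes f: "f \<in> sobolev m" and g: "g \<in> sobolev m" and m: "m > 0"
  shows "(\<lambda>x. c * f x + d * g x) \<in> sobolev m"
proof -
  let ?k = "\<lambda>x. c * f x + d * g x"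
  obtain j where j: "m = Suc j" using m by (cases m) auto
  have ac: "absolutely_continuous_on_Icc 0 1 (iter_deriv i ?k)" if "i < m" for i
    by (rule AC_linear[where f = "iter_deriv i f" and g = "iter_deriv i g"])
      (use f g that iter_deriv_linear[OF f g that] in \<open>auto simp: sobolev_def\<close>)
  have diff: "iter_deriv i ?k differentiable (at x within {0..1})" if "Suc i < m" "x \<in> {0..1}" for i x
  proof -
    have "i < m" using that(1) by simp
    then show ?thesis
      using has_vector_derivative_linear_combination[OF that(2), of "iter_deriv i f" "iter_deriv i g" "iter_deriv i ?k" c d]
        f g that iter_deriv_linear[OF f g, of i _ c d] by (auto simp: sobolev_def intro: differentiableI_vector)
  qed
  have meas: "set_borel_measurable lborel {0..1} (iter_deriv m ?k)"
    unfolding j iter_deriv.simps by (rule borel_vector_derivative[OF AC_continuous_on[OF ac]]) (simp add: j)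
  have "integrable lborel (\<lambda>x. (c * (indicator {0..1} x * iter_deriv m f x) + d * (indicator {0..1} x * iter_deriv m g x))\<^sup>2)"
  proof -
    have "integrable lborel (\<lambda>x. c\<^sup>2 * (indicator {0..1} x * iter_deriv m f x)\<^sup>2
        + d\<^sup>2 * (indicator {0..1} x * iter_deriv m g x)\<^sup>2
        + 2 * c * d * ((indicator {0..1} x * iter_deriv m f x) * (indicator {0..1} x * iter_deriv m g x)))"
      by (intro Bochner_Integration.integrable_add integrable_mult_right integrable_square_sobolev f g
          integrable_mult_of_squares sobolev_top_measurable)
    then show ?thesis by (rule Bochner_Integration.integrable_cong[THEN iffD1, rotated 2]) (auto simp: power2_eq_square algebra_simps)
  qed
  then have "integrable lborel (\<lambda>x. indicator {0..1} x *\<^sub>R (iter_deriv m ?k x)\<^sup>2)"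
  proof (rule integrable_cong_AE_imp)
    have "(\<lambda>x. (indicator {0..1} x * iter_deriv m ?k x)\<^sup>2) \<in> borel_measurable lborel"
      using meas by (intro borel_measurable_power) (simp add: set_borel_measurable_def)
    moreover have "(\<lambda>x. (indicator {0..1} x * iter_deriv m ?k x)\<^sup>2) = (\<lambda>x. indicator {0..1} x *\<^sub>R (iter_deriv m ?k x)\<^sup>2)"
      by (auto simp: indicator_def fun_eq_iff)
    ultimately show "(\<lambda>x. indicator {0..1} x *\<^sub>R (iter_deriv m ?k x)\<^sup>2) \<in> borel_measurable lborel" by simp
    show "AE x in lborel. (c * (indicator {0..1} x * iter_deriv m f x) + d * (indicator {0..1} x * iter_deriv m g x))\<^sup>2
       = indicator {0..1} x *\<^sub>R (iter_deriv m ?k x)\<^sup>2"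
      using iter_deriv_linear_AE[OF f g m, of c d] by eventually_elim (auto simp: indicator_def)
  qed
  then show ?thesis using ac diff meas by (auto simp: sobolev_def set_integrable_def)
qed

lemma penalty_integrable:
  assumes f: "f \<in> sobolev m" and g: "g \<in> sobolev m"
  shows "integrable lborel (\<lambda>z. indicator {0..1} z *\<^sub>R (iter_deriv m f z * iter_deriv m g z))"
proof -
  have "integrable lborel (\<lambda>z. (indicator {0..1} z * iter_deriv m f z) * (indicator {0..1} z * iter_deriv m g z))"
    by (intro integrable_mult_of_squares integrable_square_sobolev sobolev_top_measurable f g)
  then show ?thesis
    by (rule Bochner_Integration.integrable_cong[THEN iffD1, rotated 2]) (auto simp: indicator_def)
qed

lemma penalty_linear:
  assumes f: "f \<in> sobolev m" and g: "g \<in> sobolev m" and k: "k \<in> sobolev m" and m: "m > 0"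
  shows "penalty m (\<lambda>x. c * f x + d * g x) k = c * penalty m f k + d * penalty m g k"
proof -
  have "penalty m (\<lambda>x. c * f x + d * g x) k
      = (\<integral>z. c * (indicator {0..1} z *\<^sub>R (iter_deriv m f z * iter_deriv m k z))
            + d * (indicator {0..1} z *\<^sub>R (iter_deriv m g z * iter_deriv m k z)) \<partial>lborel)"
    unfolding penalty_def set_lebesgue_integral_def
  proof (rule integral_cong_AE)
    show "(\<lambda>x. indicator {0..1} x *\<^sub>R (iter_deriv m (\<lambda>x. c * f x + d * g x) x * iter_deriv m k x)) \<in> borel_measurable lborel"
      using penalty_integrable[OF sobolev_linear[OF f g m] k] by (rule borel_measurable_integrable)
    show "(\<lambda>z. c * (indicator {0..1} z *\<^sub>R (iter_deriv m f z * iter_deriv m k z))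
            + d * (indicator {0..1} z *\<^sub>R (iter_deriv m g z * iter_deriv m k z))) \<in> borel_measurable lborel"
      using penalty_integrable[OF f k] penalty_integrable[OF g k]
      by (intro borel_measurable_add borel_measurable_times borel_measurable_const borel_measurable_integrable)
    show "AE x in lborel. indicator {0..1} x *\<^sub>R (iter_deriv m (\<lambda>x. c * f x + d * g x) x * iter_deriv m k x) =
        c * (indicator {0..1} x *\<^sub>R (iter_deriv m f x * iter_deriv m k x))
            + d * (indicator {0..1} x *\<^sub>R (iter_deriv m g x * iter_deriv m k x))"
      using iter_deriv_linear_AE[OF f g m, of c d]
      by eventually_elim (auto simp: indicator_def algebra_simps)
  qed
  also have "\<dots> = c * penalty m f k + d * penalty m g k"
    unfolding penalty_def set_lebesgue_integral_def
    using penalty_integrable[OF f k] penalty_integrable[OF g k] by simp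
  finally show ?thesis .
qed

lemma penalty_sym: "penalty m f g = penalty m g f"
  by (simp add: penalty_def mult.commute)

lemma penalty_nonneg: "penalty m f f \<ge> 0"
  unfolding penalty_def set_lebesgue_integral_def by (intro integral_nonneg_AE) (auto simp: indicator_def)

lemma sobolev_continuous: "f \<in> sobolev m ==> m > 0 ==> continuous_on {0..1} f"
  using AC_continuous_on[of 0 1 "iter_deriv 0 f"] by (auto simp: sobolev_def)

lemma periodic_sobolev_linear:
  assumes f: "f \<in> periodic_sobolev m" and g: "g \<in> periodic_sobolev m" and m: "m > 0"
  shows "(\<lambda>x. c * f x + d * g x) \<in> periodic_sobolev m"
  using assms sobolev_linear[of f m g c d] iter_deriv_linear[of f m g _ 0 c d] iter_deriv_linear[of f m g _ 1 c d]
  by (auto simp: periodic_sobolev_def)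

lemma bilinear_Cauchy_Schwarz:
  fixes a b c :: real
  assumes nn: "\<And>t. 0 \<le> a + 2 * t * b + t\<^sup>2 * c" and c: "c \<ge> 0"
  shows "b\<^sup>2 \<le> a * c"
proof (cases "c = 0")
  case True
  have "b = 0"
  proof (rule ccontr)
    assume b: "b \<noteq> 0"
    \<comment> \<open>For \<open>c = 0\<close> the quadratic is affine in t and can be nonnegative
      only if its slope vanishes; this t would give the value -1.\<close>
    have "a + 2 * (- (a + 1) / (2 * b)) * b = - 1" using b by (simp add: field_simps)
    then show False using nn[of "- (a + 1) / (2 * b)"] True by simp
  qed
  then show ?thesis using True by simp
next
  case False
  then have c: "c > 0" using c by simp
  have "a + 2 * (- b / c) * b + (- b / c)\<^sup>2 * c = a - b\<^sup>2 / c"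
    using c by (simp add: power2_eq_square field_simps)
  then have "b\<^sup>2 / c \<le> a" using nn[of "- b / c"] by simp
  then show ?thesis using c by (simp add: field_simps)
qed

section \<open>Simultaneous diagonalization and the reproducing kernel\<close>

text \<open>The algebraic content of the eigensystem for one fixed smoothing parameter. The basis
  and its eigenvalues do not depend on \<open>lam\<close>; only the norm of the expansion
  does.\<close>

locale penalized_space =
  fixes H :: "(real => real) set"
    and V J :: "(real => real) => (real => real) => real"
    and lam :: real and hb :: "nat => real => real" and gam :: "nat => real"
  assumes H_linear: "\<And>f g c d. f \<in> H ==> g \<in> H ==> (\<lambda>x. c * f x + d * g x) \<in> H"
    and V_linear: "\<And>f g k c d. f \<in> H ==> g \<in> H ==> k \<in> H ==> V (\<lambda>x. c * f x + d * g x) k = c * V f k + d * V g k"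
    and J_linear: "\<And>f g k c d. f \<in> H ==> g \<in> H ==> k \<in> H ==> J (\<lambda>x. c * f x + d * g x) k = c * J f k + d * J g k"
    and V_sym: "\<And>f g. V f g = V g f" and J_sym: "\<And>f g. J f g = J g f"
    and V_nonneg: "\<And>f. f \<in> H ==> V f f \<ge> 0" and J_nonneg: "\<And>f. f \<in> H ==> J f f \<ge> 0"
    and lam_pos: "lam > 0"
    and hb_in: "\<And>\<nu>. hb \<nu> \<in> H"
    and V_orth: "\<And>\<mu> \<nu>. V (hb \<mu>) (hb \<nu>) = (if \<mu> = \<nu> then 1 else 0)"
    and J_orth: "\<And>\<mu> \<nu>. J (hb \<mu>) (hb \<nu>) = gam \<mu> * (if \<mu> = \<nu> then 1 else 0)"
    and expansion': "\<And>f. f \<in> H ==>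
      (\<lambda>N. sqrt (V (\<lambda>z. f z - (\<Sum>\<nu><N. V f (hb \<nu>) * hb \<nu> z)) (\<lambda>z. f z - (\<Sum>\<nu><N. V f (hb \<nu>) * hb \<nu> z))
         + lam * J (\<lambda>z. f z - (\<Sum>\<nu><N. V f (hb \<nu>) * hb \<nu> z)) (\<lambda>z. f z - (\<Sum>\<nu><N. V f (hb \<nu>) * hb \<nu> z)))) \<longlonglongrightarrow> 0"
begin

definition ip :: "(real => real) => (real => real) => real" where
  "ip f g = V f g + lam * J f g"

definition coef :: "(real => real) => nat => real" where
  "coef f \<nu> = V f (hb \<nu>)"

definition remainder :: "(real => real) => nat => real => real" where
  "remainder f N = (\<lambda>z. f z - (\<Sum>\<nu><N. coef f \<nu> * hb \<nu> z))"

lemma H_diff: "f \<in> H ==> g \<in> H ==> (\<lambda>x. f x - g x) \<in> H"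
  using H_linear[of f g 1 "-1"] by simp

lemma H_scale: "f \<in> H ==> (\<lambda>x. c * f x) \<in> H"
  using H_linear[of f f c 0] by simp

lemma H_zero: "(\<lambda>x. 0) \<in> H"
  using H_scale[OF hb_in[of 0], of 0] by simp

lemma H_sum: "finite A ==> (\<And>i. i \<in> A ==> f i \<in> H) ==> (\<lambda>x. \<Sum>i\<in>A. c i * f i x) \<in> H"
proof (induction A rule: finite_induct)
  case (insert i A)
  then show ?case using H_linear[of "f i" "\<lambda>x. \<Sum>i\<in>A. c i * f i x" "c i" 1] by simp
qed (simp add: H_zero)

lemma ip_linear: "f \<in> H ==> g \<in> H ==> k \<in> H ==> ip (\<lambda>x. c * f x + d * g x) k = c * ip f k + d * ip g k"
  by (simp add: ip_def V_linear J_linear algebra_simps)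

lemma ip_sym: "ip f g = ip g f"
  by (simp add: ip_def V_sym[of f g] J_sym[of f g])

lemma ip_nonneg: "f \<in> H ==> ip f f \<ge> 0"
  using V_nonneg J_nonneg lam_pos by (simp add: ip_def)

text \<open>A common notion for \<open>V\<close>, \<open>J\<close> and \<open>ip\<close>, so that
  linearity over sums, the square expansion and the Cauchy-Schwarz inequality are proved
  once.\<close>

definition psd_form :: "((real => real) => (real => real) => real) => bool" where
  "psd_form B \<longleftrightarrow>
     (\<forall>f\<in>H. \<forall>g\<in>H. \<forall>k\<in>H. \<forall>c d. B (\<lambda>x. c * f x + d * g x) k = c * B f k + d * B g k) \<and>
     (\<forall>f g. B f g = B g f) \<and> (\<forall>f\<in>H. B f f \<ge> 0)"

lemma psd_formD:
  assumes "psd_form B"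
  shows "f \<in> H ==> g \<in> H ==> k \<in> H ==> B (\<lambda>x. c * f x + d * g x) k = c * B f k + d * B g k"
    "B f g = B g f" "f \<in> H ==> B f f \<ge> 0"
  using assms unfolding psd_form_def by blast+

lemma psd_form_V: "psd_form V" and psd_form_J: "psd_form J" and psd_form_ip: "psd_form ip"
  unfolding psd_form_def
  by (intro conjI ballI allI V_linear J_linear ip_linear V_sym J_sym ip_sym V_nonneg J_nonneg ip_nonneg;
      assumption)+

lemma form_sum:
  assumes B: "psd_form B" and A: "finite A" "\<And>i. i \<in> A ==> f i \<in> H" and k: "k \<in> H"
  shows "B (\<lambda>x. \<Sum>i\<in>A. c i * f i x) k = (\<Sum>i\<in>A. c i * B (f i) k)"
  using A
proof (induction A rule: finite_induct)
  case empty
  then show ?case using psd_formD(1)[OF B k k k, of 0 0] by simp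
next
  case (insert i A)
  then show ?case using psd_formD(1)[OF B _ _ k, of "f i" "\<lambda>x. \<Sum>i\<in>A. c i * f i x" "c i" 1] H_sum[of A f c] by simp
qed

lemma form_expand:
  assumes B: "psd_form B" and f: "f \<in> H" and g: "g \<in> H"
  shows "B (\<lambda>x. c * f x + d * g x) (\<lambda>x. c * f x + d * g x) = c\<^sup>2 * B f f + 2 * c * d * B f g + d\<^sup>2 * B g g"
proof -
  define k where "k = (\<lambda>x. c * f x + d * g x)"
  have k: "k \<in> H" unfolding k_def by (rule H_linear[OF f g])
  have "B k k = c * B f k + d * B g k" unfolding k_def by (rule psd_formD(1)[OF B f g k[unfolded k_def]])
  also have "B f k = c * B f f + d * B g f"
    using psd_formD(1)[OF B f g f, of c d] psd_formD(2)[OF B, of f k] by (simp add: k_def)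
  also have "B g k = c * B f g + d * B g g"
    using psd_formD(1)[OF B f g g, of c d] psd_formD(2)[OF B, of g k] by (simp add: k_def)
  finally show ?thesis using psd_formD(2)[OF B, of f g] by (simp add: k_def power2_eq_square algebra_simps)
qed

lemma form_Cauchy_Schwarz:
  assumes B: "psd_form B" and f: "f \<in> H" and g: "g \<in> H"
  shows "(B f g)\<^sup>2 \<le> B f f * B g g"
proof (rule bilinear_Cauchy_Schwarz)
  fix t :: real
  show "0 \<le> B f f + 2 * t * B f g + t\<^sup>2 * B g g"
    using psd_formD(3)[OF B H_linear[OF f g, of 1 t]] form_expand[OF B f g, of 1 t] by simp
qed (rule psd_formD(3)[OF B g])

lemmas ip_Cauchy_Schwarz = form_Cauchy_Schwarz[OF psd_form_ip]
lemmas ip_expand = form_expand[OF psd_form_ip]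

lemma gam_nonneg: "gam \<nu> \<ge> 0"
  using J_nonneg[OF hb_in[of \<nu>]] by (simp add: J_orth)

lemma denom_pos: "1 + lam * gam \<nu> > 0" "1 + lam * gam \<nu> \<ge> 1"
  using mult_nonneg_nonneg[OF less_imp_le[OF lam_pos] gam_nonneg[of \<nu>]] by linarith+

lemma remainder_in: "f \<in> H ==> remainder f N \<in> H"
  unfolding remainder_def by (intro H_diff H_sum) (auto simp: hb_in)

lemma ip_remainder_tendsto:
  assumes f: "f \<in> H"
  shows "(\<lambda>N. ip (remainder f N) (remainder f N)) \<longlonglongrightarrow> 0"
proof -
  have "(\<lambda>N. sqrt (ip (remainder f N) (remainder f N))) \<longlonglongrightarrow> 0"
    using expansion'[OF f] by (simp add: ip_def remainder_def coef_def)
  then have "(\<lambda>N. (sqrt (ip (remainder f N) (remainder f N)))\<^sup>2) \<longlonglongrightarrow> 0\<^sup>2" by (rule tendsto_power)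
  then show ?thesis using ip_nonneg[OF remainder_in[OF f]] by simp
qed

text \<open>A semidefinite form dominated by \<open>ip\<close> is continuous for the norm of
  \<open>ip\<close>, by its own Cauchy-Schwarz inequality; this carries the expansion over to
  \<open>V\<close> and \<open>J\<close>.\<close>

lemma form_remainder_tendsto:
  assumes B: "psd_form B"
    and le: "\<And>f. f \<in> H ==> B f f \<le> C * ip f f"
    and f: "f \<in> H" and g: "g \<in> H"
  shows "(\<lambda>N. B (remainder f N) g) \<longlonglongrightarrow> 0"
proof -
  have "(\<lambda>N. sqrt (C * ip (remainder f N) (remainder f N) * B g g)) \<longlonglongrightarrow> sqrt (C * 0 * B g g)"
    by (intro tendsto_intros ip_remainder_tendsto f)
  then have l: "(\<lambda>N. sqrt (C * ip (remainder f N) (remainder f N) * B g g)) \<longlonglongrightarrow> 0" by simp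
  have "\<bar>B (remainder f N) g\<bar> \<le> sqrt (C * ip (remainder f N) (remainder f N) * B g g)" for N
  proof -
    have "(B (remainder f N) g)\<^sup>2 \<le> B (remainder f N) (remainder f N) * B g g"
      by (rule form_Cauchy_Schwarz[OF B remainder_in[OF f] g])
    also have "\<dots> \<le> C * ip (remainder f N) (remainder f N) * B g g"
      by (intro mult_right_mono le remainder_in f psd_formD(3)[OF B] g)
    finally show ?thesis using real_sqrt_le_mono by fastforce
  qed
  then show ?thesis by (intro Lim_null_comparison[OF _ l]) (auto simp: always_eventually)
qed

lemma V_le_ip: "f \<in> H ==> V f f \<le> 1 * ip f f"
  using J_nonneg lam_pos by (simp add: ip_def)

lemma J_le_ip: "f \<in> H ==> J f f \<le> (1 / lam) * ip f f"
  using V_nonneg lam_pos by (simp add: ip_def field_simps)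

lemma form_remainder:
  assumes B: "psd_form B"
    and f: "f \<in> H" and g: "g \<in> H"
  shows "B (remainder f N) g = B f g - (\<Sum>\<nu><N. coef f \<nu> * B (hb \<nu>) g)"
  using psd_formD(1)[OF B f H_sum[of "{..<N}" hb "coef f"] g, of 1 "-1"] form_sum[OF B _ _ g, of "{..<N}" hb "coef f"] hb_in g
  by (simp add: remainder_def)

text \<open>Pairing the remainder of the expansion with \<open>hb \<nu>\<close> gives a quantity
  that no longer changes once N exceeds \<nu>, and that tends to zero by continuity of
  \<open>J\<close>.\<close>

lemma J_hb: 
  assumes f: "f \<in> H"
  shows "J f (hb \<nu>) = gam \<nu> * coef f \<nu>"
proof -
  have "(\<lambda>N. J (remainder f N) (hb \<nu>)) \<longlonglongrightarrow> 0"
    by (rule form_remainder_tendsto[OF psd_form_J J_le_ip f hb_in])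
  moreover have "\<forall>\<^sub>F N in sequentially. J (remainder f N) (hb \<nu>) = J f (hb \<nu>) - gam \<nu> * coef f \<nu>"
    unfolding eventually_sequentially
  proof (intro exI[of _ "Suc \<nu>"] allI impI)
    fix N assume "Suc \<nu> \<le> N"
    then have "(\<Sum>\<mu><N. coef f \<mu> * J (hb \<mu>) (hb \<nu>)) = coef f \<nu> * gam \<nu>"
      by (simp add: J_orth if_distrib[of "(*) _"] sum.delta' cong: if_cong)
    then show "J (remainder f N) (hb \<nu>) = J f (hb \<nu>) - gam \<nu> * coef f \<nu>"
      using form_remainder[OF psd_form_J f hb_in[of \<nu>], of N] by simp
  qed
  ultimately have "(\<lambda>N::nat. J f (hb \<nu>) - gam \<nu> * coef f \<nu>) \<longlonglongrightarrow> 0" by (rule Lim_transform_eventually)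
  then show ?thesis by (simp add: tendsto_const_iff)
qed

lemma ip_hb: "f \<in> H ==> ip f (hb \<nu>) = (1 + lam * gam \<nu>) * coef f \<nu>"
  by (simp add: ip_def J_hb coef_def algebra_simps)

text \<open>Parseval's identity for \<open>V\<close>; with its analogues for \<open>J\<close> and
  \<open>ip\<close> it reduces every later norm computation to a weighted series in the
  coefficients.\<close>

lemma V_sums: 
  assumes f: "f \<in> H" and g: "g \<in> H"
  shows "(\<lambda>\<nu>. coef f \<nu> * coef g \<nu>) sums V f g"
proof -
  have "(\<lambda>N. V (remainder f N) g) \<longlonglongrightarrow> 0"
    by (rule form_remainder_tendsto[OF psd_form_V V_le_ip f g])
  then have "(\<lambda>N. V f g - V (remainder f N) g) \<longlonglongrightarrow> V f g - 0" by (intro tendsto_intros)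
  then show ?thesis unfolding sums_def
    using form_remainder[OF psd_form_V f g] V_sym[of "hb _" g] by (simp add: coef_def)
qed

lemma J_sums: 
  assumes f: "f \<in> H" and g: "g \<in> H"
  shows "(\<lambda>\<nu>. gam \<nu> * coef f \<nu> * coef g \<nu>) sums J f g"
proof -
  have "(\<lambda>N. J (remainder f N) g) \<longlonglongrightarrow> 0"
    by (rule form_remainder_tendsto[OF psd_form_J J_le_ip f g])
  then have "(\<lambda>N. J f g - J (remainder f N) g) \<longlonglongrightarrow> J f g - 0" by (intro tendsto_intros)
  then show ?thesis unfolding sums_def
    using form_remainder[OF psd_form_J f g] J_sym[of "hb _" g] J_hb[OF g] by (simp add: mult.assoc mult.left_commute)
qed

lemma ip_sums:
  assumes f: "f \<in> H" and g: "g \<in> H"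
  shows "(\<lambda>\<nu>. (1 + lam * gam \<nu>) * coef f \<nu> * coef g \<nu>) sums ip f g"
proof -
  have "(\<lambda>\<nu>. coef f \<nu> * coef g \<nu> + lam * (gam \<nu> * coef f \<nu> * coef g \<nu>)) sums (V f g + lam * J f g)"
    by (intro sums_add sums_mult V_sums J_sums f g)
  then show ?thesis by (simp add: ip_def algebra_simps)
qed

end

locale penalized_rkhs = penalized_space +
  fixes T :: "real set" and K :: "real => real => real" and W :: "(real => real) => real => real" and B :: real
  assumes K_in: "\<And>z. z \<in> T ==> K z \<in> H"
    and K_rep: "\<And>z f. z \<in> T ==> f \<in> H ==> ip (K z) f = f z"
    and W_in: "\<And>f. f \<in> H ==> W f \<in> H"
    and W_rep: "\<And>f g. f \<in> H ==> g \<in> H ==> ip (W f) g = lam * J f g"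
    and hb_bound: "\<And>\<nu> z. z \<in> T ==> \<bar>hb \<nu> z\<bar> \<le> B"
    and summable_denom: "summable (\<lambda>\<nu>. 1 / (1 + lam * gam \<nu>))"
begin

text \<open>The trace of \<open>id - W\<close>, whose eigenvalue on \<open>hb \<nu>\<close> is this
  term: the effective dimension of the penalized problem.\<close>

definition tr :: real where
  "tr = (\<Sum>\<nu>. 1 / (1 + lam * gam \<nu>))"

text \<open>The reproducing property at \<open>hb \<nu>\<close>, read through the diagonal form of
  \<open>ip\<close>.\<close>

lemma coef_K: "z \<in> T ==> coef (K z) \<nu> = hb \<nu> z / (1 + lam * gam \<nu>)"
  using K_rep[OF _ hb_in[of \<nu>], of z] ip_hb[OF K_in, of z \<nu>] denom_pos(1)[of \<nu>] by (simp add: field_simps)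

lemma K_sums:
  assumes z: "z \<in> T" and w: "w \<in> T"
  shows "(\<lambda>\<nu>. hb \<nu> z * hb \<nu> w / (1 + lam * gam \<nu>)) sums K z w"
proof -
  have "(\<lambda>\<nu>. (1 + lam * gam \<nu>) * coef (K w) \<nu> * coef (K z) \<nu>) sums K z w"
    using ip_sums[OF K_in[OF w] K_in[OF z]] K_rep[OF w K_in[OF z]] by simp
  moreover have "(1 + lam * gam \<nu>) * coef (K w) \<nu> * coef (K z) \<nu> = hb \<nu> z * hb \<nu> w / (1 + lam * gam \<nu>)" for \<nu>
    using denom_pos(1)[of \<nu>] z w by (simp add: coef_K)
  ultimately show ?thesis by simp
qed

lemma B_nonneg: "z \<in> T ==> B \<ge> 0"
  using hb_bound[of z 0] by simp

lemma K_bound: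
  assumes z: "z \<in> T" and w: "w \<in> T"
  shows "\<bar>K z w\<bar> \<le> B\<^sup>2 * tr"
proof -
  have s: "(\<lambda>\<nu>. B\<^sup>2 * (1 / (1 + lam * gam \<nu>))) sums (B\<^sup>2 * tr)"
    unfolding tr_def by (intro sums_mult summable_sums summable_denom)
  have b: "\<bar>hb \<nu> z * hb \<nu> w / (1 + lam * gam \<nu>)\<bar> \<le> B\<^sup>2 * (1 / (1 + lam * gam \<nu>))" for \<nu>
  proof -
    have "\<bar>hb \<nu> z * hb \<nu> w\<bar> \<le> B * B"
      using hb_bound[OF z, of \<nu>] hb_bound[OF w, of \<nu>] by (simp add: abs_mult mult_mono')
    then show ?thesis using denom_pos(1)[of \<nu>] by (simp add: abs_divide power2_eq_square divide_right_mono)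
  qed
  have "K z w \<le> B\<^sup>2 * tr" by (rule sums_le[OF _ K_sums[OF z w] s]) (use b abs_le_D1 in blast)
  moreover have "- K z w \<le> B\<^sup>2 * tr"
    by (rule sums_le[OF _ sums_minus[OF K_sums[OF z w]] s]) (use b abs_le_D2 in blast)
  ultimately show ?thesis by simp
qed

text \<open>The embedding into bounded functions. Its squared constant is a multiple of
  \<open>tr\<close>, of order 1/h, and this is how smallness in norm brings increments into the
  radius where the Taylor expansion is valid.\<close>

lemma pointwise_bound:
  assumes f: "f \<in> H" and z: "z \<in> T"
  shows "(f z)\<^sup>2 \<le> B\<^sup>2 * tr * ip f f"
proof -
  have "(f z)\<^sup>2 \<le> ip (K z) (K z) * ip f f"
    using ip_Cauchy_Schwarz[OF K_in[OF z] f] K_rep[OF z f] by simp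
  also have "ip (K z) (K z) \<le> B\<^sup>2 * tr" using K_bound[OF z z] K_rep[OF z K_in[OF z]] by simp
  finally show ?thesis using ip_nonneg[OF f] by (simp add: mult_right_mono)
qed

text \<open>Evaluation is the inner product with \<open>K z\<close>, so convergence of the expansion
  in norm implies pointwise convergence.\<close>

lemma pointwise_sums:
  assumes f: "f \<in> H" and z: "z \<in> T"
  shows "(\<lambda>\<nu>. coef f \<nu> * hb \<nu> z) sums f z"
proof -
  have "(\<lambda>N. ip (remainder f N) (K z)) \<longlonglongrightarrow> 0"
    by (rule form_remainder_tendsto[where C = 1, OF psd_form_ip _ f K_in[OF z]]) (simp only: mult_1_left order_refl)
  then have "(\<lambda>N. remainder f N z) \<longlonglongrightarrow> 0" using K_rep[OF z remainder_in[OF f]] ip_sym by simp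
  then have "(\<lambda>N. f z - remainder f N z) \<longlonglongrightarrow> f z - 0" by (intro tendsto_intros)
  then show ?thesis by (simp add: sums_def remainder_def)
qed

lemma coef_W:
  assumes g: "g \<in> H"
  shows "coef (W g) \<nu> = lam * gam \<nu> / (1 + lam * gam \<nu>) * coef g \<nu>"
  using W_rep[OF g hb_in[of \<nu>]] ip_hb[OF W_in[OF g], of \<nu>] J_hb[OF g, of \<nu>] denom_pos(1)[of \<nu>]
  by (simp add: field_simps)

text \<open>Compared term by term: with x = \<open>lam * gam \<nu>\<close>, the left series has the
  extra factor x / (1 + x), which is at most 1.\<close>

lemma ip_W_le:
  assumes g: "g \<in> H"
  shows "ip (W g) (W g) \<le> lam * J g g"
proof (rule sums_le[OF _ ip_sums[OF W_in[OF g] W_in[OF g]] sums_mult[OF J_sums[OF g g]]])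
  fix \<nu>
  let ?x = "lam * gam \<nu>"
  have x: "?x \<ge> 0" using lam_pos gam_nonneg by simp
  have "(1 + ?x) * coef (W g) \<nu> * coef (W g) \<nu> = (?x / (1 + ?x)) * (?x * (coef g \<nu>)\<^sup>2)"
  proof -
    have "(1 + y) * (y / (1 + y) * c) * (y / (1 + y) * c) = (y / (1 + y)) * (y * c\<^sup>2)" if "1 + y > 0" for y c :: real
      using that by (simp add: power2_eq_square)
    then show ?thesis unfolding coef_W[OF g] using denom_pos(1)[of \<nu>] by blast
  qed
  also have "\<dots> \<le> 1 * (?x * (coef g \<nu>)\<^sup>2)" using x by (intro mult_right_mono) auto
  finally show "(1 + ?x) * coef (W g) \<nu> * coef (W g) \<nu> \<le> lam * (gam \<nu> * coef g \<nu> * coef g \<nu>)"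
    by (simp add: power2_eq_square algebra_simps)
qed

lemma V_W_sums:
  assumes g: "g \<in> H"
  shows "(\<lambda>\<nu>. (lam * gam \<nu> / (1 + lam * gam \<nu>))\<^sup>2 * (coef g \<nu>)\<^sup>2) sums V (W g) (W g)"
  using V_sums[OF W_in[OF g] W_in[OF g]] by (simp add: coef_W[OF g] power2_eq_square mult_ac)

lemma V_K_sums:
  assumes z: "z \<in> T"
  shows "(\<lambda>\<nu>. (hb \<nu> z)\<^sup>2 / (1 + lam * gam \<nu>)\<^sup>2) sums V (K z) (K z)"
  using V_sums[OF K_in[OF z] K_in[OF z]] z by (simp add: coef_K power2_eq_square)

end

section \<open>Borel versions and conditional expectations\<close>

text \<open>The variable y is both a parameter of the integrand and an endpoint of an oriented
  interval. Separating the two orientations gives integrals over the whole line of jointly Borel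
  functions.\<close>

lemma quasi_likelihood_borel:
  fixes Var :: "real => real"
  assumes [measurable]: "Var \<in> borel_measurable borel"
  shows "(\<lambda>y. LBINT s=ereal y..ereal b. (y - s) / Var s) \<in> borel_measurable borel"
proof -
  have [measurable]: "(\<lambda>y. LINT s|lborel. (if y < s \<and> s < b then (y - s) / Var s else 0)) \<in> borel_measurable borel"
    by (rule lborel.borel_measurable_lebesgue_integral) measurable
  have [measurable]: "(\<lambda>y. LINT s|lborel. (if b < s \<and> s < y then (y - s) / Var s else 0)) \<in> borel_measurable borel"
    by (rule lborel.borel_measurable_lebesgue_integral) measurable
  have "(\<lambda>y. LBINT s=ereal y..ereal b. (y - s) / Var s) = (\<lambda>y. if y \<le> b
      then LINT s|lborel. (if y < s \<and> s < b then (y - s) / Var s else 0)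
      else - (LINT s|lborel. (if b < s \<and> s < y then (y - s) / Var s else 0)))"
    by (rule ext) (auto simp: interval_lebesgue_integral_def set_lebesgue_integral_def einterval_iff
        indicator_def intro!: Bochner_Integration.integral_cong)
  then show ?thesis by simp
qed

text \<open>Both kinds of criterion are specified only for y in \<open>S\<close>, and
  \<open>S\<close> need not be Borel. Hence the search for Borel functions that agree with the
  criterion on \<open>S\<close>, where all observations lie.\<close>

lemma criterion_borel_version:
  assumes "log_likelihood_criterion M S Y Z F g0 l \<or> quasi_likelihood_criterion M S Y Z F g0 l"
  obtains q where "\<forall>a. (\<lambda>y. q y a) \<in> borel_measurable borel" "\<forall>y\<in>S. \<forall>a. q y a = l y a"
  using assms
proof
  assume "log_likelihood_criterion M S Y Z F g0 l"
  then obtain p where p: "\<And>a. (\<lambda>y. p y (F a)) \<in> borel_measurable borel" "\<And>y a. y \<in> S ==> l y a = ln (p y (F a))"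
    unfolding log_likelihood_criterion_def by metis
  show thesis
  proof (rule that[of "\<lambda>y a. ln (p y (F a))"])
    show "\<forall>a. (\<lambda>y. ln (p y (F a))) \<in> borel_measurable borel"
      using borel_measurable_ln[OF p(1)] by simp
  qed (simp add: p(2))
next
  assume "quasi_likelihood_criterion M S Y Z F g0 l"
  then obtain Var :: "real => real" where v: "Var \<in> borel_measurable borel"
    "\<And>y a. y \<in> S ==> l y a = (LBINT s=ereal y..ereal (F a). (y - s) / Var s)"
    unfolding quasi_likelihood_criterion_def by metis
  show thesis
    by (rule that[of "\<lambda>y a. (LBINT s=ereal y..ereal (F a). (y - s) / Var s)"])
      (simp_all add: v quasi_likelihood_borel)
qed

lemma deriv_a_Suc: "deriv_a (Suc k) l y a = deriv (deriv_a k l y) a"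
  by (simp add: deriv_a_def[abs_def])

text \<open>A derivative in \<open>a\<close> is a limit of difference quotients along one sequence;
  \<open>lim\<close> is total, so the limit of Borel versions is Borel even off \<open>S\<close>,
  where it may be meaningless.\<close>

lemma deriv_a_borel_version:
  assumes q: "\<And>a. (\<lambda>y. q y a) \<in> borel_measurable borel" "\<And>y a. y \<in> S ==> q y a = l y a"
    and d: "\<And>y k a. y \<in> S ==> k < 3 ==> deriv_a k l y differentiable (at a)" and k: "k \<le> 3"
  shows "\<exists>q. (\<forall>a. (\<lambda>y. q y a) \<in> borel_measurable borel) \<and> (\<forall>y\<in>S. \<forall>a. q y a = deriv_a k l y a)"
  using k
proof (induction k)
  case 0
  then show ?case using q by (intro exI[of _ q]) (simp add: deriv_a_def)
next
  case (Suc k)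
  then obtain q' where q': "\<And>a. (\<lambda>y. q' y a) \<in> borel_measurable borel" "\<And>y a. y \<in> S ==> q' y a = deriv_a k l y a"
    by auto
  define r where "r = (\<lambda>y a. lim (\<lambda>n. (q' y (a + inverse (real (Suc n))) - q' y a) / inverse (real (Suc n))))"
  have "(\<lambda>y. r y a) \<in> borel_measurable borel" for a
    unfolding r_def by (rule borel_measurable_lim_metric) (use q'(1) in \<open>auto intro!: borel_measurable_divide borel_measurable_diff\<close>)
  moreover have "r y a = deriv_a (Suc k) l y a" if y: "y \<in> S" for y a
  proof -
    have "(deriv_a k l y has_real_derivative deriv (deriv_a k l y) a) (at a)"
      using d[OF y, of k a] Suc.prems by (metis DERIV_deriv_iff_real_differentiable Suc_le_lessD)
    then have L: "((\<lambda>t. (deriv_a k l y (a + t) - deriv_a k l y a) / t) \<longlongrightarrow> deriv_a (Suc k) l y a) (at 0)"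
      unfolding DERIV_def deriv_a_Suc .
    have "filterlim (\<lambda>n. inverse (real (Suc n))) (at 0) sequentially"
      using LIMSEQ_inverse_real_of_nat by (simp add: filterlim_at)
    then have "(\<lambda>n. (deriv_a k l y (a + inverse (real (Suc n))) - deriv_a k l y a) / inverse (real (Suc n)))
        \<longlonglongrightarrow> deriv_a (Suc k) l y a" by (rule filterlim_compose[OF L])
    then show ?thesis unfolding r_def q'(2)[OF y] by (rule limI)
  qed
  ultimately show ?case by blast
qed

text \<open>The second argument is discretized on finer and finer grids.\<close>

lemma joint_borel_version:
  fixes q :: "real => real => real"
  assumes q: "\<And>a. (\<lambda>y. q y a) \<in> borel_measurable borel"
    and c: "\<And>y. y \<in> S ==> continuous_on UNIV (q y)"
  obtains Q where "Q \<in> borel_measurable (borel \<Otimes>\<^sub>M borel)" "\<forall>y\<in>S. \<forall>a. Q (y, a) = q y a"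
proof -
  define u where "u = (\<lambda>n (a::real). of_int \<lfloor>real (Suc n) * a\<rfloor> / real (Suc n))"
  have "(\<lambda>n. u n a - a) \<longlonglongrightarrow> 0" for a
  proof (rule Lim_null_comparison)
    show "\<forall>\<^sub>F n in sequentially. norm (u n a - a) \<le> inverse (real (Suc n))"
    proof (intro always_eventually allI)
      fix n
      have "\<bar>of_int \<lfloor>real (Suc n) * a\<rfloor> - real (Suc n) * a\<bar> \<le> 1" by linarith
      moreover have "u n a - a = (of_int \<lfloor>real (Suc n) * a\<rfloor> - real (Suc n) * a) / real (Suc n)"
        by (simp add: u_def field_simps)
      ultimately have "\<bar>u n a - a\<bar> \<le> 1 / real (Suc n)"
        by (simp only: abs_divide) (intro divide_mono; simp)
      then show "norm (u n a - a) \<le> inverse (real (Suc n))" by (simp add: inverse_eq_divide)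
    qed
  qed (rule LIMSEQ_inverse_real_of_nat)
  then have u: "(\<lambda>n. u n a) \<longlonglongrightarrow> a" for a by (rule LIM_zero_cancel)
  define Q where "Q = (\<lambda>x::real \<times> real. lim (\<lambda>n. q (fst x) (u n (snd x))))"
  show thesis
  proof (rule that[of Q])
    show "Q \<in> borel_measurable (borel \<Otimes>\<^sub>M borel)"
      unfolding Q_def
    proof (rule borel_measurable_lim_metric)
      fix n
      have 1: "(\<lambda>x. q (fst x) (of_int i / real (Suc n))) \<in> borel_measurable (borel \<Otimes>\<^sub>M borel)" for i :: int
        by (rule measurable_compose[OF measurable_fst q])
      have 2: "(\<lambda>x :: real \<times> real. \<lfloor>real (Suc n) * snd x\<rfloor>) \<in> borel \<Otimes>\<^sub>M borel \<rightarrow>\<^sub>M count_space UNIV"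
        by measurable
      have "(\<lambda>x::real \<times> real. q (fst x) (of_int \<lfloor>real (Suc n) * snd x\<rfloor> / real (Suc n))) \<in> borel_measurable (borel \<Otimes>\<^sub>M borel)"
        by (rule measurable_compose_countable[OF 1 2])
      then show "(\<lambda>x. q (fst x) (u n (snd x))) \<in> borel_measurable (borel \<Otimes>\<^sub>M borel)" by (simp add: u_def)
    qed
    show "\<forall>y\<in>S. \<forall>a. Q (y, a) = q y a"
    proof (intro ballI allI)
      fix y a assume y: "y \<in> S"
      have "isCont (q y) a" using c[OF y] by (simp add: continuous_on_eq_continuous_at)
      then have "(\<lambda>n. q y (u n a)) \<longlonglongrightarrow> q y a" using u by (rule isCont_tendsto_compose)
      then show "Q (y, a) = q y a" unfolding Q_def by (simp add: limI)
    qed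
  qed
qed

lemma deriv_a_joint_borel_version:
  assumes crit: "log_likelihood_criterion M S Y Z F g0 l \<or> quasi_likelihood_criterion M S Y Z F g0 l"
    and reg: "criterion_regularity M S Y Z l g0 I" and k: "k \<le> 3"
  obtains Q where "Q \<in> borel_measurable (borel \<Otimes>\<^sub>M borel)" "\<forall>y\<in>S. \<forall>a. Q (y, a) = deriv_a k l y a"
proof -
  have d: "\<And>y k a. y \<in> S ==> k < 3 ==> deriv_a k l y differentiable (at a)"
    and c3: "\<And>y. y \<in> S ==> continuous_on UNIV (deriv_a 3 l y)"
    using reg unfolding criterion_regularity_def by blast+
  have c: "continuous_on UNIV (deriv_a k l y)" if "y \<in> S" for y
  proof (cases "k = 3")
    case False
    then have "k < 3" using k by simp
    then show ?thesis using d[OF that]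
      by (intro differentiable_imp_continuous_on) (simp add: differentiable_on_def)
  qed (use c3 that in simp)
  obtain q0 where "\<forall>a. (\<lambda>y. q0 y a) \<in> borel_measurable borel" "\<forall>y\<in>S. \<forall>a. q0 y a = l y a"
    by (rule criterion_borel_version[OF crit])
  then have q0: "\<And>a. (\<lambda>y. q0 y a) \<in> borel_measurable borel" "\<And>y a. y \<in> S ==> q0 y a = l y a" by auto
  obtain q where q: "\<And>a. (\<lambda>y. q y a) \<in> borel_measurable borel" "\<And>y a. y \<in> S ==> q y a = deriv_a k l y a"
    using deriv_a_borel_version[OF q0 d k] by metis
  have cq: "continuous_on UNIV (q y)" if "y \<in> S" for y
  proof -
    have "q y = deriv_a k l y" using q(2)[OF that] by (rule ext)
    then show ?thesis using c[OF that] by simp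
  qed
  obtain Q where "Q \<in> borel_measurable (borel \<Otimes>\<^sub>M borel)" "\<forall>y\<in>S. \<forall>a. Q (y, a) = q y a"
    by (rule joint_borel_version[OF q(1) cq])
  then show thesis using that q(2) by simp
qed

text \<open>The supremum of a set of reals is a \<open>LEAST\<close> upper bound. When there is no
  upper bound the defining predicate is constantly false, so all unbounded sets share one
  value.\<close>

lemma Sup_not_bdd_above: "\<not> bdd_above X ==> Sup X = (LEAST z::real. False)"
proof -
  assume "\<not> bdd_above X"
  then have "(\<lambda>z. \<forall>x\<in>X. x \<le> z) = (\<lambda>z. False)"
    unfolding bdd_above_def fun_eq_iff by blast
  then show ?thesis unfolding Sup_real_def by simp
qed

text \<open>The supremum over the open set \<open>I\<close> is attained along the rationals; off the set where it
  is finite, the real-valued supremum has a fixed junk value, so that it is Borel as well.\<close>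

lemma sup_deriv_a_borel_version:
  assumes Q: "Q \<in> borel_measurable (borel \<Otimes>\<^sub>M borel)" "\<And>y a. y \<in> S ==> Q (y, a) = deriv_a k l y a"
    and c: "\<And>y. y \<in> S ==> continuous_on UNIV (deriv_a k l y)" and I: "open I" "I \<noteq> {}"
  obtains w :: "real => real" and G where "w \<in> borel_measurable borel" "G \<in> sets borel"
    "\<forall>y\<in>G. w y \<ge> 0" "\<forall>y\<in>S. y \<in> G \<longleftrightarrow> bdd_above ((\<lambda>a. \<bar>deriv_a k l y a\<bar>) ` I)"
    "\<forall>y\<in>S. sup_deriv_a k l I y = w y"
    "\<forall>y\<in>S \<inter> G. \<forall>a\<in>I. \<bar>deriv_a k l y a\<bar> \<le> w y"
proof -
  define b where "b = (\<lambda>y. SUP a\<in>I \<inter> \<rat>. ennreal \<bar>Q (y, a)\<bar>)"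
  have bm[measurable]: "b \<in> borel_measurable borel"
    unfolding b_def using countable_rat Q(1)
    by (intro borel_measurable_SUP) (auto intro: countable_Int2 measurable_compose[OF _ Q(1)])
  define w where "w = (\<lambda>y. if b y < \<infinity> then enn2real (b y) else (LEAST z::real. False))"
  define G where "G = {y. b y < \<infinity>}"
  \<comment> \<open>If the bound failed at \<open>a\<close> it would, by continuity, fail on a
    neighbourhood inside the open set \<open>I\<close>, and that contains a rational.\<close>
  have ub: "ennreal \<bar>deriv_a k l y a\<bar> \<le> b y" if y: "y \<in> S" and a: "a \<in> I" for y a
  proof (cases "b y")
    case (real r)
    have "\<bar>deriv_a k l y a\<bar> \<le> r"
    proof (rule ccontr)
      assume "\<not> \<bar>deriv_a k l y a\<bar> \<le> r"
      then have "a \<in> I \<inter> (\<lambda>a. \<bar>deriv_a k l y a\<bar>) -` {r<..}" using a by simp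
      moreover have "open (I \<inter> (\<lambda>a. \<bar>deriv_a k l y a\<bar>) -` {r<..})"
        by (intro continuous_open_preimage I continuous_on_rabs continuous_on_subset[OF c[OF y]]) auto
      ultimately obtain e where e: "e > 0" "ball a e \<subseteq> I \<inter> (\<lambda>a. \<bar>deriv_a k l y a\<bar>) -` {r<..}"
        by (meson openE)
      obtain t where t: "t \<in> \<rat>" "a < t" "t < a + e" using Rats_dense_in_real[of a "a + e"] e(1) by auto
      then have "t \<in> ball a e" by (simp add: dist_real_def)
      then have tt: "t \<in> I \<inter> \<rat>" "\<bar>deriv_a k l y t\<bar> > r" using e t by auto
      have "ennreal \<bar>Q (y, t)\<bar> \<le> b y" unfolding b_def by (rule SUP_upper[OF tt(1)])
      then have "\<bar>deriv_a k l y t\<bar> \<le> r" using real Q(2)[OF y] by (simp add: ennreal_le_iff)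
      then show False using tt(2) by simp
    qed
    then show ?thesis using real by (simp add: ennreal_le_iff)
  qed simp
  have bdd: "b y < \<infinity> \<longleftrightarrow> bdd_above ((\<lambda>a. \<bar>deriv_a k l y a\<bar>) ` I)" if y: "y \<in> S" for y
  proof
    assume "b y < \<infinity>"
    then obtain r where r: "b y = ennreal r" "r \<ge> 0" by (cases "b y") auto
    have "\<bar>deriv_a k l y a\<bar> \<le> r" if "a \<in> I" for a using ub[OF y that] r by (simp add: ennreal_le_iff)
    then show "bdd_above ((\<lambda>a. \<bar>deriv_a k l y a\<bar>) ` I)" by (auto simp: bdd_above_def)
  next
    assume "bdd_above ((\<lambda>a. \<bar>deriv_a k l y a\<bar>) ` I)"
    then obtain r where r: "\<And>a. a \<in> I ==> \<bar>deriv_a k l y a\<bar> \<le> r" by (auto simp: bdd_above_def)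
    have "b y \<le> ennreal r" unfolding b_def using r Q(2)[OF y] by (intro SUP_least) (auto intro: ennreal_leI)
    then show "b y < \<infinity>" by (simp add: le_less_trans)
  qed
  have le: "\<bar>deriv_a k l y a\<bar> \<le> enn2real (b y)" if "y \<in> S" "b y < \<infinity>" "a \<in> I" for y a
    using ub[OF that(1,3)] that(2) by (cases "b y") (auto simp: ennreal_le_iff)
  show thesis
  proof (rule that[of w G])
    show "w \<in> borel_measurable borel" unfolding w_def by measurable
    show "G \<in> sets borel" unfolding G_def by measurable
    show "\<forall>y\<in>G. w y \<ge> 0" by (simp add: w_def G_def)
    show "\<forall>y\<in>S. y \<in> G \<longleftrightarrow> bdd_above ((\<lambda>a. \<bar>deriv_a k l y a\<bar>) ` I)" using bdd by (simp add: G_def)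
    show "\<forall>y\<in>S \<inter> G. \<forall>a\<in>I. \<bar>deriv_a k l y a\<bar> \<le> w y" using le by (simp add: w_def G_def)
    show "\<forall>y\<in>S. sup_deriv_a k l I y = w y"
    proof
      fix y assume y: "y \<in> S"
      show "sup_deriv_a k l I y = w y"
    proof (cases "b y < \<infinity>")
      case True
      then obtain r where r: "b y = ennreal r" "r \<ge> 0" by (cases "b y") auto
      have "(SUP a\<in>I. \<bar>deriv_a k l y a\<bar>) = r"
      proof (rule antisym)
        show "(SUP a\<in>I. \<bar>deriv_a k l y a\<bar>) \<le> r" using le[OF y True] r I(2) by (intro cSUP_least) auto
        have nn: "0 \<le> (SUP a\<in>I. \<bar>deriv_a k l y a\<bar>)"
          using I(2) bdd[OF y] True by (meson abs_ge_zero cSUP_upper2 ex_in_conv)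
        have "b y \<le> ennreal (SUP a\<in>I. \<bar>deriv_a k l y a\<bar>)"
          unfolding b_def
        proof (rule SUP_least)
          fix a assume "a \<in> I \<inter> \<rat>"
          then have "\<bar>deriv_a k l y a\<bar> \<le> (SUP a\<in>I. \<bar>deriv_a k l y a\<bar>)"
            using bdd[OF y] True by (intro cSUP_upper) auto
          then show "ennreal \<bar>Q (y, a)\<bar> \<le> ennreal (SUP a\<in>I. \<bar>deriv_a k l y a\<bar>)"
            using Q(2)[OF y] by (intro ennreal_leI) simp
        qed
        then show "r \<le> (SUP a\<in>I. \<bar>deriv_a k l y a\<bar>)" using r nn by (simp add: ennreal_le_iff)
      qed
      then show ?thesis using True r by (simp add: sup_deriv_a_def w_def)
    next
      case False
      then show ?thesis using bdd[OF y] Sup_not_bdd_above by (simp add: sup_deriv_a_def w_def)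
    qed
    qed
  qed
qed

lemma subalgebra_sigma_gen: "Z \<in> borel_measurable M ==> subalgebra M (sigma_gen M Z)"
  unfolding sigma_gen_def subalgebra_def
  by (auto simp: sets_vimage_algebra2 intro: measurable_sets)

lemma measurable_sigma_gen: 
  assumes "\<phi> \<in> borel_measurable borel"
  shows "(\<lambda>\<omega>. \<phi> (Z \<omega>)) \<in> borel_measurable (sigma_gen M Z)"
proof -
  have "Z \<in> sigma_gen M Z \<rightarrow>\<^sub>M borel" unfolding sigma_gen_def by (rule measurable_vimage_algebra1) simp
  then show ?thesis using assms by simp
qed

lemma (in prob_space) sigma_finite_subalgebra_sigma_gen:
  assumes "Z \<in> borel_measurable M"
  shows "sigma_finite_subalgebra M (sigma_gen M Z)"
proof -
  interpret finite_measure_subalgebra M "sigma_gen M Z"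
    by unfold_locales (rule subalgebra_sigma_gen[OF assms])
  show ?thesis by (rule sigma_finite_subalgebra_axioms)
qed

lemma (in prob_space) cond_E_nn_bound:
  assumes Z: "Z \<in> borel_measurable M" and X: "X \<in> borel_measurable M"
    and le: "AE \<omega> in M. cond_E_nn M Z X \<omega> \<le> ennreal C"
    and \<phi>: "\<phi> \<in> borel_measurable borel"
  shows "(\<integral>\<^sup>+\<omega>. \<phi> (Z \<omega>) * ennreal (X \<omega>) \<partial>M) \<le> ennreal C * (\<integral>\<^sup>+\<omega>. \<phi> (Z \<omega>) \<partial>M)"
proof -
  interpret sigma_finite_subalgebra M "sigma_gen M Z" by (rule sigma_finite_subalgebra_sigma_gen[OF Z])
  have "(\<integral>\<^sup>+\<omega>. \<phi> (Z \<omega>) * ennreal (X \<omega>) \<partial>M) = (\<integral>\<^sup>+\<omega>. \<phi> (Z \<omega>) * cond_E_nn M Z X \<omega> \<partial>M)"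
    unfolding cond_E_nn_def using X by (intro nn_cond_exp_intg[symmetric] measurable_sigma_gen[OF \<phi>]) simp
  also have "\<dots> \<le> (\<integral>\<^sup>+\<omega>. ennreal C * \<phi> (Z \<omega>) \<partial>M)"
  proof (rule nn_integral_mono_AE)
    show "AE \<omega> in M. \<phi> (Z \<omega>) * cond_E_nn M Z X \<omega> \<le> ennreal C * \<phi> (Z \<omega>)"
      using le by eventually_elim (simp add: mult.commute[of "ennreal C"] mult_left_mono)
  qed
  also have "\<dots> = ennreal C * (\<integral>\<^sup>+\<omega>. \<phi> (Z \<omega>) \<partial>M)"
    using Z \<phi> by (intro nn_integral_cmult) simp
  finally show ?thesis .
qed

lemma (in prob_space) cond_E_integral:
  assumes Z: "Z \<in> borel_measurable M" and X: "X \<in> borel_measurable M"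
    and int: "integrable M (\<lambda>\<omega>. \<phi> (Z \<omega>) * X \<omega>)" and \<phi>: "\<phi> \<in> borel_measurable borel"
  shows "(\<integral>\<omega>. \<phi> (Z \<omega>) * cond_E M Z X \<omega> \<partial>M) = (\<integral>\<omega>. \<phi> (Z \<omega>) * X \<omega> \<partial>M)"
proof -
  interpret sigma_finite_subalgebra M "sigma_gen M Z" by (rule sigma_finite_subalgebra_sigma_gen[OF Z])
  show ?thesis
    using real_cond_exp_intg[OF int measurable_sigma_gen[OF \<phi>] X] by (simp add: cond_E_def)
qed

section \<open>Independent samples and degenerate U-statistics\<close>

definition L4 :: "'a measure => ('a => real) => bool" where
  "L4 M f \<longleftrightarrow> f \<in> borel_measurable M \<and> integrable M (\<lambda>x. f x ^ 4)"

lemma L4_measurable: "L4 M f ==> f \<in> borel_measurable M"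
  by (simp add: L4_def)

lemma power4_mono: "\<bar>a\<bar> \<le> \<bar>b\<bar> ==> a ^ 4 \<le> b ^ 4" for a b :: real
  using power_mono[of "\<bar>a\<bar>" "\<bar>b\<bar>" 4] by simp

lemma L4_bound:
  assumes f: "L4 M f" and g: "g \<in> borel_measurable M" and le: "\<And>x. x \<in> space M ==> \<bar>g x\<bar> \<le> \<bar>f x\<bar>"
  shows "L4 M g"
proof -
  have "integrable M (\<lambda>x. g x ^ 4)"
  proof (rule Bochner_Integration.integrable_bound)
    show "integrable M (\<lambda>x. f x ^ 4)" using f by (simp add: L4_def)
    show "(\<lambda>x. g x ^ 4) \<in> borel_measurable M" using g by simp
    show "AE x in M. norm (g x ^ 4) \<le> norm (f x ^ 4)"
      using le by (intro AE_I2) (simp add: power4_mono)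
  qed
  then show ?thesis using g by (simp add: L4_def)
qed

lemma L4_cmult: "L4 M f ==> L4 M (\<lambda>x. c * f x)"
  by (auto simp: L4_def power_mult_distrib)

lemma power4_sum_le: "(a + b) ^ 4 \<le> 8 * (a ^ 4 + b ^ 4)" for a b :: real
proof -
  have sq: "(x + y)\<^sup>2 \<le> 2 * (x\<^sup>2 + y\<^sup>2)" for x y :: real
    using zero_le_power2[of "x - y"] by (simp add: power2_eq_square algebra_simps)
  have p4: "x ^ 4 = (x\<^sup>2)\<^sup>2" for x :: real by simp
  have "(a + b) ^ 4 \<le> (2 * (a\<^sup>2 + b\<^sup>2))\<^sup>2" unfolding p4[of "a + b"] by (rule power_mono[OF sq]) simp
  also have "\<dots> = 4 * (a\<^sup>2 + b\<^sup>2)\<^sup>2" by (simp add: power2_eq_square algebra_simps)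
  also have "\<dots> \<le> 4 * (2 * ((a\<^sup>2)\<^sup>2 + (b\<^sup>2)\<^sup>2))" by (intro mult_left_mono sq) simp
  finally show ?thesis by simp
qed

lemma L4_add:
  assumes f: "L4 M f" and g: "L4 M g"
  shows "L4 M (\<lambda>x. f x + g x)"
proof -
  have m: "(\<lambda>x. f x + g x) \<in> borel_measurable M" using f g by (auto simp: L4_def)
  have "integrable M (\<lambda>x. (f x + g x) ^ 4)"
  proof (rule Bochner_Integration.integrable_bound)
    show "integrable M (\<lambda>x. 8 * (f x ^ 4 + g x ^ 4))" using f g by (simp add: L4_def)
    show "(\<lambda>x. (f x + g x) ^ 4) \<in> borel_measurable M" using m by simp
    show "AE x in M. norm ((f x + g x) ^ 4) \<le> norm (8 * (f x ^ 4 + g x ^ 4))"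
      using power4_sum_le by (intro AE_I2) (simp add: abs_of_nonneg del: distrib_left_numeral)
  qed
  then show ?thesis using m by (simp add: L4_def)
qed

lemma L4_sum: "finite A ==> (\<And>i. i \<in> A ==> L4 M (f i)) ==> L4 M (\<lambda>x. \<Sum>i\<in>A. f i x)"
  by (induction A rule: finite_induct) (auto intro: L4_add simp: L4_def[of M "\<lambda>x. 0"])

lemma power_le_one_plus_power4:
  assumes "k \<le> 4"
  shows "\<bar>x :: real\<bar> ^ k \<le> 1 + x ^ 4"
proof (cases "\<bar>x\<bar> \<le> 1")
  case True
  then have "\<bar>x\<bar> ^ k \<le> 1" by (intro power_le_one) auto
  then show ?thesis by (smt (verit) zero_le_even_power even_numeral)
next
  case False
  then have "\<bar>x\<bar> ^ k \<le> \<bar>x\<bar> ^ 4" using assms by (intro power_increasing) auto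
  then show ?thesis by simp
qed

context prob_space
begin

lemma L4_integrable_power:
  assumes f: "L4 M f" and k: "k \<le> 4"
  shows "integrable M (\<lambda>x. \<bar>f x\<bar> ^ k)" (is ?A) "integrable M (\<lambda>x. f x ^ k)"
proof -
  have i: "integrable M (\<lambda>x. 1 + f x ^ 4)" using f by (simp add: L4_def)
  have b: "\<bar>f x\<bar> ^ k \<le> \<bar>1 + f x ^ 4\<bar>" for x
    using power_le_one_plus_power4[OF k, of "f x"] by linarith
  show ?A "integrable M (\<lambda>x. f x ^ k)"
    using L4_measurable[OF f] b by (auto intro!: Bochner_Integration.integrable_bound[OF i] simp: power_abs)
qed

lemma L4_integrable: "L4 M f ==> integrable M f"
  using L4_integrable_power(2)[of f 1] by simp

lemma L4_integrable_square: "L4 M f ==> integrable M (\<lambda>x. (f x)\<^sup>2)"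
  using L4_integrable_power(2)[of f 2] by simp

lemma L4_mult_square:
  assumes f: "L4 M f" and g: "L4 M g"
  shows "integrable M (\<lambda>x. (f x * g x)\<^sup>2)" (is ?A) "integrable M (\<lambda>x. f x * g x)"
proof -
  have [measurable]: "f \<in> borel_measurable M" "g \<in> borel_measurable M" using f g by (auto simp: L4_def)
  have "integrable M (\<lambda>x. (f x)\<^sup>2 * (g x)\<^sup>2)"
    by (rule integrable_mult_of_squares) (use f g in \<open>auto simp: L4_def\<close>)
  then show ?A by (simp add: power_mult_distrib)
  show "integrable M (\<lambda>x. f x * g x)"
    by (rule integrable_mult_of_squares) (use L4_integrable_square f g in auto)
qed

lemma square_expectation_le:
  assumes [measurable]: "f \<in> borel_measurable M" and "integrable M (\<lambda>x. (f x)\<^sup>2)"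
  shows "integrable M f" "(expectation f)\<^sup>2 \<le> expectation (\<lambda>x. (f x)\<^sup>2)" (is ?A)
    "expectation (\<lambda>x. \<bar>f x\<bar>) \<le> sqrt (expectation (\<lambda>x. (f x)\<^sup>2))" (is ?B)
proof -
  show i: "integrable M f" using integrable_mult_of_squares[of f M "\<lambda>_. 1"] assms by simp
  have le: "(expectation g)\<^sup>2 \<le> expectation (\<lambda>x. (g x)\<^sup>2)" if g: "integrable M g" "integrable M (\<lambda>x. (g x)\<^sup>2)" for g :: "'a => real"
    using variance_eq[OF g] variance_positive[of g] by simp
  show ?A by (rule le[OF i assms(2)])
  show ?B
    using le[of "\<lambda>x. \<bar>f x\<bar>"] i assms(2) by (intro real_le_rsqrt) simp
qed

end

text \<open>\<open>N\<close> is at once the measurable space of the observations and their common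
  law, so that expectations of functions of one observation are plain integrals over
  \<open>N\<close>. Indices start at 1.\<close>

locale iid_sample = prob_space M for M :: "'w measure" +
  fixes N :: "'b measure" and X :: "nat => 'w => 'b"
  assumes indep: "indep_vars (\<lambda>_. N) X {1..}"
    and X_measurable: "\<And>i. i \<ge> 1 ==> X i \<in> M \<rightarrow>\<^sub>M N"
    and X_distr: "\<And>i. i \<ge> 1 ==> distr M N (X i) = N"
begin

lemma prob_space_N: "prob_space N"
  using prob_space_distr[OF X_measurable[of 1]] X_distr[of 1] by simp

sublocale N: prob_space N by (rule prob_space_N)

lemma integral_X:
  fixes f :: "'b => 'c::{banach, second_countable_topology}"
  assumes "f \<in> borel_measurable N" "i \<ge> 1"
  shows "(\<integral>\<omega>. f (X i \<omega>) \<partial>M) = (\<integral>x. f x \<partial>N)"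
  using integral_distr[OF X_measurable[OF assms(2)] assms(1)] X_distr[OF assms(2)] by simp

lemma integrable_X:
  fixes f :: "'b => 'c::{banach, second_countable_topology}"
  assumes "f \<in> borel_measurable N" "i \<ge> 1"
  shows "integrable M (\<lambda>\<omega>. f (X i \<omega>)) \<longleftrightarrow> integrable N f"
  using integrable_distr_eq[OF X_measurable[OF assms(2)] assms(1)] X_distr[OF assms(2)] by simp

lemma L4_X: "L4 N f ==> i \<ge> 1 ==> L4 M (\<lambda>\<omega>. f (X i \<omega>))"
  using integrable_X[of "\<lambda>x. f x ^ 4" i] measurable_compose[OF X_measurable] by (auto simp: L4_def)

abbreviation obs :: "'w => nat => 'b" where
  "obs \<omega> \<equiv> (\<lambda>i. X i \<omega>)"

text \<open>The observations strictly before time \<open>j\<close>, as a point of a finite product;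
  functions of the past can then be treated by Fubini's theorem.\<close>

definition past :: "nat => 'w => nat => 'b" where
  "past j \<omega> = restrict (obs \<omega>) {1..<j}"

abbreviation PN :: "nat => (nat => 'b) measure" where
  "PN j \<equiv> Pi\<^sub>M {1..<j} (\<lambda>_. N)"

lemma past_measurable: "past j \<in> M \<rightarrow>\<^sub>M PN j"
  unfolding past_def by (intro measurable_restrict X_measurable) auto

lemma past_indep:
  assumes "j \<ge> 1"
  shows "indep_var (PN j) (past j) (Pi\<^sub>M {j} (\<lambda>_. N)) (\<lambda>\<omega>. restrict (obs \<omega>) {j})"
  unfolding past_def[abs_def] by (rule indep_var_restrict[OF indep]) (use assms in auto)

text \<open>Independence is available for restrictions to disjoint index sets. Evaluating the
  one-point restriction at \<open>j\<close> turns it into the product law used below.\<close>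

lemma past_distr:
  assumes j: "j \<ge> 1"
  shows "distr M (PN j \<Otimes>\<^sub>M N) (\<lambda>\<omega>. (past j \<omega>, X j \<omega>)) = distr M (PN j) (past j) \<Otimes>\<^sub>M N"
proof -
  let ?R = "\<lambda>\<omega>. restrict (obs \<omega>) {j}" and ?Q = "Pi\<^sub>M {j} (\<lambda>_. N)"
  let ?P = "distr M (PN j) (past j)"
  have Rm: "?R \<in> M \<rightarrow>\<^sub>M ?Q" using j by (intro measurable_restrict X_measurable) auto
  have em: "(\<lambda>v. v j) \<in> ?Q \<rightarrow>\<^sub>M N" by (rule measurable_component_singleton) simp
  have e: "distr (distr M ?Q ?R) N (\<lambda>v. v j) = N"
    using distr_distr[OF em Rm] X_distr[OF j] by (simp add: comp_def)
  have eq: "?P \<Otimes>\<^sub>M distr M ?Q ?R = distr M (PN j \<Otimes>\<^sub>M ?Q) (\<lambda>\<omega>. (past j \<omega>, ?R \<omega>))"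
    using past_indep[OF j] unfolding indep_var_distribution_eq by simp
  have "?P \<Otimes>\<^sub>M N = distr ?P (PN j) (\<lambda>u. u) \<Otimes>\<^sub>M distr (distr M ?Q ?R) N (\<lambda>v. v j)"
    unfolding e by (simp add: distr_id2)
  also have "\<dots> = distr (?P \<Otimes>\<^sub>M distr M ?Q ?R) (PN j \<Otimes>\<^sub>M N) (\<lambda>(u, v). (u, v j))"
    by (rule pair_measure_distr) (use em e N.sigma_finite_measure_axioms in auto)
  also have "\<dots> = distr M (PN j \<Otimes>\<^sub>M N) ((\<lambda>(u, v). (u, v j)) \<circ> (\<lambda>\<omega>. (past j \<omega>, ?R \<omega>)))"
    unfolding eq
  proof (rule distr_distr)
    show "(\<lambda>(u, v). (u, v j)) \<in> PN j \<Otimes>\<^sub>M ?Q \<rightarrow>\<^sub>M PN j \<Otimes>\<^sub>M N"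
      using measurable_compose[OF measurable_snd em] by (auto simp: case_prod_beta intro!: measurable_Pair)
    show "(\<lambda>\<omega>. (past j \<omega>, ?R \<omega>)) \<in> M \<rightarrow>\<^sub>M PN j \<Otimes>\<^sub>M ?Q"
      by (intro measurable_Pair past_measurable Rm)
  qed
  also have "((\<lambda>(u, v). (u, v j)) \<circ> (\<lambda>\<omega>. (past j \<omega>, ?R \<omega>))) = (\<lambda>\<omega>. (past j \<omega>, X j \<omega>))" by (auto simp: fun_eq_iff)
  finally show ?thesis by simp
qed

lemma pair_measurable: "j \<ge> 1 ==> (\<lambda>\<omega>. (past j \<omega>, X j \<omega>)) \<in> M \<rightarrow>\<^sub>M PN j \<Otimes>\<^sub>M N"
  by (intro measurable_Pair past_measurable X_measurable)

text \<open>This takes the place of conditional expectation given the past: a new observation may be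
  integrated out with the past frozen, or the past integrated out with the new observation frozen.
  Both orders are used.\<close>

lemma past_expectation:
  fixes f :: "(nat => 'b) \<times> 'b => 'c::{banach, second_countable_topology}"
  assumes j: "j \<ge> 1" and f: "f \<in> borel_measurable (PN j \<Otimes>\<^sub>M N)"
    and int: "integrable M (\<lambda>\<omega>. f (past j \<omega>, X j \<omega>))"
  shows "(\<integral>\<omega>. f (past j \<omega>, X j \<omega>) \<partial>M) = (\<integral>\<omega>. (\<integral>y. f (past j \<omega>, y) \<partial>N) \<partial>M)" (is ?A)
    "integrable M (\<lambda>\<omega>. \<integral>y. f (past j \<omega>, y) \<partial>N)" (is ?B)
    "(\<integral>\<omega>. f (past j \<omega>, X j \<omega>) \<partial>M) = (\<integral>y. (\<integral>\<omega>. f (past j \<omega>, y) \<partial>M) \<partial>N)" (is ?C)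
    "integrable N (\<lambda>y. \<integral>\<omega>. f (past j \<omega>, y) \<partial>M)" (is ?D)
proof -
  let ?P = "distr M (PN j) (past j)"
  interpret P: prob_space ?P by (rule prob_space_distr[OF past_measurable])
  interpret PN: pair_sigma_finite ?P N ..
  have int': "integrable (?P \<Otimes>\<^sub>M N) f"
    using integrable_distr_eq[OF pair_measurable[OF j] f] int past_distr[OF j] by simp
  have int'': "integrable (?P \<Otimes>\<^sub>M N) (case_prod (\<lambda>x y. f (x, y)))" using int' by simp
  have eq: "(\<integral>\<omega>. f (past j \<omega>, X j \<omega>) \<partial>M) = integral\<^sup>L (?P \<Otimes>\<^sub>M N) f"
    using integral_distr[OF pair_measurable[OF j] f] past_distr[OF j] by simp
  have in_m: "(\<lambda>u. \<integral>y. f (u, y) \<partial>N) \<in> borel_measurable (PN j)"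
    using f by (intro N.borel_measurable_lebesgue_integral) simp
  have y_m: "(\<lambda>u. f (u, y)) \<in> borel_measurable (PN j)" if "y \<in> space N" for y
    using measurable_compose[OF measurable_Pair2'[OF that] f] by simp
  show ?A
    using PN.integral_fst'[OF int'] eq integral_distr[OF past_measurable in_m] by simp
  show ?B
    using PN.integrable_fst'[OF int'] integrable_distr_eq[OF past_measurable in_m] by simp
  have sw: "(\<integral>u. f (u, y) \<partial>?P) = (\<integral>\<omega>. f (past j \<omega>, y) \<partial>M)" if "y \<in> space N" for y
    by (rule integral_distr[OF past_measurable y_m[OF that]])
  have "(\<integral>y. (\<integral>u. f (u, y) \<partial>?P) \<partial>N) = (\<integral>y. (\<integral>\<omega>. f (past j \<omega>, y) \<partial>M) \<partial>N)"
    by (rule Bochner_Integration.integral_cong[OF refl sw])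
  then show ?C
    using PN.Fubini_integral[OF int''] PN.integral_fst'[OF int'] eq by simp
  show ?D
    using PN.integrable_snd[OF int''] by (rule Bochner_Integration.integrable_cong[THEN iffD1, rotated 2]) (use sw in auto)
qed

lemma past_indep_mult:
  assumes j: "j \<ge> 1" and f: "f \<in> borel_measurable (PN j)" and a: "a \<in> borel_measurable N"
    and fi: "integrable M (\<lambda>\<omega>. f (past j \<omega>))" and ai: "integrable N a"
  shows "(\<integral>\<omega>. f (past j \<omega>) * a (X j \<omega>) \<partial>M) = (\<integral>\<omega>. f (past j \<omega>) \<partial>M) * (\<integral>x. (a x :: real) \<partial>N)"
    "integrable M (\<lambda>\<omega>. f (past j \<omega>) * a (X j \<omega>))" (is ?A)
proof -
  have am: "(\<lambda>v. a (v j)) \<in> borel_measurable (Pi\<^sub>M {j} (\<lambda>_. N))"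
    by (rule measurable_compose[OF _ a]) (rule measurable_component_singleton, simp)
  have iv: "indep_var borel (\<lambda>\<omega>. f (past j \<omega>)) borel (\<lambda>\<omega>. a (X j \<omega>))"
    using indep_var_compose[OF past_indep[OF j] f am] by (simp add: comp_def)
  have ai': "integrable M (\<lambda>\<omega>. a (X j \<omega>))" using integrable_X[OF a j] ai by simp
  show "(\<integral>\<omega>. f (past j \<omega>) * a (X j \<omega>) \<partial>M) = (\<integral>\<omega>. f (past j \<omega>) \<partial>M) * (\<integral>x. a x \<partial>N)"
    using indep_var_lebesgue_integral[OF iv fi ai'] integral_X[OF a j] by simp
  show ?A by (rule indep_var_integrable[OF iv fi ai'])
qed

lemma sum_past: "A \<subseteq> {1..<j} ==> (\<Sum>i\<in>A. a (X i \<omega>)) = (\<Sum>i\<in>A. a (past j \<omega> i))"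
  by (intro sum.cong) (auto simp: past_def)

lemma sum_past_measurable:
  assumes "a \<in> borel_measurable N"
  shows "(\<lambda>u. (\<Sum>i\<in>{1..<j}. (a (u i) :: real)) ^ k) \<in> borel_measurable (PN j)"
  using assms by (intro borel_measurable_power borel_measurable_sum)
    (auto intro: measurable_compose[OF measurable_component_singleton])

lemma
  assumes am: "a \<in> borel_measurable N" and a2: "integrable N (\<lambda>x. (a x)\<^sup>2)" and mean: "(\<integral>x. a x \<partial>N) = 0"
  shows iid_sum_square_integrable: "integrable M (\<lambda>\<omega>. (\<Sum>i\<in>{1..<j}. a (X i \<omega>))\<^sup>2)"
    and iid_sum_square: "(\<integral>\<omega>. (\<Sum>i\<in>{1..<j}. a (X i \<omega>))\<^sup>2 \<partial>M) = real (j - 1) * (\<integral>x. (a x)\<^sup>2 \<partial>N)"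
proof -
  let ?S = "\<lambda>j \<omega>. \<Sum>i\<in>{1..<j}. a (X i \<omega>)"
  have a1: "integrable N a" by (rule N.square_expectation_le(1)[OF am a2])
  have aX: "integrable M (\<lambda>\<omega>. a (X i \<omega>))" "integrable M (\<lambda>\<omega>. (a (X i \<omega>))\<^sup>2)" if "i \<ge> 1" for i
    using integrable_X[OF am that] integrable_X[of "\<lambda>x. (a x)\<^sup>2" i] a1 a2 am that by auto
  have S1: "integrable M (?S j)" for j using aX(1) by (intro Bochner_Integration.integrable_sum) auto
  have prod: "(\<integral>\<omega>. ?S j \<omega> * a (X j \<omega>) \<partial>M) = 0" "integrable M (\<lambda>\<omega>. ?S j \<omega> * a (X j \<omega>))" if j: "j \<ge> 1" for j
    using past_indep_mult[OF j sum_past_measurable[OF am, of j 1] am] S1[of j] a1 mean sum_past[of "{1..<j}" j a]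
    by simp_all
  have "integrable M (\<lambda>\<omega>. (?S j \<omega>)\<^sup>2) \<and> (\<integral>\<omega>. (?S j \<omega>)\<^sup>2 \<partial>M) = real (j - 1) * (\<integral>x. (a x)\<^sup>2 \<partial>N)" for j
  proof (induction j)
    case (Suc j)
    show ?case
    proof (cases "j = 0")
      case False
      then have j: "j \<ge> 1" by simp
      have e: "(?S (Suc j) \<omega>)\<^sup>2 = (?S j \<omega>)\<^sup>2 + 2 * (?S j \<omega> * a (X j \<omega>)) + (a (X j \<omega>))\<^sup>2" for \<omega>
        using j by (simp add: atLeastLessThanSuc power2_eq_square algebra_simps)
      have "(\<integral>\<omega>. (?S (Suc j) \<omega>)\<^sup>2 \<partial>M) = (\<integral>\<omega>. (?S j \<omega>)\<^sup>2 \<partial>M)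
         + 2 * (\<integral>\<omega>. ?S j \<omega> * a (X j \<omega>) \<partial>M) + (\<integral>\<omega>. (a (X j \<omega>))\<^sup>2 \<partial>M)"
        unfolding e using prod(2)[OF j] aX(2)[OF j] Suc by simp
      also have "(\<integral>\<omega>. (a (X j \<omega>))\<^sup>2 \<partial>M) = (\<integral>x. (a x)\<^sup>2 \<partial>N)" using am by (intro integral_X j) simp
      finally show ?thesis unfolding e using Suc j prod[OF j] aX(2)[OF j]
        by (simp add: of_nat_diff algebra_simps)
    qed simp
  qed simp
  then show "integrable M (\<lambda>\<omega>. (?S j \<omega>)\<^sup>2)" "(\<integral>\<omega>. (?S j \<omega>)\<^sup>2 \<partial>M) = real (j - 1) * (\<integral>x. (a x)\<^sup>2 \<partial>N)" by auto
qed

text \<open>In the binomial expansion the terms with a single factor of mean zero vanish. A new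
  summand adds 6 (j - 1) m2^2 + m4, where m2^2 is at most m4, and 3 (j - 1)^2 + 6 (j - 1) + 3 = 3
  j^2.\<close>

lemma iid_sum_power4:
  assumes a: "L4 N a" and mean: "(\<integral>x. a x \<partial>N) = 0"
  shows "(\<integral>\<omega>. (\<Sum>i\<in>{1..<j}. a (X i \<omega>)) ^ 4 \<partial>M) \<le> 3 * (real (j - 1))\<^sup>2 * (\<integral>x. a x ^ 4 \<partial>N)"
proof -
  let ?S = "\<lambda>j \<omega>. \<Sum>i\<in>{1..<j}. a (X i \<omega>)"
  have S4: "L4 M (?S j)" for j using L4_X[OF a] by (intro L4_sum) auto
  have am: "a \<in> borel_measurable N" using a by (simp add: L4_def)
  have prod: "(\<integral>\<omega>. (?S j \<omega>) ^ k * a (X j \<omega>) ^ l \<partial>M) = (\<integral>\<omega>. (?S j \<omega>) ^ k \<partial>M) * (\<integral>x. a x ^ l \<partial>N)"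
     "integrable M (\<lambda>\<omega>. (?S j \<omega>) ^ k * a (X j \<omega>) ^ l)" if "j \<ge> 1" "k \<le> 4" "l \<le> 4" for j k l
    using past_indep_mult[OF that(1) sum_past_measurable[OF am, of j k] borel_measurable_power[OF am, of l]]
      L4_integrable_power(2)[OF S4[of j] that(2)] N.L4_integrable_power(2)[OF a that(3)] sum_past[of "{1..<j}" j a]
    by simp_all
  have m: "(\<integral>\<omega>. ?S j \<omega> \<partial>M) = 0" for j
    using L4_integrable[OF L4_X[OF a]] mean integral_X[OF am] by (subst Bochner_Integration.integral_sum) auto
  have sq: "(\<integral>\<omega>. (?S j \<omega>)\<^sup>2 \<partial>M) = real (j - 1) * (\<integral>x. (a x)\<^sup>2 \<partial>N)" for j
    by (rule iid_sum_square[OF am N.L4_integrable_square[OF a] mean])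
  have m4: "(\<integral>x. (a x)\<^sup>2 \<partial>N)\<^sup>2 \<le> (\<integral>x. a x ^ 4 \<partial>N)"
    using N.square_expectation_le(2)[of "\<lambda>x. (a x)\<^sup>2"] am a by (simp add: L4_def)
  show "(\<integral>\<omega>. (?S j \<omega>) ^ 4 \<partial>M) \<le> 3 * (real (j - 1))\<^sup>2 * (\<integral>x. a x ^ 4 \<partial>N)"
  proof (induction j)
    case (Suc j)
    show ?case
    proof (cases "j = 0")
      case False
      then have j: "j \<ge> 1" by simp
      let ?m2 = "\<integral>x. (a x)\<^sup>2 \<partial>N" and ?m4 = "\<integral>x. a x ^ 4 \<partial>N"
      have e: "(?S (Suc j) \<omega>) ^ 4 = (?S j \<omega>) ^ 4 + 4 * ((?S j \<omega>) ^ 3 * a (X j \<omega>) ^ 1) + 6 * ((?S j \<omega>) ^ 2 * a (X j \<omega>) ^ 2)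
          + 4 * ((?S j \<omega>) ^ 1 * a (X j \<omega>) ^ 3) + (?S j \<omega>) ^ 0 * a (X j \<omega>) ^ 4" for \<omega>
        using j by (simp add: atLeastLessThanSuc power4_eq_xxxx power3_eq_cube power2_eq_square algebra_simps)
      have "(\<integral>\<omega>. (?S (Suc j) \<omega>) ^ 4 \<partial>M) = (\<integral>\<omega>. (?S j \<omega>) ^ 4 \<partial>M) + 4 * (\<integral>\<omega>. (?S j \<omega>) ^ 3 * a (X j \<omega>) ^ 1 \<partial>M)
         + 6 * (\<integral>\<omega>. (?S j \<omega>) ^ 2 * a (X j \<omega>) ^ 2 \<partial>M) + 4 * (\<integral>\<omega>. (?S j \<omega>) ^ 1 * a (X j \<omega>) ^ 3 \<partial>M)
         + (\<integral>\<omega>. (?S j \<omega>) ^ 0 * a (X j \<omega>) ^ 4 \<partial>M)"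
        unfolding e using prod(2)[OF j, of 3 1] prod(2)[OF j, of 2 2] prod(2)[OF j, of 1 3] prod(2)[OF j, of 0 4]
          L4_integrable_power(2)[OF S4[of j], of 4] by simp
      also have "(\<integral>\<omega>. (?S j \<omega>) ^ 3 * a (X j \<omega>) ^ 1 \<partial>M) = 0" using prod(1)[OF j, of 3 1] mean by simp
      also have "(\<integral>\<omega>. (?S j \<omega>) ^ 1 * a (X j \<omega>) ^ 3 \<partial>M) = 0" using prod(1)[OF j, of 1 3] m[of j] by simp
      also have "(\<integral>\<omega>. (?S j \<omega>) ^ 2 * a (X j \<omega>) ^ 2 \<partial>M) = real (j - 1) * ?m2 * ?m2"
        using prod(1)[OF j, of 2 2] sq[of j] by simp
      also have "(\<integral>\<omega>. (?S j \<omega>) ^ 0 * a (X j \<omega>) ^ 4 \<partial>M) = ?m4"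
        using prod(1)[OF j, of 0 4] by (simp add: prob_space)
      finally have "(\<integral>\<omega>. (?S (Suc j) \<omega>) ^ 4 \<partial>M) = (\<integral>\<omega>. (?S j \<omega>) ^ 4 \<partial>M) + 6 * real (j - 1) * ?m2\<^sup>2 + ?m4"
        by (simp add: power2_eq_square)
      also have "\<dots> \<le> 3 * (real (j - 1))\<^sup>2 * ?m4 + 6 * real (j - 1) * ?m4 + 3 * ?m4"
      proof -
        have "?m4 \<ge> 0" by (rule integral_nonneg_AE) simp
        moreover have "6 * real (j - 1) * ?m2\<^sup>2 \<le> 6 * real (j - 1) * ?m4" by (intro mult_left_mono m4) simp
        ultimately show ?thesis using Suc by linarith
      qed
      also have "\<dots> = 3 * (real (Suc j - 1))\<^sup>2 * ?m4"
        using j by (simp add: of_nat_diff power2_eq_square algebra_simps)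
      finally show ?thesis .
    qed simp
  qed simp
qed

end

text \<open>The product bound on \<open>k\<close> supplies all the integrability.\<close>

locale degenerate_kernel = iid_sample M N X for M :: "'w measure" and N :: "'b measure" and X +
  fixes k :: "'b => 'b => real" and w :: "'b => real"
  assumes k_measurable: "case_prod k \<in> borel_measurable (N \<Otimes>\<^sub>M N)"
    and w_L4: "L4 N w" and w_nonneg: "\<And>x. w x \<ge> 0"
    and k_bound: "\<And>x y. x \<in> space N ==> y \<in> space N ==> \<bar>k x y\<bar> \<le> w x * w y"
    and k_sym: "\<And>x y. k x y = k y x"
    and k_degenerate: "\<And>y. y \<in> space N ==> (\<integral>x. k x y \<partial>N) = 0"
begin

lemma k_comp: "f \<in> L \<rightarrow>\<^sub>M N ==> g \<in> L \<rightarrow>\<^sub>M N ==> (\<lambda>x. k (f x) (g x)) \<in> borel_measurable L"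
  using measurable_compose[OF measurable_Pair k_measurable, of f L g] by simp

lemma L4_section: "y \<in> space N ==> L4 N (\<lambda>x. k x y)"
  by (rule L4_bound[OF L4_cmult[OF w_L4, of "w y"]])
    (use k_comp[of "\<lambda>x. x" N "\<lambda>_. y"] k_bound w_nonneg in \<open>auto simp: abs_mult mult.commute\<close>)

lemma L4_section': "y \<in> space N ==> L4 N (k y)"
proof -
  have "k y = (\<lambda>x. k x y)" by (rule ext) (rule k_sym)
  then show "y \<in> space N ==> L4 N (k y)" using L4_section[of y] by simp
qed

text \<open>At \<open>y = u j\<close> this is the martingale difference at time \<open>j\<close>;
  \<open>y\<close> is kept free so that it can be integrated out.\<close>

definition rsum :: "nat => (nat => 'b) => 'b => real" where
  "rsum j u y = (\<Sum>i\<in>{1..<j}. k (u i) y)"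

definition psum :: "nat => (nat => 'b) => real" where
  "psum j u = (\<Sum>l\<in>{1..<j}. rsum l u (u l))"

definition k2 :: real where "k2 = (\<integral>y. (\<integral>x. (k x y)\<^sup>2 \<partial>N) \<partial>N)"
definition k4 :: real where "k4 = (\<integral>y. (\<integral>x. k x y ^ 4 \<partial>N) \<partial>N)"

text \<open>The iterated kernel, that is, the kernel of the square of the integral operator with
  kernel \<open>k\<close>. It governs how much the conditional variances fluctuate.\<close>

definition g :: "'b => 'b => real" where
  "g x x' = (\<integral>y. k x y * k x' y \<partial>N)"

lemma rsum_past: "i \<le> j ==> rsum i (past j \<omega>) y = rsum i (obs \<omega>) y"
  unfolding rsum_def by (intro sum.cong) (auto simp: past_def)

lemma psum_past: "psum j (past j \<omega>) = psum j (obs \<omega>)"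
  unfolding psum_def by (intro sum.cong) (auto simp: rsum_past, auto simp: past_def)

lemma psum_Suc: "j \<ge> 1 ==> psum (Suc j) u = psum j u + rsum j u (u j)"
  by (simp add: psum_def)

lemma component: "i \<in> {1..<j} ==> (\<lambda>u. u i) \<in> PN j \<rightarrow>\<^sub>M N"
  by (rule measurable_component_singleton)

lemma rsum_measurable: "(\<lambda>p. rsum j (fst p) (snd p)) \<in> borel_measurable (PN j \<Otimes>\<^sub>M N)"
  unfolding rsum_def
  by (intro borel_measurable_sum k_comp measurable_snd measurable_compose[OF measurable_fst component])

lemma psum_measurable: "psum j \<in> borel_measurable (PN j)"
  unfolding psum_def[abs_def] rsum_def
  by (intro borel_measurable_sum k_comp component) auto

lemma past_space: "i \<in> {1..<j} ==> \<omega> \<in> space M ==> past j \<omega> i \<in> space N"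
  using measurable_space[OF X_measurable[of i]] by (auto simp: past_def)

lemma X_space: "i \<ge> 1 ==> \<omega> \<in> space M ==> X i \<omega> \<in> space N"
  using measurable_space[OF X_measurable[of i]] by auto

lemma L4_rsum_section: "\<omega> \<in> space M ==> L4 N (rsum j (past j \<omega>))"
  unfolding rsum_def[abs_def]
  using L4_section'[OF past_space] by (intro L4_sum) auto

lemma rsum_section_mean: "\<omega> \<in> space M ==> (\<integral>y. rsum j (past j \<omega>) y \<partial>N) = 0"
  unfolding rsum_def
proof (subst Bochner_Integration.integral_sum)
  fix i assume i: "i \<in> {1..<j}" and w: "\<omega> \<in> space M"
  show "integrable N (k (past j \<omega> i))"
    by (rule N.L4_integrable[OF L4_section'[OF past_space[OF i w]]])
next
  assume w: "\<omega> \<in> space M"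
  show "(\<Sum>i\<in>{1..<j}. \<integral>y. k (past j \<omega> i) y \<partial>N) = 0"
    using k_degenerate past_space[OF _ w] by (intro sum.neutral) (auto simp: k_sym[of "past j \<omega> _"])
qed

text \<open>The dominating product \<open>w (X i \<omega>) * w (X l \<omega>)\<close> has
  independent factors, so its fourth moment factorizes.\<close>

lemma L4_k_pair:
  assumes "1 \<le> i" "i < l"
  shows "L4 M (\<lambda>\<omega>. k (X i \<omega>) (X l \<omega>))"
proof -
  have l: "l \<ge> 1" using assms by simp
  have wm: "w \<in> borel_measurable N" using w_L4 by (simp add: L4_def)
  have "integrable M (\<lambda>\<omega>. w (past l \<omega> i) ^ 4 * w (X l \<omega>) ^ 4)"
  proof (rule past_indep_mult(2)[OF l, where f = "\<lambda>u. w (u i) ^ 4" and a = "\<lambda>x. w x ^ 4"])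
    show "(\<lambda>u. w (u i) ^ 4) \<in> borel_measurable (PN l)"
      using assms by (intro borel_measurable_power measurable_compose[OF component wm]) auto
    show "integrable M (\<lambda>\<omega>. w (past l \<omega> i) ^ 4)"
      using L4_X[OF w_L4 assms(1)] assms by (simp add: L4_def past_def)
  qed (use wm w_L4 in \<open>auto simp: L4_def\<close>)
  then have "L4 M (\<lambda>\<omega>. w (X i \<omega>) * w (X l \<omega>))"
    using assms measurable_compose[OF X_measurable wm]
    by (auto simp: L4_def past_def power_mult_distrib)
  then show ?thesis
    by (rule L4_bound) (use assms in \<open>auto intro!: k_comp X_measurable order_trans[OF k_bound] X_space\<close>)
qed

lemma L4_rsum: "L4 M (\<lambda>\<omega>. rsum j (obs \<omega>) (X j \<omega>))"
  unfolding rsum_def by (intro L4_sum L4_k_pair) auto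

lemma L4_psum: "L4 M (\<lambda>\<omega>. psum j (obs \<omega>))"
  unfolding psum_def by (intro L4_sum L4_rsum) auto

lemma rsum_power_expectation:
  assumes j: "j \<ge> 1" and p: "p \<le> 4"
  shows "(\<integral>\<omega>. \<bar>rsum j (obs \<omega>) (X j \<omega>)\<bar> ^ p \<partial>M) = (\<integral>\<omega>. (\<integral>y. \<bar>rsum j (past j \<omega>) y\<bar> ^ p \<partial>N) \<partial>M)" (is ?A)
    "integrable M (\<lambda>\<omega>. \<integral>y. \<bar>rsum j (past j \<omega>) y\<bar> ^ p \<partial>N)" (is ?B)
    "(\<integral>\<omega>. \<bar>rsum j (obs \<omega>) (X j \<omega>)\<bar> ^ p \<partial>M) = (\<integral>y. (\<integral>\<omega>. \<bar>rsum j (past j \<omega>) y\<bar> ^ p \<partial>M) \<partial>N)" (is ?C)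
    "integrable N (\<lambda>y. \<integral>\<omega>. \<bar>rsum j (past j \<omega>) y\<bar> ^ p \<partial>M)" (is ?D)
proof -
  have m: "(\<lambda>q. \<bar>rsum j (fst q) (snd q)\<bar> ^ p) \<in> borel_measurable (PN j \<Otimes>\<^sub>M N)"
    using rsum_measurable[of j] by (intro borel_measurable_power borel_measurable_abs)
  have i: "integrable M (\<lambda>\<omega>. \<bar>rsum j (fst (past j \<omega>, X j \<omega>)) (snd (past j \<omega>, X j \<omega>))\<bar> ^ p)"
    using L4_integrable_power(1)[OF L4_rsum[of j] p] by (simp add: rsum_past)
  note pe = past_expectation[OF j m i]
  show ?A ?B ?C ?D
    using pe by (simp_all add: rsum_past)
qed

text \<open>With the new observation frozen, the increment is a sum of independent centred
  variables, centred by degeneracy; only then is the new observation integrated out.\<close>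

lemma rsum_square:
  assumes j: "j \<ge> 1"
  shows "(\<integral>\<omega>. (rsum j (obs \<omega>) (X j \<omega>))\<^sup>2 \<partial>M) = real (j - 1) * k2"
proof -
  have "(\<integral>\<omega>. (rsum j (obs \<omega>) (X j \<omega>))\<^sup>2 \<partial>M) = (\<integral>y. (\<integral>\<omega>. (rsum j (past j \<omega>) y)\<^sup>2 \<partial>M) \<partial>N)"
    using rsum_power_expectation(3)[OF j, of 2] by simp
  also have "\<dots> = (\<integral>y. real (j - 1) * (\<integral>x. (k x y)\<^sup>2 \<partial>N) \<partial>N)"
  proof (rule Bochner_Integration.integral_cong[OF refl])
    fix y assume y: "y \<in> space N"
    show "(\<integral>\<omega>. (rsum j (past j \<omega>) y)\<^sup>2 \<partial>M) = real (j - 1) * (\<integral>x. (k x y)\<^sup>2 \<partial>N)"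
      using iid_sum_square[OF L4_measurable[OF L4_section[OF y]] N.L4_integrable_square[OF L4_section[OF y]] k_degenerate[OF y], of j]
      unfolding rsum_past[OF order_refl] unfolding rsum_def .
  qed
  finally show ?thesis by (simp add: k2_def)
qed

lemma integrable_k4_section: "integrable N (\<lambda>y. \<integral>x. k x y ^ 4 \<partial>N)"
proof (rule Bochner_Integration.integrable_bound)
  show "integrable N (\<lambda>y. (\<integral>x. w x ^ 4 \<partial>N) * w y ^ 4)" using w_L4 by (simp add: L4_def)
  have "(\<lambda>p. k (snd p) (fst p) ^ 4) \<in> borel_measurable (N \<Otimes>\<^sub>M N)"
    by (intro borel_measurable_power k_comp measurable_fst measurable_snd)
  then show "(\<lambda>y. \<integral>x. k x y ^ 4 \<partial>N) \<in> borel_measurable N"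
    by (intro N.borel_measurable_lebesgue_integral) (simp add: case_prod_beta)
  show "AE y in N. norm (\<integral>x. k x y ^ 4 \<partial>N) \<le> norm ((\<integral>x. w x ^ 4 \<partial>N) * w y ^ 4)"
  proof (rule AE_I2)
    fix y assume y: "y \<in> space N"
    have "(\<integral>x. k x y ^ 4 \<partial>N) \<le> (\<integral>x. w x ^ 4 * w y ^ 4 \<partial>N)"
    proof (rule integral_mono)
      show "integrable N (\<lambda>x. k x y ^ 4)" using L4_section[OF y] by (simp add: L4_def)
      show "integrable N (\<lambda>x. w x ^ 4 * w y ^ 4)" using w_L4 by (simp add: L4_def)
      fix x assume "x \<in> space N"
      then have "\<bar>k x y\<bar> ^ 4 \<le> (w x * w y) ^ 4" using k_bound[OF _ y] by (intro power_mono) auto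
      then show "k x y ^ 4 \<le> w x ^ 4 * w y ^ 4" by (simp add: power_mult_distrib)
    qed
    moreover have "(\<integral>x. k x y ^ 4 \<partial>N) \<ge> 0" by (rule integral_nonneg_AE) simp
    ultimately show "norm (\<integral>x. k x y ^ 4 \<partial>N) \<le> norm ((\<integral>x. w x ^ 4 \<partial>N) * w y ^ 4)" by simp
  qed
qed

lemma rsum_power4:
  assumes j: "j \<ge> 1"
  shows "(\<integral>\<omega>. (rsum j (obs \<omega>) (X j \<omega>)) ^ 4 \<partial>M) \<le> 3 * (real (j - 1))\<^sup>2 * k4"
proof -
  have "(\<integral>\<omega>. (rsum j (obs \<omega>) (X j \<omega>)) ^ 4 \<partial>M) = (\<integral>y. (\<integral>\<omega>. (rsum j (past j \<omega>) y) ^ 4 \<partial>M) \<partial>N)"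
    using rsum_power_expectation(3)[OF j, of 4] by simp
  also have "\<dots> \<le> (\<integral>y. 3 * (real (j - 1))\<^sup>2 * (\<integral>x. k x y ^ 4 \<partial>N) \<partial>N)"
  proof (rule integral_mono)
    show "integrable N (\<lambda>y. \<integral>\<omega>. (rsum j (past j \<omega>) y) ^ 4 \<partial>M)" using rsum_power_expectation(4)[OF j, of 4] by simp
    show "integrable N (\<lambda>y. 3 * (real (j - 1))\<^sup>2 * (\<integral>x. k x y ^ 4 \<partial>N))"
      by (intro integrable_mult_right integrable_k4_section)
    fix y assume y: "y \<in> space N"
    show "(\<integral>\<omega>. (rsum j (past j \<omega>) y) ^ 4 \<partial>M) \<le> 3 * (real (j - 1))\<^sup>2 * (\<integral>x. k x y ^ 4 \<partial>N)"
      using iid_sum_power4[OF L4_section[OF y] k_degenerate[OF y], of j]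
      unfolding rsum_past[OF order_refl] unfolding rsum_def .
  qed
  finally show ?thesis by (simp add: k4_def)
qed

text \<open>Martingale differences are orthogonal, so each step adds (j - 1) times
  \<open>k2\<close>. The crude constant suffices because only the order in \<open>j\<close> matters
  for the conditional variances.\<close>

lemma psum_square: "(\<integral>\<omega>. (psum j (obs \<omega>))\<^sup>2 \<partial>M) \<le> (real j)\<^sup>2 * k2"
proof -
  have k2nn: "k2 \<ge> 0" unfolding k2_def by (intro integral_nonneg_AE AE_I2) simp
  show ?thesis
  proof (induction j)
    case 0
    then show ?case by (simp add: psum_def)
  next
    case (Suc j)
    show ?case
    proof (cases "j = 0")
      case True
      then show ?thesis using k2nn by (simp add: psum_def)
    next
      case False
      then have j: "j \<ge> 1" by simp
      let ?P = "\<lambda>\<omega>. psum j (obs \<omega>)" and ?R = "\<lambda>\<omega>. rsum j (obs \<omega>) (X j \<omega>)"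
      have m: "(\<lambda>q. psum j (fst q) * rsum j (fst q) (snd q)) \<in> borel_measurable (PN j \<Otimes>\<^sub>M N)"
        by (intro borel_measurable_times rsum_measurable measurable_compose[OF measurable_fst psum_measurable])
      have i: "integrable M (\<lambda>\<omega>. psum j (fst (past j \<omega>, X j \<omega>)) * rsum j (fst (past j \<omega>, X j \<omega>)) (snd (past j \<omega>, X j \<omega>)))"
        using L4_mult_square(2)[OF L4_psum[of j] L4_rsum[of j]] by (simp add: rsum_past psum_past)
      have "(\<integral>\<omega>. ?P \<omega> * ?R \<omega> \<partial>M) = (\<integral>\<omega>. (\<integral>y. psum j (past j \<omega>) * rsum j (past j \<omega>) y \<partial>N) \<partial>M)"
        using past_expectation(1)[OF j m i] by (simp add: rsum_past psum_past)
      also have "\<dots> = (\<integral>\<omega>. 0 \<partial>M)"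
        by (rule Bochner_Integration.integral_cong) (simp_all add: rsum_section_mean)
      finally have cross: "(\<integral>\<omega>. ?P \<omega> * ?R \<omega> \<partial>M) = 0" by simp
      have e: "(psum (Suc j) (obs \<omega>))\<^sup>2 = (?P \<omega>)\<^sup>2 + 2 * (?P \<omega> * ?R \<omega>) + (?R \<omega>)\<^sup>2" for \<omega>
        using j by (simp add: psum_Suc power2_eq_square algebra_simps)
      have "(\<integral>\<omega>. (psum (Suc j) (obs \<omega>))\<^sup>2 \<partial>M)
          = (\<integral>\<omega>. (?P \<omega>)\<^sup>2 \<partial>M) + 2 * (\<integral>\<omega>. ?P \<omega> * ?R \<omega> \<partial>M) + (\<integral>\<omega>. (?R \<omega>)\<^sup>2 \<partial>M)"
        unfolding e using L4_mult_square(2)[OF L4_psum[of j] L4_rsum[of j]]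
          L4_integrable_square[OF L4_psum[of j]] L4_integrable_square[OF L4_rsum[of j]] by simp
      also have "\<dots> \<le> (real j)\<^sup>2 * k2 + real (j - 1) * k2" using Suc cross rsum_square[OF j] by simp
      also have "\<dots> = ((real j)\<^sup>2 + real (j - 1)) * k2" by (simp add: algebra_simps)
      also have "\<dots> \<le> (real (Suc j))\<^sup>2 * k2"
        using k2nn by (intro mult_right_mono) (auto simp: power2_eq_square algebra_simps)
      finally show ?thesis .
    qed
  qed
qed

lemma g_bound: "x \<in> space N ==> x' \<in> space N ==> \<bar>g x x'\<bar> \<le> (\<integral>y. (w y)\<^sup>2 \<partial>N) * (w x * w x')"
proof -
  assume x: "x \<in> space N" "x' \<in> space N"
  have i: "integrable N (\<lambda>y. w x * w x' * (w y)\<^sup>2)" using N.L4_integrable_square[OF w_L4] by simp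
  have b: "\<bar>k x y * k x' y\<bar> \<le> w x * w x' * (w y)\<^sup>2" if "y \<in> space N" for y
  proof -
    have "\<bar>k x y\<bar> * \<bar>k x' y\<bar> \<le> (w x * w y) * (w x' * w y)"
      using k_bound x that w_nonneg by (intro mult_mono) auto
    then show ?thesis by (simp add: abs_mult power2_eq_square mult_ac)
  qed
  have "\<bar>g x x'\<bar> \<le> (\<integral>y. \<bar>k x y * k x' y\<bar> \<partial>N)" unfolding g_def by (rule integral_abs_bound)
  also have "\<dots> \<le> (\<integral>y. w x * w x' * (w y)\<^sup>2 \<partial>N)"
    by (rule integral_mono[OF integrable_abs[OF N.L4_mult_square(2)[OF L4_section'[OF x(1)] L4_section'[OF x(2)]]] i b])
  finally have "\<bar>g x x'\<bar> \<le> (\<integral>y. w x * w x' * (w y)\<^sup>2 \<partial>N)" .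
  then show ?thesis by (simp add: mult.commute)
qed

lemma g_degenerate: "x' \<in> space N ==> (\<integral>x. g x x' \<partial>N) = 0"
proof -
  assume x': "x' \<in> space N"
  interpret NN: pair_sigma_finite N N ..
  have wi: "integrable N w" "integrable N (\<lambda>y. (w y)\<^sup>2)"
    using N.L4_integrable[OF w_L4] N.L4_integrable_square[OF w_L4] by auto
  have wm: "w \<in> borel_measurable N" using w_L4 by (simp add: L4_def)
  have int: "integrable (N \<Otimes>\<^sub>M N) (\<lambda>(x, y). k x y * k x' y)"
  proof (rule Bochner_Integration.integrable_bound)
    show "integrable (N \<Otimes>\<^sub>M N) (\<lambda>(x, y). w x * (w x' * (w y)\<^sup>2))"
    proof (rule NN.Fubini_integrable)
      show "(\<lambda>(x, y). w x * (w x' * (w y)\<^sup>2)) \<in> borel_measurable (N \<Otimes>\<^sub>M N)" using wm by simp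
      show "integrable N (\<lambda>x. \<integral>y. norm (case (x, y) of (x, y) => w x * (w x' * (w y)\<^sup>2)) \<partial>N)"
        using wi w_nonneg by (simp add: abs_mult)
      show "AE x in N. integrable N (\<lambda>y. case (x, y) of (x, y) => w x * (w x' * (w y)\<^sup>2))"
        using wi by simp
    qed
    show "(\<lambda>(x, y). k x y * k x' y) \<in> borel_measurable (N \<Otimes>\<^sub>M N)"
      unfolding case_prod_beta' using x'
      by (intro borel_measurable_times k_comp measurable_fst measurable_snd measurable_const)
    show "AE q in N \<Otimes>\<^sub>M N. norm (case q of (x, y) => k x y * k x' y) \<le> norm (case q of (x, y) => w x * (w x' * (w y)\<^sup>2))"
    proof (rule AE_I2)
      fix q assume "q \<in> space (N \<Otimes>\<^sub>M N)"
      then obtain x y where q: "q = (x, y)" "x \<in> space N" "y \<in> space N" by (auto simp: space_pair_measure)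
      have "\<bar>k x y\<bar> * \<bar>k x' y\<bar> \<le> (w x * w y) * (w x' * w y)"
        using k_bound x' q w_nonneg by (intro mult_mono) auto
      then show "norm (case q of (x, y) => k x y * k x' y) \<le> norm (case q of (x, y) => w x * (w x' * (w y)\<^sup>2))"
        using w_nonneg by (simp add: q abs_mult power2_eq_square mult_ac)
    qed
  qed
  have "(\<integral>x. g x x' \<partial>N) = (\<integral>y. (\<integral>x. k x y * k x' y \<partial>N) \<partial>N)"
    unfolding g_def using NN.Fubini_integral[OF int] by simp
  also have "\<dots> = (\<integral>y. 0 \<partial>N)"
    using k_degenerate by (intro Bochner_Integration.integral_cong) auto
  finally show ?thesis by simp
qed

lemma g_measurable: "case_prod g \<in> borel_measurable (N \<Otimes>\<^sub>M N)"
proof -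
  have "(\<lambda>p. \<integral>y. k (fst p) y * k (snd p) y \<partial>N) \<in> borel_measurable (N \<Otimes>\<^sub>M N)"
  proof (rule N.borel_measurable_lebesgue_integral)
    have "(\<lambda>q. k (fst (fst q)) (snd q) * k (snd (fst q)) (snd q)) \<in> borel_measurable ((N \<Otimes>\<^sub>M N) \<Otimes>\<^sub>M N)"
      by (intro borel_measurable_times k_comp) auto
    then show "(\<lambda>(p, y). k (fst p) y * k (snd p) y) \<in> borel_measurable ((N \<Otimes>\<^sub>M N) \<Otimes>\<^sub>M N)"
      by (simp add: case_prod_beta)
  qed
  then show ?thesis unfolding case_prod_beta' g_def .
qed

text \<open>The iterated kernel inherits symmetry, the product bound and degeneracy, so the moment
  bounds proved for \<open>k\<close> apply to it unchanged.\<close>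

lemma degenerate_kernel_g: "degenerate_kernel M N X g (\<lambda>x. sqrt (\<integral>y. (w y)\<^sup>2 \<partial>N) * w x)"
proof
  have nn: "(\<integral>y. (w y)\<^sup>2 \<partial>N) \<ge> 0" by (rule integral_nonneg_AE) simp
  show "case_prod g \<in> borel_measurable (N \<Otimes>\<^sub>M N)" by (rule g_measurable)
  show "L4 N (\<lambda>x. sqrt (\<integral>y. (w y)\<^sup>2 \<partial>N) * w x)" by (rule L4_cmult[OF w_L4])
  show "0 \<le> sqrt (\<integral>y. (w y)\<^sup>2 \<partial>N) * w x" for x using nn w_nonneg by simp
  fix x y
  have s: "sqrt (\<integral>y. (w y)\<^sup>2 \<partial>N) * w x * (sqrt (\<integral>y. (w y)\<^sup>2 \<partial>N) * w y) = (\<integral>y. (w y)\<^sup>2 \<partial>N) * (w x * w y)"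
    using nn by (simp add: algebra_simps flip: real_sqrt_mult)
  show "\<bar>g x y\<bar> \<le> sqrt (\<integral>y. (w y)\<^sup>2 \<partial>N) * w x * (sqrt (\<integral>y. (w y)\<^sup>2 \<partial>N) * w y)" if "x \<in> space N" "y \<in> space N"
    unfolding s by (rule g_bound[OF that])
  show "g x y = g y x" by (simp add: g_def mult.commute)
  show "(\<integral>x. g x y \<partial>N) = 0" if "y \<in> space N" by (rule g_degenerate[OF that])
qed

definition g2 :: real where "g2 = (\<integral>y. (\<integral>x. (g x y)\<^sup>2 \<partial>N) \<partial>N)"

lemma g_diag: "g x x = (\<integral>y. (k y x)\<^sup>2 \<partial>N)"
  by (simp add: g_def power2_eq_square k_sym[of x])

lemma g_diag_measurable: "(\<lambda>x. g x x) \<in> borel_measurable N"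
  using measurable_compose[OF measurable_Pair[OF measurable_ident_sets measurable_ident_sets] g_measurable, of N]
  by simp

lemma g_diag_square: "integrable N (\<lambda>x. (g x x)\<^sup>2)" "(\<integral>x. (g x x)\<^sup>2 \<partial>N) \<le> k4" (is ?A) "(\<integral>x. g x x \<partial>N) = k2" "k2\<^sup>2 \<le> k4"
proof -
  have le: "(g x x)\<^sup>2 \<le> (\<integral>y. k y x ^ 4 \<partial>N)" if x: "x \<in> space N" for x
    unfolding g_diag
    using N.square_expectation_le(2)[OF borel_measurable_power[OF L4_measurable[OF L4_section[OF x]], of 2]]
      L4_section[OF x] by (simp add: L4_def)
  show i: "integrable N (\<lambda>x. (g x x)\<^sup>2)"
  proof (rule Bochner_Integration.integrable_bound[OF integrable_k4_section])
    show "(\<lambda>x. (g x x)\<^sup>2) \<in> borel_measurable N" using g_diag_measurable by simp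
    show "AE x in N. norm ((g x x)\<^sup>2) \<le> norm (\<integral>xa. k xa x ^ 4 \<partial>N)"
      using le by (intro AE_I2) (auto intro: order_trans[OF _ abs_ge_self])
  qed
  show le4: ?A unfolding k4_def by (rule integral_mono[OF i integrable_k4_section le])
  show eq: "(\<integral>x. g x x \<partial>N) = k2" by (simp add: k2_def g_diag)
  show "k2\<^sup>2 \<le> k4" using N.square_expectation_le(2)[OF g_diag_measurable i] le4 eq by simp
qed

text \<open>Expanding the square of the increment and integrating out the new observation leaves a
  sum of independent diagonal terms and a degenerate U-statistic with kernel
  \<open>g\<close>.\<close>

lemma conditional_variance:
  assumes \<omega>: "\<omega> \<in> space M"
  shows "(\<integral>y. (rsum j (past j \<omega>) y)\<^sup>2 \<partial>N) = (\<Sum>i\<in>{1..<j}. g (X i \<omega>) (X i \<omega>))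
      + 2 * degenerate_kernel.psum g j (obs \<omega>)"
proof -
  interpret G: degenerate_kernel M N X g "\<lambda>x. sqrt (\<integral>y. (w y)\<^sup>2 \<partial>N) * w x" by (rule degenerate_kernel_g)
  have X: "X i \<omega> \<in> space N" if "i \<in> {1..<j}" for i using X_space \<omega> that by simp
  have Lk: "L4 N (k (X i \<omega>))" if "i \<in> {1..<j}" for i
    by (rule L4_section'[OF X[OF that]])
  have ps: "integrable N (\<lambda>y. (rsum j' (obs \<omega>) y)\<^sup>2) \<and>
      (\<integral>y. (rsum j' (obs \<omega>) y)\<^sup>2 \<partial>N) = (\<Sum>i\<in>{1..<j'}. g (X i \<omega>) (X i \<omega>)) + 2 * G.psum j' (obs \<omega>)"
    if "j' \<le> j" for j'
    using that
  proof (induction j')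
    case 0
    then show ?case by (simp add: rsum_def G.psum_def)
  next
    case (Suc l)
    show ?case
    proof (cases "l = 0")
      case True
      then show ?thesis by (simp add: rsum_def G.psum_def)
    next
      case False
      then have l: "l \<in> {1..<j}" "l \<ge> 1" "l \<le> j" using Suc.prems by auto
      have L: "L4 N (rsum l (obs \<omega>))" unfolding rsum_def[abs_def] using Lk l by (intro L4_sum) auto
      have e: "(rsum (Suc l) (obs \<omega>) y)\<^sup>2 = (rsum l (obs \<omega>) y)\<^sup>2 + 2 * (rsum l (obs \<omega>) y * k (X l \<omega>) y)
        + (k (X l \<omega>) y)\<^sup>2" for y
        using l by (simp add: rsum_def power2_eq_square algebra_simps)
      have i: "integrable N (\<lambda>y. (rsum l (obs \<omega>) y)\<^sup>2)" "integrable N (\<lambda>y. rsum l (obs \<omega>) y * k (X l \<omega>) y)"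
        "integrable N (\<lambda>y. (k (X l \<omega>) y)\<^sup>2)"
        using N.L4_integrable_square[OF L] N.L4_mult_square(2)[OF L Lk[OF l(1)]] N.L4_integrable_square[OF Lk[OF l(1)]] by auto
      have c: "(\<integral>y. rsum l (obs \<omega>) y * k (X l \<omega>) y \<partial>N) = G.rsum l (obs \<omega>) (X l \<omega>)"
        unfolding rsum_def G.rsum_def g_def sum_distrib_right
        using N.L4_mult_square(2)[OF Lk Lk] l by (subst Bochner_Integration.integral_sum) auto
      have d: "(\<integral>y. (k (X l \<omega>) y)\<^sup>2 \<partial>N) = g (X l \<omega>) (X l \<omega>)" by (simp add: g_def power2_eq_square)
      show ?thesis unfolding e using i c d Suc.IH[OF l(3)] l by (simp add: G.psum_Suc)
    qed
  qed
  show ?thesis using ps[of j] by (simp add: rsum_past)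
qed

text \<open>The first error is the standard deviation of the independent diagonal sum, whose mean is
  (j - 1) times \<open>k2\<close>; the second is the root mean square of the U-statistic with kernel
  \<open>g\<close>.\<close>

lemma conditional_variance_deviation:
  "integrable M (\<lambda>\<omega>. \<integral>y. (rsum j (past j \<omega>) y)\<^sup>2 \<partial>N)" (is ?B)
  "(\<integral>\<omega>. \<bar>(\<integral>y. (rsum j (past j \<omega>) y)\<^sup>2 \<partial>N) - real (j - 1) * k2\<bar> \<partial>M) \<le> sqrt (real j * k4) + 2 * (real j * sqrt g2)" (is ?C)
proof -
  interpret G: degenerate_kernel M N X g "\<lambda>x. sqrt (\<integral>y. (w y)\<^sup>2 \<partial>N) * w x" by (rule degenerate_kernel_g)
  define a where "a = (\<lambda>x. g x x - k2)"
  have gi: "integrable N (\<lambda>x. g x x)" by (rule N.square_expectation_le(1)[OF g_diag_measurable g_diag_square(1)])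
  have am: "a \<in> borel_measurable N" using g_diag_measurable by (simp add: a_def)
  have a2: "integrable N (\<lambda>x. (a x)\<^sup>2)"
    unfolding a_def power2_diff using g_diag_square(1) gi by simp
  have a0: "(\<integral>x. a x \<partial>N) = 0" using gi g_diag_square(3) by (simp add: a_def N.prob_space)
  have a2le: "(\<integral>x. (a x)\<^sup>2 \<partial>N) \<le> k4"
  proof -
    have "(\<integral>x. (a x)\<^sup>2 \<partial>N) = (\<integral>x. (g x x)\<^sup>2 \<partial>N) - k2\<^sup>2"
      using N.variance_eq[OF gi g_diag_square(1)] g_diag_square(3) by (simp add: a_def)
    then show ?thesis using g_diag_square(2) zero_le_power2[of k2] by linarith
  qed
  let ?A = "\<lambda>\<omega>. \<Sum>i\<in>{1..<j}. a (X i \<omega>)" and ?P = "\<lambda>\<omega>. G.psum j (obs \<omega>)"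
  have A: "?A \<in> borel_measurable M"
    by (intro borel_measurable_sum measurable_compose[OF X_measurable am]) auto
  have A2: "integrable M (\<lambda>\<omega>. (?A \<omega>)\<^sup>2)" by (rule iid_sum_square_integrable[OF am a2 a0])
  have A1: "integrable M ?A" by (rule square_expectation_le(1)[OF A A2])
  have eq: "(\<integral>y. (rsum j (past j \<omega>) y)\<^sup>2 \<partial>N) = ?A \<omega> + 2 * ?P \<omega> + real (j - 1) * k2" if "\<omega> \<in> space M" for \<omega>
    using conditional_variance[OF that, of j] by (simp add: a_def sum_subtractf)
  have iP: "integrable M ?P" by (rule L4_integrable[OF G.L4_psum])
  have "integrable M (\<lambda>\<omega>. ?A \<omega> + 2 * ?P \<omega> + real (j - 1) * k2)" using A1 iP by simp
  then show ?B
    by (rule Bochner_Integration.integrable_cong[THEN iffD1, rotated 2]) (simp_all add: eq)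
  have "(\<integral>\<omega>. \<bar>(\<integral>y. (rsum j (past j \<omega>) y)\<^sup>2 \<partial>N) - real (j - 1) * k2\<bar> \<partial>M) = (\<integral>\<omega>. \<bar>?A \<omega> + 2 * ?P \<omega>\<bar> \<partial>M)"
    by (rule Bochner_Integration.integral_cong) (simp_all add: eq)
  also have "\<dots> \<le> (\<integral>\<omega>. \<bar>?A \<omega>\<bar> + 2 * \<bar>?P \<omega>\<bar> \<partial>M)"
    using A1 iP by (intro integral_mono) auto
  also have "\<dots> = (\<integral>\<omega>. \<bar>?A \<omega>\<bar> \<partial>M) + 2 * (\<integral>\<omega>. \<bar>?P \<omega>\<bar> \<partial>M)" using A1 iP by simp
  also have "(\<integral>\<omega>. \<bar>?A \<omega>\<bar> \<partial>M) \<le> sqrt (real j * k4)"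
  proof -
    have "(\<integral>\<omega>. (?A \<omega>)\<^sup>2 \<partial>M) \<le> real j * k4"
      unfolding iid_sum_square[OF am a2 a0]
    proof (rule mult_mono[OF _ a2le])
      show "0 \<le> (\<integral>x. (a x)\<^sup>2 \<partial>N)" by (rule integral_nonneg_AE) simp
    qed simp_all
    then show ?thesis by (rule order_trans[OF square_expectation_le(3)[OF A A2] real_sqrt_le_mono])
  qed
  also have "(\<integral>\<omega>. \<bar>?P \<omega>\<bar> \<partial>M) \<le> real j * sqrt g2"
  proof -
    have "(\<integral>\<omega>. (?P \<omega>)\<^sup>2 \<partial>M) \<le> (real j)\<^sup>2 * g2" using G.psum_square[of j] by (simp add: G.k2_def g2_def)
    then have "sqrt (\<integral>\<omega>. (?P \<omega>)\<^sup>2 \<partial>M) \<le> sqrt ((real j)\<^sup>2 * g2)" by (rule real_sqrt_le_mono)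
    also have "\<dots> = real j * sqrt g2" by (simp add: real_sqrt_mult)
    finally show ?thesis
      using square_expectation_le(3)[OF L4_measurable[OF G.L4_psum[of j]] L4_integrable_square[OF G.L4_psum[of j]]] by linarith
  qed
  finally show ?C
    by simp
qed

end

section \<open>Characteristic functions of the partial sums\<close>

lemma exp_minus_quadratic:
  fixes x :: real
  assumes "x \<ge> 0"
  shows "\<bar>(1 - x) - exp (- x)\<bar> \<le> x\<^sup>2 / 2"
proof -
  have l: "1 - x \<le> exp (- x)" using exp_ge_add_one_self[of "- x"] by simp
  \<comment> \<open>The product is at least 1 while its second factor is at most exp x, so the first
    factor dominates exp (-x).\<close>
  have "(1 - x + x\<^sup>2 / 2) * (1 + x + x\<^sup>2 / 2) = 1 + x ^ 4 / 4"
    by (simp add: field_simps power2_eq_square power4_eq_xxxx)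
  then have "1 \<le> (1 - x + x\<^sup>2 / 2) * (1 + x + x\<^sup>2 / 2)" by simp
  moreover have "1 - x + x\<^sup>2 / 2 \<ge> 0"
    using zero_le_power2[of "1 - x"] by (simp add: power2_eq_square algebra_simps)
  moreover have "1 + x + x\<^sup>2 / 2 \<le> exp x" by (rule exp_lower_Taylor_quadratic[OF assms])
  ultimately have "1 \<le> (1 - x + x\<^sup>2 / 2) * exp x" using mult_left_mono[of "1 + x + x\<^sup>2 / 2" "exp x"] by fastforce
  then have "exp (- x) \<le> 1 - x + x\<^sup>2 / 2" by (simp add: exp_minus field_simps)
  then show ?thesis using l by simp
qed

lemma (in prob_space) iexp_quadratic_approx:
  assumes a: "L4 M a" and mean: "expectation a = 0"
  shows "cmod ((\<integral>x. iexp (a x) \<partial>M) - of_real (1 - expectation (\<lambda>x. (a x)\<^sup>2) / 2)) \<le> expectation (\<lambda>x. \<bar>a x\<bar> ^ 3) / 6"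
proof -
  have am[measurable]: "a \<in> borel_measurable M" using a by (simp add: L4_def)
  have i1: "integrable M a" and i2: "integrable M (\<lambda>x. (a x)\<^sup>2)" and i3: "integrable M (\<lambda>x. \<bar>a x\<bar> ^ 3)"
    using L4_integrable[OF a] L4_integrable_square[OF a] L4_integrable_power(1)[OF a, of 3] by auto
  have ie: "integrable M (\<lambda>x. iexp (a x))" by (rule integrable_iexp) simp_all
  define q where "q = (\<lambda>x. complex_of_real (1 - (a x)\<^sup>2 / 2) + \<i> * complex_of_real (a x))"
  have j1: "integrable M (\<lambda>x. complex_of_real (1 - (a x)\<^sup>2 / 2))" by (rule integrable_of_real) (use i2 in simp)
  have j2: "integrable M (\<lambda>x. \<i> * complex_of_real (a x))" by (intro integrable_mult_right integrable_of_real i1)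
  have iq: "integrable M q" unfolding q_def by (rule Bochner_Integration.integrable_add[OF j1 j2])
  have Eq: "(\<integral>x. q x \<partial>M) = of_real (1 - expectation (\<lambda>x. (a x)\<^sup>2) / 2)"
  proof -
    have "(\<integral>x. q x \<partial>M) = (\<integral>x. complex_of_real (1 - (a x)\<^sup>2 / 2) \<partial>M) + \<i> * (\<integral>x. complex_of_real (a x) \<partial>M)"
      unfolding q_def Bochner_Integration.integral_add[OF j1 j2] by simp
    also have "\<dots> = of_real (expectation (\<lambda>x. 1 - (a x)\<^sup>2 / 2))"
      using mean by (simp only: integral_complex_of_real) simp
    also have "expectation (\<lambda>x. 1 - (a x)\<^sup>2 / 2) = 1 - expectation (\<lambda>x. (a x)\<^sup>2) / 2"
      using i2 by (simp add: prob_space)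
    finally show ?thesis .
  qed
  have pt: "cmod (iexp y - (complex_of_real (1 - y\<^sup>2 / 2) + \<i> * complex_of_real y)) \<le> \<bar>y\<bar> ^ 3 / 6" for y
  proof -
    have "(\<Sum>k\<le>2. (\<i> * complex_of_real y) ^ k / fact k) = complex_of_real (1 - y\<^sup>2 / 2) + \<i> * complex_of_real y"
      by (simp add: numeral_eq_Suc power_mult_distrib)
    moreover have "(fact 3 :: real) = 6" by (simp add: fact_numeral)
    ultimately show ?thesis using iexp_approx1[of y 2] by (simp add: numeral_3_eq_3 flip: numeral_3_eq_3)
  qed
  have "(\<integral>x. iexp (a x) \<partial>M) - of_real (1 - expectation (\<lambda>x. (a x)\<^sup>2) / 2) = (\<integral>x. iexp (a x) - q x \<partial>M)"
    using Eq ie iq by simp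
  also have "cmod \<dots> \<le> expectation (\<lambda>x. cmod (iexp (a x) - q x))" by (rule integral_norm_bound)
  also have "\<dots> \<le> expectation (\<lambda>x. \<bar>a x\<bar> ^ 3 / 6)"
    using ie iq i3 pt by (intro integral_mono) (auto simp: q_def)
  also have "\<dots> = expectation (\<lambda>x. \<bar>a x\<bar> ^ 3) / 6" by simp
  finally show ?thesis .
qed

context degenerate_kernel
begin

text \<open>Only the observations before \<open>j\<close> enter, so a sample of size n corresponds
  to \<open>phi s (Suc n)\<close>.\<close>

definition phi :: "real => nat => complex" where
  "phi s j = (\<integral>\<omega>. iexp (s * psum j (obs \<omega>)) \<partial>M)"

lemma phi_le_1: "cmod (phi s j) \<le> 1"
proof -
  have "cmod (phi s j) \<le> (\<integral>\<omega>. cmod (iexp (s * psum j (obs \<omega>))) \<partial>M)"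
    unfolding phi_def by (rule integral_norm_bound)
  then show ?thesis by (simp add: prob_space)
qed

lemma cmod_iexp_mult: "cmod (iexp x * z) = cmod z"
  by (simp add: norm_mult)

text \<open>One increment multiplies the characteristic function by a deterministic Gaussian factor,
  up to three errors: the cubic Taylor remainder, the replacement of the conditional variance by its
  mean, and the replacement of 1 - x by exp (-x). Each enters multiplied by a quantity of modulus at
  most 1.\<close>

lemma phi_step:
  assumes j: "j \<ge> 1"
  shows "cmod (phi s (Suc j) - of_real (exp (- (s\<^sup>2 * (real (j - 1) * k2) / 2))) * phi s j)
    \<le> \<bar>s\<bar> ^ 3 / 6 * (\<integral>\<omega>. \<bar>rsum j (obs \<omega>) (X j \<omega>)\<bar> ^ 3 \<partial>M)
      + s\<^sup>2 / 2 * (\<integral>\<omega>. \<bar>(\<integral>y. (rsum j (past j \<omega>) y)\<^sup>2 \<partial>N) - real (j - 1) * k2\<bar> \<partial>M)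
      + (s\<^sup>2 * (real (j - 1) * k2) / 2)\<^sup>2 / 2"
proof -
  let ?P = "\<lambda>\<omega>. psum j (obs \<omega>)"
  define v where "v = real (j - 1) * k2"
  define \<sigma> where "\<sigma> = (\<lambda>\<omega>. \<integral>y. (rsum j (past j \<omega>) y)\<^sup>2 \<partial>N)"
  define \<tau> where "\<tau> = (\<lambda>\<omega>. \<integral>y. \<bar>rsum j (past j \<omega>) y\<bar> ^ 3 \<partial>N)"
  define A where "A = (\<lambda>\<omega>. \<integral>y. iexp (s * rsum j (past j \<omega>) y) \<partial>N)"
  have k2nn: "k2 \<ge> 0" unfolding k2_def by (intro integral_nonneg_AE AE_I2) simp
  have Pm: "?P \<in> borel_measurable M" by (rule L4_measurable[OF L4_psum])
  have iP: "integrable M (\<lambda>\<omega>. iexp (s * ?P \<omega>))" by (rule integrable_iexp) (use Pm in simp_all)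
  have \<sigma>i: "integrable M \<sigma>" unfolding \<sigma>_def by (rule conditional_variance_deviation(1))
  have \<tau>i: "integrable M \<tau>" unfolding \<tau>_def by (rule rsum_power_expectation(2)[OF j]) simp
  have E\<tau>: "(\<integral>\<omega>. \<tau> \<omega> \<partial>M) = (\<integral>\<omega>. \<bar>rsum j (obs \<omega>) (X j \<omega>)\<bar> ^ 3 \<partial>M)"
    unfolding \<tau>_def using rsum_power_expectation(1)[OF j, of 3] by simp
  have fm: "(\<lambda>q. iexp (s * psum j (fst q)) * iexp (s * rsum j (fst q) (snd q))) \<in> borel_measurable (PN j \<Otimes>\<^sub>M N)"
    using rsum_measurable[of j] measurable_compose[OF measurable_fst psum_measurable[of j]] by measurable
  have Rm: "(\<lambda>\<omega>. rsum j (obs \<omega>) (X j \<omega>)) \<in> borel_measurable M" by (rule L4_measurable[OF L4_rsum])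
  have "integrable M (\<lambda>\<omega>. iexp (s * ?P \<omega> + s * rsum j (obs \<omega>) (X j \<omega>)))"
    by (rule integrable_iexp) (use Pm Rm in simp_all)
  then have fi: "integrable M (\<lambda>\<omega>. iexp (s * psum j (fst (past j \<omega>, X j \<omega>))) * iexp (s * rsum j (fst (past j \<omega>, X j \<omega>)) (snd (past j \<omega>, X j \<omega>))))"
    by (simp add: rsum_past psum_past distrib_left exp_add)
  have iA: "integrable M (\<lambda>\<omega>. iexp (s * ?P \<omega>) * A \<omega>)"
    using past_expectation(2)[OF j fm fi] by (simp add: psum_past A_def)
  have phiS: "phi s (Suc j) = (\<integral>\<omega>. iexp (s * ?P \<omega>) * A \<omega> \<partial>M)"
    using past_expectation(1)[OF j fm fi]
    by (simp add: phi_def psum_Suc[OF j] psum_past rsum_past A_def distrib_left exp_add)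
  have Aapp: "cmod (A \<omega> - of_real (1 - s\<^sup>2 * \<sigma> \<omega> / 2)) \<le> \<bar>s\<bar> ^ 3 / 6 * \<tau> \<omega>" if w: "\<omega> \<in> space M" for \<omega>
    using N.iexp_quadratic_approx[OF L4_cmult[OF L4_rsum_section[OF w, of j], of s]] rsum_section_mean[OF w, of j]
    by (simp add: A_def \<sigma>_def \<tau>_def abs_mult power_mult_distrib)
  \<comment> \<open>\<open>D1\<close> carries the Taylor error of the conditional characteristic
    function, \<open>D2\<close> the randomness of the conditional variance.\<close>
  define D1 where "D1 = (\<lambda>\<omega>. iexp (s * ?P \<omega>) * (A \<omega> - of_real (1 - s\<^sup>2 * \<sigma> \<omega> / 2)))"
  define D2 where "D2 = (\<lambda>\<omega>. iexp (s * ?P \<omega>) * of_real (s\<^sup>2 / 2 * (v - \<sigma> \<omega>)))"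
  have i\<sigma>: "integrable M (\<lambda>\<omega>. iexp (s * ?P \<omega>) * of_real (\<sigma> \<omega>))"
  proof (rule Bochner_Integration.integrable_bound[OF \<sigma>i])
    show "(\<lambda>\<omega>. iexp (s * ?P \<omega>) * complex_of_real (\<sigma> \<omega>)) \<in> borel_measurable M"
      using Pm borel_measurable_integrable[OF \<sigma>i] by measurable
  qed (simp add: norm_mult)
  have "integrable M (\<lambda>\<omega>. iexp (s * ?P \<omega>) * A \<omega> - (iexp (s * ?P \<omega>) - of_real (s\<^sup>2 / 2) * (iexp (s * ?P \<omega>) * of_real (\<sigma> \<omega>))))"
    by (intro Bochner_Integration.integrable_diff integrable_mult_right iA iP i\<sigma>)
  then have iD1: "integrable M D1"
    by (rule Bochner_Integration.integrable_cong[THEN iffD1, rotated 2]) (auto simp: D1_def algebra_simps)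
  have "integrable M (\<lambda>\<omega>. of_real (s\<^sup>2 / 2 * v) * iexp (s * ?P \<omega>) - of_real (s\<^sup>2 / 2) * (iexp (s * ?P \<omega>) * of_real (\<sigma> \<omega>)))"
    by (intro Bochner_Integration.integrable_diff integrable_mult_right iP i\<sigma>)
  then have iD2: "integrable M D2"
    by (rule Bochner_Integration.integrable_cong[THEN iffD1, rotated 2]) (auto simp: D2_def algebra_simps)
  have "(\<integral>\<omega>. iexp (s * ?P \<omega>) * A \<omega> \<partial>M) = (\<integral>\<omega>. D1 \<omega> + D2 \<omega> + of_real (1 - s\<^sup>2 * v / 2) * iexp (s * ?P \<omega>) \<partial>M)"
  proof (rule Bochner_Integration.integral_cong[OF refl])
    fix \<omega>
    have e: "complex_of_real (s\<^sup>2 / 2 * (v - \<sigma> \<omega>)) = of_real (1 - s\<^sup>2 * \<sigma> \<omega> / 2) - of_real (1 - s\<^sup>2 * v / 2)"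
      unfolding of_real_diff[symmetric] of_real_eq_iff by (simp add: algebra_simps diff_divide_distrib)
    show "iexp (s * ?P \<omega>) * A \<omega> = D1 \<omega> + D2 \<omega> + of_real (1 - s\<^sup>2 * v / 2) * iexp (s * ?P \<omega>)"
      unfolding D1_def D2_def e by (simp only: ring_distribs) simp
  qed
  also have "\<dots> = (\<integral>\<omega>. D1 \<omega> \<partial>M) + (\<integral>\<omega>. D2 \<omega> \<partial>M) + of_real (1 - s\<^sup>2 * v / 2) * phi s j"
    unfolding phi_def using iD1 iD2 iP
    by (subst Bochner_Integration.integral_add Bochner_Integration.integral_add integral_mult_right,
        auto intro!: integrable_mult_right Bochner_Integration.integrable_add)+
  finally have eq: "phi s (Suc j) - of_real (exp (- (s\<^sup>2 * v / 2))) * phi s j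
      = (\<integral>\<omega>. D1 \<omega> \<partial>M) + (\<integral>\<omega>. D2 \<omega> \<partial>M) + of_real ((1 - s\<^sup>2 * v / 2) - exp (- (s\<^sup>2 * v / 2))) * phi s j"
    unfolding phiS by (simp add: algebra_simps)
  have b1: "cmod (\<integral>\<omega>. D1 \<omega> \<partial>M) \<le> \<bar>s\<bar> ^ 3 / 6 * (\<integral>\<omega>. \<tau> \<omega> \<partial>M)"
  proof -
    have "cmod (\<integral>\<omega>. D1 \<omega> \<partial>M) \<le> (\<integral>\<omega>. cmod (D1 \<omega>) \<partial>M)" by (rule integral_norm_bound)
    also have "\<dots> \<le> (\<integral>\<omega>. \<bar>s\<bar> ^ 3 / 6 * \<tau> \<omega> \<partial>M)"
    proof (intro integral_mono integrable_norm iD1 integrable_mult_right \<tau>i)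
      fix \<omega> assume "\<omega> \<in> space M"
      then show "cmod (D1 \<omega>) \<le> \<bar>s\<bar> ^ 3 / 6 * \<tau> \<omega>" unfolding D1_def cmod_iexp_mult by (rule Aapp)
    qed
    finally show ?thesis by simp
  qed
  have b2: "cmod (\<integral>\<omega>. D2 \<omega> \<partial>M) \<le> s\<^sup>2 / 2 * (\<integral>\<omega>. \<bar>\<sigma> \<omega> - v\<bar> \<partial>M)"
  proof -
    have "cmod (\<integral>\<omega>. D2 \<omega> \<partial>M) \<le> (\<integral>\<omega>. cmod (D2 \<omega>) \<partial>M)" by (rule integral_norm_bound)
    also have "\<dots> = (\<integral>\<omega>. s\<^sup>2 / 2 * \<bar>\<sigma> \<omega> - v\<bar> \<partial>M)"
    proof (rule Bochner_Integration.integral_cong[OF refl])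
      fix \<omega>
      show "cmod (D2 \<omega>) = s\<^sup>2 / 2 * \<bar>\<sigma> \<omega> - v\<bar>"
        unfolding D2_def cmod_iexp_mult norm_of_real abs_mult by (simp add: abs_minus_commute)
    qed
    finally show ?thesis by simp
  qed
  have b3: "cmod (of_real ((1 - s\<^sup>2 * v / 2) - exp (- (s\<^sup>2 * v / 2))) * phi s j) \<le> (s\<^sup>2 * v / 2)\<^sup>2 / 2"
  proof -
    have "cmod (of_real ((1 - s\<^sup>2 * v / 2) - exp (- (s\<^sup>2 * v / 2))) * phi s j)
        \<le> \<bar>(1 - s\<^sup>2 * v / 2) - exp (- (s\<^sup>2 * v / 2))\<bar> * 1"
      unfolding norm_mult norm_of_real by (intro mult_left_mono phi_le_1) simp
    also have "\<dots> \<le> (s\<^sup>2 * v / 2)\<^sup>2 / 2"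
      using exp_minus_quadratic[of "s\<^sup>2 * v / 2"] k2nn by (simp add: v_def)
    finally show ?thesis .
  qed
  have "cmod (phi s (Suc j) - of_real (exp (- (s\<^sup>2 * v / 2))) * phi s j)
    \<le> cmod (\<integral>\<omega>. D1 \<omega> \<partial>M) + cmod (\<integral>\<omega>. D2 \<omega> \<partial>M) + cmod (of_real ((1 - s\<^sup>2 * v / 2) - exp (- (s\<^sup>2 * v / 2))) * phi s j)"
    unfolding eq by (intro norm_triangle_le add_mono norm_triangle_ineq order_refl)
  also have "\<dots> \<le> \<bar>s\<bar> ^ 3 / 6 * (\<integral>\<omega>. \<tau> \<omega> \<partial>M) + s\<^sup>2 / 2 * (\<integral>\<omega>. \<bar>\<sigma> \<omega> - v\<bar> \<partial>M) + (s\<^sup>2 * v / 2)\<^sup>2 / 2"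
    by (intro add_mono b1 b2 b3)
  finally show ?thesis unfolding E\<tau> by (simp only: v_def \<sigma>_def)
qed

text \<open>From |x|^3 at most (a x^2 + x^4 / a) / 2, the arithmetic-geometric mean inequality. The
  parameter \<open>a\<close> stays free so that it can be tuned to the final normalization.\<close>

lemma third_moment_bound:
  assumes j: "j \<ge> 1" "j \<le> n" and a: "a > 0"
  shows "(\<integral>\<omega>. \<bar>rsum j (obs \<omega>) (X j \<omega>)\<bar> ^ 3 \<partial>M) \<le> (a * (real n * k2) + 3 * (real n)\<^sup>2 * k4 / a) / 2"
proof -
  let ?R = "\<lambda>\<omega>. rsum j (obs \<omega>) (X j \<omega>)"
  have k2nn: "k2 \<ge> 0" unfolding k2_def by (intro integral_nonneg_AE AE_I2) simp
  have k4nn: "k4 \<ge> 0" using g_diag_square(4) zero_le_power2[of k2] by linarith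
  have pt: "\<bar>x\<bar> ^ 3 \<le> (a * x\<^sup>2 + x ^ 4 / a) / 2" for x :: real
  proof -
    have "0 \<le> (a - \<bar>x\<bar>)\<^sup>2 * (x\<^sup>2 / a)" using a by simp
    also have "\<dots> = a * x\<^sup>2 + x ^ 4 / a - 2 * \<bar>x\<bar> ^ 3"
    proof -
      have "(a - y)\<^sup>2 * (y\<^sup>2 / a) = a * y\<^sup>2 + y ^ 4 / a - 2 * y ^ 3" for y
        using a by (simp add: power2_eq_square power3_eq_cube power4_eq_xxxx field_simps)
      from this[of "\<bar>x\<bar>"] show ?thesis by simp
    qed
    finally show ?thesis by simp
  qed
  have i4: "integrable M (\<lambda>\<omega>. ?R \<omega> ^ 4)" "integrable M (\<lambda>\<omega>. (?R \<omega>)\<^sup>2)" "integrable M (\<lambda>\<omega>. \<bar>?R \<omega>\<bar> ^ 3)"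
    using L4_integrable_power[OF L4_rsum[of j]] by auto
  have "(\<integral>\<omega>. \<bar>?R \<omega>\<bar> ^ 3 \<partial>M) \<le> (\<integral>\<omega>. (a * (?R \<omega>)\<^sup>2 + ?R \<omega> ^ 4 / a) / 2 \<partial>M)"
    using i4 pt by (intro integral_mono) auto
  also have "\<dots> = (a * (\<integral>\<omega>. (?R \<omega>)\<^sup>2 \<partial>M) + (\<integral>\<omega>. ?R \<omega> ^ 4 \<partial>M) / a) / 2" using i4 by simp
  also have "\<dots> \<le> (a * (real n * k2) + 3 * (real n)\<^sup>2 * k4 / a) / 2"
  proof (intro divide_right_mono add_mono mult_left_mono)
    show "(\<integral>\<omega>. (?R \<omega>)\<^sup>2 \<partial>M) \<le> real n * k2"
      unfolding rsum_square[OF j(1)] using j k2nn by (intro mult_right_mono) auto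
    have "3 * (real (j - 1))\<^sup>2 * k4 \<le> 3 * (real n)\<^sup>2 * k4"
      using j k4nn by (intro mult_right_mono mult_left_mono power_mono) auto
    then show "(\<integral>\<omega>. ?R \<omega> ^ 4 \<partial>M) \<le> 3 * (real n)\<^sup>2 * k4" using rsum_power4[OF j(1)] by linarith
  qed (use a in auto)
  finally show ?thesis .
qed

text \<open>The Gaussian factors lie between 0 and 1, so errors of earlier steps are never amplified
  and the total is at most \<open>j\<close> times a uniform one-step error.\<close>

lemma phi_bound:
  assumes a: "a > 0" and jn: "j \<le> n"
  shows "cmod (phi s (Suc j) - of_real (exp (- (s\<^sup>2 * (\<Sum>l\<in>{1..j}. real (l - 1) * k2) / 2))))
    \<le> real j * (\<bar>s\<bar> ^ 3 / 6 * ((a * (real n * k2) + 3 * (real n)\<^sup>2 * k4 / a) / 2)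
      + s\<^sup>2 / 2 * (sqrt (real n * k4) + 2 * (real n * sqrt g2)) + (s\<^sup>2 * (real n * k2) / 2)\<^sup>2 / 2)" (is "_ \<le> real j * ?d")
  using jn
proof (induction j)
  case 0
  then show ?case by (simp add: phi_def psum_def prob_space)
next
  case (Suc j)
  define E where "E = exp (- (s\<^sup>2 * (real (Suc j - 1) * k2) / 2))"
  define G where "G = exp (- (s\<^sup>2 * (\<Sum>l\<in>{1..j}. real (l - 1) * k2) / 2))"
  have k2nn: "k2 \<ge> 0" unfolding k2_def by (intro integral_nonneg_AE AE_I2) simp
  have k4nn: "k4 \<ge> 0" using g_diag_square(4) zero_le_power2[of k2] by linarith
  have g2nn: "g2 \<ge> 0" unfolding g2_def by (intro integral_nonneg_AE AE_I2) simp
  have E1: "0 \<le> E" "E \<le> 1" using k2nn by (auto simp: E_def)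
  have EG: "exp (- (s\<^sup>2 * (\<Sum>l\<in>{1..Suc j}. real (l - 1) * k2) / 2)) = E * G"
    by (simp add: E_def G_def exp_add[symmetric] algebra_simps add_divide_distrib)
  have st: "cmod (phi s (Suc (Suc j)) - of_real E * phi s (Suc j)) \<le> ?d"
  proof -
    have "\<bar>s\<bar> ^ 3 / 6 * (\<integral>\<omega>. \<bar>rsum (Suc j) (obs \<omega>) (X (Suc j) \<omega>)\<bar> ^ 3 \<partial>M)
       \<le> \<bar>s\<bar> ^ 3 / 6 * ((a * (real n * k2) + 3 * (real n)\<^sup>2 * k4 / a) / 2)"
      using third_moment_bound[of "Suc j" n a] Suc.prems a by (intro mult_left_mono) auto
    moreover have "s\<^sup>2 / 2 * (\<integral>\<omega>. \<bar>(\<integral>y. (rsum (Suc j) (past (Suc j) \<omega>) y)\<^sup>2 \<partial>N) - real (Suc j - 1) * k2\<bar> \<partial>M)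
      \<le> s\<^sup>2 / 2 * (sqrt (real n * k4) + 2 * (real n * sqrt g2))"
    proof (intro mult_left_mono mult_right_mono order_trans[OF conditional_variance_deviation(2)] add_mono)
      show "sqrt (real (Suc j) * k4) \<le> sqrt (real n * k4)"
        using Suc.prems k4nn by (intro real_sqrt_le_mono mult_right_mono) auto
      show "real (Suc j) \<le> real n" using Suc.prems by simp
    qed (use g2nn in auto)
    moreover have "(s\<^sup>2 * (real (Suc j - 1) * k2) / 2)\<^sup>2 / 2 \<le> (s\<^sup>2 * (real n * k2) / 2)\<^sup>2 / 2"
      using Suc.prems k2nn by (intro divide_right_mono power_mono mult_left_mono mult_right_mono) auto
    ultimately show ?thesis using phi_step[of "Suc j" s] unfolding E_def by linarith
  qed
  have "phi s (Suc (Suc j)) - of_real (E * G) = (phi s (Suc (Suc j)) - of_real E * phi s (Suc j)) + of_real E * (phi s (Suc j) - of_real G)"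
    by (simp add: algebra_simps)
  then have "cmod (phi s (Suc (Suc j)) - of_real (E * G)) \<le> cmod (phi s (Suc (Suc j)) - of_real E * phi s (Suc j)) + E * cmod (phi s (Suc j) - of_real G)"
    using E1 by (metis norm_triangle_ineq norm_mult norm_of_real abs_of_nonneg)
  also have "\<dots> \<le> ?d + 1 * (real j * ?d)"
    using st Suc E1 by (intro add_mono mult_mono) (auto simp: G_def)
  also have "\<dots> = real (Suc j) * ?d" by (simp only: of_nat_Suc distrib_right mult_1_left)
  finally show ?case unfolding EG .
qed

text \<open>With \<open>s = t sqrt (2 / (n^2 k2))\<close> the deterministic variance is \<open>1 - 1/n\<close>; the free parameter of
  the third moment bound is chosen to balance its two terms.\<close>

lemma phi_normalized_bound:
  assumes n: "n \<ge> 1" and k2: "k2 > 0"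
  shows "cmod (phi (t * sqrt (2 / ((real n)\<^sup>2 * k2))) (Suc n) - of_real (exp (- (t\<^sup>2 * (1 - 1 / real n) / 2))))
    \<le> (7 / 6 * \<bar>t\<bar> ^ 3 + t\<^sup>2) * sqrt (k4 / (real n * k2\<^sup>2)) + 2 * t\<^sup>2 * (sqrt g2 / k2) + t ^ 4 / (2 * real n)"
proof -
  define c where "c = sqrt (2 / ((real n)\<^sup>2 * k2))"
  define s where "s = t * c"
  define \<alpha> where "\<alpha> = sqrt (k4 / (real n * k2\<^sup>2))"
  have npos: "real n > 0" using n by simp
  have c: "c > 0" and c2: "c\<^sup>2 = 2 / ((real n)\<^sup>2 * k2)" using npos k2 by (auto simp: c_def)
  have k4: "k4 > 0" using g_diag_square(4) k2 by (smt (verit) zero_less_power)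
  have \<alpha>: "\<alpha> > 0" and \<alpha>2: "\<alpha>\<^sup>2 = k4 / (real n * k2\<^sup>2)" using npos k2 k4 by (auto simp: \<alpha>_def)
  have k4eq: "k4 = \<alpha>\<^sup>2 * (real n * k2\<^sup>2)" using \<alpha>2 npos k2 by simp
  have cc: "(real n)\<^sup>2 * k2 * c\<^sup>2 = 2" using c2 npos k2 by simp
  have s2: "s\<^sup>2 = t\<^sup>2 * c\<^sup>2" and s3: "\<bar>s\<bar> ^ 3 = \<bar>t\<bar> ^ 3 * c ^ 3" using c by (auto simp: s_def power_mult_distrib abs_mult)
  have var: "s\<^sup>2 * (\<Sum>l\<in>{1..n}. real (l - 1) * k2) / 2 = t\<^sup>2 * (1 - 1 / real n) / 2"
  proof -
    have sm: "(\<Sum>l\<in>{1..m}. real (l - 1) * k2) = real m * (real m - 1) / 2 * k2" for m :: nat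
      by (induction m) (auto simp: algebra_simps add_divide_distrib)
    have "s\<^sup>2 * (\<Sum>l\<in>{1..n}. real (l - 1) * k2) / 2 = t\<^sup>2 * (c\<^sup>2 * (real n * (real n - 1) / 2 * k2)) / 2"
      unfolding sm s2 by (simp add: mult_ac)
    also have "c\<^sup>2 * (real n * (real n - 1) / 2 * k2) = 1 - 1 / real n"
      unfolding c2 using npos k2 by (simp add: field_simps power2_eq_square)
    finally show ?thesis .
  qed
  \<comment> \<open>With the free parameter set to \<alpha> / c the two terms contribute 2 \<alpha>
    and 12 \<alpha>; divided by 12 this is the factor 7/6.\<close>
  have T1: "real n * (\<bar>s\<bar> ^ 3 / 6 * ((\<alpha> / c * (real n * k2) + 3 * (real n)\<^sup>2 * k4 / (\<alpha> / c)) / 2)) = 7 / 6 * \<bar>t\<bar> ^ 3 * \<alpha>"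
  proof -
    have p1: "c ^ 3 * (\<alpha> / c * (real n * k2)) * real n = \<alpha> * ((real n)\<^sup>2 * k2 * c\<^sup>2)"
      using c by (simp add: power2_eq_square power3_eq_cube)
    have p2: "c ^ 3 * (3 * (real n)\<^sup>2 * k4 / (\<alpha> / c)) * real n = 3 * \<alpha> * ((real n)\<^sup>2 * k2 * c\<^sup>2)\<^sup>2"
      unfolding k4eq using c \<alpha> by (simp add: power2_eq_square power3_eq_cube)
    have "real n * (\<bar>s\<bar> ^ 3 / 6 * ((\<alpha> / c * (real n * k2) + 3 * (real n)\<^sup>2 * k4 / (\<alpha> / c)) / 2))
       = \<bar>t\<bar> ^ 3 / 12 * (c ^ 3 * (\<alpha> / c * (real n * k2)) * real n + c ^ 3 * (3 * (real n)\<^sup>2 * k4 / (\<alpha> / c)) * real n)"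
      unfolding s3 by (simp add: algebra_simps add_divide_distrib)
    also have "\<dots> = 7 / 6 * \<bar>t\<bar> ^ 3 * \<alpha>" unfolding p1 p2 cc by simp
    finally show ?thesis .
  qed
  have T2: "real n * (s\<^sup>2 / 2 * (sqrt (real n * k4) + 2 * (real n * sqrt g2))) = t\<^sup>2 * \<alpha> + 2 * t\<^sup>2 * (sqrt g2 / k2)"
  proof -
    have sq: "sqrt (real n * k4) = \<alpha> * real n * k2"
      by (rule real_sqrt_unique) (use npos k2 \<alpha> in \<open>auto simp: k4eq power2_eq_square\<close>)
    have "real n * (s\<^sup>2 / 2 * (sqrt (real n * k4) + 2 * (real n * sqrt g2)))
       = t\<^sup>2 / 2 * (\<alpha> * ((real n)\<^sup>2 * k2 * c\<^sup>2) + 2 * (sqrt g2 / k2) * ((real n)\<^sup>2 * k2 * c\<^sup>2))"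
      unfolding sq s2 using k2 by (simp add: field_simps power2_eq_square)
    also have "\<dots> = t\<^sup>2 * \<alpha> + 2 * t\<^sup>2 * (sqrt g2 / k2)" unfolding cc by (simp add: algebra_simps)
    finally show ?thesis .
  qed
  have T3: "real n * ((s\<^sup>2 * (real n * k2) / 2)\<^sup>2 / 2) = t ^ 4 / (2 * real n)"
  proof -
    have "real n * ((s\<^sup>2 * (real n * k2) / 2)\<^sup>2 / 2) = t ^ 4 / (8 * real n) * ((real n)\<^sup>2 * k2 * c\<^sup>2)\<^sup>2"
      unfolding s2 using npos by (simp add: field_simps power2_eq_square power4_eq_xxxx)
    also have "\<dots> = t ^ 4 / (2 * real n)" unfolding cc by simp
    finally show ?thesis .
  qed
  have "cmod (phi s (Suc n) - of_real (exp (- (s\<^sup>2 * (\<Sum>l\<in>{1..n}. real (l - 1) * k2) / 2))))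
    \<le> real n * (\<bar>s\<bar> ^ 3 / 6 * ((\<alpha> / c * (real n * k2) + 3 * (real n)\<^sup>2 * k4 / (\<alpha> / c)) / 2)
      + s\<^sup>2 / 2 * (sqrt (real n * k4) + 2 * (real n * sqrt g2)) + (s\<^sup>2 * (real n * k2) / 2)\<^sup>2 / 2)"
    by (rule phi_bound) (use \<alpha> c in auto)
  also have "\<dots> = 7 / 6 * \<bar>t\<bar> ^ 3 * \<alpha> + (t\<^sup>2 * \<alpha> + 2 * t\<^sup>2 * (sqrt g2 / k2)) + t ^ 4 / (2 * real n)"
    unfolding distrib_left T1[symmetric] T2[symmetric] T3[symmetric] by (simp add: distrib_left)
  finally show ?thesis unfolding var by (simp add: s_def c_def \<alpha>_def algebra_simps)
qed

end

text \<open>A triangular array: the kernel may change with n. Condition \<open>four\<close> makes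
  both the third moments of the increments and the diagonal part of the conditional variances
  negligible; \<open>comp\<close> does the same for their off-diagonal part.\<close>

theorem degenerate_U_statistic_CLT:
  fixes k :: "nat => 'b => 'b => real"
  assumes kernel: "\<And>n. degenerate_kernel M N X (k n) (w n)"
    and pos: "\<And>n. degenerate_kernel.k2 N (k n) > 0"
    and four: "(\<lambda>n. degenerate_kernel.k4 N (k n) / (real n * (degenerate_kernel.k2 N (k n))\<^sup>2)) \<longlonglongrightarrow> 0"
    and comp: "(\<lambda>n. degenerate_kernel.g2 N (k n) / (degenerate_kernel.k2 N (k n))\<^sup>2) \<longlonglongrightarrow> 0"
  shows "weak_conv_m (\<lambda>n. distr M borel (\<lambda>\<omega>. sqrt (2 / ((real n)\<^sup>2 * degenerate_kernel.k2 N (k n))) *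
      degenerate_kernel.psum (k n) (Suc n) (\<lambda>i. X i \<omega>))) std_normal_distribution"
proof -
  interpret D: degenerate_kernel M N X "k n" "w n" for n by (rule kernel)
  let ?T = "\<lambda>n \<omega>. sqrt (2 / ((real n)\<^sup>2 * D.k2 n)) * D.psum n (Suc n) (\<lambda>i. X i \<omega>)"
  have Tm: "?T n \<in> borel_measurable M" for n
    using L4_measurable[OF D.L4_psum[of n "Suc n"]] by simp
  show ?thesis
  proof (rule levy_continuity)
    show "real_distribution (distr M borel (?T n))" for n using Tm by simp
    show "real_distribution std_normal_distribution" by (rule real_dist_normal_dist)
    fix t :: real
    have ch: "char (distr M borel (?T n)) t = D.phi n (t * sqrt (2 / ((real n)\<^sup>2 * D.k2 n))) (Suc n)" for n
      unfolding char_def D.phi_def by (subst integral_distr[OF Tm]) (simp_all add: mult.assoc)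
    have s1: "(\<lambda>n. sqrt (D.k4 n / (real n * (D.k2 n)\<^sup>2))) \<longlonglongrightarrow> 0"
      using tendsto_real_sqrt[OF four] by simp
    have "(\<lambda>n. sqrt (D.g2 n / (D.k2 n)\<^sup>2)) \<longlonglongrightarrow> 0" using tendsto_real_sqrt[OF comp] by simp
    then have s2: "(\<lambda>n. sqrt (D.g2 n) / D.k2 n) \<longlonglongrightarrow> 0"
      using pos by (simp add: real_sqrt_divide less_imp_le)
    have "(\<lambda>n. (7 / 6 * \<bar>t\<bar> ^ 3 + t\<^sup>2) * sqrt (D.k4 n / (real n * (D.k2 n)\<^sup>2)) + 2 * t\<^sup>2 * (sqrt (D.g2 n) / D.k2 n)
        + t ^ 4 / 2 * (1 / real n)) \<longlonglongrightarrow> (7 / 6 * \<bar>t\<bar> ^ 3 + t\<^sup>2) * 0 + 2 * t\<^sup>2 * 0 + t ^ 4 / 2 * 0"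
      by (intro tendsto_intros s1 s2 lim_1_over_n)
    then have lim0: "(\<lambda>n. (7 / 6 * \<bar>t\<bar> ^ 3 + t\<^sup>2) * sqrt (D.k4 n / (real n * (D.k2 n)\<^sup>2)) + 2 * t\<^sup>2 * (sqrt (D.g2 n) / D.k2 n)
        + t ^ 4 / (2 * real n)) \<longlonglongrightarrow> 0" by simp
    have d0: "(\<lambda>n. D.phi n (t * sqrt (2 / ((real n)\<^sup>2 * D.k2 n))) (Suc n) - of_real (exp (- (t\<^sup>2 * (1 - 1 / real n) / 2)))) \<longlonglongrightarrow> 0"
    proof (rule Lim_null_comparison[OF _ lim0])
      show "\<forall>\<^sub>F n in sequentially. norm (D.phi n (t * sqrt (2 / ((real n)\<^sup>2 * D.k2 n))) (Suc n) - of_real (exp (- (t\<^sup>2 * (1 - 1 / real n) / 2))))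
        \<le> (7 / 6 * \<bar>t\<bar> ^ 3 + t\<^sup>2) * sqrt (D.k4 n / (real n * (D.k2 n)\<^sup>2)) + 2 * t\<^sup>2 * (sqrt (D.g2 n) / D.k2 n)
        + t ^ 4 / (2 * real n)"
        using eventually_ge_at_top[of 1] by eventually_elim (rule D.phi_normalized_bound[OF _ pos])
    qed
    have "(\<lambda>n. exp (- (t\<^sup>2 * (1 - 1 / real n) / 2))) \<longlonglongrightarrow> exp (- (t\<^sup>2 * (1 - 0) / 2))"
      by (intro tendsto_intros lim_1_over_n) auto
    then have "(\<lambda>n. complex_of_real (exp (- (t\<^sup>2 * (1 - 1 / real n) / 2)))) \<longlonglongrightarrow> complex_of_real (exp (- (t\<^sup>2 / 2)))"
      by (intro tendsto_of_real) simp
    from tendsto_add[OF d0 this]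
    show "(\<lambda>n. char (distr M borel (?T n)) t) \<longlonglongrightarrow> char std_normal_distribution t"
      by (simp add: ch char_std_normal_distribution)
  qed
qed

section \<open>Convergence in probability\<close>

context prob_space
begin

definition null_in_prob :: "(nat => 'a => real) => bool" where
  "null_in_prob R \<longleftrightarrow> (\<forall>n. R n \<in> borel_measurable M) \<and>
     (\<forall>d>0. (\<lambda>n. prob {\<omega> \<in> space M. \<bar>R n \<omega>\<bar> > d}) \<longlonglongrightarrow> 0)"

lemma null_in_prob_add:
  assumes R: "null_in_prob R" and S: "null_in_prob S"
  shows "null_in_prob (\<lambda>n \<omega>. R n \<omega> + S n \<omega>)"
  unfolding null_in_prob_def
proof (intro conjI allI impI)
  have [measurable]: "R n \<in> borel_measurable M" "S n \<in> borel_measurable M" for n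
    using R S by (auto simp: null_in_prob_def)
  show "(\<lambda>\<omega>. R n \<omega> + S n \<omega>) \<in> borel_measurable M" for n by simp
  fix d :: real assume d: "d > 0"
  have l: "(\<lambda>n. prob {\<omega> \<in> space M. \<bar>R n \<omega>\<bar> > d / 2} + prob {\<omega> \<in> space M. \<bar>S n \<omega>\<bar> > d / 2}) \<longlonglongrightarrow> 0 + 0"
  proof (rule tendsto_add)
    have "d / 2 > 0" using d by simp
    then show "(\<lambda>n. prob {\<omega> \<in> space M. \<bar>R n \<omega>\<bar> > d / 2}) \<longlonglongrightarrow> 0"
      "(\<lambda>n. prob {\<omega> \<in> space M. \<bar>S n \<omega>\<bar> > d / 2}) \<longlonglongrightarrow> 0"
      using R S unfolding null_in_prob_def by blast+
  qed
  have b: "prob {\<omega> \<in> space M. \<bar>R n \<omega> + S n \<omega>\<bar> > d}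
      \<le> prob {\<omega> \<in> space M. \<bar>R n \<omega>\<bar> > d / 2} + prob {\<omega> \<in> space M. \<bar>S n \<omega>\<bar> > d / 2}" for n
  proof -
    have "prob {\<omega> \<in> space M. \<bar>R n \<omega> + S n \<omega>\<bar> > d}
        \<le> prob ({\<omega> \<in> space M. \<bar>R n \<omega>\<bar> > d / 2} \<union> {\<omega> \<in> space M. \<bar>S n \<omega>\<bar> > d / 2})"
      by (rule finite_measure_mono) (auto simp: abs_if split: if_splits)
    also have "\<dots> \<le> prob {\<omega> \<in> space M. \<bar>R n \<omega>\<bar> > d / 2} + prob {\<omega> \<in> space M. \<bar>S n \<omega>\<bar> > d / 2}"
      by (rule measure_Un_le) measurable
    finally show ?thesis .
  qed
  show "(\<lambda>n. prob {\<omega> \<in> space M. \<bar>R n \<omega> + S n \<omega>\<bar> > d}) \<longlonglongrightarrow> 0"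
    by (rule tendsto_sandwich[OF _ _ tendsto_const l[simplified]]) (use b in \<open>auto simp: always_eventually\<close>)
qed

lemma Chebyshev_square:
  assumes [measurable]: "f \<in> borel_measurable M" and i: "integrable M (\<lambda>x. (f x)\<^sup>2)" and d: "d > 0"
  shows "prob {\<omega> \<in> space M. \<bar>f \<omega>\<bar> > d} \<le> expectation (\<lambda>x. (f x)\<^sup>2) / d\<^sup>2"
proof -
  have "prob {\<omega> \<in> space M. \<bar>f \<omega>\<bar> > d} \<le> prob {\<omega> \<in> space M. (f \<omega>)\<^sup>2 \<ge> d\<^sup>2}"
  proof (rule finite_measure_mono)
    show "{\<omega> \<in> space M. \<bar>f \<omega>\<bar> > d} \<subseteq> {\<omega> \<in> space M. (f \<omega>)\<^sup>2 \<ge> d\<^sup>2}"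
      using d by (auto simp: abs_le_square_iff[symmetric])
  qed measurable
  also have "\<dots> \<le> expectation (\<lambda>x. (f x)\<^sup>2) / d\<^sup>2"
    by (rule integral_Markov_inequality_measure[OF i, of "{}", simplified]) (use d in auto)
  finally show ?thesis .
qed

lemma null_in_prob_L2:
  assumes m: "\<And>n. R n \<in> borel_measurable M" and i: "\<And>n. integrable M (\<lambda>\<omega>. (R n \<omega>)\<^sup>2)"
    and l: "(\<lambda>n. expectation (\<lambda>\<omega>. (R n \<omega>)\<^sup>2)) \<longlonglongrightarrow> 0"
  shows "null_in_prob R"
  unfolding null_in_prob_def
proof (intro conjI allI impI m)
  fix d :: real assume d: "d > 0"
  have "(\<lambda>n. expectation (\<lambda>\<omega>. (R n \<omega>)\<^sup>2) / d\<^sup>2) \<longlonglongrightarrow> 0 / d\<^sup>2" using d by (intro tendsto_divide l) auto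
  then have l': "(\<lambda>n. expectation (\<lambda>\<omega>. (R n \<omega>)\<^sup>2) / d\<^sup>2) \<longlonglongrightarrow> 0" by simp
  show "(\<lambda>n. prob {\<omega> \<in> space M. \<bar>R n \<omega>\<bar> > d}) \<longlonglongrightarrow> 0"
    by (rule tendsto_sandwich[OF _ _ tendsto_const l'])
      (use Chebyshev_square[OF m i d] in \<open>auto simp: always_eventually\<close>)
qed

lemma null_in_probI:
  assumes m: "\<And>n. R n \<in> borel_measurable M"
    and b: "\<And>d e. d > 0 ==> e > 0 ==> \<forall>\<^sub>F n in sequentially. prob {\<omega> \<in> space M. \<bar>R n \<omega>\<bar> > d} \<le> e"
  shows "null_in_prob R"
  unfolding null_in_prob_def
proof (intro conjI allI impI m)
  fix d :: real assume d: "d > 0"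
  show "(\<lambda>n. prob {\<omega> \<in> space M. \<bar>R n \<omega>\<bar> > d}) \<longlonglongrightarrow> 0"
  proof (rule tendstoI)
    fix e :: real assume e: "e > 0"
    have "\<forall>\<^sub>F n in sequentially. prob {\<omega> \<in> space M. \<bar>R n \<omega>\<bar> > d} \<le> e / 2" using b[OF d, of "e / 2"] e by simp
    then show "\<forall>\<^sub>F n in sequentially. dist (prob {\<omega> \<in> space M. \<bar>R n \<omega>\<bar> > d}) 0 < e"
      by eventually_elim (use e in simp)
  qed
qed

text \<open>Proved on characteristic functions: off a small event the exponentials differ by at most
  |t| d, on it by at most 2.\<close>

lemma weak_conv_Slutsky:
  assumes A: "\<And>n. A n \<in> borel_measurable M" and B: "\<And>n. B n \<in> borel_measurable M"
    and conv: "weak_conv_m (\<lambda>n. distr M borel (A n)) L" and L: "real_distribution L"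
    and R: "null_in_prob (\<lambda>n \<omega>. B n \<omega> - A n \<omega>)"
  shows "weak_conv_m (\<lambda>n. distr M borel (B n)) L"
proof (rule levy_continuity)
  show "real_distribution (distr M borel (B n))" for n using B by simp
  show "real_distribution L" by (rule L)
  fix t :: real
  have chA: "(\<lambda>n. char (distr M borel (A n)) t) \<longlonglongrightarrow> char L t"
    using A L conv by (intro levy_continuity1) auto
  have ch: "char (distr M borel (f n)) t = (\<integral>\<omega>. iexp (t * f n \<omega>) \<partial>M)" if "\<And>n. f n \<in> borel_measurable M" for f n
    unfolding char_def by (subst integral_distr[OF that]) simp_all
  have "(\<lambda>n. char (distr M borel (B n)) t - char (distr M borel (A n)) t) \<longlonglongrightarrow> 0"
  proof (rule tendstoI)
    fix e :: real assume e: "e > 0"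
    \<comment> \<open>The two contributions become at most \<open>e / 4\<close> and
      \<open>2 * (e / 4)\<close>; the added 1 covers t = 0.\<close>
    define d where "d = e / (4 * (\<bar>t\<bar> + 1))"
    have d: "d > 0" using e by (auto simp: d_def intro!: divide_pos_pos)
    have td: "\<bar>t\<bar> * d \<le> e / 4"
    proof -
      have "\<bar>t\<bar> * d \<le> (\<bar>t\<bar> + 1) * d" using d by (intro mult_right_mono) auto
      also have "(\<bar>t\<bar> + 1) * d = e / 4"
      proof -
        have "\<bar>t\<bar> + 1 \<noteq> 0" by linarith
        then show ?thesis unfolding d_def by (simp add: divide_simps)
      qed
      finally show ?thesis .
    qed
    have "(\<lambda>n. prob {\<omega> \<in> space M. \<bar>B n \<omega> - A n \<omega>\<bar> > d}) \<longlonglongrightarrow> 0" using R d by (simp add: null_in_prob_def)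
    then have "\<forall>\<^sub>F n in sequentially. prob {\<omega> \<in> space M. \<bar>B n \<omega> - A n \<omega>\<bar> > d} < e / 4"
      using e by (intro order_tendstoD(2)) auto
    then show "\<forall>\<^sub>F n in sequentially. dist (char (distr M borel (B n)) t - char (distr M borel (A n)) t) 0 < e"
    proof eventually_elim
      case (elim n)
      have [measurable]: "A n \<in> borel_measurable M" "B n \<in> borel_measurable M" by (rule A B)+
      let ?E = "{\<omega> \<in> space M. \<bar>B n \<omega> - A n \<omega>\<bar> > d}"
      let ?D = "\<lambda>\<omega>. iexp (t * B n \<omega>) - iexp (t * A n \<omega>)"
      have Em: "?E \<in> events" by measurable
      have Ei: "integrable M (\<lambda>\<omega>. indicator ?E \<omega> :: real)"
        using Em by (simp add: integrable_indicator_iff less_top[symmetric])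
      have iA: "integrable M (\<lambda>\<omega>. iexp (t * A n \<omega>))" and iB: "integrable M (\<lambda>\<omega>. iexp (t * B n \<omega>))"
        by (rule integrable_iexp; simp)+
      have pt: "cmod (?D \<omega>) \<le> \<bar>t\<bar> * d + 2 * indicator ?E \<omega>" if "\<omega> \<in> space M" for \<omega>
      proof (cases "\<omega> \<in> ?E")
        case True
        have "cmod (?D \<omega>) \<le> cmod (iexp (t * B n \<omega>)) + cmod (iexp (t * A n \<omega>))"
          by (rule norm_triangle_ineq4)
        also have "\<dots> = 2" by (simp only: norm_exp_i_times)
        finally show ?thesis using True d by (simp add: add_increasing)
      next
        case False
        have "?D \<omega> = iexp (t * A n \<omega>) * (iexp (t * (B n \<omega> - A n \<omega>)) - 1)"
          by (simp add: algebra_simps flip: exp_add)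
        then have "cmod (?D \<omega>) = cmod (iexp (t * (B n \<omega> - A n \<omega>)) - 1)"
          by (simp only: norm_mult norm_exp_i_times mult_1_left)
        also have "\<dots> \<le> \<bar>t * (B n \<omega> - A n \<omega>)\<bar>"
          using iexp_approx1[of "t * (B n \<omega> - A n \<omega>)" 0] by simp
        also have "\<dots> \<le> \<bar>t\<bar> * d" using False that unfolding abs_mult by (intro mult_left_mono) auto
        finally show ?thesis using False by simp
      qed
      have "cmod (char (distr M borel (B n)) t - char (distr M borel (A n)) t)
          = cmod (\<integral>\<omega>. ?D \<omega> \<partial>M)"
        using ch[of A n] ch[of B n] A B iA iB by simp
      also have "\<dots> \<le> (\<integral>\<omega>. cmod (?D \<omega>) \<partial>M)" by (rule integral_norm_bound)
      also have "\<dots> \<le> (\<integral>\<omega>. \<bar>t\<bar> * d + 2 * indicator ?E \<omega> \<partial>M)"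
      proof (rule integral_mono)
        show "integrable M (\<lambda>\<omega>. cmod (?D \<omega>))"
          by (intro integrable_norm Bochner_Integration.integrable_diff iA iB)
        show "integrable M (\<lambda>\<omega>. \<bar>t\<bar> * d + 2 * indicator ?E \<omega>)" using Ei by simp
      qed (rule pt)
      also have "\<dots> = \<bar>t\<bar> * d + 2 * (\<integral>\<omega>. indicator ?E \<omega> \<partial>M)"
        using Ei by (subst Bochner_Integration.integral_add) (simp_all add: prob_space)
      also have "\<dots> = \<bar>t\<bar> * d + 2 * prob ?E" using Em by simp
      also have "\<dots> < e" using td elim e by simp
      finally show ?case by (simp add: dist_norm)
    qed
  qed
  from tendsto_add[OF this chA] show "(\<lambda>n. char (distr M borel (B n)) t) \<longlonglongrightarrow> char L t" by simp
qed

end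

section \<open>The effective dimension\<close>

text \<open>The integral test in disguise: 1 / (1 + x^2) decreases on the positive axis and has
  antiderivative \<open>arctan\<close>, whose telescoping increments are bounded by pi / 2 uniformly
  in \<open>h\<close>.\<close>

lemma arctan_increment:
  assumes h: "h > 0" and \<nu>: "\<nu> \<ge> 1"
  shows "h / (1 + (h * real \<nu>)\<^sup>2) \<le> arctan (h * real \<nu>) - arctan (h * (real \<nu> - 1))"
proof -
  have lt: "h * (real \<nu> - 1) < h * real \<nu>" using h by simp
  obtain z where z: "z > h * (real \<nu> - 1)" "z < h * real \<nu>"
    "arctan (h * real \<nu>) - arctan (h * (real \<nu> - 1)) = (h * real \<nu> - h * (real \<nu> - 1)) * inverse (1 + z\<^sup>2)"
    using MVT2[OF lt, of arctan "\<lambda>z. inverse (1 + z\<^sup>2)"] DERIV_arctan by blast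
  have z0: "z \<ge> 0" using z(1) h \<nu> by (smt (verit) mult_nonneg_nonneg of_nat_1 of_nat_le_iff)
  have "z\<^sup>2 \<le> (h * real \<nu>)\<^sup>2" using z(2) z0 by (intro power_mono) auto
  then have "inverse (1 + (h * real \<nu>)\<^sup>2) \<le> inverse (1 + z\<^sup>2)"
    by (intro le_imp_inverse_le) (auto intro: add_pos_nonneg)
  then have "h * inverse (1 + (h * real \<nu>)\<^sup>2) \<le> h * inverse (1 + z\<^sup>2)" using h by (intro mult_left_mono) auto
  then show ?thesis unfolding z(3) by (simp add: divide_inverse algebra_simps)
qed

text \<open>The trace is a Riemann sum of mesh \<open>h\<close>. Above, its terms are dominated by a
  multiple of 1 / (1 + (h \<nu>)^2); below, the indices with h \<nu> at most 1 number about 1/h and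
  each contributes a fixed amount. All constants are independent of \<open>h\<close>.\<close>

lemma polynomial_eigenvalues:
  assumes order: "same_order gam (\<lambda>\<nu>. real \<nu> ^ (2 * m))" and m: "m > 0" and nn: "\<And>\<nu>. gam \<nu> \<ge> 0"
  obtains C c where "C > 0" "c > 0"
    "\<And>h. 0 < h ==> summable (\<lambda>\<nu>. 1 / (1 + h ^ (2 * m) * gam \<nu>))"
    "\<And>h. 0 < h ==> h \<le> 1 ==> h * (\<Sum>\<nu>. 1 / (1 + h ^ (2 * m) * gam \<nu>)) \<le> C"
    "\<And>h N. 0 < h ==> h \<le> 1 ==> real N \<ge> 1 / h ==> c \<le> h * (\<Sum>\<nu><N. 1 / (1 + h ^ (2 * m) * gam \<nu>)\<^sup>2)"
proof -
  let ?f = "\<lambda>h \<nu>. 1 / (1 + h ^ (2 * m) * gam \<nu>)"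
  obtain c0 where c0: "c0 > 0" "(\<lambda>\<nu>. gam \<nu> / real \<nu> ^ (2 * m)) \<longlonglongrightarrow> c0"
    using order by (auto simp: same_order_def)
  have "\<forall>\<^sub>F \<nu> in sequentially. gam \<nu> / real \<nu> ^ (2 * m) > c0 / 2"
    using c0 by (intro order_tendstoD(1)) auto
  moreover have "\<forall>\<^sub>F \<nu> in sequentially. gam \<nu> / real \<nu> ^ (2 * m) < 2 * c0"
    using c0 by (intro order_tendstoD(2)) auto
  ultimately have "\<forall>\<^sub>F \<nu> in sequentially. c0 / 2 < gam \<nu> / real \<nu> ^ (2 * m) \<and> gam \<nu> / real \<nu> ^ (2 * m) < 2 * c0"
    by eventually_elim simp
  then obtain N0 where N0: "\<And>\<nu>. \<nu> \<ge> N0 ==> c0 / 2 < gam \<nu> / real \<nu> ^ (2 * m) \<and> gam \<nu> / real \<nu> ^ (2 * m) < 2 * c0"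
    by (auto simp: eventually_sequentially)
  \<comment> \<open>The successor excludes \<nu> = 0, where the comparison sequence vanishes and the
    quotient says nothing.\<close>
  define N1 where "N1 = Suc N0"
  have lo: "c0 / 2 * real \<nu> ^ (2 * m) \<le> gam \<nu>" and up: "gam \<nu> \<le> 2 * c0 * real \<nu> ^ (2 * m)" if "\<nu> \<ge> N1" for \<nu>
  proof -
    have "real \<nu> ^ (2 * m) > 0" using that by (simp add: N1_def)
    then show "c0 / 2 * real \<nu> ^ (2 * m) \<le> gam \<nu>" "gam \<nu> \<le> 2 * c0 * real \<nu> ^ (2 * m)"
      using N0[of \<nu>] that by (auto simp: N1_def pos_less_divide_eq pos_divide_less_eq)
  qed
  \<comment> \<open>Chosen for both ranges of x = h \<nu>: for x at most 1 the term 1 alone absorbs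
    \<open>c1 * (1 + x^2)\<close>, beyond that 1 absorbs \<open>c1\<close> and c0 / 2 times x^(2m)
    absorbs the rest.\<close>
  define c1 where "c1 = min 1 (c0 / 2) / 2"
  have c1: "c1 > 0" "2 * c1 \<le> 1" "2 * c1 \<le> c0 / 2" using c0 by (auto simp: c1_def)
  have key: "?f h \<nu> \<le> 1 / c1 * (1 / (1 + (h * real \<nu>)\<^sup>2))" if h: "h > 0" and \<nu>: "\<nu> \<ge> N1" for h \<nu>
  proof -
    let ?x = "h * real \<nu>"
    have x0: "?x \<ge> 0" using h by simp
    have g1: "1 + c0 / 2 * ?x ^ (2 * m) \<le> 1 + h ^ (2 * m) * gam \<nu>"
      using mult_left_mono[OF lo[OF \<nu>], of "h ^ (2 * m)"] h by (simp add: power_mult_distrib mult_ac)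
    have "c1 * (1 + ?x\<^sup>2) \<le> 1 + c0 / 2 * ?x ^ (2 * m)"
    proof (cases "?x \<le> 1")
      case True
      then have "?x\<^sup>2 \<le> 1" using x0 by (intro power_le_one) auto
      then have "c1 * (1 + ?x\<^sup>2) \<le> c1 * 2" using c1 by (intro mult_left_mono) auto
      moreover have "0 \<le> c0 / 2 * ?x ^ (2 * m)" using c0 x0 by simp
      ultimately show ?thesis using c1 by linarith
    next
      case False
      then have p: "?x\<^sup>2 \<le> ?x ^ (2 * m)" using m by (intro power_increasing) auto
      have "c1 * ?x\<^sup>2 \<le> c0 / 2 * ?x ^ (2 * m)" using c1 c0 p by (intro mult_mono) auto
      then show ?thesis using c1 by (simp add: distrib_left)
    qed
    then have "c1 * (1 + ?x\<^sup>2) \<le> 1 + h ^ (2 * m) * gam \<nu>" using g1 by linarith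
    moreover have "0 < c1 * (1 + ?x\<^sup>2)" using c1 by (simp add: add_pos_nonneg)
    ultimately have "?f h \<nu> \<le> 1 / (c1 * (1 + ?x\<^sup>2))" by (intro divide_left_mono) auto
    then show ?thesis by simp
  qed
  have d1: "?f h \<nu> \<le> 1" "0 \<le> ?f h \<nu>" if "h > 0" for h \<nu>
    using mult_nonneg_nonneg[of "h ^ (2 * m)" "gam \<nu>"] nn that by (auto simp: divide_le_eq)
  have part: "h * (\<Sum>\<nu><n. ?f h \<nu>) \<le> real N1 * h + (1 / c1) * (pi / 2)" if h: "h > 0" for h n
  proof -
    have t: "(\<Sum>\<nu>=N1..<n. h / (1 + (h * real \<nu>)\<^sup>2)) \<le> pi / 2"
    proof (cases "N1 \<le> n")
      case True
      have "(\<Sum>\<nu>=N1..<n. h / (1 + (h * real \<nu>)\<^sup>2)) \<le> (\<Sum>\<nu>=N1..<n. arctan (h * real \<nu>) - arctan (h * (real \<nu> - 1)))"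
        using arctan_increment[OF h] by (intro sum_mono) (auto simp: N1_def)
      also have "\<dots> = (\<Sum>\<nu>=N1..<n. arctan (h * (real (Suc \<nu>) - 1)) - arctan (h * (real \<nu> - 1)))" by simp
      also have "\<dots> = arctan (h * (real n - 1)) - arctan (h * (real N1 - 1))"
        by (rule sum_Suc_diff'[OF True])
      also have "\<dots> \<le> pi / 2"
      proof -
        have "0 \<le> h * (real N1 - 1)" using h by (simp add: N1_def)
        then have "0 \<le> arctan (h * (real N1 - 1))" by (simp only: zero_le_arctan_iff)
        then show ?thesis using arctan_ubound[of "h * (real n - 1)"] by linarith
      qed
      finally show ?thesis .
    qed (simp add: pi_ge_zero)
    have "(\<Sum>\<nu><n. ?f h \<nu>) \<le> (\<Sum>\<nu>\<in>{..<N1} \<union> {N1..<n}. ?f h \<nu>)"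
      using d1[OF h] by (intro sum_mono2) auto
    also have "\<dots> = (\<Sum>\<nu><N1. ?f h \<nu>) + (\<Sum>\<nu>=N1..<n. ?f h \<nu>)"
      by (rule sum.union_disjoint) auto
    also have "\<dots> \<le> (\<Sum>\<nu><N1. 1) + (\<Sum>\<nu>=N1..<n. 1 / c1 * (1 / (1 + (h * real \<nu>)\<^sup>2)))"
      using d1[OF h] key[OF h] by (intro add_mono sum_mono) auto
    finally have "h * (\<Sum>\<nu><n. ?f h \<nu>) \<le> h * (real N1 + (\<Sum>\<nu>=N1..<n. 1 / c1 * (1 / (1 + (h * real \<nu>)\<^sup>2))))"
      using h by (intro mult_left_mono) auto
    also have "\<dots> = real N1 * h + (1 / c1) * (\<Sum>\<nu>=N1..<n. h / (1 + (h * real \<nu>)\<^sup>2))"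
      by (simp add: distrib_left sum_distrib_left mult_ac)
    also have "\<dots> \<le> real N1 * h + (1 / c1) * (pi / 2)" using t c1 by (intro add_left_mono mult_left_mono) auto
    finally show ?thesis .
  qed
  have summ: "summable (\<lambda>\<nu>. ?f h \<nu>)" if h: "h > 0" for h
  proof (rule bounded_imp_summable)
    show "(\<Sum>\<nu>\<le>n. ?f h \<nu>) \<le> (real N1 * h + (1 / c1) * (pi / 2)) / h" for n
      using part[OF h, of "Suc n"] h by (simp add: lessThan_Suc_atMost field_simps)
  qed (use d1[OF h] in auto)
  \<comment> \<open>The maximum handles the initial indices, about which the asymptotics are silent,
    and 2 \<open>c0\<close> handles the tail.\<close>
  define D where "D = Max ((\<lambda>\<nu>. gam \<nu>) ` {..N1}) + 2 * c0"
  have mx: "0 \<le> Max ((\<lambda>\<nu>. gam \<nu>) ` {..N1})" by (rule order_trans[OF nn[of 0] Max_ge]) auto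
  have Dn: "D > 0" using c0(1) mx unfolding D_def by linarith
  have upD: "gam \<nu> \<le> D * (1 + real \<nu> ^ (2 * m))" for \<nu>
  proof (cases "\<nu> \<le> N1")
    case True
    then have "gam \<nu> \<le> Max ((\<lambda>\<nu>. gam \<nu>) ` {..N1})" by (intro Max_ge) auto
    then have "gam \<nu> \<le> D" using c0 by (simp add: D_def)
    moreover have "0 \<le> D * real \<nu> ^ (2 * m)" using Dn by simp
    ultimately show ?thesis by (simp add: distrib_left)
  next
    case False
    then have "gam \<nu> \<le> 2 * c0 * real \<nu> ^ (2 * m)" by (intro up) simp
    also have "\<dots> \<le> D * real \<nu> ^ (2 * m)"
      using mx unfolding D_def by (intro mult_right_mono) auto
    also have "\<dots> \<le> D * (1 + real \<nu> ^ (2 * m))" using Dn by (intro mult_left_mono) auto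
    finally show ?thesis .
  qed
  have lowsum: "1 / (1 + 2 * D)\<^sup>2 \<le> h * (\<Sum>\<nu><N. 1 / (1 + h ^ (2 * m) * gam \<nu>)\<^sup>2)"
    if h: "0 < h" "h \<le> 1" and N: "real N \<ge> 1 / h" for h N
  proof -
    \<comment> \<open>Every \<nu> below \<open>k\<close> satisfies h \<nu> at most 1, and yet h
      times \<open>k\<close> is at least 1.\<close>
    define k where "k = nat \<lceil>1 / h\<rceil>"
    have k: "real k \<ge> 1 / h" "real k < 1 / h + 1" using h by (simp_all add: k_def) linarith+
    have kN: "k \<le> N" using N by (simp add: k_def)
    have tm: "1 / (1 + 2 * D)\<^sup>2 \<le> 1 / (1 + h ^ (2 * m) * gam \<nu>)\<^sup>2" if "\<nu> < k" for \<nu>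
    proof -
      have "real \<nu> \<le> real k - 1" using that by linarith
      then have "h * real \<nu> \<le> 1" using k(2) h by (smt (verit) mult.commute pos_le_divide_eq)
      then have p: "(h * real \<nu>) ^ (2 * m) \<le> 1" using h by (intro power_le_one) auto
      have q: "h ^ (2 * m) \<le> 1" using h by (intro power_le_one) auto
      have "h ^ (2 * m) * gam \<nu> \<le> h ^ (2 * m) * (D * (1 + real \<nu> ^ (2 * m)))"
        using upD h by (intro mult_left_mono) auto
      also have "\<dots> = D * (h ^ (2 * m) + (h * real \<nu>) ^ (2 * m))" by (simp add: power_mult_distrib algebra_simps)
      also have "\<dots> \<le> D * 2" using p q Dn by (intro mult_left_mono) auto
      finally have "h ^ (2 * m) * gam \<nu> \<le> 2 * D" by simp
      moreover have "0 \<le> h ^ (2 * m) * gam \<nu>" using h nn by simp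
      ultimately show ?thesis by (intro divide_left_mono power_mono) auto
    qed
    have "1 / (1 + 2 * D)\<^sup>2 \<le> h * (real k * (1 / (1 + 2 * D)\<^sup>2))"
    proof -
      have "1 \<le> h * real k" using k(1) h by (simp add: field_simps)
      then have "1 * (1 / (1 + 2 * D)\<^sup>2) \<le> (h * real k) * (1 / (1 + 2 * D)\<^sup>2)" by (intro mult_right_mono) auto
      then show ?thesis by (simp add: mult.assoc)
    qed
    also have "\<dots> = h * (\<Sum>\<nu><k. 1 / (1 + 2 * D)\<^sup>2)" by simp
    also have "\<dots> \<le> h * (\<Sum>\<nu><k. 1 / (1 + h ^ (2 * m) * gam \<nu>)\<^sup>2)"
      using tm h by (intro mult_left_mono sum_mono) auto
    also have "\<dots> \<le> h * (\<Sum>\<nu><N. 1 / (1 + h ^ (2 * m) * gam \<nu>)\<^sup>2)"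
      using h kN by (intro mult_left_mono sum_mono2) auto
    finally show ?thesis .
  qed
  show thesis
  proof (rule that[of "real N1 + (1 / c1) * (pi / 2)" "1 / (1 + 2 * D)\<^sup>2"])
    show "real N1 + (1 / c1) * (pi / 2) > 0" using c1 by (simp add: N1_def add_pos_nonneg)
    show "1 / (1 + 2 * D)\<^sup>2 > 0" using Dn by simp
    show "summable (\<lambda>\<nu>. ?f h \<nu>)" if "0 < h" for h by (rule summ[OF that])
    show "h * (\<Sum>\<nu>. ?f h \<nu>) \<le> real N1 + (1 / c1) * (pi / 2)" if h: "0 < h" "h \<le> 1" for h
    proof -
      have "(\<Sum>\<nu>. ?f h \<nu>) \<le> (real N1 + (1 / c1) * (pi / 2)) / h"
      proof (rule suminf_le_const[OF summ[OF h(1)]])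
        fix n
        have "h * (\<Sum>\<nu><n. ?f h \<nu>) \<le> real N1 * 1 + (1 / c1) * (pi / 2)"
          using part[OF h(1), of n] mult_left_mono[OF h(2), of "real N1"] by linarith
        then show "(\<Sum>\<nu><n. ?f h \<nu>) \<le> (real N1 + (1 / c1) * (pi / 2)) / h"
          using h by (simp add: pos_le_divide_eq mult.commute)
      qed
      then show ?thesis using h by (simp add: pos_le_divide_eq mult.commute)
    qed
    show "1 / (1 + 2 * D)\<^sup>2 \<le> h * (\<Sum>\<nu><N. 1 / (1 + h ^ (2 * m) * gam \<nu>)\<^sup>2)"
      if "0 < h" "h \<le> 1" "real N \<ge> 1 / h" for h N by (rule lowsum[OF that])
  qed
qed

section \<open>The quadratic approximation\<close>

context penalized_rkhs
begin

lemma inverse_denom_nonneg: "0 \<le> 1 / (1 + lam * gam \<nu>)"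
  using denom_pos(1)[of \<nu>] by simp

lemma tr_nonneg: "tr \<ge> 0"
  unfolding tr_def by (intro suminf_nonneg summable_denom inverse_denom_nonneg)

lemma sum_denom_le_tr: "(\<Sum>\<nu><N. 1 / (1 + lam * gam \<nu>)) \<le> tr"
  unfolding tr_def by (intro sum_le_suminf summable_denom inverse_denom_nonneg) simp

text \<open>Truncations reduce the uniform bound below to finite matrices; their norms never exceed
  that of \<open>f\<close>, which also provides domination in the limit.\<close>

definition partial :: "(real => real) => nat => real => real" where
  "partial f N = (\<lambda>z. \<Sum>\<nu><N. coef f \<nu> * hb \<nu> z)"

lemma partial_in: "partial f N \<in> H"
  unfolding partial_def by (rule H_sum) (auto simp: hb_in)

lemma coef_partial:
  assumes "\<nu> < N"
  shows "coef (partial f N) \<nu> = coef f \<nu>"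
proof -
  have "V (partial f N) (hb \<nu>) = (\<Sum>\<mu><N. coef f \<mu> * V (hb \<mu>) (hb \<nu>))"
    unfolding partial_def using form_sum[OF psd_form_V, of "{..<N}" hb "hb \<nu>" "coef f"] hb_in by blast
  also have "\<dots> = (\<Sum>\<mu><N. if \<mu> = \<nu> then coef f \<nu> else 0)"
    by (rule sum.cong) (simp_all add: V_orth)
  also have "\<dots> = coef f \<nu>" using assms by simp
  finally show ?thesis by (simp only: coef_def[of "partial f N"])
qed

lemma ip_partial:
  assumes f: "f \<in> H"
  shows "ip (partial f N) (partial f N) = (\<Sum>\<nu><N. (1 + lam * gam \<nu>) * (coef f \<nu>)\<^sup>2)" (is ?A)
    "ip (partial f N) (partial f N) \<le> ip f f"
proof -
  have "ip (partial f N) (partial f N) = (\<Sum>\<nu><N. coef f \<nu> * ip (hb \<nu>) (partial f N))"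
    using form_sum[OF psd_form_ip, of "{..<N}" hb "partial f N" "coef f"] hb_in partial_in[of f N]
    unfolding partial_def by blast
  also have "\<dots> = (\<Sum>\<nu><N. (1 + lam * gam \<nu>) * (coef f \<nu>)\<^sup>2)"
  proof (rule sum.cong[OF refl])
    fix \<nu> assume "\<nu> \<in> {..<N}"
    then have "ip (hb \<nu>) (partial f N) = (1 + lam * gam \<nu>) * coef f \<nu>"
      unfolding ip_sym[of "hb \<nu>"] ip_hb[OF partial_in] by (simp add: coef_partial)
    then show "coef f \<nu> * ip (hb \<nu>) (partial f N) = (1 + lam * gam \<nu>) * (coef f \<nu>)\<^sup>2"
      by (simp add: power2_eq_square)
  qed
  finally show eq: ?A .
  have s: "(\<lambda>\<nu>. (1 + lam * gam \<nu>) * (coef f \<nu>)\<^sup>2) sums ip f f"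
    using ip_sums[OF f f] unfolding power2_eq_square mult.assoc .
  show "ip (partial f N) (partial f N) \<le> ip f f"
    unfolding eq sums_unique[OF s]
    by (intro sum_le_suminf sums_summable[OF s] mult_nonneg_nonneg less_imp_le[OF denom_pos(1)]) simp_all
qed

end

text \<open>Elements of \<open>H\<close> are arbitrary off the unit interval, possibly not even
  measurable there; extension by zero makes them Borel functions of an observation without changing
  their values on the sample.\<close>

definition on_unit :: "(real => real) => real \<times> real => real" where
  "on_unit f x = indicator {0..1} (snd x) * f (snd x)"

section \<open>Empirical quadratic forms\<close>

context iid_sample
begin

definition avg :: "nat => ('b => real) => 'w => real" where
  "avg n a \<omega> = (\<Sum>i\<in>{1..<Suc n}. a (X i \<omega>)) / real n"

lemma avg_measurable: "a \<in> borel_measurable N ==> avg n a \<in> borel_measurable M"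
  unfolding avg_def[abs_def]
  by (intro borel_measurable_divide borel_measurable_sum measurable_compose[OF X_measurable] borel_measurable_const) simp_all

lemma sample_mean_variance:
  assumes am: "a \<in> borel_measurable N" and a2: "integrable N (\<lambda>x. (a x)\<^sup>2)" and n: "n \<ge> 1"
  shows "integrable M (\<lambda>\<omega>. (avg n a \<omega> - (\<integral>x. a x \<partial>N))\<^sup>2)" (is ?A)
    "(\<integral>\<omega>. (avg n a \<omega> - (\<integral>x. a x \<partial>N))\<^sup>2 \<partial>M) \<le> (\<integral>x. (a x)\<^sup>2 \<partial>N) / real n" (is ?B)
proof -
  define m where "m = (\<integral>x. a x \<partial>N)"
  define b where "b = (\<lambda>x. a x - m)"
  have a1: "integrable N a" by (rule N.square_expectation_le(1)[OF am a2])
  have bm: "b \<in> borel_measurable N" using am by (simp add: b_def)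
  have b2: "integrable N (\<lambda>x. (b x)\<^sup>2)" unfolding b_def power2_diff using a1 a2 by simp
  have b0: "(\<integral>x. b x \<partial>N) = 0" using a1 by (simp add: b_def m_def N.prob_space)
  have bv: "(\<integral>x. (b x)\<^sup>2 \<partial>N) \<le> (\<integral>x. (a x)\<^sup>2 \<partial>N)"
  proof -
    have "(\<integral>x. (b x)\<^sup>2 \<partial>N) = (\<integral>x. (a x)\<^sup>2 \<partial>N) - m\<^sup>2"
      using N.variance_eq[OF a1 a2] by (simp add: b_def m_def)
    then show ?thesis using zero_le_power2[of m] by linarith
  qed
  have eq: "(avg n a \<omega> - m)\<^sup>2 = (\<Sum>i\<in>{1..<Suc n}. b (X i \<omega>))\<^sup>2 / (real n)\<^sup>2" for \<omega>
  proof -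
    have "(\<Sum>i\<in>{1..<Suc n}. b (X i \<omega>)) = (\<Sum>i\<in>{1..<Suc n}. a (X i \<omega>)) - real n * m"
      unfolding b_def sum_subtractf by simp
    also have "(\<Sum>i\<in>{1..<Suc n}. a (X i \<omega>)) = real n * avg n a \<omega>" using n by (simp only: avg_def) simp
    finally have "(\<Sum>i\<in>{1..<Suc n}. b (X i \<omega>)) = real n * (avg n a \<omega> - m)" by (simp only: right_diff_distrib)
    then show ?thesis using n by (simp add: power_mult_distrib)
  qed
  show ?A
    unfolding m_def[symmetric] eq using iid_sum_square_integrable[OF bm b2 b0, of "Suc n"] by simp
  have "(\<integral>\<omega>. (avg n a \<omega> - m)\<^sup>2 \<partial>M) = real n * (\<integral>x. (b x)\<^sup>2 \<partial>N) / (real n)\<^sup>2"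
    unfolding eq using iid_sum_square[OF bm b2 b0, of "Suc n"] by simp
  also have "\<dots> = (\<integral>x. (b x)\<^sup>2 \<partial>N) / real n" using n by (simp add: power2_eq_square)
  also have "\<dots> \<le> (\<integral>x. (a x)\<^sup>2 \<partial>N) / real n" using bv by (intro divide_right_mono) auto
  finally show ?B by (simp add: m_def)
qed

end

locale design_sample = iid_sample M N X + penalized_rkhs H V J lam hb gam "{0..1}" K W B
  for M :: "'w measure" and N :: "(real \<times> real) measure" and X
    and H V J lam hb gam K W B +
  assumes sets_N: "sets N = sets (borel \<Otimes>\<^sub>M borel)"
    and X_unit: "\<And>i \<omega>. i \<ge> 1 ==> \<omega> \<in> space M ==> snd (X i \<omega>) \<in> {0..1}"
    and H_continuous: "\<And>f. f \<in> H ==> continuous_on {0..1} f"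
begin

lemma space_N: "space N = UNIV"
  using sets_eq_imp_space_eq[OF sets_N] by (simp add: space_pair_measure)

lemma on_unit_measurable:
  assumes "f \<in> H"
  shows "on_unit f \<in> borel_measurable N"
proof -
  have "(\<lambda>z. indicator {0..1} z *\<^sub>R f z) \<in> borel_measurable borel"
    by (rule borel_measurable_continuous_on_indicator[OF _ H_continuous[OF assms]]) simp
  then have "(\<lambda>z. indicator {0..1} z * f z) \<in> borel_measurable borel" by (simp only: real_scaleR_def)
  then have "on_unit f \<in> borel_measurable (borel \<Otimes>\<^sub>M borel)"
    unfolding on_unit_def[abs_def] by (rule measurable_compose[OF measurable_snd])
  then show ?thesis using measurable_cong_sets[OF sets_N refl] by blast
qed

lemma on_unit_X: "i \<ge> 1 ==> \<omega> \<in> space M ==> on_unit f (X i \<omega>) = f (snd (X i \<omega>))"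
  using X_unit[of i \<omega>] by (simp add: on_unit_def)

lemma B_nonneg': "B \<ge> 0"
  by (rule B_nonneg[of 0]) simp

lemma on_unit_square_le:
  assumes "f \<in> H"
  shows "(on_unit f x)\<^sup>2 \<le> B\<^sup>2 * tr * ip f f"
  using pointwise_bound[OF assms, of "snd x"] tr_nonneg ip_nonneg[OF assms]
  by (cases "snd x \<in> {0..1}") (simp_all add: on_unit_def)

lemma on_unit_abs_le:
  assumes "f \<in> H"
  shows "\<bar>on_unit f x\<bar> \<le> sqrt (B\<^sup>2 * tr * ip f f)"
  using real_sqrt_le_mono[OF on_unit_square_le[OF assms, of x]] by simp

lemma on_unit_hb_le: "\<bar>on_unit (hb \<nu>) x\<bar> \<le> B"
  using hb_bound[of "snd x" \<nu>] B_nonneg' by (cases "snd x \<in> {0..1}") (simp_all add: on_unit_def)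

lemma on_unit_partial: "on_unit (partial f n) x = (\<Sum>\<nu><n. coef f \<nu> * on_unit (hb \<nu>) x)"
  by (simp add: on_unit_def partial_def sum_distrib_left mult_ac)

lemma on_unit_partial_tendsto:
  assumes "f \<in> H"
  shows "(\<lambda>n. on_unit (partial f n) x) \<longlonglongrightarrow> on_unit f x"
proof (cases "snd x \<in> {0..1}")
  case True
  then show ?thesis using pointwise_sums[OF assms True] by (simp add: sums_def on_unit_def partial_def)
qed (simp add: on_unit_def)

lemma integrable_weight_bounded:
  fixes w g :: "real \<times> real => real"
  assumes "integrable N w" "g \<in> borel_measurable N" "\<And>x. \<bar>g x\<bar> \<le> C"
  shows "integrable N (\<lambda>x. w x * g x)"
proof (rule Bochner_Integration.integrable_bound)
  show "integrable N (\<lambda>x. C * w x)" using assms by simp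
  show "AE x in N. norm (w x * g x) \<le> norm (C * w x)"
  proof (rule AE_I2)
    fix x
    have "\<bar>w x\<bar> * \<bar>g x\<bar> \<le> \<bar>w x\<bar> * C" using assms(3) by (intro mult_left_mono) auto
    moreover have "C \<ge> 0" using assms(3)[of x] by linarith
    ultimately show "norm (w x * g x) \<le> norm (C * w x)" by (simp add: abs_mult mult.commute)
  qed
qed (use assms in simp)

lemma integral_partial_tendsto:
  assumes f: "f \<in> H" and w: "integrable N w"
  shows "(\<lambda>n. \<integral>x. w x * (on_unit (partial f n) x)\<^sup>2 \<partial>N) \<longlonglongrightarrow> (\<integral>x. w x * (on_unit f x)\<^sup>2 \<partial>N)"
proof (rule integral_dominated_convergence)
  show "(\<lambda>x. w x * (on_unit f x)\<^sup>2) \<in> borel_measurable N"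
    using w on_unit_measurable[OF f] by (intro borel_measurable_times borel_measurable_power) auto
  show "(\<lambda>x. w x * (on_unit (partial f n) x)\<^sup>2) \<in> borel_measurable N" for n
    using w on_unit_measurable[OF partial_in] by (intro borel_measurable_times borel_measurable_power) auto
  show "integrable N (\<lambda>x. (B\<^sup>2 * tr * ip f f) * \<bar>w x\<bar>)" using w by simp
  show "AE x in N. (\<lambda>n. w x * (on_unit (partial f n) x)\<^sup>2) \<longlonglongrightarrow> w x * (on_unit f x)\<^sup>2"
    using on_unit_partial_tendsto[OF f] by (intro AE_I2 tendsto_intros)
  show "AE x in N. norm (w x * (on_unit (partial f n) x)\<^sup>2) \<le> (B\<^sup>2 * tr * ip f f) * \<bar>w x\<bar>" for n
  proof (rule AE_I2)
    fix x
    have "(on_unit (partial f n) x)\<^sup>2 \<le> B\<^sup>2 * tr * ip f f"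
      using on_unit_square_le[OF partial_in, of f n x] ip_partial(2)[OF f, of n] tr_nonneg
      by (meson mult_left_mono mult_nonneg_nonneg order_trans zero_le_power2)
    then have "\<bar>w x\<bar> * (on_unit (partial f n) x)\<^sup>2 \<le> \<bar>w x\<bar> * (B\<^sup>2 * tr * ip f f)" by (intro mult_left_mono) auto
    then show "norm (w x * (on_unit (partial f n) x)\<^sup>2) \<le> (B\<^sup>2 * tr * ip f f) * \<bar>w x\<bar>"
      by (simp add: abs_mult mult.commute)
  qed
qed

text \<open>The Hilbert--Schmidt norm of the centred empirical Gram operator controls the empirical quadratic
  form uniformly over the whole space.\<close>

lemma quadratic_deviation:
  assumes wm: "w \<in> borel_measurable N" and w2: "integrable N (\<lambda>x. (w x)\<^sup>2)" and n: "n \<ge> 1" and \<delta>: "\<delta> > 0"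
  obtains E where "E \<in> events" "prob E \<le> B ^ 4 * (\<integral>x. (w x)\<^sup>2 \<partial>N) * tr\<^sup>2 / (real n * \<delta>)"
    "\<forall>\<omega>\<in>space M - E. \<forall>f\<in>H.
      \<bar>avg n (\<lambda>x. w x * (on_unit f x)\<^sup>2) \<omega> - (\<integral>x. w x * (on_unit f x)\<^sup>2 \<partial>N)\<bar> \<le> sqrt \<delta> * ip f f"
proof -
  define d where "d = (\<lambda>\<nu>. 1 + lam * gam \<nu>)"
  have dpos: "d \<nu> > 0" for \<nu> using denom_pos(1) by (simp add: d_def)
  define \<psi> where "\<psi> = (\<lambda>\<mu> \<nu> x. w x * (on_unit (hb \<mu>) x * on_unit (hb \<nu>) x))"
  define G where "G = (\<lambda>\<mu> \<nu> \<omega>. avg n (\<psi> \<mu> \<nu>) \<omega> - (\<integral>x. \<psi> \<mu> \<nu> x \<partial>N))"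
  \<comment> \<open>The squared Hilbert-Schmidt norm of the truncated matrix in coordinates
    normalized for \<open>ip\<close>. As the basis is bounded, each entry has second moment of order
    1/n, and the weights sum to at most the square of \<open>tr\<close>.\<close>
  define \<Gamma> where "\<Gamma> = (\<lambda>k \<omega>. \<Sum>(\<mu>, \<nu>)\<in>{..<k} \<times> {..<k}. (G \<mu> \<nu> \<omega>)\<^sup>2 / (d \<mu> * d \<nu>))"
  define w2e where "w2e = (\<integral>x. (w x)\<^sup>2 \<partial>N)"
  have w2e: "w2e \<ge> 0" unfolding w2e_def by (rule integral_nonneg_AE) simp
  have hbm: "on_unit (hb \<nu>) \<in> borel_measurable N" for \<nu> by (rule on_unit_measurable[OF hb_in])
  have w1: "integrable N w" by (rule N.square_expectation_le(1)[OF wm w2])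
  have \<psi>m: "\<psi> \<mu> \<nu> \<in> borel_measurable N" for \<mu> \<nu>
    unfolding \<psi>_def using wm hbm by (intro borel_measurable_times)
  have hb2: "(on_unit (hb \<mu>) x * on_unit (hb \<nu>) x)\<^sup>2 \<le> B ^ 4" for \<mu> \<nu> x
  proof -
    have "\<bar>on_unit (hb \<mu>) x * on_unit (hb \<nu>) x\<bar> \<le> B * B"
      unfolding abs_mult using B_nonneg' by (intro mult_mono on_unit_hb_le) auto
    then have "\<bar>on_unit (hb \<mu>) x * on_unit (hb \<nu>) x\<bar>\<^sup>2 \<le> (B * B)\<^sup>2" by (intro power_mono) auto
    then show ?thesis by (simp add: power2_eq_square power4_eq_xxxx mult_ac)
  qed
  have \<psi>sq: "(\<psi> \<mu> \<nu> x)\<^sup>2 \<le> B ^ 4 * (w x)\<^sup>2" for \<mu> \<nu> x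
    unfolding \<psi>_def power_mult_distrib[of "w x"] using mult_left_mono[OF hb2[of \<mu> x \<nu>], of "(w x)\<^sup>2"] by (simp add: mult.commute)
  have \<psi>2: "integrable N (\<lambda>x. (\<psi> \<mu> \<nu> x)\<^sup>2)" for \<mu> \<nu>
  proof (rule Bochner_Integration.integrable_bound)
    show "integrable N (\<lambda>x. B ^ 4 * (w x)\<^sup>2)" using w2 by simp
    show "(\<lambda>x. (\<psi> \<mu> \<nu> x)\<^sup>2) \<in> borel_measurable N" using \<psi>m by simp
    show "AE x in N. norm ((\<psi> \<mu> \<nu> x)\<^sup>2) \<le> norm (B ^ 4 * (w x)\<^sup>2)"
      using \<psi>sq by (intro AE_I2) (auto intro: order_trans[OF _ abs_ge_self])
  qed
  have \<psi>2le: "(\<integral>x. (\<psi> \<mu> \<nu> x)\<^sup>2 \<partial>N) \<le> B ^ 4 * w2e" for \<mu> \<nu>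
    using integral_mono[OF \<psi>2[of \<mu> \<nu>] integrable_mult_right[OF w2, of "B ^ 4"] \<psi>sq] by (simp add: w2e_def)
  have Gi: "integrable M (\<lambda>\<omega>. (G \<mu> \<nu> \<omega>)\<^sup>2)" and Gle: "(\<integral>\<omega>. (G \<mu> \<nu> \<omega>)\<^sup>2 \<partial>M) \<le> B ^ 4 * w2e / real n" for \<mu> \<nu>
    unfolding G_def by (rule sample_mean_variance[OF \<psi>m \<psi>2 n])
      (rule order_trans[OF sample_mean_variance(2)[OF \<psi>m \<psi>2 n] divide_right_mono[OF \<psi>2le]], simp)
  have Gm: "G \<mu> \<nu> \<in> borel_measurable M" for \<mu> \<nu>
    unfolding G_def using avg_measurable[OF \<psi>m] by simp
  have \<Gamma>m: "\<Gamma> k \<in> borel_measurable M" for k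
    unfolding \<Gamma>_def case_prod_beta using Gm by (intro borel_measurable_sum borel_measurable_divide borel_measurable_power) auto
  have \<Gamma>i: "integrable M (\<Gamma> k)" for k
    unfolding \<Gamma>_def case_prod_beta using Gi by (intro Bochner_Integration.integrable_sum) auto
  have \<Gamma>0: "\<Gamma> k \<omega> \<ge> 0" for k \<omega>
    unfolding \<Gamma>_def using dpos by (intro sum_nonneg) (auto intro!: divide_nonneg_pos)
  have \<Gamma>E: "(\<integral>\<omega>. \<Gamma> k \<omega> \<partial>M) \<le> B ^ 4 * w2e / real n * tr\<^sup>2" for k
  proof -
    have "(\<integral>\<omega>. \<Gamma> k \<omega> \<partial>M) = (\<Sum>p\<in>{..<k} \<times> {..<k}. (\<integral>\<omega>. (G (fst p) (snd p) \<omega>)\<^sup>2 \<partial>M) / (d (fst p) * d (snd p)))"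
      unfolding \<Gamma>_def case_prod_beta using Gi by (subst Bochner_Integration.integral_sum) auto
    also have "\<dots> \<le> (\<Sum>p\<in>{..<k} \<times> {..<k}. (B ^ 4 * w2e / real n) / (d (fst p) * d (snd p)))"
      using dpos Gle by (intro sum_mono divide_right_mono) (auto intro: less_imp_le)
    also have "\<dots> = (B ^ 4 * w2e / real n) * (\<Sum>p\<in>{..<k} \<times> {..<k}. (1 / d (fst p)) * (1 / d (snd p)))"
      by (simp add: sum_distrib_left)
    also have "(\<Sum>p\<in>{..<k} \<times> {..<k}. (1 / d (fst p)) * (1 / d (snd p))) = (\<Sum>\<nu><k. 1 / d \<nu>)\<^sup>2"
      unfolding power2_eq_square sum_product sum.cartesian_product by (simp add: case_prod_beta)
    also have "(B ^ 4 * w2e / real n) * (\<Sum>\<nu><k. 1 / d \<nu>)\<^sup>2 \<le> (B ^ 4 * w2e / real n) * tr\<^sup>2"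
    proof (intro mult_left_mono power_mono)
      show "(\<Sum>\<nu><k. 1 / d \<nu>) \<le> tr" using sum_denom_le_tr by (simp add: d_def)
      show "0 \<le> (\<Sum>\<nu><k. 1 / d \<nu>)" using dpos by (intro sum_nonneg) (auto intro: less_imp_le)
    qed (use w2e in simp)
    finally show ?thesis .
  qed
  define A where "A = (\<lambda>k. {\<omega> \<in> space M. \<Gamma> k \<omega> > \<delta>})"
  \<comment> \<open>The norms grow with the truncation, so one exceptional event serves all
    truncations and still has the probability bound common to each of them.\<close>
  define E where "E = (\<Union>k. A k)"
  have Am: "A k \<in> events" for k unfolding A_def using \<Gamma>m by measurable
  have Em: "E \<in> events" unfolding E_def using Am by auto
  have inc: "incseq A"
  proof (rule incseq_SucI)
    fix k
    have "\<Gamma> k \<omega> \<le> \<Gamma> (Suc k) \<omega>" for \<omega>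
      unfolding \<Gamma>_def using dpos by (intro sum_mono2) (auto intro!: divide_nonneg_pos)
    then show "A k \<subseteq> A (Suc k)" unfolding A_def by (auto intro: less_le_trans)
  qed
  have PA: "prob (A k) \<le> B ^ 4 * w2e * tr\<^sup>2 / (real n * \<delta>)" for k
  proof -
    have "prob (A k) \<le> prob {\<omega> \<in> space M. \<Gamma> k \<omega> \<ge> \<delta>}"
      unfolding A_def using \<Gamma>m by (intro finite_measure_mono) auto
    also have "\<dots> \<le> (\<integral>\<omega>. \<Gamma> k \<omega> \<partial>M) / \<delta>"
      by (rule integral_Markov_inequality_measure[OF \<Gamma>i, of "{}", simplified]) (use \<Gamma>0 \<delta> in auto)
    also have "\<dots> \<le> (B ^ 4 * w2e / real n * tr\<^sup>2) / \<delta>" using \<Gamma>E \<delta> by (intro divide_right_mono) auto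
    finally show ?thesis by (simp add: field_simps)
  qed
  have "(\<lambda>k. prob (A k)) \<longlonglongrightarrow> prob E"
    unfolding E_def by (rule finite_Lim_measure_incseq) (use Am inc in auto)
  then have PE: "prob E \<le> B ^ 4 * w2e * tr\<^sup>2 / (real n * \<delta>)" using PA by (intro LIMSEQ_le_const2) auto
  have main: "\<bar>avg n (\<lambda>x. w x * (on_unit f x)\<^sup>2) \<omega> - (\<integral>x. w x * (on_unit f x)\<^sup>2 \<partial>N)\<bar> \<le> sqrt \<delta> * ip f f"
    if \<omega>: "\<omega> \<in> space M - E" and f: "f \<in> H" for \<omega> f
  proof -
    define L where "L = (\<lambda>k. avg n (\<lambda>x. w x * (on_unit (partial f k) x)\<^sup>2) \<omega> - (\<integral>x. w x * (on_unit (partial f k) x)\<^sup>2 \<partial>N))"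
    have "(\<lambda>k. avg n (\<lambda>x. w x * (on_unit (partial f k) x)\<^sup>2) \<omega>) \<longlonglongrightarrow> avg n (\<lambda>x. w x * (on_unit f x)\<^sup>2) \<omega>"
      unfolding avg_def divide_inverse by (intro tendsto_intros on_unit_partial_tendsto f)
    then have lim: "L \<longlonglongrightarrow> avg n (\<lambda>x. w x * (on_unit f x)\<^sup>2) \<omega> - (\<integral>x. w x * (on_unit f x)\<^sup>2 \<partial>N)"
      unfolding L_def by (intro tendsto_diff integral_partial_tendsto f w1)
    have "\<bar>L k\<bar> \<le> sqrt \<delta> * ip f f" for k
    proof -
      let ?I = "{..<k} \<times> {..<k}"
      let ?c = "\<lambda>p. coef f (fst p) * coef f (snd p)"
      have sq: "w x * (on_unit (partial f k) x)\<^sup>2 = (\<Sum>p\<in>?I. ?c p * \<psi> (fst p) (snd p) x)" for x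
        unfolding on_unit_partial power2_eq_square sum_product sum.cartesian_product \<psi>_def
        by (simp add: sum_distrib_left case_prod_beta mult_ac)
      have a: "avg n (\<lambda>x. w x * (on_unit (partial f k) x)\<^sup>2) \<omega> = (\<Sum>p\<in>?I. ?c p * avg n (\<psi> (fst p) (snd p)) \<omega>)"
        unfolding sq avg_def
        by (subst sum.swap) (simp only: sum_distrib_left[symmetric] times_divide_eq_right sum_divide_distrib[symmetric])
      have \<psi>1: "integrable N (\<psi> \<mu> \<nu>)" for \<mu> \<nu> by (rule N.square_expectation_le(1)[OF \<psi>m \<psi>2])
      have b: "(\<integral>x. w x * (on_unit (partial f k) x)\<^sup>2 \<partial>N) = (\<Sum>p\<in>?I. ?c p * (\<integral>x. \<psi> (fst p) (snd p) x \<partial>N))"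
        unfolding sq using \<psi>1 by (subst Bochner_Integration.integral_sum) auto
      have "L k = (\<Sum>p\<in>?I. ?c p * G (fst p) (snd p) \<omega>)"
        unfolding L_def a b G_def by (simp add: sum_subtractf right_diff_distrib)
      \<comment> \<open>The weights are inserted so that Cauchy-Schwarz separates the norm of
        \<open>f\<close> from a random factor that does not involve \<open>f\<close>; this is where
        the uniformity comes from.\<close>
      also have "\<dots> = (\<Sum>p\<in>?I. (?c p * sqrt (d (fst p) * d (snd p))) * (G (fst p) (snd p) \<omega> / sqrt (d (fst p) * d (snd p))))"
      proof (rule sum.cong[OF refl])
        fix p
        have "d \<nu> \<noteq> 0" for \<nu> using dpos[of \<nu>] by simp
        then show "?c p * G (fst p) (snd p) \<omega> = (?c p * sqrt (d (fst p) * d (snd p))) * (G (fst p) (snd p) \<omega> / sqrt (d (fst p) * d (snd p)))"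
          by simp
      qed
      finally have "(L k)\<^sup>2 \<le> (\<Sum>p\<in>?I. (?c p * sqrt (d (fst p) * d (snd p)))\<^sup>2) * (\<Sum>p\<in>?I. (G (fst p) (snd p) \<omega> / sqrt (d (fst p) * d (snd p)))\<^sup>2)"
        by (simp only: Cauchy_Schwarz_ineq_sum)
      also have "(\<Sum>p\<in>?I. (?c p * sqrt (d (fst p) * d (snd p)))\<^sup>2) = (\<Sum>\<nu><k. d \<nu> * (coef f \<nu>)\<^sup>2)\<^sup>2"
        unfolding power2_eq_square[of "sum _ _"] sum_product sum.cartesian_product
      proof (rule sum.cong[OF refl])
        fix p
        have "(sqrt (d (fst p) * d (snd p)))\<^sup>2 = d (fst p) * d (snd p)" using dpos by (intro real_sqrt_pow2 mult_nonneg_nonneg less_imp_le)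
        then show "(?c p * sqrt (d (fst p) * d (snd p)))\<^sup>2 = (case p of (i, j) => d i * (coef f i)\<^sup>2 * (d j * (coef f j)\<^sup>2))"
          unfolding power_mult_distrib by (simp add: case_prod_beta)
      qed
      also have "(\<Sum>p\<in>?I. (G (fst p) (snd p) \<omega> / sqrt (d (fst p) * d (snd p)))\<^sup>2) = \<Gamma> k \<omega>"
        unfolding \<Gamma>_def
      proof (rule sum.cong[OF refl])
        fix p
        have "(sqrt (d (fst p) * d (snd p)))\<^sup>2 = d (fst p) * d (snd p)" using dpos by (intro real_sqrt_pow2 mult_nonneg_nonneg less_imp_le)
        then show "(G (fst p) (snd p) \<omega> / sqrt (d (fst p) * d (snd p)))\<^sup>2 = (case p of (\<mu>, \<nu>) => (G \<mu> \<nu> \<omega>)\<^sup>2 / (d \<mu> * d \<nu>))"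
          unfolding power_divide by (simp add: case_prod_beta)
      qed
      also have "(\<Sum>\<nu><k. d \<nu> * (coef f \<nu>)\<^sup>2)\<^sup>2 * \<Gamma> k \<omega> \<le> (ip f f)\<^sup>2 * \<delta>"
      proof (intro mult_mono power_mono)
        show "(\<Sum>\<nu><k. d \<nu> * (coef f \<nu>)\<^sup>2) \<le> ip f f" using ip_partial[OF f, of k] by (simp add: d_def)
        show "\<Gamma> k \<omega> \<le> \<delta>" using \<omega> by (auto simp: E_def A_def not_less)
        show "0 \<le> (\<Sum>\<nu><k. d \<nu> * (coef f \<nu>)\<^sup>2)"
          by (intro sum_nonneg mult_nonneg_nonneg less_imp_le[OF dpos]) simp
      qed (use \<Gamma>0 in auto)
      finally have "(L k)\<^sup>2 \<le> (ip f f)\<^sup>2 * \<delta>" .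
      then have "sqrt ((L k)\<^sup>2) \<le> sqrt ((ip f f)\<^sup>2 * \<delta>)" by (rule real_sqrt_le_mono)
      then show ?thesis using ip_nonneg[OF f] by (simp add: real_sqrt_mult mult.commute)
    qed
    then show ?thesis using tendsto_rabs[OF lim] by (intro LIMSEQ_le_const2) auto
  qed
  show thesis by (rule that[OF Em]) (use PE main in \<open>auto simp: w2e_def\<close>)
qed

end

text \<open>As functions of one observation, \<open>e\<close> is the score, \<open>w2\<close> minus
  the second derivative at \<open>g0\<close>, and \<open>w3\<close> an envelope of the third
  derivative. Conditional moment assumptions enter only as integrals against functions of the
  design; the score and the Hessian both represent \<open>V\<close>.\<close>

locale plrt_sample = design_sample M N X H V J lam hb gam K W B
  for M :: "'w measure" and N :: "(real \<times> real) measure" and X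
    and H V J lam hb gam K W B +
  fixes e w2 w3 :: "real \<times> real => real" and C3 :: real and g0 :: "real => real"
  assumes e_L4: "L4 N e"
    and w2_measurable: "w2 \<in> borel_measurable N" and w2_square: "integrable N (\<lambda>x. (w2 x)\<^sup>2)"
    and w3_measurable: "w3 \<in> borel_measurable N" and w3_square: "integrable N (\<lambda>x. (w3 x)\<^sup>2)"
    and w3_nonneg: "\<And>x. w3 x \<ge> 0"
    and e_mean: "\<And>f. f \<in> H ==> (\<integral>x. e x * on_unit f x \<partial>N) = 0"
    and e_square: "\<And>f g. f \<in> H ==> g \<in> H ==> (\<integral>x. (e x)\<^sup>2 * (on_unit f x * on_unit g x) \<partial>N) = V f g"
    and w2_form: "\<And>f. f \<in> H ==> (\<integral>x. w2 x * (on_unit f x)\<^sup>2 \<partial>N) = V f f"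
    and w3_form: "\<And>f. f \<in> H ==> (\<integral>x. w3 x * (on_unit f x)\<^sup>2 \<partial>N) \<le> C3 * V f f"
    and C3_nonneg: "C3 \<ge> 0"
    and g0_in: "g0 \<in> H"
begin

lemma e_measurable: "e \<in> borel_measurable N"
  by (rule L4_measurable[OF e_L4])

lemma integrable_e2: "integrable N (\<lambda>x. (e x)\<^sup>2)"
  by (rule N.L4_integrable_square[OF e_L4])

definition kern :: "real \<times> real => real \<times> real => real" where
  "kern x y = (if snd x \<in> {0..1} \<and> snd y \<in> {0..1} then K (snd x) (snd y) else 0)"

lemma kern_tendsto:
  "(\<lambda>n. \<Sum>\<nu><n. on_unit (hb \<nu>) x * on_unit (hb \<nu>) y / (1 + lam * gam \<nu>)) \<longlonglongrightarrow> kern x y"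
proof (cases "snd x \<in> {0..1} \<and> snd y \<in> {0..1}")
  case True
  then show ?thesis using K_sums[of "snd x" "snd y"] by (simp add: sums_def on_unit_def kern_def)
next
  case False
  then have z: "on_unit (hb \<nu>) x * on_unit (hb \<nu>) y = 0" for \<nu> by (auto simp: on_unit_def)
  have k: "kern x y = 0" unfolding kern_def using False by (simp only: if_False)
  show ?thesis by (simp only: z k div_0 sum.neutral_const tendsto_const)
qed

lemma K_sym: "z \<in> {0..1} ==> w \<in> {0..1} ==> K z w = K w z"
  using K_sums[of z w] K_sums[of w z] by (simp add: mult.commute sums_unique2)

lemma kern_sym: "kern x y = kern y x"
  using K_sym by (simp add: kern_def)

lemma kern_bound: "\<bar>kern x y\<bar> \<le> B\<^sup>2 * tr"
  using K_bound[of "snd x" "snd y"] tr_nonneg by (auto simp: kern_def)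

text \<open>The reproducing kernel is given only section by section; joint measurability comes from
  its spectral expansion, a pointwise limit of finite sums of products.\<close>

lemma kern_measurable: "case_prod kern \<in> borel_measurable (N \<Otimes>\<^sub>M N)"
proof -
  have "(\<lambda>p. kern (fst p) (snd p)) \<in> borel_measurable (N \<Otimes>\<^sub>M N)"
  proof (rule borel_measurable_LIMSEQ_real[OF kern_tendsto])
    show "(\<lambda>p. \<Sum>\<nu><n. on_unit (hb \<nu>) (fst p) * on_unit (hb \<nu>) (snd p) / (1 + lam * gam \<nu>)) \<in> borel_measurable (N \<Otimes>\<^sub>M N)" for n
      by (intro borel_measurable_sum borel_measurable_divide borel_measurable_times borel_measurable_const
          measurable_compose[OF measurable_fst on_unit_measurable[OF hb_in]]
          measurable_compose[OF measurable_snd on_unit_measurable[OF hb_in]])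
  qed
  then show ?thesis by (simp only: case_prod_beta')
qed

lemma kern_section: "snd y \<in> {0..1} ==> kern x y = on_unit (K (snd y)) x"
  using K_sym by (auto simp: kern_def on_unit_def)

lemma kern_X: "i \<ge> 1 ==> j \<ge> 1 ==> \<omega> \<in> space M ==> kern (X i \<omega>) (X j \<omega>) = K (snd (X i \<omega>)) (snd (X j \<omega>))"
  using X_unit by (simp add: kern_def)

definition kk :: "real \<times> real => real \<times> real => real" where
  "kk x y = e x * e y * kern x y"

lemma degenerate_kernel_kk: "degenerate_kernel M N X kk (\<lambda>x. sqrt (B\<^sup>2 * tr) * \<bar>e x\<bar>)"
proof
  have Bt: "B\<^sup>2 * tr \<ge> 0" using tr_nonneg by simp
  have "(\<lambda>p. e (fst p) * e (snd p) * case_prod kern p) \<in> borel_measurable (N \<Otimes>\<^sub>M N)"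
    by (intro borel_measurable_times kern_measurable measurable_compose[OF measurable_fst e_measurable]
        measurable_compose[OF measurable_snd e_measurable])
  then show "case_prod kk \<in> borel_measurable (N \<Otimes>\<^sub>M N)" by (simp only: case_prod_beta' kk_def)
  have "L4 N (\<lambda>x. \<bar>e x\<bar>)" by (rule L4_bound[OF e_L4]) (use e_measurable in simp_all)
  then show "L4 N (\<lambda>x. sqrt (B\<^sup>2 * tr) * \<bar>e x\<bar>)" by (rule L4_cmult)
  show "0 \<le> sqrt (B\<^sup>2 * tr) * \<bar>e x\<bar>" for x using Bt by simp
  show "\<bar>kk x y\<bar> \<le> sqrt (B\<^sup>2 * tr) * \<bar>e x\<bar> * (sqrt (B\<^sup>2 * tr) * \<bar>e y\<bar>)" for x y
  proof -
    have "\<bar>e x * e y\<bar> * \<bar>kern x y\<bar> \<le> \<bar>e x * e y\<bar> * (sqrt (B\<^sup>2 * tr) * sqrt (B\<^sup>2 * tr))"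
      using kern_bound[of x y] Bt by (intro mult_left_mono) auto
    then show ?thesis unfolding kk_def abs_mult by (simp only: mult_ac)
  qed
  show "kk x y = kk y x" for x y using kern_sym[of x y] by (simp add: kk_def mult_ac)
  show "(\<integral>x. kk x y \<partial>N) = 0" for y
  proof (cases "snd y \<in> {0..1}")
    case True
    have "kk x y = e y * (e x * on_unit (K (snd y)) x)" for x
      using kern_section[OF True] by (simp add: kk_def mult_ac)
    then show ?thesis using e_mean[OF K_in[OF True]] by simp
  next
    case False
    then have "kk x y = 0" for x unfolding kk_def kern_def by (simp only: simp_thms if_False mult_zero_right)
    then show ?thesis by simp
  qed
qed

sublocale Q: degenerate_kernel M N X kk "\<lambda>x. sqrt (B\<^sup>2 * tr) * \<bar>e x\<bar>"
  by (rule degenerate_kernel_kk)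

lemma integral_e2_tendsto:
  assumes m: "\<And>n. F n \<in> borel_measurable N" "F' \<in> borel_measurable N"
    and lim: "\<And>x. (\<lambda>n. F n x) \<longlonglongrightarrow> F' x" and b: "\<And>n x. \<bar>F n x\<bar> \<le> C"
  shows "(\<lambda>n. \<integral>x. (e x)\<^sup>2 * F n x \<partial>N) \<longlonglongrightarrow> (\<integral>x. (e x)\<^sup>2 * F' x \<partial>N)"
proof (rule integral_dominated_convergence)
  show "integrable N (\<lambda>x. C * (e x)\<^sup>2)" using integrable_e2 by simp
  show "AE x in N. (\<lambda>n. (e x)\<^sup>2 * F n x) \<longlonglongrightarrow> (e x)\<^sup>2 * F' x" by (intro AE_I2 tendsto_intros lim)
  show "AE x in N. norm ((e x)\<^sup>2 * F n x) \<le> C * (e x)\<^sup>2" for n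
    using b[of n] by (intro AE_I2) (simp add: abs_mult mult.commute mult_right_mono)
qed (use m e_measurable in \<open>auto intro!: borel_measurable_times borel_measurable_power\<close>)

lemma integral_e2_hb: "(\<integral>x. (e x)\<^sup>2 * (on_unit (hb \<nu>) x)\<^sup>2 \<partial>N) = 1"
  using e_square[OF hb_in hb_in, of \<nu> \<nu>] by (simp add: V_orth power2_eq_square)

text \<open>Since the weighted squares of the basis functions integrate to 1, the coefficients
  themselves sum to the integral; their domination by the trace weights gives the bounded majorant.
  Applied with the first, second and fourth powers of
  \<open>1 / (1 + lam * gam \<nu>)\<close>.\<close>

lemma integral_e2_sums:
  assumes c: "\<And>\<nu>. 0 \<le> c \<nu>" "\<And>\<nu>. c \<nu> \<le> 1 / (1 + lam * gam \<nu>)"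
    and F: "\<And>x. (\<lambda>\<nu>. c \<nu> * (on_unit (hb \<nu>) x)\<^sup>2) sums F x"
  shows "c sums (\<integral>x. (e x)\<^sup>2 * F x \<partial>N)"
proof -
  have hbm: "on_unit (hb \<nu>) \<in> borel_measurable N" for \<nu> by (rule on_unit_measurable[OF hb_in])
  define P where "P = (\<lambda>n x. \<Sum>\<nu><n. c \<nu> * (on_unit (hb \<nu>) x)\<^sup>2)"
  have Pm: "P n \<in> borel_measurable N" for n
    unfolding P_def using hbm by (intro borel_measurable_sum borel_measurable_times borel_measurable_power) auto
  have lim: "(\<lambda>n. P n x) \<longlonglongrightarrow> F x" for x using F by (simp add: P_def sums_def)
  have hb2: "(on_unit (hb \<nu>) x)\<^sup>2 \<le> B\<^sup>2" for \<nu> x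
    using power_mono[OF on_unit_hb_le[of \<nu> x], of 2] by simp
  have Pb: "\<bar>P n x\<bar> \<le> B\<^sup>2 * tr" for n x
  proof -
    have "P n x \<ge> 0" unfolding P_def using c by (intro sum_nonneg mult_nonneg_nonneg) auto
    moreover have "P n x \<le> (\<Sum>\<nu><n. 1 / (1 + lam * gam \<nu>) * B\<^sup>2)"
      unfolding P_def using c hb2 inverse_denom_nonneg by (intro sum_mono mult_mono) auto
    moreover have "(\<Sum>\<nu><n. 1 / (1 + lam * gam \<nu>) * B\<^sup>2) \<le> tr * B\<^sup>2"
      unfolding sum_distrib_right[symmetric] by (intro mult_right_mono sum_denom_le_tr) simp
    ultimately show ?thesis by (simp add: mult.commute)
  qed
  have Fm: "F \<in> borel_measurable N" by (rule borel_measurable_LIMSEQ_real[OF lim Pm])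
  have "(\<lambda>n. \<integral>x. (e x)\<^sup>2 * P n x \<partial>N) \<longlonglongrightarrow> (\<integral>x. (e x)\<^sup>2 * F x \<partial>N)"
    by (rule integral_e2_tendsto[OF Pm Fm lim Pb])
  moreover have "(\<integral>x. (e x)\<^sup>2 * P n x \<partial>N) = (\<Sum>\<nu><n. c \<nu>)" for n
  proof -
    have i: "integrable N (\<lambda>x. (e x)\<^sup>2 * (on_unit (hb \<nu>) x)\<^sup>2)" for \<nu>
      by (rule integrable_weight_bounded[OF integrable_e2, where C = "B\<^sup>2"]) (use hbm hb2 in auto)
    have "(e x)\<^sup>2 * P n x = (\<Sum>\<nu><n. c \<nu> * ((e x)\<^sup>2 * (on_unit (hb \<nu>) x)\<^sup>2))" for x
      by (simp add: P_def sum_distrib_left mult_ac)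
    then have "(\<integral>x. (e x)\<^sup>2 * P n x \<partial>N) = (\<Sum>\<nu><n. \<integral>x. c \<nu> * ((e x)\<^sup>2 * (on_unit (hb \<nu>) x)\<^sup>2) \<partial>N)"
      using i by (simp only:) (rule Bochner_Integration.integral_sum, simp)
    then show ?thesis by (simp add: integral_e2_hb)
  qed
  ultimately show ?thesis by (simp add: sums_def)
qed

lemma denom_power_le: "k \<ge> 1 ==> 1 / (1 + lam * gam \<nu>) ^ k \<le> 1 / (1 + lam * gam \<nu>)"
  using denom_pos[of \<nu>] self_le_power[of "1 + lam * gam \<nu>" k] by (intro divide_left_mono) auto

lemma kern_diag_sums: "(\<lambda>\<nu>. 1 / (1 + lam * gam \<nu>)) sums (\<integral>x. (e x)\<^sup>2 * kern x x \<partial>N)"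
  by (rule integral_e2_sums[OF inverse_denom_nonneg order_refl])
    (use kern_tendsto in \<open>simp add: sums_def power2_eq_square\<close>)

lemma kern_diag_integral: "(\<integral>x. (e x)\<^sup>2 * kern x x \<partial>N) = tr"
  unfolding tr_def by (rule sums_unique[OF kern_diag_sums])

lemma k2_inner: "(\<integral>x. (kk x y)\<^sup>2 \<partial>N) = (e y)\<^sup>2 * (indicator {0..1} (snd y) * V (K (snd y)) (K (snd y)))"
proof (cases "snd y \<in> {0..1}")
  case True
  have "(kk x y)\<^sup>2 = (e y)\<^sup>2 * ((e x)\<^sup>2 * (on_unit (K (snd y)) x * on_unit (K (snd y)) x))" for x
    using kern_section[OF True, of x] by (simp add: kk_def power2_eq_square mult_ac)
  then show ?thesis using e_square[OF K_in[OF True] K_in[OF True]] True by simp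
next
  case False
  then have "kk x y = 0" for x unfolding kk_def kern_def by (simp only: simp_thms if_False mult_zero_right)
  then show ?thesis using False by simp
qed

lemma k2_sums: "(\<lambda>\<nu>. 1 / (1 + lam * gam \<nu>)\<^sup>2) sums Q.k2"
proof -
  have "(\<lambda>\<nu>. 1 / (1 + lam * gam \<nu>)\<^sup>2) sums (\<integral>y. (e y)\<^sup>2 * (indicator {0..1} (snd y) * V (K (snd y)) (K (snd y))) \<partial>N)"
  proof (rule integral_e2_sums)
    show "0 \<le> 1 / (1 + lam * gam \<nu>)\<^sup>2" for \<nu> by simp
    show "1 / (1 + lam * gam \<nu>)\<^sup>2 \<le> 1 / (1 + lam * gam \<nu>)" for \<nu> by (rule denom_power_le) simp
    show "(\<lambda>\<nu>. 1 / (1 + lam * gam \<nu>)\<^sup>2 * (on_unit (hb \<nu>) x)\<^sup>2) sums (indicator {0..1} (snd x) * V (K (snd x)) (K (snd x)))" for x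
      using V_K_sums[of "snd x"] by (cases "snd x \<in> {0..1}") (simp_all add: on_unit_def)
  qed
  then show ?thesis unfolding Q.k2_def k2_inner .
qed

text \<open>As \<open>V f (K z) = (f - W f) z\<close>, the iterated kernel is the kernel of the operator \<open>id - W\<close>.\<close>

lemma V_K_eq:
  assumes f: "f \<in> H" and z: "z \<in> {0..1}"
  shows "V f (K z) = f z - W f z"
proof -
  have "V f (K z) = ip f (K z) - lam * J f (K z)" by (simp add: ip_def)
  also have "\<dots> = ip (K z) f - ip (W f) (K z)" using W_rep[OF f K_in[OF z]] ip_sym by simp
  also have "\<dots> = f z - W f z" using K_rep[OF z f] K_rep[OF z W_in[OF f]] ip_sym[of "W f"] by simp
  finally show ?thesis .
qed

lemma g_eq:
  assumes "snd y \<in> {0..1}"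
  shows "Q.g x y = e y * (e x * on_unit (\<lambda>z. K (snd y) z - W (K (snd y)) z) x)"
proof (cases "snd x \<in> {0..1}")
  case True
  have "kk x v * kk y v = e x * e y * ((e v)\<^sup>2 * (on_unit (K (snd y)) v * on_unit (K (snd x)) v))" for v
    using kern_section[OF assms, of v] kern_section[OF True, of v] kern_sym[of x v] kern_sym[of y v]
    by (simp add: kk_def power2_eq_square mult_ac)
  then have "Q.g x y = e x * e y * V (K (snd y)) (K (snd x))"
    unfolding Q.g_def using e_square[OF K_in[OF assms] K_in[OF True]] by simp
  then show ?thesis using V_K_eq[OF K_in[OF assms] True] True by (simp add: on_unit_def)
next
  case False
  then have "kk x v = 0" for v unfolding kk_def kern_def by (simp only: simp_thms if_False mult_zero_right)
  then show ?thesis using False by (simp add: Q.g_def on_unit_def)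
qed

text \<open>Applying \<open>id - W\<close> to the kernel squares the weights of its expansion, so
  \<open>g2\<close> is the sum of their fourth powers and \<open>k2\<close> that of their squares;
  the weights are at most 1. The consequence needed later is that \<open>g2 / k2^2\<close> is at
  most \<open>1 / k2\<close>, hence of order h.\<close>

lemma g2_le: "Q.g2 \<le> Q.k2"
proof -
  define R where "R = (\<lambda>z x. K z x - W (K z) x)"
  have Rin: "R z \<in> H" if "z \<in> {0..1}" for z
    unfolding R_def using K_in[OF that] W_in by (intro H_diff) auto
  have cR: "coef (R z) \<nu> = hb \<nu> z / (1 + lam * gam \<nu>)\<^sup>2" if z: "z \<in> {0..1}" for z \<nu>
  proof -
    have "coef (R z) \<nu> = coef (K z) \<nu> - coef (W (K z)) \<nu>"
      using V_linear[OF K_in[OF z] W_in[OF K_in[OF z]] hb_in, of 1 "-1" \<nu>] by (simp add: coef_def R_def)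
    also have "\<dots> = hb \<nu> z / (1 + lam * gam \<nu>)\<^sup>2"
    proof -
      have "a / d - (d - 1) / d * (a / d) = a / d\<^sup>2" if "d > 0" for a d :: real
        using that by (simp add: field_simps power2_eq_square)
      from this[OF denom_pos(1), of "hb \<nu> z" \<nu>] show ?thesis unfolding coef_W[OF K_in[OF z]] coef_K[OF z] by simp
    qed
    finally show ?thesis .
  qed
  have inner: "(\<integral>x. (Q.g x y)\<^sup>2 \<partial>N) = (e y)\<^sup>2 * (indicator {0..1} (snd y) * V (R (snd y)) (R (snd y)))" for y
  proof (cases "snd y \<in> {0..1}")
    case True
    have "(Q.g x y)\<^sup>2 = (e y)\<^sup>2 * ((e x)\<^sup>2 * (on_unit (R (snd y)) x * on_unit (R (snd y)) x))" for x
      unfolding g_eq[OF True] R_def by (simp add: power2_eq_square mult_ac)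
    then show ?thesis using e_square[OF Rin[OF True] Rin[OF True]] True by simp
  next
    case False
    then have "kk y v = 0" for v unfolding kk_def kern_def by (simp only: simp_thms if_False mult_zero_right)
    then show ?thesis using False by (simp add: Q.g_def)
  qed
  have s: "(\<lambda>\<nu>. 1 / (1 + lam * gam \<nu>) ^ 4) sums Q.g2"
    unfolding Q.g2_def inner
  proof (rule integral_e2_sums)
    show "0 \<le> 1 / (1 + lam * gam \<nu>) ^ 4" for \<nu> by simp
    show "1 / (1 + lam * gam \<nu>) ^ 4 \<le> 1 / (1 + lam * gam \<nu>)" for \<nu> by (rule denom_power_le) simp
    show "(\<lambda>\<nu>. 1 / (1 + lam * gam \<nu>) ^ 4 * (on_unit (hb \<nu>) x)\<^sup>2) sums (indicator {0..1} (snd x) * V (R (snd x)) (R (snd x)))" for x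
    proof (cases "snd x \<in> {0..1}")
      case True
      have "1 / (1 + lam * gam \<nu>) ^ 4 * (on_unit (hb \<nu>) x)\<^sup>2 = coef (R (snd x)) \<nu> * coef (R (snd x)) \<nu>" for \<nu>
        unfolding cR[OF True] using True by (simp add: on_unit_def power2_eq_square power4_eq_xxxx)
      then show ?thesis using V_sums[OF Rin[OF True] Rin[OF True]] True by simp
    qed (simp add: on_unit_def)
  qed
  show ?thesis
  proof (rule sums_le[OF _ s k2_sums])
    fix \<nu>
    have "(1 + lam * gam \<nu>)\<^sup>2 \<le> (1 + lam * gam \<nu>) ^ 4"
      using denom_pos(2)[of \<nu>] by (intro power_increasing) auto
    then show "1 / (1 + lam * gam \<nu>) ^ 4 \<le> 1 / (1 + lam * gam \<nu>)\<^sup>2"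
      using denom_pos(1)[of \<nu>] by (intro divide_left_mono) auto
  qed
qed

text \<open>The plain supremum bound on the kernel, of order h^(-4) in total. Divided by n times the
  square of \<open>k2\<close>, which is at least of order h^(-2), it leaves 1 / (n h^2).\<close>

lemma k4_le: "Q.k4 \<le> (B\<^sup>2 * tr) ^ 4 * (\<integral>x. e x ^ 4 \<partial>N)\<^sup>2"
proof -
  let ?m = "\<integral>x. e x ^ 4 \<partial>N" and ?b = "(B\<^sup>2 * tr) ^ 4"
  have e4: "integrable N (\<lambda>x. e x ^ 4)" using e_L4 by (simp add: L4_def)
  have pt: "kk x y ^ 4 \<le> ?b * e y ^ 4 * e x ^ 4" for x y
  proof -
    have "kern x y ^ 4 \<le> ?b" using power_mono[OF kern_bound[of x y], of 4] by simp
    then have "(e x * e y) ^ 4 * kern x y ^ 4 \<le> (e x * e y) ^ 4 * ?b" by (intro mult_left_mono) auto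
    then show ?thesis by (simp only: kk_def power_mult_distrib mult_ac)
  qed
  have inner: "(\<integral>x. kk x y ^ 4 \<partial>N) \<le> ?b * e y ^ 4 * ?m" for y
  proof -
    have "(\<integral>x. kk x y ^ 4 \<partial>N) \<le> (\<integral>x. ?b * e y ^ 4 * e x ^ 4 \<partial>N)"
      using Q.L4_section[of y] e4 pt by (intro integral_mono) (auto simp: L4_def space_N)
    then show ?thesis by simp
  qed
  have "Q.k4 \<le> (\<integral>y. ?b * e y ^ 4 * ?m \<partial>N)"
    unfolding Q.k4_def using Q.integrable_k4_section inner e4 by (intro integral_mono) auto
  then show ?thesis by (simp add: power2_eq_square mult_ac)
qed

text \<open>The Riesz representer, for \<open>ip\<close>, of the score functional on the sample; the
  penalty adds \<open>- W g0\<close> to it.\<close>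

definition A :: "nat => 'w => real => real" where
  "A n \<omega> = (\<lambda>z. \<Sum>i\<in>{1..<Suc n}. (e (X i \<omega>) / real n) * K (snd (X i \<omega>)) z)"

definition S :: "nat => 'w => real => real" where
  "S n \<omega> = (\<lambda>z. A n \<omega> z - W g0 z)"

lemma A_in: "\<omega> \<in> space M ==> A n \<omega> \<in> H"
  unfolding A_def using X_unit by (intro H_sum K_in) auto

lemma S_in: "\<omega> \<in> space M ==> S n \<omega> \<in> H"
  unfolding S_def using A_in W_in[OF g0_in] by (intro H_diff)

lemma ip_A:
  assumes \<omega>: "\<omega> \<in> space M" and f: "f \<in> H"
  shows "ip (A n \<omega>) f = avg n (\<lambda>x. e x * on_unit f x) \<omega>"
proof -
  have "ip (A n \<omega>) f = (\<Sum>i\<in>{1..<Suc n}. (e (X i \<omega>) / real n) * ip (K (snd (X i \<omega>))) f)"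
    unfolding A_def
    using form_sum[OF psd_form_ip _ _ f, of "{1..<Suc n}" "\<lambda>i. K (snd (X i \<omega>))" "\<lambda>i. e (X i \<omega>) / real n"]
      K_in X_unit[OF _ \<omega>] by simp
  also have "\<dots> = (\<Sum>i\<in>{1..<Suc n}. e (X i \<omega>) * on_unit f (X i \<omega>) / real n)"
    using X_unit[OF _ \<omega>] f on_unit_X[OF _ \<omega>] by (intro sum.cong) (auto simp: K_rep)
  finally show ?thesis by (simp only: avg_def sum_divide_distrib)
qed

lemma ip_S:
  assumes \<omega>: "\<omega> \<in> space M" and f: "f \<in> H"
  shows "ip (S n \<omega>) f = avg n (\<lambda>x. e x * on_unit f x) \<omega> - lam * J g0 f"
  using ip_linear[OF A_in[OF \<omega>, of n] W_in[OF g0_in] f, of 1 "-1"] ip_A[OF \<omega> f, of n] W_rep[OF g0_in f]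
  by (simp add: S_def)

text \<open>The reproducing property turns the norm into a double sum over the sample; symmetry
  collects it into the diagonal and twice the sum over pairs, which is the degenerate
  U-statistic.\<close>

lemma ip_A_A:
  assumes \<omega>: "\<omega> \<in> space M" and n: "n \<ge> 1"
  shows "real n * ip (A n \<omega>) (A n \<omega>) = avg n (\<lambda>x. (e x)\<^sup>2 * kern x x) \<omega> + 2 / real n * Q.psum (Suc n) (obs \<omega>)"
proof -
  define a where "a = (\<lambda>i j. kk (X i \<omega>) (X j \<omega>))"
  have asym: "a i j = a j i" for i j using Q.k_sym by (simp add: a_def)
  have dbl: "(\<Sum>i\<in>{1..<m}. \<Sum>j\<in>{1..<m}. a i j) = (\<Sum>i\<in>{1..<m}. a i i) + 2 * (\<Sum>l\<in>{1..<m}. \<Sum>i\<in>{1..<l}. a i l)" for m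
  proof (induction m)
    case (Suc m)
    show ?case
    proof (cases "m = 0")
      case False
      then have m: "{1..<Suc m} = insert m {1..<m}" by auto
      have "(\<Sum>i\<in>{1..<Suc m}. \<Sum>j\<in>{1..<Suc m}. a i j)
         = a m m + (\<Sum>j\<in>{1..<m}. a m j) + ((\<Sum>i\<in>{1..<m}. a i m) + (\<Sum>i\<in>{1..<m}. \<Sum>j\<in>{1..<m}. a i j))"
        unfolding m by (simp add: sum.distrib)
      also have "(\<Sum>j\<in>{1..<m}. a m j) = (\<Sum>i\<in>{1..<m}. a i m)" using asym by simp
      finally show ?thesis unfolding Suc unfolding m by simp
    qed simp
  qed simp
  have AX: "on_unit (A n \<omega>) (X i \<omega>) = (\<Sum>j\<in>{1..<Suc n}. e (X j \<omega>) * kern (X j \<omega>) (X i \<omega>)) / real n"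
    if i: "i \<in> {1..<Suc n}" for i
  proof -
    have "on_unit (A n \<omega>) (X i \<omega>) = (\<Sum>j\<in>{1..<Suc n}. (e (X j \<omega>) / real n) * K (snd (X j \<omega>)) (snd (X i \<omega>)))"
      using on_unit_X[of i \<omega>] i \<omega> by (simp add: A_def)
    also have "\<dots> = (\<Sum>j\<in>{1..<Suc n}. (e (X j \<omega>) / real n) * kern (X j \<omega>) (X i \<omega>))"
      using i \<omega> kern_X by (intro sum.cong) auto
    finally show ?thesis by (simp only: sum_divide_distrib times_divide_eq_left)
  qed
  have "real n * ip (A n \<omega>) (A n \<omega>) = (\<Sum>i\<in>{1..<Suc n}. e (X i \<omega>) * on_unit (A n \<omega>) (X i \<omega>))"
    unfolding ip_A[OF \<omega> A_in[OF \<omega>]] using n by (simp only: avg_def) simp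
  also have "\<dots> = (\<Sum>i\<in>{1..<Suc n}. (\<Sum>j\<in>{1..<Suc n}. a i j) / real n)"
  proof (rule sum.cong[OF refl])
    fix i assume i: "i \<in> {1..<Suc n}"
    have "e (X i \<omega>) * on_unit (A n \<omega>) (X i \<omega>) = (\<Sum>j\<in>{1..<Suc n}. e (X i \<omega>) * (e (X j \<omega>) * kern (X j \<omega>) (X i \<omega>))) / real n"
      unfolding AX[OF i] by (simp only: sum_distrib_left times_divide_eq_right)
    also have "(\<Sum>j\<in>{1..<Suc n}. e (X i \<omega>) * (e (X j \<omega>) * kern (X j \<omega>) (X i \<omega>))) = (\<Sum>j\<in>{1..<Suc n}. a i j)"
      using kern_sym by (intro sum.cong) (auto simp: a_def kk_def mult_ac)
    finally show "e (X i \<omega>) * on_unit (A n \<omega>) (X i \<omega>) = (\<Sum>j\<in>{1..<Suc n}. a i j) / real n" .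
  qed
  also have "\<dots> = (\<Sum>i\<in>{1..<Suc n}. a i i) / real n + 2 / real n * (\<Sum>l\<in>{1..<Suc n}. \<Sum>i\<in>{1..<l}. a i l)"
    unfolding sum_divide_distrib[symmetric] dbl by (simp only: add_divide_distrib times_divide_eq_left)
  also have "(\<Sum>i\<in>{1..<Suc n}. a i i) / real n = avg n (\<lambda>x. (e x)\<^sup>2 * kern x x) \<omega>"
    by (simp only: avg_def a_def kk_def power2_eq_square)
  finally show ?thesis by (simp only: Q.psum_def Q.rsum_def a_def)
qed

lemma ip_S_S:
  assumes \<omega>: "\<omega> \<in> space M"
  shows "ip (S n \<omega>) (S n \<omega>) = ip (A n \<omega>) (A n \<omega>) - 2 * avg n (\<lambda>x. e x * on_unit (W g0) x) \<omega> + ip (W g0) (W g0)"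
  using ip_expand[OF A_in[OF \<omega>, of n] W_in[OF g0_in], of 1 "-1"] ip_A[OF \<omega> W_in[OF g0_in], of n]
  by (simp add: S_def)

text \<open>The cross term is absorbed by nonnegativity of the squared norm of
  \<open>A + W g0\<close>, and the bias is then bounded by the penalty of \<open>g0\<close>.\<close>

lemma ip_S_S_le:
  assumes \<omega>: "\<omega> \<in> space M"
  shows "ip (S n \<omega>) (S n \<omega>) \<le> 2 * ip (A n \<omega>) (A n \<omega>) + 2 * (lam * J g0 g0)"
proof -
  have "0 \<le> ip (\<lambda>x. 1 * A n \<omega> x + 1 * W g0 x) (\<lambda>x. 1 * A n \<omega> x + 1 * W g0 x)"
    using A_in[OF \<omega>] W_in[OF g0_in] by (intro ip_nonneg H_linear)
  then have "0 \<le> ip (A n \<omega>) (A n \<omega>) + 2 * ip (A n \<omega>) (W g0) + ip (W g0) (W g0)"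
    unfolding ip_expand[OF A_in[OF \<omega>] W_in[OF g0_in]] by simp
  then show ?thesis using ip_S_S[OF \<omega>, of n] ip_A[OF \<omega> W_in[OF g0_in], of n] ip_W_le[OF g0_in] by simp
qed

lemma diag_square: "integrable N (\<lambda>x. ((e x)\<^sup>2 * kern x x)\<^sup>2)" (is ?A)
  "(\<integral>x. ((e x)\<^sup>2 * kern x x)\<^sup>2 \<partial>N) \<le> (B\<^sup>2 * tr)\<^sup>2 * (\<integral>x. e x ^ 4 \<partial>N)" (is ?B)
  "(\<lambda>x. (e x)\<^sup>2 * kern x x) \<in> borel_measurable N" (is ?C)
proof -
  have e4: "integrable N (\<lambda>x. e x ^ 4)" using e_L4 by (simp add: L4_def)
  have dm: "(\<lambda>x. kern x x) \<in> borel_measurable N"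
    using measurable_compose[OF measurable_Pair[OF measurable_ident_sets measurable_ident_sets] kern_measurable, of N]
    by simp
  show m: ?C
    by (intro borel_measurable_times borel_measurable_power e_measurable dm)
  have pt: "((e x)\<^sup>2 * kern x x)\<^sup>2 \<le> (B\<^sup>2 * tr)\<^sup>2 * e x ^ 4" for x
  proof -
    have "(kern x x)\<^sup>2 \<le> (B\<^sup>2 * tr)\<^sup>2" using power_mono[OF kern_bound[of x x], of 2] by simp
    then have "((e x)\<^sup>2)\<^sup>2 * (kern x x)\<^sup>2 \<le> ((e x)\<^sup>2)\<^sup>2 * (B\<^sup>2 * tr)\<^sup>2" by (intro mult_left_mono) auto
    then show ?thesis by (simp add: power_mult_distrib mult.commute)
  qed
  show i: ?A
  proof (rule Bochner_Integration.integrable_bound)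
    show "integrable N (\<lambda>x. (B\<^sup>2 * tr)\<^sup>2 * e x ^ 4)" using e4 by simp
    show "(\<lambda>x. ((e x)\<^sup>2 * kern x x)\<^sup>2) \<in> borel_measurable N" by (rule borel_measurable_power[OF m])
    show "AE x in N. norm (((e x)\<^sup>2 * kern x x)\<^sup>2) \<le> norm ((B\<^sup>2 * tr)\<^sup>2 * e x ^ 4)"
      using pt by (intro AE_I2) (auto intro: order_trans[OF _ abs_ge_self])
  qed
  show ?B
    using integral_mono[OF i integrable_mult_right[OF e4] pt] by simp
qed

lemma psum_mean: "(\<integral>\<omega>. Q.psum j (obs \<omega>) \<partial>M) = 0"
proof (induction j)
  case (Suc j)
  show ?case
  proof (cases "j = 0")
    case False
    then have j: "j \<ge> 1" by simp
    have i: "integrable M (\<lambda>\<omega>. Q.rsum j (fst (past j \<omega>, X j \<omega>)) (snd (past j \<omega>, X j \<omega>)))"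
      using L4_integrable[OF Q.L4_rsum[of j]] by (simp add: Q.rsum_past)
    have "(\<integral>\<omega>. Q.rsum j (obs \<omega>) (X j \<omega>) \<partial>M) = (\<integral>\<omega>. (\<integral>y. Q.rsum j (past j \<omega>) y \<partial>N) \<partial>M)"
      using past_expectation(1)[OF j Q.rsum_measurable i] by (simp add: Q.rsum_past)
    also have "\<dots> = (\<integral>\<omega>. 0 \<partial>M)"
      by (rule Bochner_Integration.integral_cong) (simp_all add: Q.rsum_section_mean)
    finally show ?thesis using Suc L4_integrable[OF Q.L4_psum[of j]] L4_integrable[OF Q.L4_rsum[of j]]
      by (simp add: Q.psum_Suc[OF j])
  qed (simp add: Q.psum_def)
qed (simp add: Q.psum_def)

lemma A_A_measurable: "(\<lambda>\<omega>. ip (A n \<omega>) (A n \<omega>)) \<in> borel_measurable M" if n: "n \<ge> 1"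
proof -
  have "(\<lambda>\<omega>. (avg n (\<lambda>x. (e x)\<^sup>2 * kern x x) \<omega> + 2 / real n * Q.psum (Suc n) (obs \<omega>)) / real n) \<in> borel_measurable M"
    by (intro borel_measurable_divide borel_measurable_add borel_measurable_times borel_measurable_const
        avg_measurable diag_square(3) L4_measurable[OF Q.L4_psum])
  then show ?thesis
    by (rule measurable_cong[THEN iffD2, rotated]) (use ip_A_A[OF _ n] n in \<open>simp add: field_simps\<close>)
qed

lemma A_A_expectation:
  assumes n: "n \<ge> 1"
  shows "integrable M (\<lambda>\<omega>. ip (A n \<omega>) (A n \<omega>))" (is ?A) "(\<integral>\<omega>. ip (A n \<omega>) (A n \<omega>) \<partial>M) = tr / real n" (is ?B)
proof -
  let ?a = "\<lambda>x. (e x)\<^sup>2 * kern x x"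
  have a1: "integrable N ?a" by (rule N.square_expectation_le(1)[OF diag_square(3,1)])
  have aX: "integrable M (\<lambda>\<omega>. ?a (X i \<omega>))" if "i \<ge> 1" for i
    using integrable_X[OF diag_square(3) that] a1 by simp
  have av: "integrable M (avg n ?a)" "(\<integral>\<omega>. avg n ?a \<omega> \<partial>M) = tr"
  proof -
    show "integrable M (avg n ?a)" unfolding avg_def[abs_def] using aX by (intro integrable_divide Bochner_Integration.integrable_sum) auto
    have "(\<integral>\<omega>. avg n ?a \<omega> \<partial>M) = (\<Sum>i\<in>{1..<Suc n}. \<integral>\<omega>. ?a (X i \<omega>) \<partial>M) / real n"
      unfolding avg_def using aX by (simp del: sum.op_ivl_Suc)
    also have "\<dots> = (\<Sum>i\<in>{1..<Suc n}. tr) / real n"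
      using integral_X[OF diag_square(3)] kern_diag_integral by (intro arg_cong2[where f = "(/)"] sum.cong) auto
    finally show "(\<integral>\<omega>. avg n ?a \<omega> \<partial>M) = tr" using n by simp
  qed
  have pi: "integrable M (\<lambda>\<omega>. Q.psum (Suc n) (obs \<omega>))" by (rule L4_integrable[OF Q.L4_psum])
  have eq: "ip (A n \<omega>) (A n \<omega>) = (avg n ?a \<omega> + 2 / real n * Q.psum (Suc n) (obs \<omega>)) / real n" if "\<omega> \<in> space M" for \<omega>
    using ip_A_A[OF that n] n by (simp add: field_simps)
  have i: "integrable M (\<lambda>\<omega>. (avg n ?a \<omega> + 2 / real n * Q.psum (Suc n) (obs \<omega>)) / real n)"
    using av(1) pi by simp
  show ?A
    using i by (rule Bochner_Integration.integrable_cong[THEN iffD1, rotated 2]) (simp_all add: eq)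
  have "(\<integral>\<omega>. ip (A n \<omega>) (A n \<omega>) \<partial>M) = (\<integral>\<omega>. (avg n ?a \<omega> + 2 / real n * Q.psum (Suc n) (obs \<omega>)) / real n \<partial>M)"
    by (rule Bochner_Integration.integral_cong) (simp_all add: eq)
  also have "\<dots> = tr / real n" using av pi psum_mean[of "Suc n"] by simp
  finally show ?B .
qed

end

text \<open>The loss \<open>L x t\<close> stands for \<open>l (y; g0 z + t) - l (y; g0 z)\<close> at \<open>x = (y, z)\<close>.\<close>

locale plrt_loss = plrt_sample M N X H V J lam hb gam K W B e w2 w3 C3 g0
  for M :: "'w measure" and N :: "(real \<times> real) measure" and X
    and H V J lam hb gam K W B e w2 w3 C3 g0 +
  fixes L :: "real \<times> real => real => real" and G :: "(real \<times> real) set" and s0 :: real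
  assumes G_sets: "G \<in> sets N" and AE_G: "AE x in N. x \<in> G" and s0_pos: "s0 > 0"
    and taylor: "\<And>i \<omega> t. i \<ge> 1 ==> \<omega> \<in> space M ==> X i \<omega> \<in> G ==> \<bar>t\<bar> \<le> s0 ==>
      \<bar>L (X i \<omega>) t - (e (X i \<omega>) * t - w2 (X i \<omega>) * t\<^sup>2 / 2)\<bar> \<le> w3 (X i \<omega>) * \<bar>t\<bar> ^ 3 / 6"
begin

definition gain :: "nat => 'w => (real => real) => real" where
  "gain n \<omega> f = avg n (\<lambda>x. L x (on_unit f x)) \<omega> - lam * J g0 f - lam / 2 * J f f"

definition outside :: "nat => 'w set" where
  "outside n = (\<Union>i\<in>{1..<Suc n}. X i -` (- G) \<inter> space M)"

lemma outside_null: "outside n \<in> events" "prob (outside n) = 0"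
proof -
  have c: "- G \<in> sets N" using G_sets sets.compl_sets[OF G_sets] by (simp add: space_N Compl_eq_Diff_UNIV)
  have ev: "X i -` (- G) \<inter> space M \<in> events" if "i \<ge> 1" for i
    using measurable_sets[OF X_measurable[OF that] c] .
  have z: "X i -` (- G) \<inter> space M \<in> null_sets M" if "i \<ge> 1" for i
  proof -
    have "(- G \<in> null_sets N) = (AE x in N. x \<notin> - G)" by (rule AE_iff_null_sets[OF c])
    then have "- G \<in> null_sets N" using AE_G by simp
    then have "emeasure (distr M N (X i)) (- G) = 0" using X_distr[OF that] by auto
    then have "emeasure M (X i -` (- G) \<inter> space M) = 0" using emeasure_distr[OF X_measurable[OF that] c] by simp
    then show ?thesis using ev[OF that] by (rule null_setsI)
  qed
  have "outside n \<in> null_sets M" unfolding outside_def by (rule null_sets_UN') (use z in auto)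
  then show "outside n \<in> events" "prob (outside n) = 0" by (auto simp: null_sets_def measure_def)
qed

text \<open>The cubic Taylor remainder is estimated by the supremum of |f| times a quadratic form
  with weight \<open>w3\<close>. Hence one uniform bound on empirical quadratic forms controls the
  second and the third order terms alike.\<close>

lemma remainder_bound:
  assumes \<omega>: "\<omega> \<in> space M" "\<omega> \<notin> outside n" and n: "n \<ge> 1"
    and f: "f \<in> H" and small: "B\<^sup>2 * tr * ip f f \<le> s0\<^sup>2"
    and d2: "\<bar>avg n (\<lambda>x. w2 x * (on_unit f x)\<^sup>2) \<omega> - (\<integral>x. w2 x * (on_unit f x)\<^sup>2 \<partial>N)\<bar> \<le> q * ip f f"
    and d3: "\<bar>avg n (\<lambda>x. w3 x * (on_unit f x)\<^sup>2) \<omega> - (\<integral>x. w3 x * (on_unit f x)\<^sup>2 \<partial>N)\<bar> \<le> q * ip f f"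
  shows "\<bar>gain n \<omega> f - (ip (S n \<omega>) f - ip f f / 2)\<bar>
    \<le> q * ip f f / 2 + sqrt (B\<^sup>2 * tr * ip f f) * ((C3 + q) * ip f f) / 6"
proof -
  define s where "s = sqrt (B\<^sup>2 * tr * ip f f)"
  have ipn: "ip f f \<ge> 0" by (rule ip_nonneg[OF f])
  have s: "s \<ge> 0" "s \<le> s0"
  proof -
    show "s \<ge> 0" unfolding s_def using tr_nonneg ipn by simp
    have "s \<le> sqrt (s0\<^sup>2)" unfolding s_def by (rule real_sqrt_le_mono[OF small])
    then show "s \<le> s0" using s0_pos by simp
  qed
  have fs: "\<bar>on_unit f x\<bar> \<le> s" for x unfolding s_def by (rule on_unit_abs_le[OF f])
  have V_le: "V f f \<le> ip f f" using V_le_ip[OF f] by simp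
  define r where "r = (\<lambda>x. L x (on_unit f x) - (e x * on_unit f x - w2 x * (on_unit f x)\<^sup>2 / 2))"
  have rle: "\<bar>r (X i \<omega>)\<bar> \<le> s / 6 * (w3 (X i \<omega>) * (on_unit f (X i \<omega>))\<^sup>2)" if i: "i \<in> {1..<Suc n}" for i
  proof -
    have "X i \<omega> \<in> G" using \<omega> i by (auto simp: outside_def)
    then have "\<bar>r (X i \<omega>)\<bar> \<le> w3 (X i \<omega>) * \<bar>on_unit f (X i \<omega>)\<bar> ^ 3 / 6"
      unfolding r_def using taylor[of i \<omega> "on_unit f (X i \<omega>)"] i \<omega> fs[of "X i \<omega>"] s by simp
    also have "\<bar>on_unit f (X i \<omega>)\<bar> ^ 3 = \<bar>on_unit f (X i \<omega>)\<bar> * (on_unit f (X i \<omega>))\<^sup>2"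
      by (simp add: power3_eq_cube power2_eq_square)
    also have "w3 (X i \<omega>) * (\<bar>on_unit f (X i \<omega>)\<bar> * (on_unit f (X i \<omega>))\<^sup>2) / 6
       \<le> w3 (X i \<omega>) * (s * (on_unit f (X i \<omega>))\<^sup>2) / 6"
      using fs w3_nonneg by (intro divide_right_mono mult_left_mono mult_right_mono) auto
    finally show ?thesis by (simp add: mult_ac)
  qed
  have ravg: "\<bar>avg n r \<omega>\<bar> \<le> s / 6 * ((C3 + q) * ip f f)"
  proof -
    have "\<bar>avg n r \<omega>\<bar> = \<bar>\<Sum>i\<in>{1..<Suc n}. r (X i \<omega>)\<bar> / real n" by (simp only: avg_def abs_divide abs_of_nat)
    also have "\<dots> \<le> (\<Sum>i\<in>{1..<Suc n}. \<bar>r (X i \<omega>)\<bar>) / real n" by (intro divide_right_mono sum_abs) simp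
    also have "\<dots> \<le> (\<Sum>i\<in>{1..<Suc n}. s / 6 * (w3 (X i \<omega>) * (on_unit f (X i \<omega>))\<^sup>2)) / real n"
      by (intro divide_right_mono sum_mono rle) simp_all
    also have "\<dots> = s / 6 * avg n (\<lambda>x. w3 x * (on_unit f x)\<^sup>2) \<omega>"
      by (simp only: avg_def sum_distrib_left[symmetric] times_divide_eq_right)
    also have "\<dots> \<le> s / 6 * ((C3 + q) * ip f f)"
    proof (rule mult_left_mono)
      have "C3 * V f f \<le> C3 * ip f f" by (rule mult_left_mono[OF V_le C3_nonneg])
      then show "avg n (\<lambda>x. w3 x * (on_unit f x)\<^sup>2) \<omega> \<le> (C3 + q) * ip f f"
        using d3 w3_form[OF f] by (simp only: distrib_right)
    qed (use s in simp)
    finally show ?thesis .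
  qed
  have "avg n r \<omega> = avg n (\<lambda>x. L x (on_unit f x)) \<omega> - (avg n (\<lambda>x. e x * on_unit f x) \<omega> - avg n (\<lambda>x. w2 x * (on_unit f x)\<^sup>2) \<omega> / 2)"
    unfolding r_def avg_def sum_subtractf sum_divide_distrib[symmetric] by (simp only: diff_divide_distrib divide_divide_eq_left mult.commute)
  then have "gain n \<omega> f - (ip (S n \<omega>) f - ip f f / 2) = avg n r \<omega> - (avg n (\<lambda>x. w2 x * (on_unit f x)\<^sup>2) \<omega> - V f f) / 2"
    unfolding gain_def ip_S[OF \<omega>(1) f] by (simp add: ip_def field_simps)
  moreover have "\<bar>avg n (\<lambda>x. w2 x * (on_unit f x)\<^sup>2) \<omega> - V f f\<bar> \<le> q * ip f f"
    using d2 w2_form[OF f] by simp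
  moreover have "\<bar>x\<bar> \<le> a + b / 2" if "x = r - y / 2" "\<bar>y\<bar> \<le> b" "\<bar>r\<bar> \<le> a" for x y r a b :: real
    using that by arith
  ultimately have "\<bar>gain n \<omega> f - (ip (S n \<omega>) f - ip f f / 2)\<bar> \<le> s / 6 * ((C3 + q) * ip f f) + q * ip f f / 2"
    using ravg by blast
  then show ?thesis by (simp add: s_def mult_ac)
qed

lemma ip_polarization_bound:
  assumes "f \<in> H" "g \<in> H"
  shows "2 * ip f g - ip g g \<le> ip f f"
proof -
  have "0 \<le> ip (\<lambda>x. 1 * f x + (-1) * g x) (\<lambda>x. 1 * f x + (-1) * g x)"
    by (intro ip_nonneg H_linear assms)
  then show ?thesis unfolding ip_expand[OF assms] by simp
qed

text \<open>A competitor which beats \<open>S\<close> has almost the gain of the maximizer \<open>S\<close> of the quadratic approximation;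
  no rate for the difference of the two is needed.\<close>

lemma gain_approximation:
  assumes n: "n \<ge> 1" and \<delta>: "\<delta> > 0" and \<rho>: "\<rho> > 0" and small: "B\<^sup>2 * tr * \<rho>\<^sup>2 \<le> s0\<^sup>2"
    and bias: "4 * (lam * J g0 g0) \<le> \<rho>\<^sup>2"
  obtains E where "E \<in> events"
    "prob E \<le> (B ^ 4 * (\<integral>x. (w2 x)\<^sup>2 \<partial>N) * tr\<^sup>2 + B ^ 4 * (\<integral>x. (w3 x)\<^sup>2 \<partial>N) * tr\<^sup>2) / (real n * \<delta>) + 4 * tr / (real n * \<rho>\<^sup>2)"
    "\<forall>\<omega>\<in>space M - E. \<forall>f\<in>H. ip f f \<le> \<rho>\<^sup>2 \<longrightarrow> gain n \<omega> (S n \<omega>) \<le> gain n \<omega> f \<longrightarrow>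
      \<bar>2 * gain n \<omega> f - ip (S n \<omega>) (S n \<omega>)\<bar> \<le> sqrt \<delta> * \<rho>\<^sup>2 + sqrt (B\<^sup>2 * tr) * \<rho> ^ 3 * (C3 + sqrt \<delta>) / 3"
proof -
  obtain E2 where E2: "E2 \<in> events" "prob E2 \<le> B ^ 4 * (\<integral>x. (w2 x)\<^sup>2 \<partial>N) * tr\<^sup>2 / (real n * \<delta>)"
    "\<forall>\<omega>\<in>space M - E2. \<forall>f\<in>H.
      \<bar>avg n (\<lambda>x. w2 x * (on_unit f x)\<^sup>2) \<omega> - (\<integral>x. w2 x * (on_unit f x)\<^sup>2 \<partial>N)\<bar> \<le> sqrt \<delta> * ip f f"
    by (rule quadratic_deviation[OF w2_measurable w2_square n \<delta>])
  obtain E3 where E3: "E3 \<in> events" "prob E3 \<le> B ^ 4 * (\<integral>x. (w3 x)\<^sup>2 \<partial>N) * tr\<^sup>2 / (real n * \<delta>)"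
    "\<forall>\<omega>\<in>space M - E3. \<forall>f\<in>H.
      \<bar>avg n (\<lambda>x. w3 x * (on_unit f x)\<^sup>2) \<omega> - (\<integral>x. w3 x * (on_unit f x)\<^sup>2 \<partial>N)\<bar> \<le> sqrt \<delta> * ip f f"
    by (rule quadratic_deviation[OF w3_measurable w3_square n \<delta>])
  \<comment> \<open>Off this event the score part and, by \<open>bias\<close>, the penalty part each
    contribute at most half of the squared radius to the squared norm of \<open>S\<close>, so
    \<open>S\<close> lies in the ball where the remainder is controlled.\<close>
  define E1 where "E1 = {\<omega> \<in> space M. ip (A n \<omega>) (A n \<omega>) \<ge> \<rho>\<^sup>2 / 4}"
  have E1m: "E1 \<in> events" unfolding E1_def using A_A_measurable[OF n] by measurable
  have E1p: "prob E1 \<le> 4 * tr / (real n * \<rho>\<^sup>2)"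
  proof -
    have "prob E1 \<le> (\<integral>\<omega>. ip (A n \<omega>) (A n \<omega>) \<partial>M) / (\<rho>\<^sup>2 / 4)"
      unfolding E1_def
      by (rule integral_Markov_inequality_measure[OF A_A_expectation(1)[OF n], of "{}", simplified])
        (use \<rho> in \<open>auto intro!: AE_I2 ip_nonneg A_in\<close>)
    then show ?thesis unfolding A_A_expectation(2)[OF n] by (simp add: field_simps)
  qed
  define E where "E = (E2 \<union> E3) \<union> (E1 \<union> outside n)"
  have Em: "E \<in> events" unfolding E_def using E1m E2(1) E3(1) outside_null(1) by auto
  have "prob E \<le> (prob E2 + prob E3) + (prob E1 + prob (outside n))"
    unfolding E_def using E1m E2(1) E3(1) outside_null(1)[of n]
    by (intro order_trans[OF measure_Un_le] add_mono measure_Un_le) auto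
  then have PE: "prob E \<le> (B ^ 4 * (\<integral>x. (w2 x)\<^sup>2 \<partial>N) * tr\<^sup>2 + B ^ 4 * (\<integral>x. (w3 x)\<^sup>2 \<partial>N) * tr\<^sup>2) / (real n * \<delta>) + 4 * tr / (real n * \<rho>\<^sup>2)"
    using E2(2) E3(2) E1p outside_null(2)[of n] unfolding add_divide_distrib by linarith
  define \<eta> where "\<eta> = sqrt \<delta> * \<rho>\<^sup>2 / 2 + sqrt (B\<^sup>2 * tr) * \<rho> ^ 3 * (C3 + sqrt \<delta>) / 6"
  have main: "\<bar>2 * gain n \<omega> f - ip (S n \<omega>) (S n \<omega>)\<bar> \<le> 2 * \<eta>"
    if \<omega>: "\<omega> \<in> space M - E" and f: "f \<in> H" "ip f f \<le> \<rho>\<^sup>2" and better: "gain n \<omega> (S n \<omega>) \<le> gain n \<omega> f" for \<omega> f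
  proof -
    have rem: "\<bar>gain n \<omega> k - (ip (S n \<omega>) k - ip k k / 2)\<bar> \<le> \<eta>" if k: "k \<in> H" "ip k k \<le> \<rho>\<^sup>2" for k
    proof -
      have Bt: "B\<^sup>2 * tr \<ge> 0" using tr_nonneg by simp
      have le: "B\<^sup>2 * tr * ip k k \<le> B\<^sup>2 * tr * \<rho>\<^sup>2" using k(2) Bt by (intro mult_left_mono)
      have "\<bar>gain n \<omega> k - (ip (S n \<omega>) k - ip k k / 2)\<bar>
        \<le> sqrt \<delta> * ip k k / 2 + sqrt (B\<^sup>2 * tr * ip k k) * ((C3 + sqrt \<delta>) * ip k k) / 6"
        by (rule remainder_bound) (use \<omega> n k le small E2(3) E3(3) in \<open>auto simp: E_def\<close>)
      also have "\<dots> \<le> sqrt \<delta> * \<rho>\<^sup>2 / 2 + sqrt (B\<^sup>2 * tr * \<rho>\<^sup>2) * ((C3 + sqrt \<delta>) * \<rho>\<^sup>2) / 6"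
        using k(2) le \<delta> C3_nonneg ip_nonneg[OF k(1)] Bt
        by (intro add_mono divide_right_mono mult_mono mult_left_mono real_sqrt_le_mono) auto
      also have "sqrt (B\<^sup>2 * tr * \<rho>\<^sup>2) * ((C3 + sqrt \<delta>) * \<rho>\<^sup>2) = sqrt (B\<^sup>2 * tr) * \<rho> ^ 3 * (C3 + sqrt \<delta>)"
        using \<rho> by (simp add: real_sqrt_mult power2_eq_square power3_eq_cube mult_ac)
      finally show ?thesis by (simp only: \<eta>_def)
    qed
    have SH: "S n \<omega> \<in> H" using S_in \<omega> by blast
    have "ip (A n \<omega>) (A n \<omega>) < \<rho>\<^sup>2 / 4" using \<omega> by (auto simp: E_def E1_def not_le)
    then have "ip (S n \<omega>) (S n \<omega>) \<le> \<rho>\<^sup>2"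
      using ip_S_S_le[of \<omega> n] \<omega> bias by auto
    then have "ip (S n \<omega>) (S n \<omega>) / 2 - \<eta> \<le> gain n \<omega> (S n \<omega>)" using rem[OF SH] by linarith
    moreover have "gain n \<omega> f \<le> ip (S n \<omega>) (S n \<omega>) / 2 + \<eta>"
      using rem[OF f] ip_polarization_bound[OF SH f(1)] by linarith
    ultimately show ?thesis using better by linarith
  qed
  show thesis
  proof (rule that[OF Em PE])
    have "2 * \<eta> = sqrt \<delta> * \<rho>\<^sup>2 + sqrt (B\<^sup>2 * tr) * \<rho> ^ 3 * (C3 + sqrt \<delta>) / 3" by (simp add: \<eta>_def)
    then show "\<forall>\<omega>\<in>space M - E. \<forall>f\<in>H. ip f f \<le> \<rho>\<^sup>2 \<longrightarrow> gain n \<omega> (S n \<omega>) \<le> gain n \<omega> f \<longrightarrow>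
      \<bar>2 * gain n \<omega> f - ip (S n \<omega>) (S n \<omega>)\<bar> \<le> sqrt \<delta> * \<rho>\<^sup>2 + sqrt (B\<^sup>2 * tr) * \<rho> ^ 3 * (C3 + sqrt \<delta>) / 3"
      using main by (intro ballI impI) simp
  qed
qed

end

section \<open>The regression model\<close>

text \<open>The model with its Borel versions made explicit: \<open>Q0\<close>, \<open>Q1\<close>,
  \<open>Q2\<close> for the criterion and its first two derivatives, \<open>b2\<close> and
  \<open>b3\<close> for the suprema over \<open>I\<close>, with \<open>G2\<close> and
  \<open>G3\<close> the sets of responses where these suprema are genuine bounds.\<close>

locale regression_model = prob_space M for M :: "'w measure" +
  fixes S :: "real set" and Y Z :: "'w => real" and Ys Zs :: "nat => 'w => real"
    and l :: "real => real => real" and g0 :: "real => real" and I :: "real set"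
    and Q0 Q1 Q2 :: "real \<times> real => real" and b2 b3 :: "real => real" and G2 G3 :: "real set"
    and C0 C1 C2 C4 :: real
  assumes data: "iid_copies M S Y Z Ys Zs"
    and g0_continuous: "continuous_on {0..1} g0"
    and Q0: "Q0 \<in> borel_measurable (borel \<Otimes>\<^sub>M borel)" "\<And>y a. y \<in> S ==> Q0 (y, a) = deriv_a 0 l y a"
    and Q1: "Q1 \<in> borel_measurable (borel \<Otimes>\<^sub>M borel)" "\<And>y a. y \<in> S ==> Q1 (y, a) = deriv_a 1 l y a"
    and Q2: "Q2 \<in> borel_measurable (borel \<Otimes>\<^sub>M borel)" "\<And>y a. y \<in> S ==> Q2 (y, a) = deriv_a 2 l y a"
    and b2: "b2 \<in> borel_measurable borel" "\<And>y. y \<in> S ==> sup_deriv_a 2 l I y = b2 y"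
      "\<And>y. y \<in> G2 ==> b2 y \<ge> 0" "\<And>y a. y \<in> S ==> y \<in> G2 ==> a \<in> I ==> \<bar>deriv_a 2 l y a\<bar> \<le> b2 y"
    and b3: "b3 \<in> borel_measurable borel" "\<And>y. y \<in> S ==> sup_deriv_a 3 l I y = b3 y"
      "\<And>y. y \<in> G3 ==> b3 y \<ge> 0" "\<And>y a. y \<in> S ==> y \<in> G3 ==> a \<in> I ==> \<bar>deriv_a 3 l y a\<bar> \<le> b3 y"
    and G2: "AE \<omega> in M. Y \<omega> \<in> G2"
    and G3: "G3 \<in> sets borel" "AE \<omega> in M. Y \<omega> \<in> G3"
    and I_open: "open I" and g0_range: "g0 ` {0..1} \<subseteq> I"
    and smooth: "\<And>y k a. y \<in> S ==> k < 3 ==> deriv_a k l y differentiable (at a)"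
    and C_pos: "C0 > 0" "C1 > 0" "C2 > 0"
    and exp2: "AE \<omega> in M. cond_E_nn M Z (\<lambda>\<omega>. exp (sup_deriv_a 2 l I (Y \<omega>) / C0)) \<omega> \<le> ennreal C0"
    and exp3: "AE \<omega> in M. cond_E_nn M Z (\<lambda>\<omega>. exp (sup_deriv_a 3 l I (Y \<omega>) / C0)) \<omega> \<le> ennreal C1"
    and info: "AE \<omega> in M. 1 / C2 \<le> information M Y Z l g0 \<omega> \<and> information M Y Z l g0 \<omega> \<le> C2"
    and score_mean: "AE \<omega> in M. cond_E M Z (\<lambda>\<omega>. score l g0 (Y \<omega>) (Z \<omega>)) \<omega> = 0"
    and score_square: "AE \<omega> in M. cond_E M Z (\<lambda>\<omega>. (score l g0 (Y \<omega>) (Z \<omega>))\<^sup>2) \<omega> = information M Y Z l g0 \<omega>"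
    and score_fourth: "AE \<omega> in M. cond_E_nn M Z (\<lambda>\<omega>. score l g0 (Y \<omega>) (Z \<omega>) ^ 4) \<omega> \<le> ennreal C4"
begin

definition N :: "(real \<times> real) measure" where
  "N = distr M (borel \<Otimes>\<^sub>M borel) (\<lambda>\<omega>. (Y \<omega>, Z \<omega>))"

definition X :: "nat => 'w => real \<times> real" where "X i \<omega> = (Ys i \<omega>, Zs i \<omega>)"

definition extend :: "(real => real) => real => real" where "extend f z = indicator {0..1} z * f z"

definition e :: "real \<times> real => real" where "e x = Q1 (fst x, extend g0 (snd x))"

definition w2 :: "real \<times> real => real" where "w2 x = - Q2 (fst x, extend g0 (snd x))"

text \<open>Off \<open>G3\<close> the supremum has a default value whose sign is unknown; the
  maximum keeps the weight nonnegative everywhere.\<close>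

definition w3 :: "real \<times> real => real" where "w3 x = max 0 (b3 (fst x))"

definition L :: "real \<times> real => real => real" where
  "L x t = Q0 (fst x, extend g0 (snd x) + t) - Q0 (fst x, extend g0 (snd x))"

abbreviation Vf :: "(real => real) => (real => real) => real" where
  "Vf \<equiv> V_form M Y Z l g0"

abbreviation info_Z :: "'w => real" where
  "info_Z \<equiv> information M Y Z l g0"

abbreviation eps :: "'w => real" where
  "eps \<omega> \<equiv> score l g0 (Y \<omega>) (Z \<omega>)"

lemma YZ: "Y \<in> borel_measurable M" "Z \<in> borel_measurable M"
  "\<omega> \<in> space M ==> Y \<omega> \<in> S" "\<omega> \<in> space M ==> Z \<omega> \<in> {0..1}"
  using data by (auto simp: iid_copies_def)

lemma X_in: "i \<ge> 1 ==> \<omega> \<in> space M ==> fst (X i \<omega>) \<in> S" "i \<ge> 1 ==> \<omega> \<in> space M ==> snd (X i \<omega>) \<in> {0..1}"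
  using data by (auto simp: iid_copies_def X_def)

lemma YZ_pair: "(\<lambda>\<omega>. (Y \<omega>, Z \<omega>)) \<in> M \<rightarrow>\<^sub>M borel \<Otimes>\<^sub>M borel"
  using YZ(1,2) by measurable

lemma sets_N: "sets N = sets (borel \<Otimes>\<^sub>M borel)" by (simp add: N_def)

lemma measurable_N: "f \<in> borel_measurable N \<longleftrightarrow> f \<in> borel_measurable (borel \<Otimes>\<^sub>M borel)"
  by (simp only: measurable_cong_sets[OF sets_N refl])

lemma integral_N:
  fixes f :: "real \<times> real => real"
  assumes "f \<in> borel_measurable (borel \<Otimes>\<^sub>M borel)"
  shows "(\<integral>x. f x \<partial>N) = (\<integral>\<omega>. f (Y \<omega>, Z \<omega>) \<partial>M)"
  unfolding N_def using YZ_pair assms by (rule integral_distr)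

lemma integrable_N:
  fixes f :: "real \<times> real => real"
  assumes "f \<in> borel_measurable (borel \<Otimes>\<^sub>M borel)"
  shows "integrable N f \<longleftrightarrow> integrable M (\<lambda>\<omega>. f (Y \<omega>, Z \<omega>))"
  unfolding N_def using YZ_pair assms by (rule integrable_distr_eq)

lemma sample: "iid_sample M N X"
proof unfold_locales
  have i: "indep_vars (\<lambda>_. borel \<Otimes>\<^sub>M borel) X {1..}"
    using data by (simp add: iid_copies_def X_def[abs_def])
  have sp: "space N = space (borel \<Otimes>\<^sub>M borel)" by (rule sets_eq_imp_space_eq[OF sets_N])
  show "indep_vars (\<lambda>_. N) X {1..}"
    using i unfolding indep_vars_def sets_N sp measurable_cong_sets[OF refl sets_N] .
  show Xm: "X i \<in> M \<rightarrow>\<^sub>M N" if "i \<ge> 1" for i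
    using i that unfolding indep_vars_def measurable_cong_sets[OF refl sets_N] by auto
  show "distr M N (X i) = N" if "i \<ge> 1" for i
  proof -
    have "distr M N (X i) = distr M (borel \<Otimes>\<^sub>M borel) (X i)" by (rule distr_cong) (simp_all add: sets_N)
    also have "\<dots> = N" using data that by (auto simp: iid_copies_def N_def X_def[abs_def])
    finally show ?thesis .
  qed
qed

lemma extend_measurable:
  assumes "continuous_on {0..1} f"
  shows "extend f \<in> borel_measurable borel"
proof -
  have "(\<lambda>z. indicator {0..1} z *\<^sub>R f z) \<in> borel_measurable borel"
    by (rule borel_measurable_continuous_on_indicator[OF _ assms]) simp
  then show ?thesis by (simp add: extend_def[abs_def])
qed

lemma extend_Z: "\<omega> \<in> space M ==> extend f (Z \<omega>) = f (Z \<omega>)"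
  using YZ(4) by (simp add: extend_def)

lemma on_unit_extend: "on_unit f x = extend f (snd x)"
  by (simp add: on_unit_def extend_def)

lemma extend_bounded:
  assumes "continuous_on {0..1} f"
  obtains C where "C \<ge> 0" "\<And>z. \<bar>extend f z\<bar> \<le> C"
proof -
  have "bounded (f ` {0..1})" using compact_continuous_image[OF assms] compact_imp_bounded by blast
  then obtain C where C: "\<forall>z\<in>{0..1}. \<bar>f z\<bar> \<le> C" by (auto simp: bounded_iff)
  have "\<bar>extend f z\<bar> \<le> max C 0" for z using C by (cases "z \<in> {0..1}") (auto simp: extend_def max.coboundedI1)
  then show thesis by (intro that[of "max C 0"]) auto
qed

lemma plug_measurable:
  assumes "Q \<in> borel_measurable (borel \<Otimes>\<^sub>M borel)"
  shows "(\<lambda>x. Q (fst x, extend g0 (snd x))) \<in> borel_measurable (borel \<Otimes>\<^sub>M borel)"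
proof -
  have [measurable]: "extend g0 \<in> borel_measurable borel" by (rule extend_measurable[OF g0_continuous])
  show ?thesis using assms by measurable
qed

lemma e_measurable: "e \<in> borel_measurable (borel \<Otimes>\<^sub>M borel)"
  unfolding e_def[abs_def] by (rule plug_measurable[OF Q1(1)])

lemma w2_measurable: "w2 \<in> borel_measurable (borel \<Otimes>\<^sub>M borel)"
  unfolding w2_def[abs_def] by (intro borel_measurable_uminus plug_measurable[OF Q2(1)])

lemma w3_measurable: "w3 \<in> borel_measurable (borel \<Otimes>\<^sub>M borel)"
  unfolding w3_def[abs_def] using b3(1) by measurable

lemma e_eq: "\<omega> \<in> space M ==> e (Y \<omega>, Z \<omega>) = eps \<omega>"
  using YZ(3) Q1(2) by (simp add: e_def extend_Z score_def)

lemma e_X: "i \<ge> 1 ==> \<omega> \<in> space M ==> e (X i \<omega>) = score l g0 (Ys i \<omega>) (Zs i \<omega>)"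
  using X_in[of i \<omega>] Q1(2) by (simp add: e_def extend_def score_def X_def)

lemma w2_eq: "\<omega> \<in> space M ==> w2 (Y \<omega>, Z \<omega>) = - deriv_a 2 l (Y \<omega>) (g0 (Z \<omega>))"
  using YZ(3) Q2(2) by (simp add: w2_def extend_Z)

lemma compose_YZ: "f \<in> borel_measurable (borel \<Otimes>\<^sub>M borel) ==> (\<lambda>\<omega>. f (Y \<omega>, Z \<omega>)) \<in> borel_measurable M"
  by (rule measurable_compose[OF YZ_pair])

lemma score_measurable: "(\<lambda>\<omega>. eps \<omega>) \<in> borel_measurable M"
  using compose_YZ[OF e_measurable] e_eq by (simp cong: measurable_cong)

lemma deriv2_measurable: "(\<lambda>\<omega>. deriv_a 2 l (Y \<omega>) (g0 (Z \<omega>))) \<in> borel_measurable M"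
proof -
  have "(\<lambda>\<omega>. - w2 (Y \<omega>, Z \<omega>)) \<in> borel_measurable M"
    by (intro borel_measurable_uminus compose_YZ[OF w2_measurable])
  then show ?thesis using w2_eq by (simp cong: measurable_cong)
qed

lemma e_L4: "L4 N e"
proof -
  have "(\<integral>\<^sup>+\<omega>. 1 * ennreal (eps \<omega> ^ 4) \<partial>M) \<le> ennreal C4 * (\<integral>\<^sup>+\<omega>. 1 \<partial>M)"
    using score_measurable by (intro cond_E_nn_bound[OF YZ(2) _ score_fourth]) auto
  also have "\<dots> < \<infinity>" by (simp add: emeasure_space_1)
  finally have "integrable M (\<lambda>\<omega>. eps \<omega> ^ 4)"
    using score_measurable by (intro integrableI_nonneg) auto
  then have "integrable M (\<lambda>\<omega>. e (Y \<omega>, Z \<omega>) ^ 4)" using e_eq by (simp cong: Bochner_Integration.integrable_cong)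
  then show ?thesis
    using e_measurable integrable_N[of "\<lambda>x. e x ^ 4"] by (simp add: L4_def measurable_N)
qed

lemma exp_moment:
  assumes b: "b \<in> borel_measurable borel" "\<And>y. y \<in> S ==> sup_deriv_a k l I y = b y"
    and le: "AE \<omega> in M. cond_E_nn M Z (\<lambda>\<omega>. exp (sup_deriv_a k l I (Y \<omega>) / C0)) \<omega> \<le> ennreal C"
    and f: "f \<in> borel_measurable borel"
  shows "(\<integral>\<^sup>+\<omega>. f (Z \<omega>) * ennreal (exp (b (Y \<omega>) / C0)) \<partial>M) \<le> ennreal C * (\<integral>\<^sup>+\<omega>. f (Z \<omega>) \<partial>M)"
proof -
  have eq: "sup_deriv_a k l I (Y \<omega>) = b (Y \<omega>)" if "\<omega> \<in> space M" for \<omega> using b(2) YZ(3)[OF that] by blast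
  have "(\<lambda>\<omega>. exp (b (Y \<omega>) / C0)) \<in> borel_measurable M" using b(1) YZ(1) by measurable
  then have "(\<lambda>\<omega>. exp (sup_deriv_a k l I (Y \<omega>) / C0)) \<in> borel_measurable M"
    using eq by (simp cong: measurable_cong)
  from cond_E_nn_bound[OF YZ(2) this le f] show ?thesis using eq by (simp cong: nn_integral_cong)
qed

text \<open>The quadratic Taylor bound of the exponential at x / C0, used to draw second moments of
  the envelopes from their exponential moments.\<close>

lemma square_le_exp: "(max 0 x)\<^sup>2 \<le> 2 * C0\<^sup>2 * exp (x / C0)" for x :: real
proof (cases "x \<ge> 0")
  case True
  have "(x / C0)\<^sup>2 / 2 \<le> exp (x / C0)"
    using exp_lower_Taylor_quadratic[of "x / C0"] divide_nonneg_pos[OF True C_pos(1)] by linarith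
  then show ?thesis using True C_pos(1) by (simp add: field_simps)
qed simp

lemma envelope_square_integrable:
  assumes b: "b \<in> borel_measurable borel" "\<And>y. y \<in> S ==> sup_deriv_a k l I y = b y"
    and le: "AE \<omega> in M. cond_E_nn M Z (\<lambda>\<omega>. exp (sup_deriv_a k l I (Y \<omega>) / C0)) \<omega> \<le> ennreal C"
  shows "integrable M (\<lambda>\<omega>. (max 0 (b (Y \<omega>)))\<^sup>2)"
proof -
  have m: "(\<lambda>\<omega>. exp (b (Y \<omega>) / C0)) \<in> borel_measurable M" using b(1) YZ(1) by measurable
  have "(\<integral>\<^sup>+\<omega>. 1 * ennreal (exp (b (Y \<omega>) / C0)) \<partial>M) \<le> ennreal C * (\<integral>\<^sup>+\<omega>. 1 \<partial>M)"
    by (rule exp_moment[OF b le, of "\<lambda>_. 1"]) (assumption, rule borel_measurable_const)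
  also have "\<dots> < \<infinity>" by (simp add: emeasure_space_1)
  finally have "integrable M (\<lambda>\<omega>. exp (b (Y \<omega>) / C0))"
    using m by (intro integrableI_nonneg) auto
  then have i: "integrable M (\<lambda>\<omega>. 2 * C0\<^sup>2 * exp (b (Y \<omega>) / C0))" by simp
  show ?thesis
  proof (rule Bochner_Integration.integrable_bound[OF i])
    show "(\<lambda>\<omega>. (max 0 (b (Y \<omega>)))\<^sup>2) \<in> borel_measurable M" using b(1) YZ(1) by measurable
    show "AE \<omega> in M. norm ((max 0 (b (Y \<omega>)))\<^sup>2) \<le> norm (2 * C0\<^sup>2 * exp (b (Y \<omega>) / C0))"
    proof (rule AE_I2)
      fix \<omega>
      have "0 \<le> 2 * C0\<^sup>2 * exp (b (Y \<omega>) / C0)" by simp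
      then show "norm ((max 0 (b (Y \<omega>)))\<^sup>2) \<le> norm (2 * C0\<^sup>2 * exp (b (Y \<omega>) / C0))"
        using square_le_exp[of "b (Y \<omega>)"] by (simp only: real_norm_def abs_of_nonneg zero_le_power2)
    qed
  qed
qed

lemma w3_square: "integrable N (\<lambda>x. (w3 x)\<^sup>2)"
  using envelope_square_integrable[OF b3(1,2) exp3] borel_measurable_power[OF w3_measurable, of 2]
  by (subst integrable_N) (simp_all add: w3_def)

lemma w2_square: "integrable N (\<lambda>x. (w2 x)\<^sup>2)"
proof -
  have "integrable M (\<lambda>\<omega>. (w2 (Y \<omega>, Z \<omega>))\<^sup>2)"
  proof (rule Bochner_Integration.integrable_bound[OF envelope_square_integrable[OF b2(1,2) exp2]])
    show "(\<lambda>\<omega>. (w2 (Y \<omega>, Z \<omega>))\<^sup>2) \<in> borel_measurable M"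
      by (intro borel_measurable_power compose_YZ[OF w2_measurable])
    show "AE \<omega> in M. norm ((w2 (Y \<omega>, Z \<omega>))\<^sup>2) \<le> norm ((max 0 (b2 (Y \<omega>)))\<^sup>2)"
      using G2 AE_space
    proof eventually_elim
      case (elim \<omega>)
      have "g0 (Z \<omega>) \<in> I" using g0_range YZ(4)[OF elim(2)] by blast
      then have "\<bar>w2 (Y \<omega>, Z \<omega>)\<bar> \<le> b2 (Y \<omega>)"
        unfolding w2_eq[OF elim(2)] using b2(4)[OF YZ(3)[OF elim(2)] elim(1)] by simp
      then have "\<bar>w2 (Y \<omega>, Z \<omega>)\<bar>\<^sup>2 \<le> (max 0 (b2 (Y \<omega>)))\<^sup>2" by (intro power_mono) auto
      then show ?case by simp
    qed
  qed
  then show ?thesis using w2_measurable by (subst integrable_N) auto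
qed

lemma integrable_bounded_times:
  fixes f :: "real => real"
  assumes X: "integrable M X'" and f: "f \<in> borel_measurable borel" "\<And>z. \<bar>f z\<bar> \<le> C"
  shows "integrable M (\<lambda>\<omega>. f (Z \<omega>) * X' \<omega>)"
proof (rule Bochner_Integration.integrable_bound)
  show "integrable M (\<lambda>\<omega>. C * X' \<omega>)" using X by simp
  show "(\<lambda>\<omega>. f (Z \<omega>) * X' \<omega>) \<in> borel_measurable M" using f(1) YZ(2) X by measurable
  have "\<bar>f z\<bar> * \<bar>t\<bar> \<le> \<bar>C\<bar> * \<bar>t\<bar>" for z t using f(2)[of z] by (intro mult_right_mono) auto
  then show "AE \<omega> in M. norm (f (Z \<omega>) * X' \<omega>) \<le> norm (C * X' \<omega>)" by (simp add: abs_mult)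
qed

lemma cond_E_bounded:
  fixes f :: "real => real"
  assumes X: "integrable M X'" and f: "f \<in> borel_measurable borel" "\<And>z. \<bar>f z\<bar> \<le> C"
  shows "(\<integral>\<omega>. f (Z \<omega>) * X' \<omega> \<partial>M) = (\<integral>\<omega>. f (Z \<omega>) * cond_E M Z X' \<omega> \<partial>M)"
  using cond_E_integral[OF YZ(2) _ integrable_bounded_times[OF X f] f(1)] X by simp

lemma product_extend_bounded:
  assumes f: "continuous_on {0..1} f" and g: "continuous_on {0..1} g"
  obtains C where "\<And>z. \<bar>extend f z * extend g z\<bar> \<le> C"
proof -
  obtain Cf where Cf: "Cf \<ge> 0" "\<And>z. \<bar>extend f z\<bar> \<le> Cf" using extend_bounded[OF f] by blast
  obtain Cg where Cg: "Cg \<ge> 0" "\<And>z. \<bar>extend g z\<bar> \<le> Cg" using extend_bounded[OF g] by blast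
  have "\<bar>extend f z * extend g z\<bar> \<le> Cf * Cg" for z
    unfolding abs_mult using Cf Cg by (intro mult_mono) auto
  then show thesis by (rule that)
qed

lemma square_integrable_imp:
  assumes "f \<in> borel_measurable M" "integrable M (\<lambda>\<omega>. (f \<omega>)\<^sup>2)"
  shows "integrable M (f :: 'w => real)"
  by (rule square_integrable_imp_integrable[OF assms])

lemma score_integrable: "integrable M (\<lambda>\<omega>. eps \<omega>)" (is ?A)
  "integrable M (\<lambda>\<omega>. (eps \<omega>)\<^sup>2)" (is ?B)
proof -
  interpret s: iid_sample M N X by (rule sample)
  have "integrable N (\<lambda>x. (e x)\<^sup>2)" by (rule s.N.L4_integrable_square[OF e_L4])
  then have "integrable M (\<lambda>\<omega>. (e (Y \<omega>, Z \<omega>))\<^sup>2)" using e_measurable by (subst (asm) integrable_N) auto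
  then show 2: ?B using e_eq by (simp cong: Bochner_Integration.integrable_cong)
  show ?A
    by (rule square_integrable_imp[OF score_measurable 2])
qed

lemma deriv2_integrable: "integrable M (\<lambda>\<omega>. deriv_a 2 l (Y \<omega>) (g0 (Z \<omega>)))"
proof (rule square_integrable_imp[OF deriv2_measurable])
  have "integrable M (\<lambda>\<omega>. (w2 (Y \<omega>, Z \<omega>))\<^sup>2)" using w2_square w2_measurable by (subst (asm) integrable_N) auto
  then show "integrable M (\<lambda>\<omega>. (deriv_a 2 l (Y \<omega>) (g0 (Z \<omega>)))\<^sup>2)"
    using w2_eq by (simp cong: Bochner_Integration.integrable_cong)
qed

lemma info_measurable: "info_Z \<in> borel_measurable M"
  unfolding information_def[abs_def] cond_E_def by measurable

lemma info_integrable: "integrable M (info_Z)"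
proof (rule integrable_const_bound)
  show "AE \<omega> in M. norm (info_Z \<omega>) \<le> C2"
    using info
  proof eventually_elim
    case (elim \<omega>)
    have "0 < 1 / C2" using C_pos(3) by simp
    then show ?case using elim unfolding real_norm_def by linarith
  qed
qed (rule info_measurable)

lemma V_form_eq: "Vf f g = (\<integral>\<omega>. extend f (Z \<omega>) * extend g (Z \<omega>) * info_Z \<omega> \<partial>M)"
  unfolding V_form_def by (rule Bochner_Integration.integral_cong) (simp_all add: extend_Z mult_ac)

lemma V_integrable:
  assumes f: "continuous_on {0..1} f" and g: "continuous_on {0..1} g"
  shows "integrable M (\<lambda>\<omega>. extend f (Z \<omega>) * extend g (Z \<omega>) * info_Z \<omega>)"
proof -
  obtain C where C: "\<And>z. \<bar>extend f z * extend g z\<bar> \<le> C" using product_extend_bounded[OF f g] by blast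
  have "(\<lambda>z. extend f z * extend g z) \<in> borel_measurable borel"
    by (intro borel_measurable_times extend_measurable f g)
  from integrable_bounded_times[OF info_integrable this C] show ?thesis .
qed

lemma V_form_linear:
  assumes f: "continuous_on {0..1} f" and g: "continuous_on {0..1} g" and k: "continuous_on {0..1} k"
  shows "Vf (\<lambda>x. c * f x + d * g x) k = c * Vf f k + d * Vf g k"
proof -
  have eq: "extend (\<lambda>x. c * f x + d * g x) z * extend k z * i
    = c * (extend f z * extend k z * i) + d * (extend g z * extend k z * i)" for z i
    by (simp add: extend_def algebra_simps)
  show ?thesis unfolding V_form_eq eq using V_integrable[OF f k] V_integrable[OF g k] by simp
qed

lemma V_form_sym: "Vf f g = Vf g f"
  unfolding V_form_def by (simp add: mult_ac)

text \<open>The lower bound on the information makes \<open>V\<close> dominate the plain mean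
  square, which is what the third derivative bound is compared with.\<close>

lemma V_form_ge:
  assumes f: "continuous_on {0..1} f"
  shows "integrable M (\<lambda>\<omega>. (extend f (Z \<omega>))\<^sup>2)" (is ?A) "(\<integral>\<omega>. (extend f (Z \<omega>))\<^sup>2 \<partial>M) \<le> C2 * Vf f f" (is ?B)
proof -
  obtain C where C: "\<And>z. \<bar>extend f z * extend f z\<bar> \<le> C" using product_extend_bounded[OF f f] by blast
  have m: "(\<lambda>z. extend f z * extend f z) \<in> borel_measurable borel"
    by (intro borel_measurable_times extend_measurable f)
  show i: ?A
    using integrable_bounded_times[OF _ m C, of "\<lambda>_. 1"] by (simp add: power2_eq_square)
  have "(\<integral>\<omega>. (extend f (Z \<omega>))\<^sup>2 \<partial>M) \<le> (\<integral>\<omega>. C2 * (extend f (Z \<omega>) * extend f (Z \<omega>) * info_Z \<omega>) \<partial>M)"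
  proof (rule integral_mono_AE[OF i])
    show "AE \<omega> in M. (extend f (Z \<omega>))\<^sup>2 \<le> C2 * (extend f (Z \<omega>) * extend f (Z \<omega>) * info_Z \<omega>)"
      using info
    proof eventually_elim
      case (elim \<omega>)
      have "1 \<le> C2 * info_Z \<omega>" using elim C_pos(3) by (simp add: field_simps)
      then have "(extend f (Z \<omega>))\<^sup>2 * 1 \<le> (extend f (Z \<omega>))\<^sup>2 * (C2 * info_Z \<omega>)"
        by (intro mult_left_mono) auto
      then show ?case by (simp add: power2_eq_square mult_ac)
    qed
  qed (use V_integrable[OF f f] in simp)
  then show ?B by (simp add: V_form_eq)
qed

lemma V_form_nonneg:
  assumes f: "continuous_on {0..1} f"
  shows "Vf f f \<ge> 0"
proof -
  have "0 \<le> (\<integral>\<omega>. (extend f (Z \<omega>))\<^sup>2 \<partial>M)" by simp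
  then have "0 \<le> C2 * Vf f f" using V_form_ge(2)[OF f] by linarith
  then show ?thesis using C_pos(3) by (simp add: zero_le_mult_iff)
qed

lemma e_mean:
  assumes f: "continuous_on {0..1} f"
  shows "(\<integral>x. e x * on_unit f x \<partial>N) = 0"
proof -
  obtain C where C: "\<And>z. \<bar>extend f z\<bar> \<le> C" using extend_bounded[OF f] by blast
  have [measurable]: "extend f \<in> borel_measurable borel" by (rule extend_measurable[OF f])
  note [measurable] = e_measurable
  have "(\<integral>x. e x * on_unit f x \<partial>N) = (\<integral>\<omega>. e (Y \<omega>, Z \<omega>) * extend f (Z \<omega>) \<partial>M)"
    unfolding on_unit_extend by (subst integral_N) simp_all
  also have "\<dots> = (\<integral>\<omega>. extend f (Z \<omega>) * eps \<omega> \<partial>M)"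
    by (rule Bochner_Integration.integral_cong) (simp_all add: e_eq mult.commute)
  also have "\<dots> = (\<integral>\<omega>. extend f (Z \<omega>) * cond_E M Z (\<lambda>\<omega>. eps \<omega>) \<omega> \<partial>M)"
    by (rule cond_E_bounded[OF score_integrable(1) extend_measurable[OF f] C])
  also have "\<dots> = 0" by (rule integral_eq_zero_AE) (use score_mean in eventually_elim, simp)
  finally show ?thesis .
qed

lemma e_square:
  assumes f: "continuous_on {0..1} f" and g: "continuous_on {0..1} g"
  shows "(\<integral>x. (e x)\<^sup>2 * (on_unit f x * on_unit g x) \<partial>N) = Vf f g"
proof -
  obtain C where C: "\<And>z. \<bar>extend f z * extend g z\<bar> \<le> C" using product_extend_bounded[OF f g] by blast
  have [measurable]: "extend f \<in> borel_measurable borel" "extend g \<in> borel_measurable borel"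
    by (rule extend_measurable[OF f], rule extend_measurable[OF g])
  note [measurable] = e_measurable YZ(1,2)
  have m: "(\<lambda>z. extend f z * extend g z) \<in> borel_measurable borel" by measurable
  have "(\<integral>x. (e x)\<^sup>2 * (on_unit f x * on_unit g x) \<partial>N) = (\<integral>\<omega>. (e (Y \<omega>, Z \<omega>))\<^sup>2 * (extend f (Z \<omega>) * extend g (Z \<omega>)) \<partial>M)"
    unfolding on_unit_extend by (subst integral_N) simp_all
  also have "\<dots> = (\<integral>\<omega>. (extend f (Z \<omega>) * extend g (Z \<omega>)) * (eps \<omega>)\<^sup>2 \<partial>M)"
    by (rule Bochner_Integration.integral_cong) (simp_all add: e_eq mult.commute)
  also have "\<dots> = (\<integral>\<omega>. (extend f (Z \<omega>) * extend g (Z \<omega>)) * cond_E M Z (\<lambda>\<omega>. (eps \<omega>)\<^sup>2) \<omega> \<partial>M)"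
    by (rule cond_E_bounded[OF score_integrable(2) m C])
  also have "\<dots> = (\<integral>\<omega>. extend f (Z \<omega>) * extend g (Z \<omega>) * info_Z \<omega> \<partial>M)"
    by (rule integral_cong_AE) (use score_square info_measurable in \<open>auto simp: cond_E_def elim: eventually_mono\<close>)
  finally show ?thesis by (simp only: V_form_eq)
qed

lemma w2_form:
  assumes f: "continuous_on {0..1} f"
  shows "(\<integral>x. w2 x * (on_unit f x)\<^sup>2 \<partial>N) = Vf f f"
proof -
  obtain C where C: "\<And>z. \<bar>extend f z * extend f z\<bar> \<le> C" using product_extend_bounded[OF f f] by blast
  have [measurable]: "extend f \<in> borel_measurable borel" by (rule extend_measurable[OF f])
  note [measurable] = w2_measurable
  have m: "(\<lambda>z. extend f z * extend f z) \<in> borel_measurable borel" by measurable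
  have "(\<integral>x. w2 x * (on_unit f x)\<^sup>2 \<partial>N) = (\<integral>\<omega>. w2 (Y \<omega>, Z \<omega>) * (extend f (Z \<omega>))\<^sup>2 \<partial>M)"
    unfolding on_unit_extend by (subst integral_N) simp_all
  also have "\<dots> = (\<integral>\<omega>. - ((extend f (Z \<omega>) * extend f (Z \<omega>)) * deriv_a 2 l (Y \<omega>) (g0 (Z \<omega>))) \<partial>M)"
    by (rule Bochner_Integration.integral_cong) (simp_all add: w2_eq power2_eq_square)
  also have "\<dots> = - (\<integral>\<omega>. (extend f (Z \<omega>) * extend f (Z \<omega>)) * deriv_a 2 l (Y \<omega>) (g0 (Z \<omega>)) \<partial>M)" by simp
  also have "\<dots> = - (\<integral>\<omega>. (extend f (Z \<omega>) * extend f (Z \<omega>)) * cond_E M Z (\<lambda>\<omega>. deriv_a 2 l (Y \<omega>) (g0 (Z \<omega>))) \<omega> \<partial>M)"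
    by (simp only: cond_E_bounded[OF deriv2_integrable m C])
  also have "\<dots> = Vf f f" by (simp add: V_form_eq information_def)
  finally show ?thesis .
qed

text \<open>The three constants have separate origins: x is at most C0 exp (x / C0), the conditional
  exponential moment is at most C1, and C2 converts the mean square into \<open>V\<close>.\<close>

lemma w3_form:
  assumes f: "continuous_on {0..1} f"
  shows "(\<integral>x. w3 x * (on_unit f x)\<^sup>2 \<partial>N) \<le> C0 * C1 * C2 * Vf f f"
proof -
  have [measurable]: "extend f \<in> borel_measurable borel" by (rule extend_measurable[OF f])
  note [measurable] = w3_measurable YZ(1,2) b3(1)
  have w3_le: "w3 (y, z) \<le> C0 * exp (b3 y / C0)" for y z
  proof -
    have "b3 y / C0 \<le> exp (b3 y / C0)" using exp_ge_add_one_self[of "b3 y / C0"] by linarith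
    then have "b3 y \<le> C0 * exp (b3 y / C0)" using C_pos(1) by (simp add: field_simps)
    then show ?thesis using C_pos(1) by (simp add: w3_def)
  qed
  have "(\<integral>\<^sup>+\<omega>. ennreal ((extend f (Z \<omega>))\<^sup>2) * ennreal (exp (b3 (Y \<omega>) / C0)) \<partial>M)
    \<le> ennreal C1 * (\<integral>\<^sup>+\<omega>. ennreal ((extend f (Z \<omega>))\<^sup>2) \<partial>M)"
    by (rule exp_moment[OF b3(1,2) exp3]) measurable
  also have "\<dots> = ennreal (C1 * (\<integral>\<omega>. (extend f (Z \<omega>))\<^sup>2 \<partial>M))"
    using V_form_ge(1)[OF f] C_pos(2) by (simp add: nn_integral_eq_integral ennreal_mult)
  finally have le: "(\<integral>\<^sup>+\<omega>. ennreal ((extend f (Z \<omega>))\<^sup>2 * exp (b3 (Y \<omega>) / C0)) \<partial>M) \<le> ennreal (C1 * (\<integral>\<omega>. (extend f (Z \<omega>))\<^sup>2 \<partial>M))"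
    by (simp add: ennreal_mult)
  have i: "integrable M (\<lambda>\<omega>. (extend f (Z \<omega>))\<^sup>2 * exp (b3 (Y \<omega>) / C0))"
    by (rule integrableI_nonneg) (use le in \<open>auto simp: less_top[symmetric] top_unique\<close>)
  have ile: "(\<integral>\<omega>. (extend f (Z \<omega>))\<^sup>2 * exp (b3 (Y \<omega>) / C0) \<partial>M) \<le> C1 * (\<integral>\<omega>. (extend f (Z \<omega>))\<^sup>2 \<partial>M)"
    using le C_pos(2) by (subst (asm) nn_integral_eq_integral[OF i]) (auto simp: ennreal_le_iff)
  have "(\<integral>x. w3 x * (on_unit f x)\<^sup>2 \<partial>N) = (\<integral>\<omega>. w3 (Y \<omega>, Z \<omega>) * (extend f (Z \<omega>))\<^sup>2 \<partial>M)"
    unfolding on_unit_extend by (subst integral_N) simp_all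
  also have "\<dots> \<le> (\<integral>\<omega>. C0 * ((extend f (Z \<omega>))\<^sup>2 * exp (b3 (Y \<omega>) / C0)) \<partial>M)"
  proof (rule integral_mono_AE')
    have le: "w3 (Y \<omega>, Z \<omega>) * (extend f (Z \<omega>))\<^sup>2 \<le> C0 * exp (b3 (Y \<omega>) / C0) * (extend f (Z \<omega>))\<^sup>2" for \<omega>
      by (rule mult_right_mono[OF w3_le]) simp
    show "AE \<omega> in M. w3 (Y \<omega>, Z \<omega>) * (extend f (Z \<omega>))\<^sup>2 \<le> C0 * ((extend f (Z \<omega>))\<^sup>2 * exp (b3 (Y \<omega>) / C0))"
      using le by (simp add: mult_ac)
    show "integrable M (\<lambda>\<omega>. C0 * ((extend f (Z \<omega>))\<^sup>2 * exp (b3 (Y \<omega>) / C0)))" using i by simp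
    show "AE \<omega> in M. 0 \<le> C0 * ((extend f (Z \<omega>))\<^sup>2 * exp (b3 (Y \<omega>) / C0))" using C_pos(1) by simp
  qed
  also have "\<dots> = C0 * (\<integral>\<omega>. (extend f (Z \<omega>))\<^sup>2 * exp (b3 (Y \<omega>) / C0) \<partial>M)" by simp
  also have "\<dots> \<le> C0 * (C1 * (C2 * Vf f f))"
    using ile V_form_ge(2)[OF f] C_pos by (intro mult_left_mono order_trans[OF ile]) auto
  finally show ?thesis by (simp add: mult_ac)
qed

lemma AE_N: "G \<in> sets borel ==> AE \<omega> in M. Y \<omega> \<in> G ==> AE x in N. x \<in> {x. fst x \<in> G}"
  unfolding N_def by (subst AE_distr_iff[OF YZ_pair]) simp_all

lemma taylor_bound:
  assumes y: "y \<in> S" "y \<in> G3" and seg: "closed_segment a (a + t) \<subseteq> I"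
  shows "\<bar>deriv_a 0 l y (a + t) - deriv_a 0 l y a - (deriv_a 1 l y a * t + deriv_a 2 l y a * t\<^sup>2 / 2)\<bar> \<le> b3 y * \<bar>t\<bar> ^ 3 / 6"
proof (cases "t = 0")
  case False
  have der: "DERIV (deriv_a k l y) s :> deriv_a (Suc k) l y s" if "k < 3" for k s
    using smooth[OF y(1) that, of s] by (simp add: deriv_a_Suc DERIV_deriv_iff_real_differentiable)
  obtain s where s: "if a + t < a then a + t < s \<and> s < a else a < s \<and> s < a + t"
    "deriv_a 0 l y (a + t) = (\<Sum>k<3. deriv_a k l y a / fact k * (a + t - a) ^ k) + deriv_a 3 l y s / fact 3 * (a + t - a) ^ 3"
    using Taylor[of 3 "\<lambda>k. deriv_a k l y" "deriv_a 0 l y" "min a (a + t)" "max a (a + t)" a "a + t"] der False by auto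
  have "s \<in> closed_segment a (a + t)" using s(1) by (auto simp: closed_segment_eq_real_ivl split: if_splits)
  then have b: "\<bar>deriv_a 3 l y s\<bar> \<le> b3 y" using b3(4)[OF y] seg by blast
  have "deriv_a 0 l y (a + t) - deriv_a 0 l y a - (deriv_a 1 l y a * t + deriv_a 2 l y a * t\<^sup>2 / 2) = deriv_a 3 l y s * t ^ 3 / 6"
    unfolding s(2) by (simp add: eval_nat_numeral fact_reduce power2_eq_square)
  also have "\<bar>\<dots>\<bar> = \<bar>deriv_a 3 l y s\<bar> * \<bar>t\<bar> ^ 3 / 6" by (simp add: abs_mult power_abs)
  also have "\<dots> \<le> b3 y * \<bar>t\<bar> ^ 3 / 6" using b by (intro divide_right_mono mult_right_mono) auto
  finally show ?thesis .
qed simp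

text \<open>The range of \<open>g0\<close> is compact inside the open set \<open>I\<close>, so it
  keeps a positive distance from the complement; half of it leaves room for closed segments.\<close>

lemma radius:
  obtains s0 where "s0 > 0" "\<And>z t. z \<in> {0..1} ==> \<bar>t\<bar> \<le> s0 ==> closed_segment (g0 z) (g0 z + t) \<subseteq> I"
proof -
  have "compact (g0 ` {0..1})" by (rule compact_continuous_image[OF g0_continuous]) simp
  then obtain d where d: "d > 0" "(\<Union>x\<in>g0 ` {0..1}. ball x d) \<subseteq> I"
    using compact_subset_open_imp_ball_epsilon_subset[OF _ I_open g0_range] by blast
  have "closed_segment (g0 z) (g0 z + t) \<subseteq> I" if "z \<in> {0..1}" "\<bar>t\<bar> \<le> d / 2" for z t
  proof -
    have "closed_segment (g0 z) (g0 z + t) \<subseteq> ball (g0 z) d"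
      using d(1) that(2) by (intro closed_segment_subset) (auto simp: dist_real_def)
    then show ?thesis using d(2) that(1) by blast
  qed
  then show thesis using d(1) by (intro that[of "d / 2"]) auto
qed

lemma L_taylor:
  assumes s0: "\<And>z t. z \<in> {0..1} ==> \<bar>t\<bar> \<le> s0 ==> closed_segment (g0 z) (g0 z + t) \<subseteq> I"
    and i: "i \<ge> 1" "\<omega> \<in> space M" and G: "X i \<omega> \<in> {x. fst x \<in> G3}" and t: "\<bar>t\<bar> \<le> s0"
  shows "\<bar>L (X i \<omega>) t - (e (X i \<omega>) * t - w2 (X i \<omega>) * t\<^sup>2 / 2)\<bar> \<le> w3 (X i \<omega>) * \<bar>t\<bar> ^ 3 / 6"
proof -
  define y z where "y = fst (X i \<omega>)" and "z = snd (X i \<omega>)"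
  have y: "y \<in> S" "y \<in> G3" and z: "z \<in> {0..1}" using X_in[OF i] G by (auto simp: y_def z_def)
  have "L (X i \<omega>) t - (e (X i \<omega>) * t - w2 (X i \<omega>) * t\<^sup>2 / 2)
    = deriv_a 0 l y (g0 z + t) - deriv_a 0 l y (g0 z) - (deriv_a 1 l y (g0 z) * t + deriv_a 2 l y (g0 z) * t\<^sup>2 / 2)"
    using y(1) z Q0(2) Q1(2) Q2(2) by (simp add: L_def e_def w2_def extend_def y_def[symmetric] z_def[symmetric])
  then show ?thesis using taylor_bound[OF y s0[OF z t]] b3(3)[OF y(2)] by (simp add: w3_def y_def[symmetric])
qed

lemma L_X: "i \<ge> 1 ==> \<omega> \<in> space M ==> L (X i \<omega>) t = l (Ys i \<omega>) (g0 (Zs i \<omega>) + t) - l (Ys i \<omega>) (g0 (Zs i \<omega>))"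
  using X_in[of i \<omega>] Q0(2) by (simp add: L_def extend_def X_def deriv_a_def)

lemma L_measurable: "(\<lambda>(x, t). L x t) \<in> borel_measurable ((borel \<Otimes>\<^sub>M borel) \<Otimes>\<^sub>M borel)"
proof -
  have [measurable]: "extend g0 \<in> borel_measurable borel" by (rule extend_measurable[OF g0_continuous])
  note [measurable] = Q0(1)
  show ?thesis unfolding L_def by measurable
qed

end

section \<open>The limit theorem\<close>

context plrt_sample
begin

text \<open>The random function is measurable at each fixed point only. Rounding the evaluation
  point down to a grid gives finite sums of measurable products, and continuity in z passes to the
  limit.\<close>

lemma random_function_measurable:
  assumes f: "\<And>\<omega>. \<omega> \<in> space M ==> f \<omega> \<in> H" and fm: "\<And>z. z \<in> {0..1} ==> (\<lambda>\<omega>. f \<omega> z) \<in> borel_measurable M"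
  shows "(\<lambda>p. on_unit (f (fst p)) (snd p)) \<in> borel_measurable (M \<Otimes>\<^sub>M N)"
proof (rule borel_measurable_LIMSEQ_real)
  define D where "D = (\<lambda>k j. {x :: real \<times> real. snd x \<in> {0..1} \<and> nat \<lfloor>real (Suc k) * snd x\<rfloor> = j})"
  \<comment> \<open>The last index \<open>Suc k\<close> stands for z = 1 alone, which no half-open
    grid cell contains.\<close>
  define u where "u = (\<lambda>k p. \<Sum>j\<le>Suc k. indicator (D k j) (snd p) * f (fst p) (real j / real (Suc k)))"
  have D: "D k j \<in> sets N" for k j
  proof -
    have "D k j = {x \<in> space (borel \<Otimes>\<^sub>M borel). snd x \<in> {0..1} \<and> nat \<lfloor>real (Suc k) * snd x\<rfloor> = j}"
      by (simp add: D_def space_pair_measure)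
    also have "\<dots> \<in> sets (borel \<Otimes>\<^sub>M borel)" by measurable
    finally show ?thesis by (simp only: sets_N)
  qed
  show "u k \<in> borel_measurable (M \<Otimes>\<^sub>M N)" for k
    unfolding u_def
  proof (intro borel_measurable_sum borel_measurable_times)
    fix j assume j: "j \<in> {..Suc k}"
    show "(\<lambda>p. indicator (D k j) (snd p)) \<in> borel_measurable (M \<Otimes>\<^sub>M N)"
      by (rule measurable_compose[OF measurable_snd]) (use D in simp)
    have "real j / real (Suc k) \<in> {0..1}" using j by (simp add: field_simps)
    then show "(\<lambda>p. f (fst p) (real j / real (Suc k))) \<in> borel_measurable (M \<Otimes>\<^sub>M N)"
      by (rule measurable_compose[OF measurable_fst fm])
  qed
  fix p assume p: "p \<in> space (M \<Otimes>\<^sub>M N)"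
  define z where "z = snd (snd p)"
  have fH: "f (fst p) \<in> H" using p f by (auto simp: space_pair_measure)
  show "(\<lambda>k. u k p) \<longlonglongrightarrow> on_unit (f (fst p)) (snd p)"
  proof (cases "z \<in> {0..1}")
    case True
    define v where "v = (\<lambda>k. real (nat \<lfloor>real (Suc k) * z\<rfloor>) / real (Suc k))"
    have ge: "0 \<le> real (Suc k) * z" for k using True by simp
    have fl: "real (nat \<lfloor>real (Suc k) * z\<rfloor>) \<le> real (Suc k) * z" "real (Suc k) * z \<le> real (nat \<lfloor>real (Suc k) * z\<rfloor>) + 1" for k
      using ge[of k] by linarith+
    have v: "v k \<in> {0..1}" "\<bar>v k - z\<bar> \<le> 1 / real (Suc k)" for k
    proof -
      have "real (Suc k) * z \<le> real (Suc k)" using True mult_left_mono[of z 1 "real (Suc k)"] by simp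
      then have "real (nat \<lfloor>real (Suc k) * z\<rfloor>) \<le> real (Suc k)" by (rule order_trans[OF fl(1)])
      then show "v k \<in> {0..1}" by (simp add: v_def)
      have "v k - z = (real (nat \<lfloor>real (Suc k) * z\<rfloor>) - real (Suc k) * z) / real (Suc k)"
        by (simp add: v_def diff_divide_distrib del: of_nat_Suc)
      also have "\<bar>\<dots>\<bar> = \<bar>real (nat \<lfloor>real (Suc k) * z\<rfloor>) - real (Suc k) * z\<bar> / real (Suc k)" by (simp only: abs_divide abs_of_nat)
      also have "\<dots> \<le> 1 / real (Suc k)"
      proof (rule divide_right_mono)
        have "\<bar>a - b\<bar> \<le> 1" if "a \<le> b" "b \<le> a + 1" for a b :: real using that by arith
        then show "\<bar>real (nat \<lfloor>real (Suc k) * z\<rfloor>) - real (Suc k) * z\<bar> \<le> 1" using fl by blast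
      qed (rule of_nat_0_le_iff)
      finally show "\<bar>v k - z\<bar> \<le> 1 / real (Suc k)" .
    qed
    have "u k p = f (fst p) (v k)" for k
    proof -
      have "nat \<lfloor>real (Suc k) * z\<rfloor> \<le> Suc k"
        using v(1)[of k] unfolding v_def by (simp add: divide_le_eq del: of_nat_Suc)
      then have m: "nat \<lfloor>real (Suc k) * z\<rfloor> \<in> {..Suc k}" by simp
      have "u k p = (\<Sum>j\<le>Suc k. if nat \<lfloor>real (Suc k) * z\<rfloor> = j then f (fst p) (real j / real (Suc k)) else 0)"
        unfolding u_def by (rule sum.cong) (use True in \<open>auto simp: D_def z_def indicator_def simp del: of_nat_Suc\<close>)
      also have "\<dots> = f (fst p) (v k)"
        unfolding sum.delta[OF finite_atMost] v_def using m by simp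
      finally show ?thesis .
    qed
    moreover have "(\<lambda>k. f (fst p) (v k)) \<longlonglongrightarrow> f (fst p) z"
    proof (rule continuous_on_tendsto_compose[OF H_continuous[OF fH]])
      have "(\<lambda>k. v k - z) \<longlonglongrightarrow> 0"
        by (rule Lim_null_comparison[OF _ LIMSEQ_inverse_real_of_nat]) (use v(2) in \<open>simp add: inverse_eq_divide\<close>)
      then show "v \<longlonglongrightarrow> z" by (simp add: LIM_zero_iff)
    qed (use v(1) True in auto)
    ultimately show ?thesis using True by (simp add: on_unit_def z_def)
  next
    case False
    then have "u k p = 0" for k unfolding u_def by (intro sum.neutral) (auto simp: D_def z_def)
    then show ?thesis using False by (simp add: on_unit_def z_def)
  qed
qed

text \<open>\<open>e_square\<close> writes the coefficient as an integral over one observation of a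
  jointly measurable function.\<close>

lemma random_coef_measurable:
  assumes f: "\<And>\<omega>. \<omega> \<in> space M ==> f \<omega> \<in> H" and fm: "\<And>z. z \<in> {0..1} ==> (\<lambda>\<omega>. f \<omega> z) \<in> borel_measurable M"
  shows "(\<lambda>\<omega>. coef (f \<omega>) \<nu>) \<in> borel_measurable M"
proof -
  have "(\<lambda>p. (e (snd p))\<^sup>2 * (on_unit (f (fst p)) (snd p) * on_unit (hb \<nu>) (snd p))) \<in> borel_measurable (M \<Otimes>\<^sub>M N)"
    by (intro borel_measurable_times borel_measurable_power random_function_measurable[OF f fm]
        measurable_compose[OF measurable_snd e_measurable] measurable_compose[OF measurable_snd on_unit_measurable[OF hb_in]])
  then have "(\<lambda>\<omega>. \<integral>x. (e x)\<^sup>2 * (on_unit (f \<omega>) x * on_unit (hb \<nu>) x) \<partial>N) \<in> borel_measurable M"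
    by (intro N.borel_measurable_lebesgue_integral) (simp add: case_prod_beta')
  then show ?thesis using e_square[OF f hb_in] by (simp add: coef_def cong: measurable_cong)
qed

text \<open>The m-th derivative of a random function is out of reach of pointwise measurability; the
  spectral series expresses the penalty through coefficients instead.\<close>

lemma random_J_measurable:
  assumes f: "\<And>\<omega>. \<omega> \<in> space M ==> f \<omega> \<in> H" and fm: "\<And>z. z \<in> {0..1} ==> (\<lambda>\<omega>. f \<omega> z) \<in> borel_measurable M"
    and g: "\<And>\<omega>. \<omega> \<in> space M ==> g \<omega> \<in> H" and gm: "\<And>z. z \<in> {0..1} ==> (\<lambda>\<omega>. g \<omega> z) \<in> borel_measurable M"
  shows "(\<lambda>\<omega>. J (f \<omega>) (g \<omega>)) \<in> borel_measurable M"
proof (rule borel_measurable_LIMSEQ_real)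
  show "(\<lambda>n. \<Sum>\<nu><n. gam \<nu> * coef (f \<omega>) \<nu> * coef (g \<omega>) \<nu>) \<longlonglongrightarrow> J (f \<omega>) (g \<omega>)" if "\<omega> \<in> space M" for \<omega>
    using J_sums[OF f[OF that] g[OF that]] by (simp add: sums_def)
  show "(\<lambda>\<omega>. \<Sum>\<nu><n. gam \<nu> * coef (f \<omega>) \<nu> * coef (g \<omega>) \<nu>) \<in> borel_measurable M" for n
    by (intro borel_measurable_sum borel_measurable_times borel_measurable_const random_coef_measurable f fm g gm)
qed

lemma bias_cross_term:
  assumes n: "n \<ge> 1"
  shows "integrable M (\<lambda>\<omega>. (avg n (\<lambda>x. e x * on_unit (W g0) x) \<omega>)\<^sup>2)"
    "(\<integral>\<omega>. (avg n (\<lambda>x. e x * on_unit (W g0) x) \<omega>)\<^sup>2 \<partial>M) \<le> V (W g0) (W g0) / real n"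
    "avg n (\<lambda>x. e x * on_unit (W g0) x) \<in> borel_measurable M"
proof -
  let ?f = "W g0"
  let ?a = "\<lambda>x. e x * on_unit ?f x"
  have W: "?f \<in> H" by (rule W_in[OF g0_in])
  have m: "?a \<in> borel_measurable N" by (intro borel_measurable_times e_measurable on_unit_measurable W)
  show "avg n ?a \<in> borel_measurable M" by (rule avg_measurable[OF m])
  have sq: "(?a x)\<^sup>2 = (e x)\<^sup>2 * (on_unit ?f x * on_unit ?f x)" for x by (simp add: power2_eq_square mult_ac)
  have b: "\<bar>on_unit ?f x * on_unit ?f x\<bar> \<le> B\<^sup>2 * tr * ip ?f ?f" for x
    using on_unit_square_le[OF W, of x] by (simp add: power2_eq_square)
  have i: "integrable N (\<lambda>x. (?a x)\<^sup>2)"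
    unfolding sq by (rule integrable_weight_bounded[OF integrable_e2 _ b])
      (intro borel_measurable_times on_unit_measurable W)
  show "integrable M (\<lambda>\<omega>. (avg n ?a \<omega>)\<^sup>2)" "(\<integral>\<omega>. (avg n ?a \<omega>)\<^sup>2 \<partial>M) \<le> V ?f ?f / real n"
    using sample_mean_variance[OF m i n] e_mean[OF W] e_square[OF W W] unfolding sq by simp_all
qed

lemma S_S_measurable: "(\<lambda>\<omega>. ip (S n \<omega>) (S n \<omega>)) \<in> borel_measurable M" if n: "n \<ge> 1"
proof -
  have "(\<lambda>\<omega>. ip (A n \<omega>) (A n \<omega>) - 2 * avg n (\<lambda>x. e x * on_unit (W g0) x) \<omega> + ip (W g0) (W g0)) \<in> borel_measurable M"
    by (intro borel_measurable_add borel_measurable_diff borel_measurable_times borel_measurable_const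
        A_A_measurable[OF n] bias_cross_term(3)[OF n])
  then show ?thesis using ip_S_S by (simp cong: measurable_cong)
qed

lemma k2_pos: "Q.k2 > 0"
proof -
  have "0 < (\<Sum>\<nu>. 1 / (1 + lam * gam \<nu>)\<^sup>2)"
    by (intro suminf_pos sums_summable[OF k2_sums] divide_pos_pos zero_less_power denom_pos(1) zero_less_one)
  then show ?thesis using sums_unique[OF k2_sums] by simp
qed

end

context plrt_loss
begin

lemma gain_measurable:
  assumes L: "(\<lambda>(x, t). L x t) \<in> borel_measurable (N \<Otimes>\<^sub>M borel)"
    and f: "\<And>\<omega>. \<omega> \<in> space M ==> f \<omega> \<in> H" and fm: "\<And>z. z \<in> {0..1} ==> (\<lambda>\<omega>. f \<omega> z) \<in> borel_measurable M"
  shows "(\<lambda>\<omega>. gain n \<omega> (f \<omega>)) \<in> borel_measurable M"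
proof -
  have g: "(\<lambda>\<omega>. J g0 (f \<omega>)) \<in> borel_measurable M"
    by (rule random_J_measurable[OF _ _ f fm]) (use g0_in in auto)
  have "(\<lambda>\<omega>. L (X i \<omega>) (on_unit (f \<omega>) (X i \<omega>))) \<in> borel_measurable M" if i: "i \<ge> 1" for i
  proof -
    have "(\<lambda>\<omega>. (\<omega>, X i \<omega>)) \<in> M \<rightarrow>\<^sub>M M \<Otimes>\<^sub>M N" by (intro measurable_Pair measurable_ident_sets X_measurable i refl)
    from measurable_compose[OF this random_function_measurable[OF f fm]]
    have "(\<lambda>\<omega>. on_unit (f \<omega>) (X i \<omega>)) \<in> borel_measurable M" by simp
    from measurable_compose[OF measurable_Pair[OF X_measurable[OF i] this] L] show ?thesis by simp
  qed
  then show ?thesis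
    unfolding gain_def avg_def
    by (intro borel_measurable_diff borel_measurable_divide borel_measurable_sum borel_measurable_times
        borel_measurable_const g random_J_measurable f fm) auto
qed

end

text \<open>Only the smoothing parameter, and with it the kernel, the operator and the inner
  product, varies with n; the sample, the basis and all constants are fixed, which is what makes the
  bounds uniform in n.\<close>

locale plrt_sequence = iid_sample M N X
  for M :: "'w measure" and N :: "(real \<times> real) measure" and X +
  fixes H :: "(real => real) set" and V J :: "(real => real) => (real => real) => real"
    and lam :: "nat => real" and hb :: "nat => real => real" and gam :: "nat => real"
    and K :: "nat => real => real => real" and W :: "nat => (real => real) => real => real" and B :: real
    and e w2 w3 :: "real \<times> real => real" and C3 :: real and g0 :: "real => real"
    and L :: "real \<times> real => real => real" and G :: "(real \<times> real) set" and s0 :: real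
    and h :: "nat => real" and m :: nat and ghat :: "nat => 'w => real => real"
  assumes loss: "\<And>n. plrt_loss M N X H V J (lam n) hb gam (K n) (W n) B e w2 w3 C3 g0 L G s0"
    and L_measurable: "(\<lambda>(x, t). L x t) \<in> borel_measurable (N \<Otimes>\<^sub>M borel)"
    and h_pos: "\<And>n. h n > 0" and lam_eq: "\<And>n. lam n = h n ^ (2 * m)" and m_pos: "m > 0"
    and h_lim: "h \<longlonglongrightarrow> 0"
    and gam_order: "same_order gam (\<lambda>\<nu>. real \<nu> ^ (2 * m))"
    and bw_upper: "(\<lambda>n. real n * h n ^ (2 * m + 1)) \<in> O(\<lambda>_. 1)"
    and bw_lower: "filterlim (\<lambda>n. real n * h n ^ 3) at_top sequentially"
    and ghat_in: "\<And>n \<omega>. \<omega> \<in> space M ==> ghat n \<omega> \<in> H"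
    and ghat_measurable: "\<And>n z. z \<in> {0..1} ==> (\<lambda>\<omega>. ghat n \<omega> z) \<in> borel_measurable M"
begin

sublocale P: plrt_loss M N X H V J "lam n" hb gam "K n" "W n" B e w2 w3 C3 g0 L G s0 for n
  by (rule loss)


text \<open>This is what \<open>(2 * u n) powr (- 1 / 2) * rK n\<close> becomes once
  \<open>sigma2\<close> and \<open>rho2\<close> are identified with h times \<open>tr\<close> and h
  times \<open>k2\<close>: the powers of h cancel.\<close>

abbreviation scale :: "nat => real" where
  "scale n \<equiv> sqrt (1 / (2 * P.Q.k2 n))"

end

text \<open>Dominated convergence of indicators. It converts the almost sure, eventual maximality of
  the estimate into a statement about probabilities.\<close>

lemma (in prob_space) eventually_avoided_null:
  assumes E: "\<And>n. E n \<in> events" and ev: "AE \<omega> in M. \<forall>\<^sub>F n in sequentially. \<omega> \<notin> E n"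
  shows "(\<lambda>n. prob (E n)) \<longlonglongrightarrow> 0"
proof -
  have "(\<lambda>n. \<integral>\<omega>. indicator (E n) \<omega> \<partial>M) \<longlonglongrightarrow> (\<integral>\<omega>. (0 :: real) \<partial>M)"
  proof (rule integral_dominated_convergence[where w = "\<lambda>_. 1"])
    show "AE \<omega> in M. (\<lambda>n. indicator (E n) \<omega>) \<longlonglongrightarrow> (0 :: real)"
      using ev
    proof eventually_elim
      case (elim \<omega>)
      then have "\<forall>\<^sub>F n in sequentially. (indicator (E n) \<omega> :: real) = 0" by eventually_elim simp
      then show ?case by (rule tendsto_eventually)
    qed
  qed (use E in auto)
  then show ?thesis using E by simp
qed

text \<open>With \<open>h = a\<^sup>2\<close> and \<open>n = b\<^sup>2\<close> all radicals become monomials in \<open>a\<close> and \<open>b\<close>.\<close>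

lemma quadratic_error_rate:
  fixes n h t k c C K B C3 :: real
  assumes n: "n > 0" and h: "h > 0" and t: "0 \<le> t" "t \<le> C / h" and c: "c > 0" and k: "k \<ge> c / h"
    and K: "K > 0" and C3: "C3 \<ge> 0" and small: "1 / sqrt (n * h) \<le> 1"
  shows "sqrt (1 / (2 * k)) * (n * (sqrt (1 / sqrt (n * h)) * (sqrt (K / (n * h)))\<^sup>2
      + sqrt (B\<^sup>2 * t) * sqrt (K / (n * h)) ^ 3 * (C3 + sqrt (1 / sqrt (n * h))) / 3))
    \<le> K / sqrt (2 * c) * sqrt (1 / sqrt (n * h ^ 3)) + \<bar>B\<bar> * sqrt C * sqrt K ^ 3 * (C3 + 1) / (3 * sqrt (2 * c)) * (1 / sqrt (n * h ^ 3))"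
proof -
  define a b where "a = sqrt h" and "b = sqrt n"
  have ab: "a > 0" "b > 0" using h n by (auto simp: a_def b_def)
  have hn: "h = a\<^sup>2" "n = b\<^sup>2" using h n by (auto simp: a_def b_def)
  have r: "sqrt (n * h) = a * b" "sqrt (n * h ^ 3) = a ^ 3 * b" "sqrt (K / (n * h)) = sqrt K / (a * b)"
  proof -
    show r1: "sqrt (n * h) = a * b"
      by (rule real_sqrt_unique) (use ab in \<open>auto simp: hn power_mult_distrib\<close>)
    show "sqrt (n * h ^ 3) = a ^ 3 * b"
      by (rule real_sqrt_unique) (use ab in \<open>auto simp: hn power_mult_distrib power_mult[symmetric]\<close>)
    show "sqrt (K / (n * h)) = sqrt K / (a * b)" by (simp only: real_sqrt_divide r1)
  qed
  have C: "C \<ge> 0" using t h by (metis divide_nonneg_pos dual_order.trans mult_nonneg_nonneg less_imp_le nonzero_eq_divide_eq order_less_irrefl)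
  define s where "s = sqrt (1 / (2 * k))"
  define p where "p = sqrt (1 / (a * b))"
  have s: "0 \<le> s" "s \<le> a / sqrt (2 * c)"
  proof -
    have kp: "k > 0" using k c h by (meson divide_pos_pos less_le_trans)
    then show "0 \<le> s" by (simp add: s_def)
    have "1 / (2 * k) \<le> h / (2 * c)" using k kp c h by (simp add: field_simps)
    then have "s \<le> sqrt (h / (2 * c))" unfolding s_def by (rule real_sqrt_le_mono)
    then show "s \<le> a / sqrt (2 * c)" by (simp add: a_def real_sqrt_divide)
  qed
  have p: "0 \<le> p" "p \<le> 1" using ab small unfolding r by (auto simp: p_def)
  have pa: "p / a = sqrt (1 / (a ^ 3 * b))"
  proof -
    have "sqrt (1 / (a ^ 3 * b)) = sqrt (1 / (a * b) / a\<^sup>2)" using ab by (simp add: power2_eq_square power3_eq_cube mult_ac)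
    also have "\<dots> = p / a" unfolding real_sqrt_divide[of _ "a\<^sup>2"] p_def using ab by simp
    finally show ?thesis by simp
  qed
  have t': "sqrt (B\<^sup>2 * t) \<le> \<bar>B\<bar> * (sqrt C / a)"
  proof -
    have "sqrt t \<le> sqrt (C / h)" using t by simp
    then have "\<bar>B\<bar> * sqrt t \<le> \<bar>B\<bar> * (sqrt C / a)" by (intro mult_left_mono) (auto simp: a_def real_sqrt_divide)
    then show ?thesis by (simp add: real_sqrt_mult)
  qed
  define c' where "c' = sqrt (2 * c)"
  have c': "c' > 0" using c by (simp add: c'_def)
  have one: "s * (n * (p * (sqrt K / (a * b))\<^sup>2)) \<le> K / c' * (p / a)"
  proof -
    have "s * (n * (p * (sqrt K / (a * b))\<^sup>2)) \<le> a / c' * (n * (p * (sqrt K / (a * b))\<^sup>2))"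
      using s p n by (intro mult_right_mono) (auto simp: c'_def)
    also have "\<dots> = K / c' * (p / a)" using ab c' K by (simp add: hn power_divide field_simps power2_eq_square)
    finally show ?thesis .
  qed
  have two: "s * (n * (sqrt (B\<^sup>2 * t) * (sqrt K / (a * b)) ^ 3 * (C3 + p) / 3)) \<le> \<bar>B\<bar> * sqrt C * sqrt K ^ 3 * (C3 + 1) / (3 * c') * (1 / (a ^ 3 * b))"
  proof -
    have q: "0 \<le> (sqrt K / (a * b)) ^ 3" using K ab by simp
    have "s * (n * (sqrt (B\<^sup>2 * t) * (sqrt K / (a * b)) ^ 3 * (C3 + p) / 3))
      \<le> a / c' * (n * (\<bar>B\<bar> * (sqrt C / a) * (sqrt K / (a * b)) ^ 3 * (C3 + 1) / 3))"
      using s p n t' q C3 t C ab K c'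
      by (intro mult_mono divide_right_mono order_refl add_left_mono mult_nonneg_nonneg divide_nonneg_nonneg add_nonneg_nonneg) (auto simp: c'_def)
    also have "\<dots> = \<bar>B\<bar> * sqrt C * sqrt K ^ 3 * (C3 + 1) / (3 * c') * (1 / (a ^ 3 * b))"
      using ab c' by (simp add: hn power_divide field_simps eval_nat_numeral)
    finally show ?thesis .
  qed
  have "s * (n * (p * (sqrt K / (a * b))\<^sup>2 + sqrt (B\<^sup>2 * t) * (sqrt K / (a * b)) ^ 3 * (C3 + p) / 3))
    = s * (n * (p * (sqrt K / (a * b))\<^sup>2)) + s * (n * (sqrt (B\<^sup>2 * t) * (sqrt K / (a * b)) ^ 3 * (C3 + p) / 3))"
    by (simp only: distrib_left)
  from order_trans[OF eq_refl[OF this] add_mono[OF one two]]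
  show ?thesis unfolding pa unfolding r s_def p_def c'_def .
qed

section \<open>Rates along the sequence of bandwidths\<close>

context plrt_sequence
begin

lemma eventually_h_le: "\<forall>\<^sub>F n in sequentially. h n \<le> 1"
  using order_tendstoD(2)[OF h_lim zero_less_one] by eventually_elim simp

lemma eventually_ge_1: "\<forall>\<^sub>F n::nat in sequentially. n \<ge> 1"
  by (rule eventually_ge_at_top)

lemma nh3_null: "(\<lambda>n. 1 / (real n * h n ^ 3)) \<longlonglongrightarrow> 0"
  using tendsto_inverse_0_at_top[OF bw_lower] by (simp add: inverse_eq_divide)

lemma nh_power_null:
  assumes "k \<le> 3"
  shows "(\<lambda>n. 1 / (real n * h n ^ k)) \<longlonglongrightarrow> 0"
proof (rule Lim_null_comparison[OF _ nh3_null])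
  show "\<forall>\<^sub>F n in sequentially. norm (1 / (real n * h n ^ k)) \<le> 1 / (real n * h n ^ 3)"
    using eventually_h_le eventually_ge_1
  proof eventually_elim
    case (elim n)
    have "h n ^ 3 \<le> h n ^ k" using elim h_pos[of n] assms by (intro power_decreasing) auto
    then have "real n * h n ^ 3 \<le> real n * h n ^ k" by (intro mult_left_mono) auto
    then have "1 / (real n * h n ^ k) \<le> 1 / (real n * h n ^ 3)"
      using elim h_pos[of n] by (intro divide_left_mono mult_pos_pos zero_less_power) auto
    then show ?case using h_pos[of n] by (simp del: divide_le_eq_1)
  qed
qed

text \<open>With \<open>lam = h^(2m)\<close> this restates the upper bandwidth condition: the
  squared bias is at most of the order 1 / (n h) of the variance.\<close>

lemma undersmoothing:
  obtains Cb where "Cb > 0" "\<forall>\<^sub>F n in sequentially. real n * h n * lam n \<le> Cb"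
proof -
  obtain Cb where Cb: "Cb > 0" "\<forall>\<^sub>F n in sequentially. norm (real n * h n ^ (2 * m + 1)) \<le> Cb * norm (1 :: real)"
    using landau_o.bigE[OF bw_upper] by blast
  have "\<forall>\<^sub>F n in sequentially. real n * h n * lam n \<le> Cb"
    using Cb(2)
  proof eventually_elim
    case (elim n)
    then show ?case using abs_ge_self[of "real n * h n ^ (2 * m + 1)"] by (simp add: lam_eq mult_ac)
  qed
  then show thesis using that Cb(1) by blast
qed

lemma trace_bounds:
  obtains C c where "C > 0" "c > 0" "\<forall>\<^sub>F n in sequentially. P.tr n \<le> C / h n \<and> c / h n \<le> P.Q.k2 n"
proof -
  have nn: "gam \<nu> \<ge> 0" for \<nu> by (rule P.gam_nonneg)
  obtain C c where C: "C > 0" "c > 0"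
    "\<And>h. 0 < h ==> h \<le> 1 ==> h * (\<Sum>\<nu>. 1 / (1 + h ^ (2 * m) * gam \<nu>)) \<le> C"
    "\<And>h N. 0 < h ==> h \<le> 1 ==> real N \<ge> 1 / h ==> c \<le> h * (\<Sum>\<nu><N. 1 / (1 + h ^ (2 * m) * gam \<nu>)\<^sup>2)"
    by (rule polynomial_eigenvalues[OF gam_order m_pos nn]) blast
  have "\<forall>\<^sub>F n in sequentially. P.tr n \<le> C / h n \<and> c / h n \<le> P.Q.k2 n"
    using eventually_h_le
  proof eventually_elim
    case (elim n)
    define N' where "N' = nat \<lceil>1 / h n\<rceil>"
    have N': "real N' \<ge> 1 / h n" unfolding N'_def by linarith
    have "h n * P.tr n \<le> C" using C(3)[OF h_pos elim] by (simp only: lam_eq[symmetric] P.tr_def)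
    moreover have "(\<Sum>\<nu><N'. 1 / (1 + lam n * gam \<nu>)\<^sup>2) \<le> P.Q.k2 n"
      unfolding sums_unique[OF P.k2_sums] by (rule sum_le_suminf[OF sums_summable[OF P.k2_sums]]) auto
    then have "h n * (\<Sum>\<nu><N'. 1 / (1 + lam n * gam \<nu>)\<^sup>2) \<le> h n * P.Q.k2 n"
      using h_pos[of n] by (intro mult_left_mono) auto
    then have "c \<le> h n * P.Q.k2 n" using C(4)[OF h_pos elim N'] unfolding lam_eq by linarith
    ultimately show ?case using h_pos[of n] by (simp add: field_simps)
  qed
  then show thesis using that C by blast
qed

text \<open>The two conditions of the limit theorem hold at the rates 1 / (n h^2) and h.\<close>

lemma U_CLT: "weak_conv_m (\<lambda>n. distr M borel (\<lambda>\<omega>. sqrt (2 / ((real n)\<^sup>2 * P.Q.k2 n)) * P.Q.psum n (Suc n) (obs \<omega>))) std_normal_distribution"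
proof (rule degenerate_U_statistic_CLT)
  obtain C c where C: "C > 0" "c > 0" "\<forall>\<^sub>F n in sequentially. P.tr n \<le> C / h n \<and> c / h n \<le> P.Q.k2 n"
    by (rule trace_bounds)
  show "degenerate_kernel M N X (P.kk n) (\<lambda>x. sqrt (B\<^sup>2 * P.tr n) * \<bar>e x\<bar>)" for n
    by (rule P.degenerate_kernel_kk)
  show "P.Q.k2 n > 0" for n by (rule P.k2_pos)
  show "(\<lambda>n. P.Q.k4 n / (real n * (P.Q.k2 n)\<^sup>2)) \<longlonglongrightarrow> 0"
  proof (rule Lim_null_comparison)
    let ?D = "(B\<^sup>2 * C) ^ 4 * (\<integral>x. e x ^ 4 \<partial>N)\<^sup>2 / c\<^sup>2"
    show "(\<lambda>n. ?D * (1 / (real n * h n ^ 2))) \<longlonglongrightarrow> 0"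
      using tendsto_mult[OF tendsto_const nh_power_null[of 2], of ?D] by simp
    show "\<forall>\<^sub>F n in sequentially. norm (P.Q.k4 n / (real n * (P.Q.k2 n)\<^sup>2)) \<le> ?D * (1 / (real n * h n ^ 2))"
      using C(3) eventually_ge_1
    proof eventually_elim
      case (elim n)
      have hn: "h n > 0" by (rule h_pos)
      have "(B\<^sup>2 * P.tr n) ^ 4 \<le> (B\<^sup>2 * (C / h n)) ^ 4"
        using elim P.tr_nonneg[of n] by (intro power_mono mult_left_mono) auto
      then have "(B\<^sup>2 * P.tr n) ^ 4 * (\<integral>x. e x ^ 4 \<partial>N)\<^sup>2 \<le> (B\<^sup>2 * (C / h n)) ^ 4 * (\<integral>x. e x ^ 4 \<partial>N)\<^sup>2"
        by (rule mult_right_mono) simp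
      then have k4: "P.Q.k4 n \<le> (B\<^sup>2 * (C / h n)) ^ 4 * (\<integral>x. e x ^ 4 \<partial>N)\<^sup>2"
        by (rule order_trans[OF P.k4_le])
      have k2: "(c / h n)\<^sup>2 \<le> (P.Q.k2 n)\<^sup>2" using elim C hn by (intro power_mono) auto
      have nn: "P.Q.k4 n \<ge> 0" unfolding P.Q.k4_def by (intro Bochner_Integration.integral_nonneg) auto
      have "P.Q.k4 n / (real n * (P.Q.k2 n)\<^sup>2) \<le> ((B\<^sup>2 * (C / h n)) ^ 4 * (\<integral>x. e x ^ 4 \<partial>N)\<^sup>2) / (real n * (c / h n)\<^sup>2)"
        using elim C hn by (intro frac_le k4 mult_left_mono k2 mult_pos_pos zero_less_power divide_pos_pos) auto
      also have "\<dots> = ?D * (1 / (real n * h n ^ 2))"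
        using hn C elim by (simp add: power_mult_distrib power_divide field_simps eval_nat_numeral)
      finally show ?case using nn by simp
    qed
  qed
  show "(\<lambda>n. P.Q.g2 n / (P.Q.k2 n)\<^sup>2) \<longlonglongrightarrow> 0"
  proof (rule Lim_null_comparison)
    show "(\<lambda>n. (1 / c) * h n) \<longlonglongrightarrow> 0" using tendsto_mult[OF tendsto_const h_lim, of "1 / c"] by simp
    show "\<forall>\<^sub>F n in sequentially. norm (P.Q.g2 n / (P.Q.k2 n)\<^sup>2) \<le> (1 / c) * h n"
      using C(3)
    proof eventually_elim
      case (elim n)
      have nn: "P.Q.g2 n \<ge> 0" unfolding P.Q.g2_def by (intro Bochner_Integration.integral_nonneg) auto
      have "P.Q.g2 n / (P.Q.k2 n)\<^sup>2 \<le> P.Q.k2 n / (P.Q.k2 n)\<^sup>2" by (intro divide_right_mono P.g2_le) simp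
      also have "\<dots> = 1 / P.Q.k2 n" by (simp add: power2_eq_square)
      also have "\<dots> \<le> 1 / (c / h n)" using elim C(2) h_pos[of n] P.k2_pos[of n] by (intro divide_left_mono) auto
      finally show ?case using nn by simp
    qed
  qed
qed

text \<open>The variance of the diagonal average is at most of order h^(-2) / n, and the squared
  scale contributes a factor of order h, leaving 1 / (n h).\<close>

lemma diagonal_null:
  "null_in_prob (\<lambda>n \<omega>. scale n * (avg n (\<lambda>x. (e x)\<^sup>2 * P.kern n x x) \<omega> - P.tr n))"
proof (rule null_in_prob_L2)
  let ?a = "\<lambda>n x. (e x)\<^sup>2 * P.kern n x x"
  obtain C c where C: "C > 0" "c > 0" "\<forall>\<^sub>F n in sequentially. P.tr n \<le> C / h n \<and> c / h n \<le> P.Q.k2 n"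
    by (rule trace_bounds)
  note mv = sample_mean_variance[OF P.diag_square(3,1), unfolded P.kern_diag_integral]
  show "(\<lambda>\<omega>. scale n * (avg n (?a n) \<omega> - P.tr n)) \<in> borel_measurable M" for n
    by (intro borel_measurable_times borel_measurable_diff borel_measurable_const avg_measurable P.diag_square(3))
  have sq: "(scale n * x)\<^sup>2 = 1 / (2 * P.Q.k2 n) * x\<^sup>2" for n x
    using P.k2_pos[of n] by (simp add: power_mult_distrib power_divide real_sqrt_divide real_sqrt_mult)
  show "integrable M (\<lambda>\<omega>. (scale n * (avg n (?a n) \<omega> - P.tr n))\<^sup>2)" for n
  proof (cases "n = 0")
    case False
    then have n: "n \<ge> 1" by simp
    show ?thesis unfolding sq by (rule integrable_mult_right[OF mv(1)[OF n]])
  qed (simp add: avg_def)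
  show "(\<lambda>n. expectation (\<lambda>\<omega>. (scale n * (avg n (?a n) \<omega> - P.tr n))\<^sup>2)) \<longlonglongrightarrow> 0"
  proof (rule Lim_null_comparison)
    let ?D = "(B\<^sup>2 * C)\<^sup>2 * (\<integral>x. e x ^ 4 \<partial>N) / (2 * c)"
    show "(\<lambda>n. ?D * (1 / (real n * h n ^ 1))) \<longlonglongrightarrow> 0"
      using tendsto_mult[OF tendsto_const nh_power_null[of 1], of ?D] by simp
    show "\<forall>\<^sub>F n in sequentially. norm (expectation (\<lambda>\<omega>. (scale n * (avg n (?a n) \<omega> - P.tr n))\<^sup>2)) \<le> ?D * (1 / (real n * h n ^ 1))"
      using C(3) eventually_ge_1
    proof eventually_elim
      case (elim n)
      have hn: "h n > 0" by (rule h_pos)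
      have m4: "0 \<le> (\<integral>x. e x ^ 4 \<partial>N)" by simp
      have "(\<integral>x. (?a n x)\<^sup>2 \<partial>N) \<le> (B\<^sup>2 * P.tr n)\<^sup>2 * (\<integral>x. e x ^ 4 \<partial>N)" by (rule P.diag_square(2))
      also have "\<dots> \<le> (B\<^sup>2 * (C / h n))\<^sup>2 * (\<integral>x. e x ^ 4 \<partial>N)"
        using elim P.tr_nonneg[of n] m4 by (intro mult_right_mono power_mono mult_left_mono) auto
      finally have "(\<integral>x. (?a n x)\<^sup>2 \<partial>N) / real n \<le> (B\<^sup>2 * (C / h n))\<^sup>2 * (\<integral>x. e x ^ 4 \<partial>N) / real n"
        by (rule divide_right_mono) simp
      then have le: "(\<integral>\<omega>. (avg n (?a n) \<omega> - P.tr n)\<^sup>2 \<partial>M) \<le> (B\<^sup>2 * (C / h n))\<^sup>2 * (\<integral>x. e x ^ 4 \<partial>N) / real n"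
        by (rule order_trans[OF mv(2)[OF elim(2)]])
      have k: "1 / (2 * P.Q.k2 n) \<le> h n / (2 * c)" using elim C hn P.k2_pos[of n] by (simp add: field_simps)
      have "1 / (2 * P.Q.k2 n) * (\<integral>\<omega>. (avg n (?a n) \<omega> - P.tr n)\<^sup>2 \<partial>M) \<le> h n / (2 * c) * ((B\<^sup>2 * (C / h n))\<^sup>2 * (\<integral>x. e x ^ 4 \<partial>N) / real n)"
        using C hn by (intro mult_mono k le) auto
      also have "\<dots> = ?D * (1 / (real n * h n ^ 1))"
        using hn C elim by (simp add: power_mult_distrib power_divide field_simps power2_eq_square)
      finally show ?case unfolding sq using P.k2_pos[of n] by simp
    qed
  qed
qed

text \<open>Dominated convergence for series: \<open>lam n * gam \<nu> / (1 + lam n * gam \<nu>)\<^sup>2\<close> is bounded by 1 and vanishes in the limit.\<close>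

lemma bias_null: "(\<lambda>n. real n * h n * V (W n g0) (W n g0)) \<longlonglongrightarrow> 0"
proof -
  obtain Cb where Cb: "Cb > 0" "\<forall>\<^sub>F n in sequentially. real n * h n * lam n \<le> Cb" by (rule undersmoothing)
  define a where "a = (\<lambda>\<nu>. V g0 (hb \<nu>))"
  have g0: "g0 \<in> H" by (rule P.g0_in)
  have J: "(\<lambda>\<nu>. gam \<nu> * (a \<nu>)\<^sup>2) sums J g0 g0"
    using P.J_sums[OF g0 g0] by (simp add: a_def P.coef_def power2_eq_square mult.assoc)
  \<comment> \<open>One factor \<open>lam n\<close> is split off, against which n h stays bounded;
    what remains is dominated by the convergent series of \<open>J g0 g0\<close>.\<close>
  define f where "f = (\<lambda>\<nu> n. gam \<nu> * (a \<nu>)\<^sup>2 * (lam n * gam \<nu> / (1 + lam n * gam \<nu>)\<^sup>2))"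
  have x: "lam n * gam \<nu> \<ge> 0" for n \<nu> using P.lam_pos[of n] P.gam_nonneg[of \<nu>] by simp
  have fr: "0 \<le> lam n * gam \<nu> / (1 + lam n * gam \<nu>)\<^sup>2" "lam n * gam \<nu> / (1 + lam n * gam \<nu>)\<^sup>2 \<le> 1"
    "lam n * gam \<nu> / (1 + lam n * gam \<nu>)\<^sup>2 \<le> lam n * gam \<nu>" for n \<nu>
  proof -
    have d: "1 \<le> (1 + lam n * gam \<nu>)\<^sup>2" "lam n * gam \<nu> \<le> (1 + lam n * gam \<nu>)\<^sup>2"
    proof -
      have "1 \<le> (1 + y)\<^sup>2" "y \<le> (1 + y)\<^sup>2" if "y \<ge> 0" for y :: real
        using that zero_le_power2[of y] unfolding power2_sum power_one by linarith+
      then show "1 \<le> (1 + lam n * gam \<nu>)\<^sup>2" "lam n * gam \<nu> \<le> (1 + lam n * gam \<nu>)\<^sup>2" using x by blast+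
    qed
    then have d0: "0 < (1 + lam n * gam \<nu>)\<^sup>2" by linarith
    show "0 \<le> lam n * gam \<nu> / (1 + lam n * gam \<nu>)\<^sup>2" using x[of n \<nu>] by simp
    show "lam n * gam \<nu> / (1 + lam n * gam \<nu>)\<^sup>2 \<le> 1" using d by (simp add: divide_le_eq)
    show "lam n * gam \<nu> / (1 + lam n * gam \<nu>)\<^sup>2 \<le> lam n * gam \<nu>"
      unfolding pos_divide_le_eq[OF d0] using mult_left_mono[OF d(1) x[of n \<nu>]] by (simp only: mult_1_right)
  qed
  have f_le: "norm (f k n) \<le> gam k * (a k)\<^sup>2" "norm (f k n) \<le> gam k * (a k)\<^sup>2 * (lam n * gam k)" for k n
  proof -
    have nn: "0 \<le> gam k * (a k)\<^sup>2" using P.gam_nonneg[of k] by simp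
    have "norm (f k n) = f k n" unfolding f_def real_norm_def by (intro abs_of_nonneg mult_nonneg_nonneg nn fr(1))
    moreover have "f k n \<le> gam k * (a k)\<^sup>2 * 1" unfolding f_def by (intro mult_left_mono nn fr(2))
    moreover have "f k n \<le> gam k * (a k)\<^sup>2 * (lam n * gam k)" unfolding f_def by (intro mult_left_mono nn fr(3))
    ultimately show "norm (f k n) \<le> gam k * (a k)\<^sup>2" "norm (f k n) \<le> gam k * (a k)\<^sup>2 * (lam n * gam k)" by simp_all
  qed
  have lam0: "lam \<longlonglongrightarrow> 0"
    unfolding lam_eq using tendsto_power[OF h_lim, of "2 * m"] m_pos by (simp add: power_0_left)
  have Vf: "V (W n g0) (W n g0) = lam n * (\<Sum>\<nu>. f \<nu> n)" and fs: "summable (\<lambda>\<nu>. f \<nu> n)" for n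
  proof -
    have "(\<lambda>\<nu>. (1 / lam n) * ((lam n * gam \<nu> / (1 + lam n * gam \<nu>))\<^sup>2 * (a \<nu>)\<^sup>2)) sums ((1 / lam n) * V (W n g0) (W n g0))"
      using P.V_W_sums[OF g0, of n] unfolding P.coef_def a_def by (rule sums_mult)
    moreover have "(1 / lam n) * ((lam n * gam \<nu> / (1 + lam n * gam \<nu>))\<^sup>2 * (a \<nu>)\<^sup>2) = f \<nu> n" for \<nu>
      using P.lam_pos[of n] by (simp add: f_def power2_eq_square)
    ultimately have s: "(\<lambda>\<nu>. f \<nu> n) sums ((1 / lam n) * V (W n g0) (W n g0))" by simp
    show "summable (\<lambda>\<nu>. f \<nu> n)" by (rule sums_summable[OF s])
    show "V (W n g0) (W n g0) = lam n * (\<Sum>\<nu>. f \<nu> n)" using sums_unique[OF s] P.lam_pos[of n] by (simp add: field_simps)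
  qed
  have lim: "(\<lambda>n. \<Sum>\<nu>. f \<nu> n) \<longlonglongrightarrow> (\<Sum>\<nu>. 0)"
  proof (rule tannerys_theorem[THEN conjunct2, THEN conjunct2])
    show "(f \<nu> \<longlongrightarrow> 0) sequentially" for \<nu>
    proof (rule Lim_null_comparison)
      show "(\<lambda>n. gam \<nu> * (a \<nu>)\<^sup>2 * (lam n * gam \<nu>)) \<longlonglongrightarrow> 0"
        using tendsto_mult[OF tendsto_const tendsto_mult[OF lam0 tendsto_const], of "gam \<nu> * (a \<nu>)\<^sup>2" "gam \<nu>"] by simp
      show "\<forall>\<^sub>F n in sequentially. norm (f \<nu> n) \<le> gam \<nu> * (a \<nu>)\<^sup>2 * (lam n * gam \<nu>)"
        using f_le(2) by (intro always_eventually allI)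
    qed
    show "\<forall>\<^sub>F (k, n) in sequentially \<times>\<^sub>F sequentially. norm (f k n) \<le> gam k * (a k)\<^sup>2"
      using f_le(1) by (intro always_eventually) auto
    show "summable (\<lambda>k. gam k * (a k)\<^sup>2)" by (rule sums_summable[OF J])
  qed simp
  show ?thesis
  proof (rule Lim_null_comparison)
    show "(\<lambda>n. Cb * (\<Sum>\<nu>. f \<nu> n)) \<longlonglongrightarrow> 0" using tendsto_mult[OF tendsto_const lim, of Cb] by simp
    show "\<forall>\<^sub>F n in sequentially. norm (real n * h n * V (W n g0) (W n g0)) \<le> Cb * (\<Sum>\<nu>. f \<nu> n)"
      using Cb(2)
    proof eventually_elim
      case (elim n)
      have nn: "0 \<le> (\<Sum>\<nu>. f \<nu> n)"
        unfolding f_def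
        by (intro suminf_nonneg fs[unfolded f_def] mult_nonneg_nonneg[OF mult_nonneg_nonneg[OF P.gam_nonneg zero_le_power2] fr(1)])
      have "real n * h n * V (W n g0) (W n g0) = (real n * h n * lam n) * (\<Sum>\<nu>. f \<nu> n)" by (simp add: Vf mult_ac)
      also have "\<dots> \<le> Cb * (\<Sum>\<nu>. f \<nu> n)" by (rule mult_right_mono[OF elim nn])
      finally show ?case using h_pos[of n] P.V_nonneg[OF P.W_in[OF g0], of n] by simp
    qed
  qed
qed

text \<open>After scaling, the second moment is of order n h times
  \<open>V (W n g0) (W n g0)\<close>. Bounding the latter by the penalty of \<open>g0\<close> would
  only show boundedness, hence the finer \<open>bias_null\<close>.\<close>

lemma cross_null:
  "null_in_prob (\<lambda>n \<omega>. scale n * (- (2 * real n) * avg n (\<lambda>x. e x * on_unit (W n g0) x) \<omega>))"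
proof (rule null_in_prob_L2)
  let ?a = "\<lambda>n. avg n (\<lambda>x. e x * on_unit (W n g0) x)"
  obtain C c where C: "C > 0" "c > 0" "\<forall>\<^sub>F n in sequentially. P.tr n \<le> C / h n \<and> c / h n \<le> P.Q.k2 n"
    by (rule trace_bounds)
  have a0: "avg 0 f \<omega> = 0" for f \<omega> by (simp add: avg_def)
  have am: "?a n \<in> borel_measurable M" for n
  proof (cases "n = 0")
    case True
    have "?a 0 = (\<lambda>_. 0)" using a0 by (intro ext)
    then show ?thesis using True by simp
  qed (use P.bias_cross_term(3)[of n n] in simp)
  show "(\<lambda>\<omega>. scale n * (- (2 * real n) * ?a n \<omega>)) \<in> borel_measurable M" for n
    using am[of n] by measurable
  have sq: "(scale n * (- (2 * real n) * x))\<^sup>2 = (2 * (real n)\<^sup>2 / P.Q.k2 n) * x\<^sup>2" for n x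
    using P.k2_pos[of n] by (simp add: power_mult_distrib power_divide real_sqrt_divide real_sqrt_mult)
  show "integrable M (\<lambda>\<omega>. (scale n * (- (2 * real n) * ?a n \<omega>))\<^sup>2)" for n
  proof (cases "n = 0")
    case False
    then have n: "n \<ge> 1" by simp
    show ?thesis unfolding sq by (rule integrable_mult_right[OF P.bias_cross_term(1)[OF n]])
  qed simp
  show "(\<lambda>n. expectation (\<lambda>\<omega>. (scale n * (- (2 * real n) * ?a n \<omega>))\<^sup>2)) \<longlonglongrightarrow> 0"
  proof (rule Lim_null_comparison)
    show "(\<lambda>n. 2 / c * (real n * h n * V (W n g0) (W n g0))) \<longlonglongrightarrow> 0"
      using tendsto_mult[OF tendsto_const bias_null, of "2 / c"] by simp
    show "\<forall>\<^sub>F n in sequentially. norm (expectation (\<lambda>\<omega>. (scale n * (- (2 * real n) * ?a n \<omega>))\<^sup>2))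
        \<le> 2 / c * (real n * h n * V (W n g0) (W n g0))"
      using C(3) eventually_ge_1
    proof eventually_elim
      case (elim n)
      have hn: "h n > 0" by (rule h_pos)
      have "2 * (real n)\<^sup>2 / P.Q.k2 n \<le> 2 * (real n)\<^sup>2 / (c / h n)"
        using elim C hn P.k2_pos[of n] by (intro divide_left_mono) auto
      then have "2 * (real n)\<^sup>2 / P.Q.k2 n * (\<integral>\<omega>. (?a n \<omega>)\<^sup>2 \<partial>M) \<le> 2 * (real n)\<^sup>2 / (c / h n) * (V (W n g0) (W n g0) / real n)"
        using C hn by (intro mult_mono P.bias_cross_term(2)[OF elim(2)]) auto
      also have "\<dots> = 2 / c * (real n * h n * V (W n g0) (W n g0))"
        using hn C elim by (simp add: field_simps power2_eq_square)
      finally show ?case unfolding sq using P.k2_pos[of n] by simp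
    qed
  qed
qed

definition increment :: "nat => 'w => real => real" where
  "increment n \<omega> = (\<lambda>z. ghat n \<omega> z - g0 z)"

abbreviation attained :: "nat => 'w => real" where
  "attained n \<omega> \<equiv> P.gain n n \<omega> (increment n \<omega>)"

abbreviation quad_max :: "nat => 'w => real" where
  "quad_max n \<omega> \<equiv> P.ip n (P.S n n \<omega>) (P.S n n \<omega>)"

lemma increment_in: "\<omega> \<in> space M ==> increment n \<omega> \<in> H"
  unfolding increment_def by (rule P.H_diff[OF ghat_in P.g0_in])

lemma gain_increment_measurable: "(\<lambda>\<omega>. attained n \<omega>) \<in> borel_measurable M"
proof (rule P.gain_measurable[OF L_measurable increment_in])
  show "(\<lambda>\<omega>. increment n \<omega> z) \<in> borel_measurable M" if "z \<in> {0..1}" for z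
    unfolding increment_def using ghat_measurable[OF that] by measurable
qed

text \<open>The rate hypothesis puts the estimate in a ball of squared radius of order 1 / (n h)
  with high probability, where the quadratic approximation applies. Both its error and its
  exceptional probability reduce to powers of 1 / (n h^3).\<close>

lemma gain_null:
  assumes rate: "big_O_P M (\<lambda>n \<omega>. sqrt (P.ip n (increment n \<omega>) (increment n \<omega>))) r"
    and r: "\<And>n. n \<ge> 1 ==> (r n)\<^sup>2 \<le> 2 * (1 / (real n * h n) + lam n)" "\<And>n. r n \<ge> 0"
    and maximal: "AE \<omega> in M. \<forall>\<^sub>F n in sequentially. \<forall>f\<in>H. P.gain n n \<omega> f \<le> attained n \<omega>"
  shows "null_in_prob (\<lambda>n \<omega>. scale n *
    (2 * real n * attained n \<omega> - real n * quad_max n \<omega>))"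
    (is "null_in_prob ?R")
proof (rule null_in_probI)
  show Rm: "?R n \<in> borel_measurable M" for n
  proof (cases "n = 0")
    case False
    then have "n \<ge> 1" by simp
    then show ?thesis
      by (intro borel_measurable_times borel_measurable_diff borel_measurable_const
          gain_increment_measurable P.S_S_measurable)
  qed simp
  define nrm where "nrm = (\<lambda>n \<omega>. sqrt (P.ip n (increment n \<omega>) (increment n \<omega>)))"
  have nm: "nrm n \<in> borel_measurable M" for n using rate by (simp add: big_O_P_def nrm_def)
  obtain C c where C: "C > 0" "c > 0" "\<forall>\<^sub>F n in sequentially. P.tr n \<le> C / h n \<and> c / h n \<le> P.Q.k2 n"
    by (rule trace_bounds)
  obtain Cb where Cb: "Cb > 0" "\<forall>\<^sub>F n in sequentially. real n * h n * lam n \<le> Cb" by (rule undersmoothing)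
  fix d \<epsilon> :: real assume d: "d > 0" and \<epsilon>: "\<epsilon> > 0"
  have e4: "0 < \<epsilon> / 4" using \<epsilon> by simp
  obtain Cr where Cr: "Cr > 0" "\<forall>\<^sub>F n in sequentially. prob {\<omega> \<in> space M. \<bar>nrm n \<omega>\<bar> > Cr * r n} \<le> \<epsilon> / 4"
    using rate \<epsilon> unfolding big_O_P_def nrm_def by (meson divide_pos_pos zero_less_numeral)
  define J0 where "J0 = J g0 g0"
  have J0: "J0 \<ge> 0" unfolding J0_def by (rule P.J_nonneg[OF P.g0_in])
  \<comment> \<open>One summand for each demand on the radius: it must contain the estimate, keep
    the Markov bound for the score part at \<epsilon> / 4, and dominate the bias.\<close>
  define k where "k = 2 * Cr\<^sup>2 * (1 + Cb) + 16 * C / \<epsilon> + 4 * Cb * J0"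
  have k: "k > 0" "2 * Cr\<^sup>2 * (1 + Cb) \<le> k" "16 * C / \<epsilon> \<le> k" "4 * Cb * J0 \<le> k"
  proof -
    have "2 * Cr\<^sup>2 * (1 + Cb) \<ge> 0" "16 * C / \<epsilon> > 0" "4 * Cb * J0 \<ge> 0" using C Cb \<epsilon> J0 by auto
    then show "k > 0" "2 * Cr\<^sup>2 * (1 + Cb) \<le> k" "16 * C / \<epsilon> \<le> k" "4 * Cb * J0 \<le> k" unfolding k_def by linarith+
  qed
  \<comment> \<open>With this level the exceptional probability is of order v = (n h^3)^(-1/2),
    while the scaled second order error is of order \<open>sqrt v\<close>; both vanish.\<close>
  define \<delta> where "\<delta> = (\<lambda>n. 1 / sqrt (real n * h n))"
  define \<rho> where "\<rho> = (\<lambda>n. sqrt (k / (real n * h n)))"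
  define D where "D = B ^ 4 * (\<integral>x. (w2 x)\<^sup>2 \<partial>N) + B ^ 4 * (\<integral>x. (w3 x)\<^sup>2 \<partial>N)"
  have Dn: "D \<ge> 0" by (simp add: D_def)
  define v where "v = (\<lambda>n. 1 / sqrt (real n * h n ^ 3))"
  have v0: "v \<longlonglongrightarrow> 0"
    using tendsto_real_sqrt[OF nh3_null] by (simp add: v_def real_sqrt_divide)
  define err where "err = (\<lambda>n. k / sqrt (2 * c) * sqrt (v n) + \<bar>B\<bar> * sqrt C * sqrt k ^ 3 * (C3 + 1) / (3 * sqrt (2 * c)) * v n)"
  have err0: "err \<longlonglongrightarrow> 0"
  proof -
    have "(\<lambda>n. x * sqrt (v n) + y * v n) \<longlonglongrightarrow> 0" for x y
      using tendsto_add[OF tendsto_mult[OF tendsto_const tendsto_real_sqrt[OF v0]] tendsto_mult[OF tendsto_const v0], of x y] by simp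
    then show ?thesis unfolding err_def .
  qed
  have \<delta>0: "\<delta> \<longlonglongrightarrow> 0"
    using tendsto_real_sqrt[OF nh_power_null[of 1]] by (simp add: \<delta>_def real_sqrt_divide)
  have small0: "(\<lambda>n. B\<^sup>2 * C * k * (1 / (real n * h n ^ 2))) \<longlonglongrightarrow> 0"
    using tendsto_mult[OF tendsto_const nh_power_null[of 2]] by simp
  have dev0: "(\<lambda>n. D * C\<^sup>2 * v n) \<longlonglongrightarrow> 0"
    using tendsto_mult[OF tendsto_const v0] by simp
  have s0: "s0\<^sup>2 > 0" using P.s0_pos by simp
  define good where "good = (\<lambda>n. n \<ge> 1 \<and> P.tr n \<le> C / h n \<and> c / h n \<le> P.Q.k2 n \<and> real n * h n * lam n \<le> Cb
    \<and> \<delta> n \<le> 1 \<and> B\<^sup>2 * C * k * (1 / (real n * h n ^ 2)) \<le> s0\<^sup>2 \<and> D * C\<^sup>2 * v n \<le> \<epsilon> / 4 \<and> err n \<le> d)"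
  have ev_good: "\<forall>\<^sub>F n in sequentially. good n"
    using eventually_ge_1 C(3) Cb(2) order_tendstoD(2)[OF \<delta>0 zero_less_one] order_tendstoD(2)[OF small0 s0]
      order_tendstoD(2)[OF dev0 e4] order_tendstoD(2)[OF err0 d]
    by eventually_elim (auto simp: good_def intro: less_imp_le)
  have "\<exists>E. E \<in> events \<and> (good n \<longrightarrow> prob E \<le> \<epsilon> / 2 \<and>
      (\<forall>\<omega>\<in>space M - E. \<bar>nrm n \<omega>\<bar> \<le> Cr * r n \<longrightarrow> (\<forall>f\<in>H. P.gain n n \<omega> f \<le> attained n \<omega>) \<longrightarrow> \<bar>?R n \<omega>\<bar> \<le> d))" for n
  proof (cases "good n")
    case False
    then show ?thesis by (intro exI[of _ "{}"]) simp
  next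
    case True
    have n: "n \<ge> 1" and tr: "P.tr n \<le> C / h n" and k2: "c / h n \<le> P.Q.k2 n" and cb: "real n * h n * lam n \<le> Cb"
      and \<delta>1: "\<delta> n \<le> 1" and sm: "B\<^sup>2 * C * k * (1 / (real n * h n ^ 2)) \<le> s0\<^sup>2" and dv: "D * C\<^sup>2 * v n \<le> \<epsilon> / 4" and er: "err n \<le> d"
      using True unfolding good_def by blast+
    have hn: "h n > 0" "real n > 0" using h_pos n by auto
    have trn: "P.tr n \<ge> 0" by (rule P.tr_nonneg)
    have \<delta>p: "\<delta> n > 0" and \<rho>p: "\<rho> n > 0" and \<rho>2: "(\<rho> n)\<^sup>2 = k / (real n * h n)"
      using hn k by (auto simp: \<delta>_def \<rho>_def)
    have lam_le: "lam n \<le> Cb / (real n * h n)" using cb hn by (simp add: field_simps)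
    have small: "B\<^sup>2 * P.tr n * (\<rho> n)\<^sup>2 \<le> s0\<^sup>2"
    proof -
      have "B\<^sup>2 * P.tr n * (\<rho> n)\<^sup>2 \<le> B\<^sup>2 * (C / h n) * (\<rho> n)\<^sup>2" using tr by (intro mult_right_mono mult_left_mono) auto
      also have "\<dots> = B\<^sup>2 * C * k * (1 / (real n * h n ^ 2))" unfolding \<rho>2 by (simp add: power2_eq_square mult_ac)
      finally show ?thesis using sm by linarith
    qed
    have bias: "4 * (lam n * J g0 g0) \<le> (\<rho> n)\<^sup>2"
    proof -
      have "4 * (lam n * J0) \<le> 4 * (Cb / (real n * h n) * J0)" using lam_le J0 by (intro mult_left_mono mult_right_mono) auto
      also have "\<dots> = (4 * Cb * J0) / (real n * h n)" by simp
      also have "\<dots> \<le> k / (real n * h n)" using k(4) hn by (intro divide_right_mono) auto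
      finally show ?thesis by (simp add: \<rho>2 J0_def)
    qed
    obtain E where E: "E \<in> events"
      "prob E \<le> (B ^ 4 * (\<integral>x. (w2 x)\<^sup>2 \<partial>N) * (P.tr n)\<^sup>2 + B ^ 4 * (\<integral>x. (w3 x)\<^sup>2 \<partial>N) * (P.tr n)\<^sup>2) / (real n * \<delta> n) + 4 * P.tr n / (real n * (\<rho> n)\<^sup>2)"
      "\<forall>\<omega>\<in>space M - E. \<forall>f\<in>H. P.ip n f f \<le> (\<rho> n)\<^sup>2 \<longrightarrow> P.gain n n \<omega> (P.S n n \<omega>) \<le> P.gain n n \<omega> f \<longrightarrow>
        \<bar>2 * P.gain n n \<omega> f - quad_max n \<omega>\<bar> \<le> sqrt (\<delta> n) * (\<rho> n)\<^sup>2 + sqrt (B\<^sup>2 * P.tr n) * \<rho> n ^ 3 * (C3 + sqrt (\<delta> n)) / 3"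
      by (rule P.gain_approximation[OF n \<delta>p \<rho>p small bias])
    have tr2: "(P.tr n)\<^sup>2 \<le> (C / h n)\<^sup>2" using tr trn by (intro power_mono) auto
    have "prob E \<le> \<epsilon> / 2"
    proof -
      have "(B ^ 4 * (\<integral>x. (w2 x)\<^sup>2 \<partial>N) * (P.tr n)\<^sup>2 + B ^ 4 * (\<integral>x. (w3 x)\<^sup>2 \<partial>N) * (P.tr n)\<^sup>2) / (real n * \<delta> n)
        = D * (P.tr n)\<^sup>2 / (real n * \<delta> n)" by (simp add: D_def distrib_right)
      also have "\<dots> \<le> D * (C / h n)\<^sup>2 / (real n * \<delta> n)"
        using tr2 Dn \<delta>p by (intro divide_right_mono mult_left_mono) auto
      also have "\<dots> = D * C\<^sup>2 * v n"
      proof -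
        have "real n * \<delta> n * h n ^ 2 = sqrt (real n * h n ^ 3)"
        proof (rule real_sqrt_unique[symmetric])
          have "(real n * \<delta> n * h n ^ 2)\<^sup>2 = (real n)\<^sup>2 * (\<delta> n)\<^sup>2 * h n ^ 4" by (simp add: power_mult_distrib power_mult[symmetric])
          also have "(\<delta> n)\<^sup>2 = 1 / (real n * h n)" using hn by (simp add: \<delta>_def power_divide)
          also have "(real n)\<^sup>2 * (1 / (real n * h n)) * h n ^ 4 = real n * h n ^ 3"
            using hn by (simp add: field_simps eval_nat_numeral)
          finally show "(real n * \<delta> n * h n ^ 2)\<^sup>2 = real n * h n ^ 3" .
        qed (use hn \<delta>p in auto)
        then have "v n = 1 / (real n * \<delta> n * h n ^ 2)" by (simp add: v_def)
        then show ?thesis by (simp add: power_divide)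
      qed
      finally have 1: "(B ^ 4 * (\<integral>x. (w2 x)\<^sup>2 \<partial>N) * (P.tr n)\<^sup>2 + B ^ 4 * (\<integral>x. (w3 x)\<^sup>2 \<partial>N) * (P.tr n)\<^sup>2) / (real n * \<delta> n) \<le> \<epsilon> / 4"
        using dv by linarith
      have "4 * P.tr n / (real n * (\<rho> n)\<^sup>2) \<le> 4 * (C / h n) / (real n * (\<rho> n)\<^sup>2)"
        using tr by (intro divide_right_mono mult_left_mono) auto
      also have "\<dots> = 4 * C / k" using hn k(1) by (simp add: \<rho>2)
      also have "\<dots> \<le> \<epsilon> / 4" using k(1,3) \<epsilon> by (simp add: field_simps)
      finally show ?thesis using 1 E(2) by linarith
    qed
    moreover have "\<bar>?R n \<omega>\<bar> \<le> d"
      if \<omega>: "\<omega> \<in> space M - E" and small_nrm: "\<bar>nrm n \<omega>\<bar> \<le> Cr * r n"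
        and mx: "\<forall>f\<in>H. P.gain n n \<omega> f \<le> attained n \<omega>" for \<omega>
    proof -
      have iH: "increment n \<omega> \<in> H" using \<omega> by (intro increment_in) simp
      have "P.ip n (increment n \<omega>) (increment n \<omega>) = \<bar>nrm n \<omega>\<bar>\<^sup>2"
        using P.ip_nonneg[OF iH, of n] by (simp add: nrm_def)
      also have "\<dots> \<le> (Cr * r n)\<^sup>2" using small_nrm by (intro power_mono) auto
      also have "\<dots> = Cr\<^sup>2 * (r n)\<^sup>2" by (rule power_mult_distrib)
      also have "\<dots> \<le> Cr\<^sup>2 * (2 * (1 / (real n * h n) + Cb / (real n * h n)))"
        using r(1)[OF n] lam_le by (intro mult_left_mono) auto
      also have "\<dots> = (2 * Cr\<^sup>2 * (1 + Cb)) / (real n * h n)" by (simp add: add_divide_distrib[symmetric])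
      also have "\<dots> \<le> (\<rho> n)\<^sup>2" unfolding \<rho>2 using k(2) hn by (intro divide_right_mono) auto
      finally have ip: "P.ip n (increment n \<omega>) (increment n \<omega>) \<le> (\<rho> n)\<^sup>2" .
      have "P.S n n \<omega> \<in> H" using \<omega> by (intro P.S_in) simp
      then have "\<bar>2 * attained n \<omega> - quad_max n \<omega>\<bar>
        \<le> sqrt (\<delta> n) * (\<rho> n)\<^sup>2 + sqrt (B\<^sup>2 * P.tr n) * \<rho> n ^ 3 * (C3 + sqrt (\<delta> n)) / 3"
        using E(3) \<omega> iH ip mx by blast
      then have b: "scale n * (real n * \<bar>2 * attained n \<omega> - quad_max n \<omega>\<bar>)
        \<le> scale n * (real n * (sqrt (\<delta> n) * (\<rho> n)\<^sup>2 + sqrt (B\<^sup>2 * P.tr n) * \<rho> n ^ 3 * (C3 + sqrt (\<delta> n)) / 3))"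
        using P.k2_pos[of n] by (intro mult_left_mono) auto
      have "\<bar>?R n \<omega>\<bar> = scale n * (real n * \<bar>2 * attained n \<omega> - quad_max n \<omega>\<bar>)"
      proof -
        have "?R n \<omega> = scale n * (real n * (2 * attained n \<omega> - quad_max n \<omega>))"
          by (simp add: algebra_simps)
        then show ?thesis using P.k2_pos[of n] by (simp only: abs_mult abs_of_nat) simp
      qed
      also note b
      also have "scale n * (real n * (sqrt (\<delta> n) * (\<rho> n)\<^sup>2 + sqrt (B\<^sup>2 * P.tr n) * \<rho> n ^ 3 * (C3 + sqrt (\<delta> n)) / 3)) \<le> err n"
        unfolding err_def v_def \<delta>_def \<rho>_def
        by (rule quadratic_error_rate) (use hn trn tr C k2 k P.C3_nonneg \<delta>1 in \<open>auto simp: \<delta>_def\<close>)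
      finally show ?thesis using er by linarith
    qed
    ultimately show ?thesis using E(1) by (intro exI[of _ E]) blast
  qed
  then obtain E where E: "\<And>n. E n \<in> events" "\<And>n. good n ==> prob (E n) \<le> \<epsilon> / 2"
    "\<And>n \<omega>. good n ==> \<omega> \<in> space M - E n ==> \<bar>nrm n \<omega>\<bar> \<le> Cr * r n ==>
      (\<forall>f\<in>H. P.gain n n \<omega> f \<le> attained n \<omega>) ==> \<bar>?R n \<omega>\<bar> \<le> d"
    by metis
  define far where "far = (\<lambda>n. {\<omega> \<in> space M. \<bar>nrm n \<omega>\<bar> > Cr * r n})"
  define big where "big = (\<lambda>n. {\<omega> \<in> space M. \<bar>?R n \<omega>\<bar> > d})"
  have far: "far n \<in> events" for n unfolding far_def using nm[of n] by measurable
  have big: "big n \<in> events" for n unfolding big_def using Rm[of n] by measurable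
  \<comment> \<open>The set where the estimate maximizes need not be measurable.
    \<open>bad n\<close> is a measurable event that can occur only where maximality fails, so it is
    eventually avoided almost surely.\<close>
  define bad where "bad = (\<lambda>n. if good n then big n - (E n \<union> far n) else {})"
  have bad: "bad n \<in> events" for n unfolding bad_def using big far E(1) by auto
  have "AE \<omega> in M. \<forall>\<^sub>F n in sequentially. \<omega> \<notin> bad n"
    using maximal AE_space
  proof eventually_elim
    case (elim \<omega>)
    show ?case using elim(1)
    proof eventually_elim
      case (elim n)
      show ?case
      proof
        assume "\<omega> \<in> bad n"
        then have g: "good n" and w: "\<omega> \<in> big n" "\<omega> \<notin> E n" "\<omega> \<notin> far n" by (auto simp: bad_def split: if_splits)
        then have "\<bar>?R n \<omega>\<bar> \<le> d" using E(3)[OF g _ _ elim] by (auto simp: big_def far_def)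
        then show False using w(1) by (simp add: big_def)
      qed
    qed
  qed
  then have "(\<lambda>n. prob (bad n)) \<longlonglongrightarrow> 0" by (rule eventually_avoided_null[OF bad])
  from order_tendstoD(2)[OF this e4]
  have "\<forall>\<^sub>F n in sequentially. prob (bad n) < \<epsilon> / 4" by simp
  then show "\<forall>\<^sub>F n in sequentially. prob {\<omega> \<in> space M. \<bar>?R n \<omega>\<bar> > d} \<le> \<epsilon>"
    using Cr(2) ev_good
  proof eventually_elim
    case (elim n)
    have "big n \<subseteq> (E n \<union> far n) \<union> bad n" using elim(3) by (auto simp: bad_def)
    then have "prob (big n) \<le> prob ((E n \<union> far n) \<union> bad n)" using E(1) far bad by (intro finite_measure_mono) auto
    also have "\<dots> \<le> (prob (E n) + prob (far n)) + prob (bad n)"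
      using E(1) far bad by (intro order_trans[OF measure_Un_le] add_mono measure_Un_le) auto
    finally show ?case using elim E(2)[OF elim(3)] unfolding far_def big_def by linarith
  qed
qed

text \<open>The difference from the U-statistic splits exactly into the quadratic approximation
  error, the centred diagonal and the cross term with the bias; the squared norm of
  \<open>W g0\<close> and the trace are the centring and cancel.\<close>

theorem likelihood_ratio_CLT:
  assumes rate: "big_O_P M (\<lambda>n \<omega>. sqrt (P.ip n (increment n \<omega>) (increment n \<omega>))) r"
    and r: "\<And>n. n \<ge> 1 ==> (r n)\<^sup>2 \<le> 2 * (1 / (real n * h n) + lam n)" "\<And>n. r n \<ge> 0"
    and maximal: "AE \<omega> in M. \<forall>\<^sub>F n in sequentially. \<forall>f\<in>H. P.gain n n \<omega> f \<le> attained n \<omega>"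
  shows "weak_conv_m (\<lambda>n. distr M borel (\<lambda>\<omega>. scale n *
    (2 * real n * attained n \<omega> - real n * P.ip n (W n g0) (W n g0) - P.tr n))) std_normal_distribution"
proof (rule weak_conv_Slutsky[OF _ _ U_CLT real_dist_normal_dist])
  let ?A = "\<lambda>n \<omega>. sqrt (2 / ((real n)\<^sup>2 * P.Q.k2 n)) * P.Q.psum n (Suc n) (obs \<omega>)"
  let ?B = "\<lambda>n \<omega>. scale n *
    (2 * real n * attained n \<omega> - real n * P.ip n (W n g0) (W n g0) - P.tr n)"
  let ?R = "\<lambda>n \<omega>. scale n *
      (2 * real n * attained n \<omega> - real n * quad_max n \<omega>) +
    (scale n * (avg n (\<lambda>x. (e x)\<^sup>2 * P.kern n x x) \<omega> - P.tr n) +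
     scale n * (- (2 * real n) * avg n (\<lambda>x. e x * on_unit (W n g0) x) \<omega>))"
  show Am: "?A n \<in> borel_measurable M" for n
    by (intro borel_measurable_times borel_measurable_const L4_measurable[OF P.Q.L4_psum])
  show Bm: "?B n \<in> borel_measurable M" for n
    by (intro borel_measurable_times borel_measurable_diff borel_measurable_const gain_increment_measurable)
  have R: "null_in_prob ?R"
    by (intro null_in_prob_add gain_null[OF rate r maximal] diagonal_null cross_null)
  have eq: "?B n \<omega> - ?A n \<omega> = ?R n \<omega>" if n: "n \<ge> 1" and \<omega>: "\<omega> \<in> space M" for n \<omega>
  proof -
    define s p where "s = scale n" and "p = P.Q.psum n (Suc n) (obs \<omega>)"
    have sA: "sqrt (2 / ((real n)\<^sup>2 * P.Q.k2 n)) = s * (2 / real n)"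
    proof -
      have "2 / ((real n)\<^sup>2 * P.Q.k2 n) = 1 / (2 * P.Q.k2 n) * (2 / real n)\<^sup>2" by (simp add: power2_eq_square)
      then show ?thesis unfolding s_def by (simp only: real_sqrt_mult real_sqrt_abs) simp
    qed
    have SS: "real n * quad_max n \<omega> = avg n (\<lambda>x. (e x)\<^sup>2 * P.kern n x x) \<omega> + 2 / real n * p
      - 2 * real n * avg n (\<lambda>x. e x * on_unit (W n g0) x) \<omega> + real n * P.ip n (W n g0) (W n g0)"
      unfolding P.ip_S_S[OF \<omega>] p_def P.ip_A_A[OF \<omega> n, symmetric] by (simp add: algebra_simps)
    show ?thesis unfolding sA SS s_def[symmetric] p_def[symmetric] by (simp add: algebra_simps)
  qed
  have prob_eq: "prob {\<omega> \<in> space M. \<bar>?B n \<omega> - ?A n \<omega>\<bar> > d} = prob {\<omega> \<in> space M. \<bar>?R n \<omega>\<bar> > d}" if "n \<ge> 1" for n d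
    using eq[OF that] by (intro arg_cong[where f = prob] Collect_cong) auto
  have ev: "\<forall>\<^sub>F n in sequentially. prob {\<omega> \<in> space M. \<bar>?R n \<omega>\<bar> > d} = prob {\<omega> \<in> space M. \<bar>?B n \<omega> - ?A n \<omega>\<bar> > d}" for d
    by (rule eventually_mono[OF eventually_ge_1]) (rule prob_eq[symmetric])
  show "null_in_prob (\<lambda>n \<omega>. ?B n \<omega> - ?A n \<omega>)"
    unfolding null_in_prob_def
  proof (intro conjI allI impI)
    show "(\<lambda>\<omega>. ?B n \<omega> - ?A n \<omega>) \<in> borel_measurable M" for n by (intro borel_measurable_diff Am Bm)
    fix d :: real assume "d > 0"
    then have "(\<lambda>n. prob {\<omega> \<in> space M. \<bar>?R n \<omega>\<bar> > d}) \<longlonglongrightarrow> 0" using R unfolding null_in_prob_def by blast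
    then show "(\<lambda>n. prob {\<omega> \<in> space M. \<bar>?B n \<omega> - ?A n \<omega>\<bar> > d}) \<longlonglongrightarrow> 0"
      by (rule Lim_transform_eventually[OF _ ev])
  qed
qed

end

lemma (in degenerate_kernel) k2_expectation: "(\<integral>\<omega>. (k (X 1 \<omega>) (X 2 \<omega>))\<^sup>2 \<partial>M) = k2"
proof -
  have r: "rsum 2 u y = k (u 1) y" for u y by (simp add: rsum_def numeral_2_eq_2)
  have p: "past 2 \<omega> 1 = X 1 \<omega>" for \<omega> by (simp add: past_def)
  let ?f = "\<lambda>q. (rsum 2 (fst q) (snd q))\<^sup>2"
  have i: "integrable M (\<lambda>\<omega>. ?f (past 2 \<omega>, X 2 \<omega>))"
    using L4_integrable_square[OF L4_rsum[of 2]] unfolding fst_conv snd_conv r p .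
  have "(\<integral>\<omega>. ?f (past 2 \<omega>, X 2 \<omega>) \<partial>M) = (\<integral>y. (\<integral>\<omega>. ?f (past 2 \<omega>, y) \<partial>M) \<partial>N)"
    by (rule past_expectation(3)[OF _ borel_measurable_power[OF rsum_measurable] i]) simp
  also have "\<dots> = (\<integral>y. (\<integral>x. (k x y)\<^sup>2 \<partial>N) \<partial>N)"
  proof (rule Bochner_Integration.integral_cong[OF refl])
    fix y assume y: "y \<in> space N"
    have m: "(\<lambda>x. (k x y)\<^sup>2) \<in> borel_measurable N"
      by (intro borel_measurable_power L4_measurable[OF L4_section[OF y]])
    have "(\<integral>\<omega>. ?f (past 2 \<omega>, y) \<partial>M) = (\<integral>\<omega>. (k (X 1 \<omega>) y)\<^sup>2 \<partial>M)" by (simp only: fst_conv snd_conv r p)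
    also have "\<dots> = (\<integral>x. (k x y)\<^sup>2 \<partial>N)" by (rule integral_X[OF m]) simp
    finally show "(\<integral>\<omega>. ?f (past 2 \<omega>, y) \<partial>M) = (\<integral>x. (k x y)\<^sup>2 \<partial>N)" .
  qed
  finally show ?thesis by (simp only: fst_conv snd_conv r p k2_def)
qed

text \<open>The growth of \<open>n h\<^sup>3\<close> comes from the first summand of \<open>a\<close>.\<close>

lemma bandwidth_cubed:
  fixes h r :: "nat => real"
  assumes h: "\<And>n. h n > 0" "h \<longlonglongrightarrow> 0" and m: "m \<ge> 1" and Cl: "Cl \<ge> 0" and r: "\<And>n. r n \<ge> 0"
    and a: "a = (\<lambda>n. real n powr (- 1 / 2) * ((real n * h n) powr (- 1 / 2) + h n ^ m)
                          * h n powr (- (6 * real m - 1) / (4 * real m))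
                          * (ln (ln (real n))) powr (1 / 2)
                        + Cl * h n powr (- 1 / 2)
                          * (1 / (real n * h n) + h n ^ (2 * m)) / ln (real n))"
    and small: "a \<in> o(\<lambda>n. min (r n)
                     (min (1 / (real n * r n * h n powr (1 / 2) * ln (real n)))
                          (1 / (real n powr (1 / 2) * ln (real n)))))"
  shows "filterlim (\<lambda>n. real n * h n ^ 3) at_top sequentially"
proof -
  have l1: "filterlim (\<lambda>n. ln (real n)) at_top sequentially"
    by (rule filterlim_compose[OF ln_at_top filterlim_real_sequentially])
  have l2: "filterlim (\<lambda>n. ln (ln (real n))) at_top sequentially"
    by (rule filterlim_compose[OF ln_at_top l1])
  have e1: "\<forall>\<^sub>F n in sequentially. 1 \<le> ln (real n)" and e2: "\<forall>\<^sub>F n in sequentially. 1 \<le> ln (ln (real n))"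
    using l1 l2 unfolding filterlim_at_top by blast+
  have e3: "\<forall>\<^sub>F n in sequentially. h n < 1" by (rule order_tendstoD(2)[OF h(2) zero_less_one])
  have e4: "\<forall>\<^sub>F n in sequentially. norm (a n) \<le> 1 * norm (min (r n)
                     (min (1 / (real n * r n * h n powr (1 / 2) * ln (real n)))
                          (1 / (real n powr (1 / 2) * ln (real n)))))"
    by (rule landau_o.smallD[OF small]) simp
  have "\<forall>\<^sub>F n in sequentially. ln (real n) \<le> real n * h n ^ 3"
    using e1 e2 e3 e4 eventually_ge_at_top[of 1]
  proof eventually_elim
    case (elim n)
    have n: "real n > 0" and hn: "h n > 0" using elim(5) h(1) by auto
    let ?z = "1 / (real n powr (1 / 2) * ln (real n))"
    have pos: "0 \<le> min (r n) (min (1 / (real n * r n * h n powr (1 / 2) * ln (real n))) ?z)"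
      using r[of n] elim(1) n by (auto intro!: divide_nonneg_nonneg mult_nonneg_nonneg)
    have le: "a n \<le> ?z"
    proof -
      have "a n \<le> norm (a n)" by simp
      also have "\<dots> \<le> min (r n) (min (1 / (real n * r n * h n powr (1 / 2) * ln (real n))) ?z)"
        using elim(4) pos by simp
      also have "\<dots> \<le> ?z" by simp
      finally show ?thesis .
    qed
    \<comment> \<open>Since m is at least 1, the exponent (6m - 1) / (4m) is at least 1, and h is
      below 1.\<close>
    have hp: "1 / h n \<le> h n powr (- (6 * real m - 1) / (4 * real m))"
    proof -
      have "- (6 * real m - 1) / (4 * real m) \<le> -1" using m by (simp add: field_simps)
      then have "h n powr (-1) \<le> h n powr (- (6 * real m - 1) / (4 * real m))"
        using hn elim(3) by (intro powr_mono') auto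
      then show ?thesis using hn by (simp add: powr_minus_divide)
    qed
    have lp: "1 \<le> (ln (ln (real n))) powr (1 / 2)" using elim(2) by (intro ge_one_powr_ge_zero) auto
    \<comment> \<open>Keeping only the variance part of the first summand of \<open>a\<close> and
      comparing it with n^(-1/2) / log n gives log n at most h times the root of n h; squaring
      produces n h^3.\<close>
    have "real n powr (- 1 / 2) * (real n * h n) powr (- 1 / 2) * (1 / h n) * 1
      \<le> real n powr (- 1 / 2) * ((real n * h n) powr (- 1 / 2) + h n ^ m)
        * h n powr (- (6 * real m - 1) / (4 * real m)) * (ln (ln (real n))) powr (1 / 2)"
      using hn by (intro mult_mono hp lp) auto
    also have "\<dots> \<le> a n"
      unfolding a using Cl hn elim(1) by (auto intro!: divide_nonneg_nonneg mult_nonneg_nonneg add_nonneg_nonneg)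
    finally have "real n powr (- 1 / 2) * (real n * h n) powr (- 1 / 2) * (1 / h n) \<le> ?z" using le by simp
    moreover have "real n powr (- 1 / 2) = 1 / sqrt (real n)" "(real n * h n) powr (- 1 / 2) = 1 / sqrt (real n * h n)"
      "real n powr (1 / 2) = sqrt (real n)"
      using n hn by (simp_all add: powr_minus_divide powr_half_sqrt)
    ultimately have "1 / sqrt (real n) * (1 / sqrt (real n * h n)) * (1 / h n) \<le> 1 / (sqrt (real n) * ln (real n))" by simp
    then have "1 / sqrt (real n) * (1 / (sqrt (real n * h n) * h n)) \<le> 1 / sqrt (real n) * (1 / ln (real n))" by simp
    then have "1 / (sqrt (real n * h n) * h n) \<le> 1 / ln (real n)"
      by (rule mult_left_le_imp_le) (use n in simp)
    then have "inverse (sqrt (real n * h n) * h n) \<le> inverse (ln (real n))" by (simp only: inverse_eq_divide)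
    then have "ln (real n) \<le> sqrt (real n * h n) * h n" by (rule inverse_le_imp_le) (use n hn in simp)
    then have "(ln (real n))\<^sup>2 \<le> (sqrt (real n * h n) * h n)\<^sup>2" using elim(1) by (intro power_mono) auto
    also have "\<dots> = real n * h n ^ 3" using n hn by (simp add: power_mult_distrib eval_nat_numeral)
    finally have "(ln (real n))\<^sup>2 \<le> real n * h n ^ 3" .
    moreover have "ln (real n) \<le> (ln (real n))\<^sup>2" using elim(1) by (rule self_le_power) simp
    ultimately show ?case by linarith
  qed
  then show ?thesis by (rule filterlim_at_top_mono[OF l1])
qed

text \<open>The normalization with \<open>sigma2 = h * t\<close> and \<open>rho2 = h * k\<close>
  made explicit: h drops out and the factor t / k is absorbed by the square root.\<close>

lemma studentization:
  fixes h t k n P b :: real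
  assumes h: "h > 0" and t: "t > 0" and k: "k > 0"
  shows "(2 * ((h * t)\<^sup>2 / (h * (h * k)))) powr (- 1 / 2)
      * (- 2 * n * ((h * t) / (h * k)) * P - n * ((h * t) / (h * k)) * b - (h * t)\<^sup>2 / (h * (h * k)))
    = sqrt (1 / (2 * k)) * (2 * n * (- P) - n * b - t)"
proof -
  have u: "(h * t)\<^sup>2 / (h * (h * k)) = t\<^sup>2 / k" and r: "(h * t) / (h * k) = t / k"
    using h by (simp_all add: power2_eq_square)
  have "(2 * (t\<^sup>2 / k)) powr (- 1 / 2) = 1 / sqrt (2 * (t\<^sup>2 / k))"
    using t k by (simp add: powr_minus_divide powr_half_sqrt)
  also have "sqrt (2 * (t\<^sup>2 / k)) = t / k * sqrt (2 * k)"
  proof (rule real_sqrt_unique)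
    have "(t / k * sqrt (2 * k))\<^sup>2 = t\<^sup>2 / k\<^sup>2 * (2 * k)" using k by (simp add: power_mult_distrib power_divide)
    then show "(t / k * sqrt (2 * k))\<^sup>2 = 2 * (t\<^sup>2 / k)" by (simp add: power2_eq_square)
  qed (use t k in simp)
  finally have p: "(2 * (t\<^sup>2 / k)) powr (- 1 / 2) * (t / k) = sqrt (1 / (2 * k))"
    using t k by (simp add: real_sqrt_divide)
  have "- 2 * n * (t / k) * P - n * (t / k) * b - t\<^sup>2 / k = (t / k) * (2 * n * (- P) - n * b - t)"
    using k by (simp add: field_simps power2_eq_square)
  then show ?thesis unfolding u r using p by (simp only: mult.assoc[symmetric])
qed

theorem theorem5p3:
  fixes M :: "'w measure"
    and S :: "real set"
    and Y Z :: "'w \<Rightarrow> real"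
    and Ys Zs :: "nat \<Rightarrow> 'w \<Rightarrow> real"
    and m :: nat
    and H :: "(real \<Rightarrow> real) set"
    and F :: "real \<Rightarrow> real"
    and g g0 :: "real \<Rightarrow> real"
    and l :: "real \<Rightarrow> real \<Rightarrow> real"
    and lam h r a :: "nat \<Rightarrow> real"
    and J V :: "(real \<Rightarrow> real) \<Rightarrow> (real \<Rightarrow> real) \<Rightarrow> real"
    and ip :: "nat \<Rightarrow> (real \<Rightarrow> real) \<Rightarrow> (real \<Rightarrow> real) \<Rightarrow> real"
    and nrm :: "nat \<Rightarrow> (real \<Rightarrow> real) \<Rightarrow> real"
    and K :: "nat \<Rightarrow> real \<Rightarrow> real \<Rightarrow> real"
    and W :: "nat \<Rightarrow> (real \<Rightarrow> real) \<Rightarrow> real \<Rightarrow> real"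
    and ghat :: "nat \<Rightarrow> 'w \<Rightarrow> real \<Rightarrow> real"
    and PLRT :: "nat \<Rightarrow> 'w \<Rightarrow> real"
    and I :: "real set"
    and hb :: "nat \<Rightarrow> real \<Rightarrow> real"
    and gam :: "nat \<Rightarrow> real"
    and sigma2 rho2 rK u :: "nat \<Rightarrow> real"
  assumes prob: "prob_space M"
    and data: "iid_copies M S Y Z Ys Zs"
    and order_m: "real m > 1 / 2"
    and H_space: "H = sobolev m \<or> H = periodic_sobolev m"
    and J_def: "J = penalty m"
    and g_in: "g \<in> H" and g0_in: "g0 \<in> H"
    and model: "regression_function M Y Z F g"
    and H0_global: "\<forall>z\<in>{0..1}. g z = g0 z"
    and criterion: "log_likelihood_criterion M S Y Z F g0 l \<or>
                    quasi_likelihood_criterion M S Y Z F g0 l"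
    and lam_pos: "\<forall>n. lam n > 0" and lam_lim: "lam \<longlonglongrightarrow> 0"
    and h_def: "h = (\<lambda>n. lam n powr (1 / (2 * real m)))"
    and V_def: "V = V_form M Y Z l g0"
    and ip_def: "ip = (\<lambda>n f f'. V f f' + lam n * J f f')"
    and nrm_def: "nrm = (\<lambda>n f. sqrt (ip n f f))"
    and K_kernel: "\<forall>n. reproducing_kernel H (ip n) (K n)"
    and W_operator: "\<forall>n. self_adjoint_representer H (ip n) (\<lambda>f f'. lam n * J f f') (W n)"
    and ghat_random: "\<forall>n. (\<forall>\<omega>\<in>space M. ghat n \<omega> \<in> H) \<and>
                          (\<forall>z\<in>{0..1}. (\<lambda>\<omega>. ghat n \<omega> z) \<in> borel_measurable M)"
    and ghat_max: "AE \<omega> in M. \<forall>\<^sub>F n in sequentially.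
                     unique_maximizer H (penalized_criterion m l Ys Zs lam n \<omega>) (ghat n \<omega>)"
    and PLRT_def: "PLRT = (\<lambda>n \<omega>. penalized_criterion m l Ys Zs lam n \<omega> g0
                                - penalized_criterion m l Ys Zs lam n \<omega> (ghat n \<omega>))"
    and r_def: "r = (\<lambda>n. (real n * h n) powr (- 1 / 2) + h n ^ m)"
    \<comment> \<open>(1)\<close>
    and regularity: "criterion_regularity M S Y Z l g0 I"
    \<comment> \<open>(2)\<close>
    and hb_in: "\<forall>\<nu>. hb \<nu> \<in> H"
    and hb_bounded: "bdd_above (range (\<lambda>\<nu>. sup_norm (hb \<nu>)))"
    and gam_mono: "incseq gam"
    and gam_order: "same_order gam (\<lambda>\<nu>. real \<nu> ^ (2 * m))"
    and V_orth: "\<forall>\<mu> \<nu>. V (hb \<mu>) (hb \<nu>) = (if \<mu> = \<nu> then 1 else 0)"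
    and J_orth: "\<forall>\<mu> \<nu>. J (hb \<mu>) (hb \<nu>) = gam \<mu> * (if \<mu> = \<nu> then 1 else 0)"
    and expansion: "\<forall>n. \<forall>f\<in>H.
                      (\<lambda>N. nrm n (\<lambda>z. f z - (\<Sum>\<nu><N. V f (hb \<nu>) * hb \<nu> z))) \<longlonglongrightarrow> 0"
    \<comment> \<open>(3)\<close>
    and rate: "big_O_P M (\<lambda>n \<omega>. nrm n (\<lambda>z. ghat n \<omega> z - g0 z)) r"
    \<comment> \<open>(4)\<close>
    and a_def: "a = (\<lambda>n. real n powr (- 1 / 2) * ((real n * h n) powr (- 1 / 2) + h n ^ m)
                          * h n powr (- (6 * real m - 1) / (4 * real m))
                          * (ln (ln (real n))) powr (1 / 2)
                        + C_l M Y Z l I * h n powr (- 1 / 2)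
                          * (1 / (real n * h n) + h n ^ (2 * m)) / ln (real n))"
    and bw_upper: "(\<lambda>n. real n * h n ^ (2 * m + 1)) \<in> O(\<lambda>_. 1)"
    and bw_lower: "filterlim (\<lambda>n. real n * (h n)\<^sup>2) at_top sequentially"
    and a_small: "a \<in> o(\<lambda>n. min (r n)
                     (min (1 / (real n * r n * h n powr (1 / 2) * ln (real n)))
                          (1 / (real n powr (1 / 2) * ln (real n)))))"
    and a_large: "(\<lambda>n. (r n)\<^sup>2 * h n powr (- 1 / 2)) \<in> o(a)"
    \<comment> \<open>(5)\<close>
    and fourth_moment: "\<exists>C>0. AE \<omega> in M.
                          cond_E_nn M Z (\<lambda>\<omega>. score l g0 (Y \<omega>) (Z \<omega>) ^ 4) \<omega> \<le> ennreal C"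
    \<comment> \<open>the quantities in the conclusion\<close>
    and sigma2_def: "sigma2 = (\<lambda>n. h n *
                       (\<integral>\<omega>. (score l g0 (Y \<omega>) (Z \<omega>))\<^sup>2 * K n (Z \<omega>) (Z \<omega>) \<partial>M))"
    and rho2_def: "rho2 = (\<lambda>n. h n *
                       (\<integral>\<omega>. (score l g0 (Ys 1 \<omega>) (Zs 1 \<omega>))\<^sup>2
                           * (score l g0 (Ys 2 \<omega>) (Zs 2 \<omega>))\<^sup>2
                           * (K n (Zs 1 \<omega>) (Zs 2 \<omega>))\<^sup>2 \<partial>M))"
    and rK_def: "rK = (\<lambda>n. sigma2 n / rho2 n)"
    and u_def: "u = (\<lambda>n. (sigma2 n)\<^sup>2 / (h n * rho2 n))"
  shows "(\<forall>n. (\<lambda>\<nu>. h n / (1 + lam n * gam \<nu>)) sums sigma2 n) \<and>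
         (\<forall>n. (\<lambda>\<nu>. h n / (1 + lam n * gam \<nu>)\<^sup>2) sums rho2 n) \<and>
         weak_conv_m
           (\<lambda>n. distr M borel (\<lambda>\<omega>. (2 * u n) powr (- 1 / 2) *
              (- 2 * real n * rK n * PLRT n \<omega> - real n * rK n * (nrm n (W n g0))\<^sup>2 - u n)))
           std_normal_distribution"
proof -
  interpret prob_space M by (rule prob)
  have m: "m > 0" "m \<ge> 1" using order_m by (auto intro: gr0I)
  have lam: "lam n > 0" for n using lam_pos by blast
  have h_pos: "h n > 0" for n using lam[of n] by (simp add: h_def)
  have lam_eq: "lam n = h n ^ (2 * m)" for n
  proof -
    have "h n ^ (2 * m) = h n powr (2 * real m)" using h_pos[of n] by (simp add: powr_realpow[symmetric])
    also have "\<dots> = lam n powr 1" using m unfolding h_def powr_powr by simp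
    finally show ?thesis using lam[of n] by simp
  qed
  have h_lim: "h \<longlonglongrightarrow> 0"
    unfolding h_def using lam m by (intro tendsto_zero_powrI[OF lam_lim tendsto_const]) (auto intro: always_eventually less_imp_le)
  have H_sobolev: "H \<subseteq> sobolev m" using H_space by (auto simp: periodic_sobolev_def)
  have H_linear: "(\<lambda>x. c * f x + d * k x) \<in> H" if "f \<in> H" "k \<in> H" for f k c d
    using H_space sobolev_linear[OF _ _ m(1)] periodic_sobolev_linear[OF _ _ m(1)] that by metis
  have H_cont: "continuous_on {0..1} f" if "f \<in> H" for f
    using sobolev_continuous[OF _ m(1)] H_sobolev that by blast
  note reg = regularity[unfolded criterion_regularity_def]
  have smooth: "\<forall>y\<in>S. (\<forall>k<3. \<forall>a. deriv_a k l y differentiable (at a)) \<and>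
      continuous_on UNIV (deriv_a 3 l y) \<and> concave_on UNIV (l y)"
    and I: "open I" "g0 ` {0..1} \<subseteq> I"
    and bdd: "AE \<omega> in M. bdd_above ((\<lambda>a. \<bar>deriv_a 2 l (Y \<omega>) a\<bar>) ` I) \<and> bdd_above ((\<lambda>a. \<bar>deriv_a 3 l (Y \<omega>) a\<bar>) ` I)"
    and mean: "AE \<omega> in M. cond_E M Z (\<lambda>\<omega>. score l g0 (Y \<omega>) (Z \<omega>)) \<omega> = 0"
    and square: "AE \<omega> in M. cond_E M Z (\<lambda>\<omega>. (score l g0 (Y \<omega>) (Z \<omega>))\<^sup>2) \<omega> = information M Y Z l g0 \<omega>"
    by - (insert reg, elim conjE exE, assumption)+
  obtain C0 C1 where exp: "AE \<omega> in M. cond_E_nn M Z (\<lambda>\<omega>. exp (sup_deriv_a 2 l I (Y \<omega>) / C0)) \<omega> \<le> ennreal C0"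
    "AE \<omega> in M. cond_E_nn M Z (\<lambda>\<omega>. exp (sup_deriv_a 3 l I (Y \<omega>) / C0)) \<omega> \<le> ennreal C1" and C01: "C0 > 0" "C1 > 0"
    using reg by (elim conjE exE) (rule that, assumption+)
  obtain C2 where info: "AE \<omega> in M. 1 / C2 \<le> information M Y Z l g0 \<omega> \<and> information M Y Z l g0 \<omega> \<le> C2" and C2: "C2 > 0"
    using reg by (elim conjE exE) (rule that, assumption+)
  have I_ne: "I \<noteq> {}" using I(2) by auto
  have YS: "\<omega> \<in> space M ==> Y \<omega> \<in> S" for \<omega> using data by (auto simp: iid_copies_def)
  obtain C4 where C4: "AE \<omega> in M. cond_E_nn M Z (\<lambda>\<omega>. score l g0 (Y \<omega>) (Z \<omega>) ^ 4) \<omega> \<le> ennreal C4"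
    using fourth_moment by blast
  have version: "\<exists>Q. Q \<in> borel_measurable (borel \<Otimes>\<^sub>M borel) \<and> (\<forall>y\<in>S. \<forall>a. Q (y, a) = deriv_a k l y a)" if "k \<le> 3" for k
    by (rule deriv_a_joint_borel_version[OF criterion regularity that]) blast
  obtain Q0 where Q0: "Q0 \<in> borel_measurable (borel \<Otimes>\<^sub>M borel)" "\<forall>y\<in>S. \<forall>a. Q0 (y, a) = deriv_a 0 l y a"
    using version[of 0] by auto
  obtain Q1 where Q1: "Q1 \<in> borel_measurable (borel \<Otimes>\<^sub>M borel)" "\<forall>y\<in>S. \<forall>a. Q1 (y, a) = deriv_a 1 l y a"
    using version[of 1] by auto
  obtain Q2 where Q2: "Q2 \<in> borel_measurable (borel \<Otimes>\<^sub>M borel)" "\<forall>y\<in>S. \<forall>a. Q2 (y, a) = deriv_a 2 l y a"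
    using version[of 2] by auto
  obtain Q3 where Q3: "Q3 \<in> borel_measurable (borel \<Otimes>\<^sub>M borel)" "\<forall>y\<in>S. \<forall>a. Q3 (y, a) = deriv_a 3 l y a"
    using version[of 3] by auto
  have c3: "continuous_on UNIV (deriv_a 3 l y)" if "y \<in> S" for y using smooth that by blast
  have c2: "continuous_on UNIV (deriv_a 2 l y)" if "y \<in> S" for y
    using smooth that by (intro differentiable_imp_continuous_on) (simp add: differentiable_on_def)
  obtain b2 G2 where b2: "b2 \<in> borel_measurable borel" "\<forall>y\<in>G2. b2 y \<ge> 0"
    "\<forall>y\<in>S. y \<in> G2 \<longleftrightarrow> bdd_above ((\<lambda>a. \<bar>deriv_a 2 l y a\<bar>) ` I)" "\<forall>y\<in>S. sup_deriv_a 2 l I y = b2 y"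
    "\<forall>y\<in>S \<inter> G2. \<forall>a\<in>I. \<bar>deriv_a 2 l y a\<bar> \<le> b2 y"
    by (rule sup_deriv_a_borel_version[OF Q2(1) _ c2 I(1) I_ne]) (use Q2(2) in auto)
  obtain b3 G3 where b3: "b3 \<in> borel_measurable borel" "G3 \<in> sets borel" "\<forall>y\<in>G3. b3 y \<ge> 0"
    "\<forall>y\<in>S. y \<in> G3 \<longleftrightarrow> bdd_above ((\<lambda>a. \<bar>deriv_a 3 l y a\<bar>) ` I)" "\<forall>y\<in>S. sup_deriv_a 3 l I y = b3 y"
    "\<forall>y\<in>S \<inter> G3. \<forall>a\<in>I. \<bar>deriv_a 3 l y a\<bar> \<le> b3 y"
    by (rule sup_deriv_a_borel_version[OF Q3(1) _ c3 I(1) I_ne]) (use Q3(2) in auto)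
  have AE_G: "AE \<omega> in M. Y \<omega> \<in> G2" "AE \<omega> in M. Y \<omega> \<in> G3"
    using bdd AE_space by (eventually_elim, use b2(3) b3(4) YS in blast)+
  interpret R: regression_model M S Y Z Ys Zs l g0 I Q0 Q1 Q2 b2 b3 G2 G3 C0 C1 C2 C4
  proof unfold_locales
    show "Q0 (y, a) = deriv_a 0 l y a" "Q1 (y, a) = deriv_a 1 l y a" "Q2 (y, a) = deriv_a 2 l y a"
      "sup_deriv_a 2 l I y = b2 y" "sup_deriv_a 3 l I y = b3 y" if "y \<in> S" for y a
      using Q0(2) Q1(2) Q2(2) b2(4) b3(5) that by simp_all
    show "0 \<le> b2 y" if "y \<in> G2" for y using b2(2) that by simp
    show "0 \<le> b3 y" if "y \<in> G3" for y using b3(3) that by simp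
    show "\<bar>deriv_a 2 l y a\<bar> \<le> b2 y" if "y \<in> S" "y \<in> G2" "a \<in> I" for y a using b2(5) that by simp
    show "\<bar>deriv_a 3 l y a\<bar> \<le> b3 y" if "y \<in> S" "y \<in> G3" "a \<in> I" for y a using b3(6) that by simp
    show "deriv_a k l y differentiable at a" if "y \<in> S" "k < 3" for y k a using smooth that by simp
  qed (rule data H_cont[OF g0_in] Q0(1) Q1(1) Q2(1) b2(1) b3(1,2) AE_G I C01 C2 exp info mean square C4)+
  have gam_nonneg: "gam \<nu> \<ge> 0" for \<nu>
    using J_orth penalty_nonneg[of m "hb \<nu>"] unfolding J_def by (metis mult.right_neutral)
  obtain B where B: "\<And>\<nu> z. z \<in> {0..1} ==> \<bar>hb \<nu> z\<bar> \<le> B"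
  proof -
    obtain B where B: "\<forall>\<nu>. sup_norm (hb \<nu>) \<le> B" using hb_bounded by (auto simp: bdd_above_def)
    have "\<bar>hb \<nu> z\<bar> \<le> B" if z: "z \<in> {0..1}" for \<nu> z
    proof -
      \<comment> \<open>The real supremum in \<open>sup_norm\<close> bounds its terms only for sets
        bounded above, which continuity on the compact interval guarantees.\<close>
      have "compact ((\<lambda>z. \<bar>hb \<nu> z\<bar>) ` {0..1})"
        using hb_in H_cont by (intro compact_continuous_image continuous_on_rabs) auto
      then have "bdd_above ((\<lambda>z. \<bar>hb \<nu> z\<bar>) ` {0..1})" by (intro bounded_imp_bdd_above compact_imp_bounded)
      then have "\<bar>hb \<nu> z\<bar> \<le> sup_norm (hb \<nu>)" unfolding sup_norm_def by (rule cSUP_upper[OF z])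
      then show ?thesis using B order_trans by blast
    qed
    then show thesis using that by blast
  qed
  have summable: "summable (\<lambda>\<nu>. 1 / (1 + lam n * gam \<nu>))" for n
    by (rule polynomial_eigenvalues[OF gam_order m(1) gam_nonneg]) (use h_pos lam_eq in auto)
  have space: "penalized_space H V J (lam n) hb gam" for n
  proof
    show "V (\<lambda>x. c * f x + d * k x) v = c * V f v + d * V k v" if "f \<in> H" "k \<in> H" "v \<in> H" for f k v c d
      unfolding V_def using H_cont that by (intro R.V_form_linear)
    show "J (\<lambda>x. c * f x + d * k x) v = c * J f v + d * J k v" if "f \<in> H" "k \<in> H" "v \<in> H" for f k v c d
      unfolding J_def using H_sobolev that m by (intro penalty_linear) auto
    show "V f k = V k f" for f k unfolding V_def by (rule R.V_form_sym)
    show "J f k = J k f" for f k unfolding J_def by (rule penalty_sym)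
    show "0 \<le> V f f" if "f \<in> H" for f unfolding V_def by (rule R.V_form_nonneg[OF H_cont[OF that]])
    show "0 \<le> J f f" for f unfolding J_def by (rule penalty_nonneg)
    show "(\<lambda>N. sqrt (V (\<lambda>z. f z - (\<Sum>\<nu><N. V f (hb \<nu>) * hb \<nu> z)) (\<lambda>z. f z - (\<Sum>\<nu><N. V f (hb \<nu>) * hb \<nu> z))
         + lam n * J (\<lambda>z. f z - (\<Sum>\<nu><N. V f (hb \<nu>) * hb \<nu> z)) (\<lambda>z. f z - (\<Sum>\<nu><N. V f (hb \<nu>) * hb \<nu> z)))) \<longlonglongrightarrow> 0"
      if "f \<in> H" for f using expansion that unfolding nrm_def ip_def by blast
  qed (use H_linear lam hb_in V_orth J_orth in auto)
  have ip_eq: "penalized_space.ip V J (lam n) = ip n" for n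
    by (intro ext) (simp add: penalized_space.ip_def[OF space] ip_def)
  have rkhs: "penalized_rkhs H V J (lam n) hb gam {0..1} (K n) (W n) B" for n
  proof (intro penalized_rkhs.intro space penalized_rkhs_axioms.intro, unfold ip_eq)
    show "summable (\<lambda>\<nu>. 1 / (1 + lam n * gam \<nu>))" by (rule summable)
  qed (use K_kernel W_operator B in \<open>auto simp: reproducing_kernel_def self_adjoint_representer_def\<close>)
  have design: "design_sample M R.N R.X H V J (lam n) hb gam (K n) (W n) B" for n
    by (intro design_sample.intro R.sample rkhs design_sample_axioms.intro R.sets_N R.X_in(2) H_cont)
  have plrt: "plrt_sample M R.N R.X H V J (lam n) hb gam (K n) (W n) B R.e R.w2 R.w3 (C0 * C1 * C2) g0" for n
  proof (intro plrt_sample.intro design plrt_sample_axioms.intro)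
    show "R.w2 \<in> borel_measurable R.N" "R.w3 \<in> borel_measurable R.N"
      using R.w2_measurable R.w3_measurable by (simp_all add: R.measurable_N)
    show "0 \<le> R.w3 x" for x by (simp add: R.w3_def)
    show "0 \<le> C0 * C1 * C2" using C01 C2 by simp
  qed (use R.e_L4 R.w2_square R.w3_square R.e_mean R.e_square R.w2_form R.w3_form H_cont g0_in in \<open>auto simp: V_def\<close>)
  obtain s0 where s0: "s0 > 0" "\<And>z t. z \<in> {0..1} ==> \<bar>t\<bar> \<le> s0 ==> closed_segment (g0 z) (g0 z + t) \<subseteq> I"
    using R.radius by blast
  have loss: "plrt_loss M R.N R.X H V J (lam n) hb gam (K n) (W n) B R.e R.w2 R.w3 (C0 * C1 * C2) g0 R.L {x. fst x \<in> G3} s0" for n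
  proof (intro plrt_loss.intro plrt plrt_loss_axioms.intro)
    show "{x. fst x \<in> G3} \<in> sets R.N"
    proof -
      have "{x \<in> space (borel \<Otimes>\<^sub>M borel). fst x \<in> G3} \<in> sets (borel \<Otimes>\<^sub>M borel)" using b3(2) by measurable
      then show ?thesis by (simp add: R.sets_N space_pair_measure)
    qed
    show "AE x in R.N. x \<in> {x. fst x \<in> G3}" by (rule R.AE_N[OF b3(2) AE_G(2)])
  qed (use s0 R.L_taylor[OF s0(2)] in auto)
  have r_nonneg: "r n \<ge> 0" for n using h_pos[of n] by (simp add: r_def)
  have nh3: "filterlim (\<lambda>n. real n * h n ^ 3) at_top sequentially"
    \<comment> \<open>The remaining premise is nonnegativity of \<open>C_l\<close>, which holds
      because it is an \<open>enn2real\<close>.\<close>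
    by (rule bandwidth_cubed[OF h_pos h_lim m(2) _ r_nonneg a_def a_small]) (simp add: C_l_def)
  interpret Q: plrt_sequence M R.N R.X H V J lam hb gam K W B R.e R.w2 R.w3 "C0 * C1 * C2" g0 R.L "{x. fst x \<in> G3}" s0 h m ghat
  proof (intro plrt_sequence.intro R.sample plrt_sequence_axioms.intro loss h_pos lam_eq m h_lim gam_order bw_upper nh3)
    have eq: "measurable (R.N \<Otimes>\<^sub>M borel) (borel :: real measure) = measurable ((borel \<Otimes>\<^sub>M borel) \<Otimes>\<^sub>M (borel :: real measure)) borel"
      by (rule measurable_cong_sets[OF sets_pair_measure_cong[OF R.sets_N refl] refl])
    show "(\<lambda>(x, t). R.L x t) \<in> borel_measurable (R.N \<Otimes>\<^sub>M borel)"
      unfolding eq by (rule R.L_measurable)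
    show "ghat n \<omega> \<in> H" if "\<omega> \<in> space M" for n \<omega> using ghat_random that by blast
    show "(\<lambda>\<omega>. ghat n \<omega> z) \<in> borel_measurable M" if "z \<in> {0..1}" for n z using ghat_random that by blast
  qed
  have ip': "Q.P.ip n f k = ip n f k" for n f k by (simp add: Q.P.ip_def ip_def)
  have sg: "sigma2 n = h n * Q.P.tr n" for n
  proof -
    have "(\<integral>\<omega>. (score l g0 (Y \<omega>) (Z \<omega>))\<^sup>2 * K n (Z \<omega>) (Z \<omega>) \<partial>M) = (\<integral>\<omega>. (R.e (Y \<omega>, Z \<omega>))\<^sup>2 * Q.P.kern n (Y \<omega>, Z \<omega>) (Y \<omega>, Z \<omega>) \<partial>M)"
      using R.YZ(4) by (intro Bochner_Integration.integral_cong) (simp_all add: R.e_eq Q.P.kern_def)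
    also have "\<dots> = (\<integral>x. (R.e x)\<^sup>2 * Q.P.kern n x x \<partial>R.N)"
      by (rule R.integral_N[symmetric], fold R.measurable_N) (rule Q.P.diag_square(3))
    also have "\<dots> = Q.P.tr n" by (rule Q.P.kern_diag_integral)
    finally show ?thesis by (simp add: sigma2_def)
  qed
  have rh: "rho2 n = h n * Q.P.Q.k2 n" for n
  proof -
    have "(\<integral>\<omega>. (score l g0 (Ys 1 \<omega>) (Zs 1 \<omega>))\<^sup>2 * (score l g0 (Ys 2 \<omega>) (Zs 2 \<omega>))\<^sup>2 * (K n (Zs 1 \<omega>) (Zs 2 \<omega>))\<^sup>2 \<partial>M)
      = (\<integral>\<omega>. (Q.P.kk n (R.X 1 \<omega>) (R.X 2 \<omega>))\<^sup>2 \<partial>M)"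
    proof (rule Bochner_Integration.integral_cong[OF refl])
      fix \<omega> assume \<omega>: "\<omega> \<in> space M"
      show "(score l g0 (Ys 1 \<omega>) (Zs 1 \<omega>))\<^sup>2 * (score l g0 (Ys 2 \<omega>) (Zs 2 \<omega>))\<^sup>2 * (K n (Zs 1 \<omega>) (Zs 2 \<omega>))\<^sup>2
        = (Q.P.kk n (R.X 1 \<omega>) (R.X 2 \<omega>))\<^sup>2"
        using R.e_X[of 1 \<omega>] R.e_X[of 2 \<omega>] R.X_in(2)[of 1 \<omega>] R.X_in(2)[of 2 \<omega>] \<omega>
        by (simp add: Q.P.kk_def Q.P.kern_def power_mult_distrib R.X_def)
    qed
    also have "\<dots> = Q.P.Q.k2 n" by (rule Q.P.Q.k2_expectation)
    finally show ?thesis by (simp add: rho2_def)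
  qed
  \<comment> \<open>Here bilinearity of the penalty is spent: its expansion at \<open>g0\<close>
    gives the terms linear and quadratic in \<open>f\<close>. As \<open>H\<close> is a linear space,
    maximality of the estimate becomes maximality of the gain over all increments.\<close>
  have gain: "Q.P.gain n n \<omega> f = penalized_criterion m l Ys Zs lam n \<omega> (\<lambda>z. g0 z + f z) - penalized_criterion m l Ys Zs lam n \<omega> g0"
    if \<omega>: "\<omega> \<in> space M" and f: "f \<in> H" for n \<omega> f
  proof -
    have "Q.avg n (\<lambda>x. R.L x (on_unit f x)) \<omega> = (\<Sum>i=1..n. l (Ys i \<omega>) (g0 (Zs i \<omega>) + f (Zs i \<omega>)) - l (Ys i \<omega>) (g0 (Zs i \<omega>))) / real n"
      unfolding Q.avg_def atLeastLessThanSuc_atLeastAtMost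
      using R.L_X[OF _ \<omega>] Q.P.on_unit_X[OF _ \<omega>] by (intro arg_cong2[where f = "(/)"] sum.cong) (auto simp: R.X_def)
    moreover have "J (\<lambda>z. g0 z + f z) (\<lambda>z. g0 z + f z) = J g0 g0 + 2 * J g0 f + J f f"
    proof -
      have s: "(\<lambda>z. 1 * g0 z + 1 * f z) \<in> H" by (rule H_linear[OF g0_in f])
      have "J (\<lambda>z. 1 * g0 z + 1 * f z) (\<lambda>z. 1 * g0 z + 1 * f z) = J g0 (\<lambda>z. 1 * g0 z + 1 * f z) + J f (\<lambda>z. 1 * g0 z + 1 * f z)"
        using Q.P.J_linear[OF g0_in f s, where c = 1 and d = 1] by simp
      also have "J g0 (\<lambda>z. 1 * g0 z + 1 * f z) = J g0 g0 + J f g0"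
        using Q.P.J_linear[OF g0_in f g0_in, where c = 1 and d = 1] Q.P.J_sym[of g0 "\<lambda>z. 1 * g0 z + 1 * f z"] by simp
      also have "J f (\<lambda>z. 1 * g0 z + 1 * f z) = J g0 f + J f f"
        using Q.P.J_linear[OF g0_in f f, where c = 1 and d = 1] Q.P.J_sym[of f "\<lambda>z. 1 * g0 z + 1 * f z"] by simp
      finally show ?thesis using Q.P.J_sym[of f g0] by simp
    qed
    ultimately show ?thesis
      unfolding Q.P.gain_def penalized_criterion_def J_def[symmetric]
      by (simp add: sum_subtractf diff_divide_distrib algebra_simps)
  qed
  have inc: "(\<lambda>z. g0 z + Q.increment n \<omega> z) = ghat n \<omega>" for n \<omega> by (simp add: Q.increment_def)
  have PLRT_eq: "PLRT n \<omega> = - Q.P.gain n n \<omega> (Q.increment n \<omega>)" if "\<omega> \<in> space M" for n \<omega>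
    using gain[OF that Q.increment_in[OF that]] by (simp add: PLRT_def inc)
  have maximal: "AE \<omega> in M. \<forall>\<^sub>F n in sequentially. \<forall>f\<in>H. Q.P.gain n n \<omega> f \<le> Q.P.gain n n \<omega> (Q.increment n \<omega>)"
    using ghat_max AE_space
  proof eventually_elim
    case (elim \<omega>)
    show ?case using elim(1)
    proof eventually_elim
      case (elim n)
      show ?case
      proof
        fix f assume f: "f \<in> H"
        have "(\<lambda>z. g0 z + f z) \<in> H" using H_linear[OF g0_in f, of 1 1] by simp
        then have "penalized_criterion m l Ys Zs lam n \<omega> (\<lambda>z. g0 z + f z) \<le> penalized_criterion m l Ys Zs lam n \<omega> (ghat n \<omega>)"
          using elim by (simp add: unique_maximizer_def)
        then show "Q.P.gain n n \<omega> f \<le> Q.P.gain n n \<omega> (Q.increment n \<omega>)"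
          using gain[OF \<open>\<omega> \<in> space M\<close> f] gain[OF \<open>\<omega> \<in> space M\<close> Q.increment_in[OF \<open>\<omega> \<in> space M\<close>]] by (simp add: inc)
      qed
    qed
  qed
  have rate': "big_O_P M (\<lambda>n \<omega>. sqrt (Q.P.ip n (Q.increment n \<omega>) (Q.increment n \<omega>))) r"
    using rate by (simp only: nrm_def ip' Q.increment_def)
  have r_le: "(r n)\<^sup>2 \<le> 2 * (1 / (real n * h n) + lam n)" if "n \<ge> 1" for n
  proof -
    have p: "real n * h n > 0" using that h_pos[of n] by simp
    have "(x + y)\<^sup>2 \<le> 2 * (x\<^sup>2 + y\<^sup>2)" for x y :: real
      using sum_squares_bound[of x y] by (simp add: power2_sum)
    then have "(r n)\<^sup>2 \<le> 2 * (((real n * h n) powr (- 1 / 2))\<^sup>2 + (h n ^ m)\<^sup>2)" unfolding r_def .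
    also have "((real n * h n) powr (- 1 / 2))\<^sup>2 = 1 / (real n * h n)"
      using p by (simp add: powr_minus_divide powr_half_sqrt power_divide)
    also have "(h n ^ m)\<^sup>2 = lam n" by (simp add: lam_eq power_mult[symmetric] mult.commute)
    finally show ?thesis .
  qed
  have tr_pos: "Q.P.tr n > 0" for n
    unfolding Q.P.tr_def by (intro suminf_pos Q.P.summable_denom divide_pos_pos Q.P.denom_pos(1) zero_less_one)
  let ?T = "\<lambda>n \<omega>. (2 * u n) powr (- 1 / 2) * (- 2 * real n * rK n * PLRT n \<omega> - real n * rK n * (nrm n (W n g0))\<^sup>2 - u n)"
  have stat: "?T n \<omega> = sqrt (1 / (2 * Q.P.Q.k2 n)) * (2 * real n * Q.P.gain n n \<omega> (Q.increment n \<omega>) - real n * Q.P.ip n (W n g0) (W n g0) - Q.P.tr n)"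
    if \<omega>: "\<omega> \<in> space M" for n \<omega>
  proof -
    have "(nrm n (W n g0))\<^sup>2 = Q.P.ip n (W n g0) (W n g0)"
      using Q.P.ip_nonneg[OF Q.P.W_in[OF g0_in, of n], of n] by (simp add: nrm_def ip')
    then show ?thesis
      using studentization[OF h_pos[of n] tr_pos[of n] Q.P.k2_pos[of n], of "real n" "PLRT n \<omega>" "Q.P.ip n (W n g0) (W n g0)"]
      unfolding u_def rK_def sg rh PLRT_eq[OF \<omega>] by simp
  qed
  have distr_eq: "distr M borel (?T n) = distr M borel (\<lambda>\<omega>. sqrt (1 / (2 * Q.P.Q.k2 n)) * (2 * real n * Q.P.gain n n \<omega> (Q.increment n \<omega>) - real n * Q.P.ip n (W n g0) (W n g0) - Q.P.tr n))" for n
    by (rule distr_cong[OF refl refl stat])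
  show ?thesis
  proof (intro conjI allI)
    show "(\<lambda>\<nu>. h n / (1 + lam n * gam \<nu>)) sums sigma2 n" for n
      using sums_mult[OF Q.P.kern_diag_sums[of n], of "h n"] unfolding Q.P.kern_diag_integral sg by simp
    show "(\<lambda>\<nu>. h n / (1 + lam n * gam \<nu>)\<^sup>2) sums rho2 n" for n
      using sums_mult[OF Q.P.k2_sums[of n], of "h n"] unfolding rh by simp
    show "weak_conv_m (\<lambda>n. distr M borel (?T n)) std_normal_distribution"
      unfolding distr_eq by (rule Q.likelihood_ratio_CLT[OF rate' r_le r_nonneg maximal])
  qed
qed

end
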